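(* Let $\{|e_0\rangle,|e_1\rangle,|e_2\rangle\}$ and $\{|f_0\rangle,|f_1\rangle,|f_2\rangle,|f_3\rangle\}$ be the standard bases of $\mathbb{C}^3$ and $\mathbb{C}^4$, and let $\Phi:\mathcal{L}(\mathbb{C}^3)\to\mathcal{L}(\mathbb{C}^4)$ be the quantum channel $\Phi(X)=E_0XE_0^*+E_1XE_1^*$ with $$E_0=|f_0\rangle\langle e_0|+\tfrac1{\sqrt2}|f_1\rangle\langle e_1|,\qquad E_1=\tfrac1{\sqrt2}|f_2\rangle\langle e_1|+|f_3\rangle\langle e_2|.$$ Let $\Delta_2:\mathcal{L}(\mathbb{C}^2)\to\mathcal{L}(\mathbb{C}^2)$, $\Delta_2(X)=|0\rangle\langle0|X|0\rangle\langle0|+|1\rangle\langle1|X|1\rangle\langle1|$, and $\Psi=\Delta_2\otimes\Phi$. For $n\in\mathbb{N}$ and $1\le q\le2^n$ let $s_n(q)=\sum_{i=1}^q2^{|x^{(i)}|}$, where $x^{(1)},\ldots,x^{(2^n)}$ is an enumeration of $\{0,1\}^n$ in order of nondecreasing Hamming weight $|\cdot|$. Then the following hold for every $n\in\mathbb{N}$. (a) For every $1\leq q\leq2^n$, the algebra $$\mathscr{B}_{n,q}=\mathbb{M}_q(\mathbb{C})\oplus\mathbb{C}^{3^n-s_n(q)}$$ is transmittable via $\Phi^{\otimes n}$ and is a maximal element of $\mathscr{T}(\Phi^{\otimes n})$. In particular, $w_n(\Phi)\geq2^n$. (b) For every $N=(N_1,\ldots,N_{2^n})\in\mathbb{N}_0^{2^n}$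 with $\sum_{q=1}^{2^n}N_q=2^n$, the algebra $$\mathscr{C}_N=\bigoplus_{q=1}^{2^n}\mathscr{B}_{n,q}^{\oplus N_q}$$ is transmittable via $\Psi^{\otimes n}$ and is a maximal element of $\mathscr{T}(\Psi^{\otimes n})$. In particular, $w_n(\Psi)\geq2^{2^n-1}$.
   Context: All Hilbert spaces are finite-dimensional and complex; all $C^*$-algebras are finite-dimensional and nonzero. $\mathcal{L}(\mathcal{H})$ is the algebra of linear operators on $\mathcal{H}$. A quantum channel is a linear, completely positive, trace-preserving map $\Phi:\mathcal{L}(\mathcal{H})\to\mathcal{L}(\mathcal{K})$; its adjoint $\Phi^*$ is defined by $\mathrm{Tr}(Y\Phi(X))=\mathrm{Tr}(\Phi^*(Y)X)$. $\mathbb{N}=\{1,2,\ldots\}$, $\mathbb{N}_0=\{0,1,2,\ldots\}$. Direct summands of zero multiplicity (e.g. $\mathbb{C}^0$) are omitted. The value $s_n(q)$ does not depend on the choice of enumeration; $s_n(1)=1$ and $s_n(2^n)=3^n$. Embedding: $\mathscr{A}\leq\mathscr{B}$ means there is an injective (not necessarily unital) $*$-homomorphism $\mathscr{A}\to\mathscr{B}$. Correctability: a $*$-subalgebra $\mathscr{A}\subseteq\mathcal{L}(\mathcal{H})$ with unit projection $P$ (possibly $P\neq 1_{\mathcal{H}}$) is correctable for $\Phi$ if, with $C=P\mathcal{H}$, $V:C\to\mathcal{H}$ the inclusion and $\Phi|_C(Y)=\Phi(VYV^* )$, there is a channel $\mathcal{D}:\mathcal{L}(\mathcal{K})\to\mathcal{L}(C)$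 with $(\mathcal{D}\circ\Phi|_C)^*(X)=X$ for all $X\in V^*\mathscr{A}V$. $\mathscr{A}$ is transmittable via $\Phi$ if there is an injective $*$-homomorphism $\pi:\mathscr{A}\to\mathcal{L}(\mathcal{H})$ whose image is correctable for $\Phi$; $\mathscr{T}(\Phi)$ is the set of transmittable algebras up to $*$-isomorphism. $\mathscr{A}\in\mathscr{T}(\Phi)$ is maximal if $\mathscr{B}\in\mathscr{T}(\Phi)$, $\mathscr{A}\leq\mathscr{B}$ imply $\mathscr{A}\cong\mathscr{B}$; $\max(\mathscr{T}(\Phi))$ is the set of maximal elements up to $*$-isomorphism. Width: $w_n(\Phi)=|\max(\mathscr{T}(\Phi^{\otimes n}))|$. *)

theory Defs
  imports "Jordan_Normal_Form.Schur_Decomposition"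
begin

text \<open>
  A finite-dimensional Hilbert space of dimension \<open>d\<close> is \<open>\<complex>\<^sup>d\<close> with its standard basis, so that
  \<open>L(\<complex>\<^sup>d)\<close> is \<open>carrier_mat d d\<close>. The inner product \<open>v \<bullet>c w\<close> is linear in \<open>v\<close>, and \<open>0 \<le> z\<close> for
  complex \<open>z\<close> means that \<open>z\<close> is real and nonnegative.
\<close>

definition mtrace :: "complex mat \<Rightarrow> complex" where
  "mtrace A = sum_list (diag_mat A)"

definition psd :: "nat \<Rightarrow> complex mat \<Rightarrow> bool" where
  "psd d A \<longleftrightarrow> A \<in> carrier_mat d d \<and> (\<forall>v\<in>carrier_vec d. 0 \<le> (A *\<^sub>v v) \<bullet>c v)"

definition ketbra :: "complex vec \<Rightarrow> complex vec \<Rightarrow> complex mat" where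
  "ketbra v w = mat (dim_vec v) (dim_vec w) (\<lambda>(i, j). v $ i * cnj (w $ j))"

text \<open>The basis vector \<open>e\<^sub>i \<otimes> e\<^sub>k\<close> of \<open>\<complex>\<^sup>m \<otimes> \<complex>\<^sup>n = \<complex>\<^sup>m\<^sup>n\<close> has index \<open>i * n + k\<close>.\<close>

definition kron :: "complex mat \<Rightarrow> complex mat \<Rightarrow> complex mat" where
  "kron A B = mat (dim_row A * dim_row B) (dim_col A * dim_col B)
     (\<lambda>(r, s). A $$ (r div dim_row B, s div dim_col B) * B $$ (r mod dim_row B, s mod dim_col B))"


text \<open>A map \<open>app \<Phi> : L(\<complex>\<^sup>d) \<rightarrow> L(\<complex>\<^sup>e)\<close> with \<open>d = idim \<Phi>\<close> and \<open>e = odim \<Phi>\<close>; its values outside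
  \<open>carrier_mat d d\<close> are irrelevant.\<close>

record supermap =
  idim :: nat
  odim :: nat
  app :: "complex mat \<Rightarrow> complex mat"

definition linear_super :: "supermap \<Rightarrow> bool" where
  "linear_super \<Phi> \<longleftrightarrow>
     (\<forall>X\<in>carrier_mat (idim \<Phi>) (idim \<Phi>). app \<Phi> X \<in> carrier_mat (odim \<Phi>) (odim \<Phi>)) \<and>
     (\<forall>X\<in>carrier_mat (idim \<Phi>) (idim \<Phi>). \<forall>Y\<in>carrier_mat (idim \<Phi>) (idim \<Phi>).
        app \<Phi> (X + Y) = app \<Phi> X + app \<Phi> Y) \<and>
     (\<forall>c. \<forall>X\<in>carrier_mat (idim \<Phi>) (idim \<Phi>). app \<Phi> (c \<cdot>\<^sub>m X) = c \<cdot>\<^sub>m app \<Phi> X)"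

definition id_super :: "nat \<Rightarrow> supermap" where
  "id_super d = \<lparr>idim = d, odim = d, app = (\<lambda>X. X)\<rparr>"

definition comp_super :: "supermap \<Rightarrow> supermap \<Rightarrow> supermap" where
  "comp_super \<Psi> \<Phi> = \<lparr>idim = idim \<Phi>, odim = odim \<Psi>, app = (\<lambda>X. app \<Psi> (app \<Phi> X))\<rparr>"

text \<open>The linear extension of \<open>X \<otimes> Y \<mapsto> \<Phi>(X) \<otimes> \<Psi>(Y)\<close>: every \<open>Z\<close> is the sum of
  \<open>Z\<^bsub>(i,k),(j,l)\<^esub> (|e\<^sub>i\<rangle>\<langle>e\<^sub>j| \<otimes> |e\<^sub>k\<rangle>\<langle>e\<^sub>l|)\<close>. The lemma \<open>tensor_super_kron\<close> below confirms the formula.\<close>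

definition tensor_super :: "supermap \<Rightarrow> supermap \<Rightarrow> supermap" where
  "tensor_super \<Phi> \<Psi> =
     \<lparr>idim = idim \<Phi> * idim \<Psi>,
      odim = odim \<Phi> * odim \<Psi>,
      app = (\<lambda>Z. mat (odim \<Phi> * odim \<Psi>) (odim \<Phi> * odim \<Psi>) (\<lambda>rs.
        \<Sum>i<idim \<Phi>. \<Sum>j<idim \<Phi>. \<Sum>k<idim \<Psi>. \<Sum>l<idim \<Psi>.
          Z $$ (i * idim \<Psi> + k, j * idim \<Psi> + l) *
          kron (app \<Phi> (ketbra (unit_vec (idim \<Phi>) i) (unit_vec (idim \<Phi>) j)))
               (app \<Psi> (ketbra (unit_vec (idim \<Psi>) k) (unit_vec (idim \<Psi>) l))) $$ rs))\<rparr>"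

lemma kron_index:
  assumes "r < dim_row A * dim_row B" "s < dim_col A * dim_col B"
  shows "kron A B $$ (r, s) =
    A $$ (r div dim_row B, s div dim_col B) * B $$ (r mod dim_row B, s mod dim_col B)"
  using assms by (simp add: kron_def)

lemma linear_super_expand:
  assumes lin: "linear_super \<Phi>" and X: "X \<in> carrier_mat (idim \<Phi>) (idim \<Phi>)"
    and ab: "a < odim \<Phi>" "b < odim \<Phi>"
  shows "app \<Phi> X $$ (a, b) = (\<Sum>i<idim \<Phi>. \<Sum>j<idim \<Phi>.
    X $$ (i, j) * app \<Phi> (ketbra (unit_vec (idim \<Phi>) i) (unit_vec (idim \<Phi>) j)) $$ (a, b))"
proof -
  let ?d = "idim \<Phi>"
  let ?E = "\<lambda>p. ketbra (unit_vec ?d (fst p)) (unit_vec ?d (snd p))"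
  let ?R = "\<lambda>S. mat ?d ?d (\<lambda>p. if p \<in> S then X $$ p else 0)"
  have cE: "?E p \<in> carrier_mat ?d ?d" for p by (simp add: ketbra_def)
  have add: "app \<Phi> (U + W) = app \<Phi> U + app \<Phi> W"
    if "U \<in> carrier_mat ?d ?d" "W \<in> carrier_mat ?d ?d" for U W
    using lin that unfolding linear_super_def by blast
  have scale: "app \<Phi> (c \<cdot>\<^sub>m U) = c \<cdot>\<^sub>m app \<Phi> U" if "U \<in> carrier_mat ?d ?d" for c U
    using lin that unfolding linear_super_def by blast
  have cod: "app \<Phi> U \<in> carrier_mat (odim \<Phi>) (odim \<Phi>)" if "U \<in> carrier_mat ?d ?d" for U
    using lin that unfolding linear_super_def by blast
  have main: "app \<Phi> (?R S) $$ (a, b) = (\<Sum>p\<in>S. X $$ p * app \<Phi> (?E p) $$ (a, b))"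
    if "finite S" "S \<subseteq> {..<?d} \<times> {..<?d}" for S
    using that
  proof (induction S rule: finite_induct)
    case empty
    have R: "?R {} = 0 \<cdot>\<^sub>m (0\<^sub>m ?d ?d)" by (intro eq_matI) auto
    have "app \<Phi> (?R {}) = 0 \<cdot>\<^sub>m app \<Phi> (0\<^sub>m ?d ?d)" unfolding R by (rule scale) simp
    moreover have "app \<Phi> (0\<^sub>m ?d ?d) \<in> carrier_mat (odim \<Phi>) (odim \<Phi>)" by (rule cod) simp
    ultimately show ?case using ab by simp
  next
    case (insert p S)
    have "?R (insert p S) = X $$ p \<cdot>\<^sub>m ?E p + ?R S"
      using insert by (intro eq_matI) (auto simp: ketbra_def split: if_splits)
    then have "app \<Phi> (?R (insert p S)) = X $$ p \<cdot>\<^sub>m app \<Phi> (?E p) + app \<Phi> (?R S)"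
      using add[of "X $$ p \<cdot>\<^sub>m ?E p" "?R S"] scale[OF cE] cE by simp
    then show ?case using insert ab cod[OF cE[of p]] cod[of "?R S"] by simp
  qed
  have "?R ({..<?d} \<times> {..<?d}) = X" using X by (intro eq_matI) auto
  then show ?thesis using main[of "{..<?d} \<times> {..<?d}"]
    by (simp add: sum.cartesian_product case_prod_beta)
qed

lemma tensor_super_kron:
  assumes lin: "linear_super \<Phi>" "linear_super \<Psi>"
    and X: "X \<in> carrier_mat (idim \<Phi>) (idim \<Phi>)" and Y: "Y \<in> carrier_mat (idim \<Psi>) (idim \<Psi>)"
  shows "app (tensor_super \<Phi> \<Psi>) (kron X Y) = kron (app \<Phi> X) (app \<Psi> Y)"
proof -
  let ?d = "idim \<Phi>" and ?e = "idim \<Psi>" and ?d' = "odim \<Phi>" and ?e' = "odim \<Psi>"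
  let ?E = "\<lambda>i j. app \<Phi> (ketbra (unit_vec ?d i) (unit_vec ?d j))"
  let ?F = "\<lambda>k l. app \<Psi> (ketbra (unit_vec ?e k) (unit_vec ?e l))"
  have cE: "?E i j \<in> carrier_mat ?d' ?d'" and cF: "?F i j \<in> carrier_mat ?e' ?e'" for i j
    using lin unfolding linear_super_def by (auto simp: ketbra_def)
  have cX: "app \<Phi> X \<in> carrier_mat ?d' ?d'" and cY: "app \<Psi> Y \<in> carrier_mat ?e' ?e'"
    using lin X Y unfolding linear_super_def by auto
  show ?thesis
  proof (intro eq_matI)
    fix r s assume "r < dim_row (kron (app \<Phi> X) (app \<Psi> Y))" "s < dim_col (kron (app \<Phi> X) (app \<Psi> Y))"
    then have rs: "r < ?d' * ?e'" "s < ?d' * ?e'" using cX cY by (auto simp: kron_def)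
    then have e0: "0 < ?e'" by (cases ?e') auto
    have b: "r div ?e' < ?d'" "s div ?e' < ?d'" "r mod ?e' < ?e'" "s mod ?e' < ?e'"
      using rs e0 by (auto simp: less_mult_imp_div_less)
    have K: "kron X Y $$ (i * ?e + k, j * ?e + l) = X $$ (i, j) * Y $$ (k, l)"
      if "i < ?d" "j < ?d" "k < ?e" "l < ?e" for i j k l
    proof -
      have lt: "p * ?e + q < ?d * ?e" if "p < ?d" "q < ?e" for p q
      proof -
        have "p * ?e + q < Suc p * ?e" using that by simp
        also have "\<dots> \<le> ?d * ?e" using that by (intro mult_le_mono) auto
        finally show ?thesis .
      qed
      show ?thesis using that X Y lt[of i k] lt[of j l] by (simp add: kron_index)
    qed
    have G: "kron (?E i j) (?F k l) $$ (r, s) =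
        ?E i j $$ (r div ?e', s div ?e') * ?F k l $$ (r mod ?e', s mod ?e')" for i j k l
      using cE[of i j] cF[of k l] rs by (simp add: kron_index)
    have "app (tensor_super \<Phi> \<Psi>) (kron X Y) $$ (r, s) =
      (\<Sum>i<?d. \<Sum>j<?d. \<Sum>k<?e. \<Sum>l<?e.
        (X $$ (i, j) * ?E i j $$ (r div ?e', s div ?e')) *
        (Y $$ (k, l) * ?F k l $$ (r mod ?e', s mod ?e')))"
      using rs
      by (simp add: tensor_super_def G) (intro sum.cong refl, simp add: K mult_ac)
    also have "\<dots> = app \<Phi> X $$ (r div ?e', s div ?e') * app \<Psi> Y $$ (r mod ?e', s mod ?e')"
      unfolding linear_super_expand[OF lin(1) X b(1,2)] linear_super_expand[OF lin(2) Y b(3,4)]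
      by (simp only: sum_distrib_right, simp only: sum_distrib_left)
    also have "\<dots> = kron (app \<Phi> X) (app \<Psi> Y) $$ (r, s)"
      using cX cY rs by (simp add: kron_index)
    finally show "app (tensor_super \<Phi> \<Psi>) (kron X Y) $$ (r, s) = kron (app \<Phi> X) (app \<Psi> Y) $$ (r, s)" .
  qed (use cX cY in \<open>auto simp: tensor_super_def kron_def\<close>)
qed

fun tensor_power :: "supermap \<Rightarrow> nat \<Rightarrow> supermap" where
  "tensor_power \<Phi> 0 = id_super 1"
| "tensor_power \<Phi> (Suc n) = tensor_super \<Phi> (tensor_power \<Phi> n)"

definition completely_positive :: "supermap \<Rightarrow> bool" where
  "completely_positive \<Phi> \<longleftrightarrow>
     (\<forall>k X. psd (k * idim \<Phi>) X \<longrightarrow> psd (k * odim \<Phi>) (app (tensor_super (id_super k) \<Phi>) X))"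

definition trace_preserving :: "supermap \<Rightarrow> bool" where
  "trace_preserving \<Phi> \<longleftrightarrow> (\<forall>X\<in>carrier_mat (idim \<Phi>) (idim \<Phi>). mtrace (app \<Phi> X) = mtrace X)"

definition channel :: "supermap \<Rightarrow> bool" where
  "channel \<Phi> \<longleftrightarrow> linear_super \<Phi> \<and> completely_positive \<Phi> \<and> trace_preserving \<Phi>"

definition adj_super :: "supermap \<Rightarrow> supermap" where
  "adj_super \<Phi> =
     \<lparr>idim = odim \<Phi>, odim = idim \<Phi>,
      app = (\<lambda>Y. THE Z. Z \<in> carrier_mat (idim \<Phi>) (idim \<Phi>) \<and>
        (\<forall>X\<in>carrier_mat (idim \<Phi>) (idim \<Phi>). mtrace (Y * app \<Phi> X) = mtrace (Z * X)))\<rparr>"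


text \<open>Finite-dimensional C*-algebras are taken concretely, as nonzero *-subalgebras of some
  \<open>L(\<complex>\<^sup>d)\<close>. They need not contain the identity matrix of \<open>L(\<complex>\<^sup>d)\<close>; norm-closedness is automatic in
  finite dimension.\<close>

definition star_subalgebra :: "nat \<Rightarrow> complex mat set \<Rightarrow> bool" where
  "star_subalgebra d A \<longleftrightarrow>
     A \<subseteq> carrier_mat d d \<and> 0\<^sub>m d d \<in> A \<and>
     (\<forall>X\<in>A. \<forall>Y\<in>A. X + Y \<in> A) \<and>
     (\<forall>c. \<forall>X\<in>A. c \<cdot>\<^sub>m X \<in> A) \<and>
     (\<forall>X\<in>A. \<forall>Y\<in>A. X * Y \<in> A) \<and>
     (\<forall>X\<in>A. mat_adjoint X \<in> A)"

definition cstar_algebra :: "complex mat set \<Rightarrow> bool" where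
  "cstar_algebra A \<longleftrightarrow> (\<exists>d. star_subalgebra d A \<and> A \<noteq> {0\<^sub>m d d})"

definition star_hom :: "complex mat set \<Rightarrow> complex mat set \<Rightarrow> (complex mat \<Rightarrow> complex mat) \<Rightarrow> bool" where
  "star_hom A B \<pi> \<longleftrightarrow>
     (\<forall>X\<in>A. \<pi> X \<in> B) \<and>
     (\<forall>X\<in>A. \<forall>Y\<in>A. \<pi> (X + Y) = \<pi> X + \<pi> Y) \<and>
     (\<forall>c. \<forall>X\<in>A. \<pi> (c \<cdot>\<^sub>m X) = c \<cdot>\<^sub>m \<pi> X) \<and>
     (\<forall>X\<in>A. \<forall>Y\<in>A. \<pi> (X * Y) = \<pi> X * \<pi> Y) \<and>
     (\<forall>X\<in>A. \<pi> (mat_adjoint X) = mat_adjoint (\<pi> X))"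

definition embeds :: "complex mat set \<Rightarrow> complex mat set \<Rightarrow> bool" where
  "embeds A B \<longleftrightarrow> (\<exists>\<pi>. star_hom A B \<pi> \<and> inj_on \<pi> A)"

definition star_iso :: "complex mat set \<Rightarrow> complex mat set \<Rightarrow> bool" where
  "star_iso A B \<longleftrightarrow> (\<exists>\<pi>. star_hom A B \<pi> \<and> bij_betw \<pi> A B)"

definition star_iso_rel :: "(complex mat set \<times> complex mat set) set" where
  "star_iso_rel = {(A, B). cstar_algebra A \<and> cstar_algebra B \<and> star_iso A B}"

definition full_matrix_algebra :: "nat \<Rightarrow> complex mat set" where
  "full_matrix_algebra q = carrier_mat q q"

text \<open>Direct sums are block-diagonal; the summand \<open>{0\<^sub>m 0 0}\<close> contributes nothing.\<close>

definition direct_sum :: "complex mat set list \<Rightarrow> complex mat set" where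
  "direct_sum As = {diag_block_mat Xs | Xs. list_all2 (\<in>) Xs As}"

definition complex_power_algebra :: "nat \<Rightarrow> complex mat set" where
  "complex_power_algebra k = direct_sum (replicate k (full_matrix_algebra 1))"


definition unit_projection :: "complex mat set \<Rightarrow> complex mat \<Rightarrow> bool" where
  "unit_projection A P \<longleftrightarrow> P \<in> A \<and> (\<forall>X\<in>A. P * X = X \<and> X * P = X)"

definition restrict_super :: "supermap \<Rightarrow> complex mat \<Rightarrow> supermap" where
  "restrict_super \<Phi> V =
     \<lparr>idim = dim_col V, odim = odim \<Phi>, app = (\<lambda>Y. app \<Phi> (V * Y * mat_adjoint V))\<rparr>"

text \<open>The subspace \<open>C = P H\<close> is identified with \<open>\<complex>\<^sup>m\<close> by an orthonormal basis of \<open>C\<close>; the inclusion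
  of \<open>C\<close> into \<open>H\<close> then is a \<open>d \<times> m\<close> isometry \<open>V\<close> with range projection \<open>P\<close>, and its columns are the basis.\<close>

definition correctable :: "supermap \<Rightarrow> complex mat set \<Rightarrow> bool" where
  "correctable \<Phi> A \<longleftrightarrow>
     star_subalgebra (idim \<Phi>) A \<and>
     (\<exists>P m V. unit_projection A P \<and>
        V \<in> carrier_mat (idim \<Phi>) m \<and> mat_adjoint V * V = 1\<^sub>m m \<and> V * mat_adjoint V = P \<and>
        (\<exists>D. channel D \<and> idim D = odim \<Phi> \<and> odim D = m \<and>
           (\<forall>X\<in>(\<lambda>X. mat_adjoint V * X * V) ` A.
              app (adj_super (comp_super D (restrict_super \<Phi> V))) X = X)))"

definition transmittable :: "supermap \<Rightarrow> complex mat set \<Rightarrow> bool" where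
  "transmittable \<Phi> A \<longleftrightarrow> cstar_algebra A \<and>
     (\<exists>\<pi>. star_hom A (full_matrix_algebra (idim \<Phi>)) \<pi> \<and> inj_on \<pi> A \<and> correctable \<Phi> (\<pi> ` A))"

text \<open>Transmittability and maximality are invariant under *-isomorphism, so they are defined on
  algebras; isomorphic algebras are identified when they are counted.\<close>

definition maximal_transmittable :: "supermap \<Rightarrow> complex mat set \<Rightarrow> bool" where
  "maximal_transmittable \<Phi> A \<longleftrightarrow> transmittable \<Phi> A \<and>
     (\<forall>B. transmittable \<Phi> B \<and> embeds A B \<longrightarrow> star_iso A B)"

definition max_classes :: "supermap \<Rightarrow> complex mat set set set" where
  "max_classes \<Phi> = {A. maximal_transmittable \<Phi> A} // star_iso_rel"

definition width :: "nat \<Rightarrow> supermap \<Rightarrow> nat" where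
  "width n \<Phi> = card (max_classes (tensor_power \<Phi> n))"


definition E0 :: "complex mat" where
  "E0 = ketbra (unit_vec 4 0) (unit_vec 3 0) +
        complex_of_real (1 / sqrt 2) \<cdot>\<^sub>m ketbra (unit_vec 4 1) (unit_vec 3 1)"

definition E1 :: "complex mat" where
  "E1 = complex_of_real (1 / sqrt 2) \<cdot>\<^sub>m ketbra (unit_vec 4 2) (unit_vec 3 1) +
        ketbra (unit_vec 4 3) (unit_vec 3 2)"

definition Phi :: supermap where
  "Phi = \<lparr>idim = 3, odim = 4, app = (\<lambda>X. E0 * X * mat_adjoint E0 + E1 * X * mat_adjoint E1)\<rparr>"

definition Delta2 :: supermap where
  "Delta2 = \<lparr>idim = 2, odim = 2, app = (\<lambda>X.
     ketbra (unit_vec 2 0) (unit_vec 2 0) * X * ketbra (unit_vec 2 0) (unit_vec 2 0) +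
     ketbra (unit_vec 2 1) (unit_vec 2 1) * X * ketbra (unit_vec 2 1) (unit_vec 2 1))\<rparr>"

definition Psi :: supermap where
  "Psi = tensor_super Delta2 Phi"


definition hamming_weight :: "bool list \<Rightarrow> nat" where
  "hamming_weight b = count_list b True"

definition weight_enumeration :: "nat \<Rightarrow> (nat \<Rightarrow> bool list) \<Rightarrow> bool" where
  "weight_enumeration n x \<longleftrightarrow>
     bij_betw x {1..2 ^ n} {b. length b = n} \<and> mono_on {1..2 ^ n} (\<lambda>i. hamming_weight (x i))"

lemma weight_enumeration_exists: "\<exists>x. weight_enumeration n x"
proof -
  let ?B = "{b :: bool list. length b = n}"
  have fin: "finite ?B" and card: "card ?B = 2 ^ n"
    using finite_lists_length_eq[of "UNIV :: bool set" n] card_lists_length_eq[of "UNIV :: bool set" n]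
    by auto
  obtain xs where xs: "set xs = ?B" "distinct xs" using finite_distinct_list[OF fin] by blast
  define ys where "ys = sort_key hamming_weight xs"
  have ys: "set ys = ?B" "distinct ys" "sorted (map hamming_weight ys)"
    using xs by (auto simp: ys_def)
  then have len: "length ys = 2 ^ n" using card distinct_card[of ys] by simp
  have "bij_betw ((!) ys) {..<2 ^ n} ?B"
    using bij_betw_nth[OF ys(2), of "{..<2 ^ n}" ?B] ys(1) len by simp
  moreover have "bij_betw (\<lambda>i. i - 1) {1..2 ^ n} {..<2 ^ n :: nat}"
    by (rule bij_betw_byWitness[where f' = Suc]) auto
  ultimately have "bij_betw (\<lambda>i. ys ! (i - 1)) {1..2 ^ n} ?B"
    using bij_betw_trans[of "\<lambda>i. i - 1" "{1..2 ^ n}" "{..<2 ^ n :: nat}" "(!) ys" ?B]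
    by (simp add: comp_def)
  moreover have "mono_on {1..2 ^ n} (\<lambda>i. hamming_weight (ys ! (i - 1)))"
  proof (rule mono_onI)
    fix i j :: nat assume "i \<in> {1..2 ^ n}" "j \<in> {1..2 ^ n}" "i \<le> j"
    then have "i - 1 \<le> j - 1" "j - 1 < length ys" using len by auto
    then show "hamming_weight (ys ! (i - 1)) \<le> hamming_weight (ys ! (j - 1))"
      using sorted_nth_mono[OF ys(3), of "i - 1" "j - 1"] by simp
  qed
  ultimately show ?thesis unfolding weight_enumeration_def by blast
qed

definition weight_sum :: "(nat \<Rightarrow> bool list) \<Rightarrow> nat \<Rightarrow> nat" where
  "weight_sum x q = (\<Sum>i = 1..q. 2 ^ hamming_weight (x i))"

definition B_alg :: "(nat \<Rightarrow> bool list) \<Rightarrow> nat \<Rightarrow> nat \<Rightarrow> complex mat set" where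
  "B_alg x n q =
     direct_sum [full_matrix_algebra q, complex_power_algebra (3 ^ n - weight_sum x q)]"

definition C_alg :: "(nat \<Rightarrow> bool list) \<Rightarrow> nat \<Rightarrow> (nat \<Rightarrow> nat) \<Rightarrow> complex mat set" where
  "C_alg x n N = direct_sum (concat (map (\<lambda>q. replicate (N q) (B_alg x n q)) [1..<2 ^ n + 1]))"

end

theory Submission
  imports Defs "HOL-Computational_Algebra.Fundamental_Theorem_Algebra"
begin

text \<open>
  Index the standard basis of \<open>(\<complex>\<^sup>3)\<^sup>\<otimes>\<^sup>n\<close> by the faces of the cube \<open>{0,1}\<^sup>n\<close>: \<open>e\<^sub>0\<close> and \<open>e\<^sub>2\<close> are the
  endpoints of an edge and \<open>e\<^sub>1\<close> is the edge. The \<open>n\<close>-th power of \<open>\<Phi>\<close> then has one Kraus operator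
  \<open>E\<^sub>v\<close> for each vertex \<open>v\<close>. It keeps the faces that contain \<open>v\<close>, with amplitude \<open>2\<^sup>-\<^sup>k\<^sup>/\<^sup>2\<close> for a face of
  dimension \<open>k\<close>. For \<open>\<Psi>\<close> there are \<open>2\<^sup>n\<close> such cubes, distinguished by the classical register.

  Suppose that an algebra with blocks of sizes \<open>q\<^sub>j\<close> is transmittable. By the Knill--Laflamme conditions each
  \<open>E\<^sub>v\<close> acts on the code vectors of a block as a multiple of an isometry, and it keeps different blocks orthogonal.
  Bessel's inequality at every vertex and an edge count on the cube then give \<open>q\<^sub>j \<le> 2\<^sup>n\<close> and
  \<open>\<Sum>\<^sub>j s\<^sub>n(q\<^sub>j) \<le> 3\<^sup>n\<close> for \<open>\<Phi>\<close>, and \<open>6\<^sup>n\<close> on the right-hand side for \<open>\<Psi>\<close>. The algebras of the theorem attain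
  equality; they are transmitted by the uniform superpositions of the \<open>2\<^sup>|\<^sup>z\<^sup>|\<close> parallel faces whose fixed
  coordinates are those in \<open>z\<close>. Since \<open>s\<^sub>n\<close> is positive and strictly superadditive, an embedding
  that is not onto strictly increases \<open>\<Sum>\<^sub>j s\<^sub>n(q\<^sub>j)\<close>, so equality implies maximality.
\<close>

section \<open>Finitely supported matrices\<close>

text \<open>The upper bounds are proved for arbitrary systems of matrix units, complete or not: any
  family of mutually orthogonal minimal projections of a correctable algebra yields code vectors.
  Rigidity exploits this. If an embedding of a tight algebra were not onto, one more minimal
  projection, or a coarser grouping into blocks, would appear beside minimal projections chosen
  below the images, and the bound would fail for that family. The number \<open>s_n(q)\<close>
  arises as an optimum. A code seen by a set \<open>S\<close> of vertices can use at
  \<open>v\<close> in \<open>S\<close> only faces all of whose vertices lie in \<open>S\<close>,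
  hence only directions towards neighbours in \<open>S\<close>. Relative to the factor
  \<open>2^(-deg v)\<close>, the cheapest \<open>q\<close> such faces cost the sum of the
  \<open>q\<close> smallest values \<open>2^|z|\<close>; the factors sum to at least 1 over
  \<open>S\<close>. The capacity is the sum of \<open>2^(-dim)\<close> over all incident pairs of a
  vertex and a face, \<open>2^n (3/2)^n = 3^n\<close> for one cube. Since \<open>s_n(1) = 1\<close>,
  each face left over by the superpositions accounts for exactly one unit of the remainder.\<close>

text \<open>Matrices of all sizes in a single type, so that algebras of different sizes live in one ring
  (without unit); \<open>L(\<complex>\<^sup>d)\<close> is its corner \<open>supp_le d\<close>.\<close>

typedef fmat = "{f :: nat \<Rightarrow> nat \<Rightarrow> complex. \<exists>d. \<forall>i j. d \<le> i \<or> d \<le> j \<longrightarrow> f i j = 0}"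
  morphisms ent Abs_fmat
  by (rule exI[of _ "\<lambda>_ _. 0"]) auto

setup_lifting type_definition_fmat

lemma fmat_eqI: "(\<And>i j. ent A i j = ent B i j) \<Longrightarrow> A = B"
  by (metis ent_inject ext)

definition supp_le :: "nat \<Rightarrow> fmat \<Rightarrow> bool" where
  "supp_le d A \<longleftrightarrow> (\<forall>i j. d \<le> i \<or> d \<le> j \<longrightarrow> ent A i j = 0)"

lemma supp_leD: "supp_le d A \<Longrightarrow> ent A i j \<noteq> 0 \<Longrightarrow> i < d \<and> j < d"
  unfolding supp_le_def by (meson not_le)

lemma supp_le_exists: "\<exists>d. supp_le d A"
  using ent[of A] by (auto simp: supp_le_def)

lemma supp_le_mono: "supp_le d A \<Longrightarrow> d \<le> e \<Longrightarrow> supp_le e A"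
  by (auto simp: supp_le_def)

lemma supp_le_common:
  obtains d where "supp_le d A" "supp_le d B"
proof -
  obtain d e where "supp_le d A" "supp_le e B" using supp_le_exists by blast
  then show ?thesis using that[of "max d e"] by (meson supp_le_mono max.cobounded1 max.cobounded2)
qed

lemma supp_le_common3:
  obtains d where "supp_le d A" "supp_le d B" "supp_le d C"
proof -
  obtain d e where "supp_le d A" "supp_le d B" "supp_le e C"
    using supp_le_exists supp_le_common by metis
  then show ?thesis using that[of "max d e"] by (meson supp_le_mono max.cobounded1 max.cobounded2)
qed

instantiation fmat :: ring
begin

lift_definition zero_fmat :: fmat is "\<lambda>_ _. 0" by auto

lift_definition plus_fmat :: "fmat \<Rightarrow> fmat \<Rightarrow> fmat" is "\<lambda>f g i j. f i j + g i j"
proof -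
  fix f g :: "nat \<Rightarrow> nat \<Rightarrow> complex"
  assume "\<exists>d. \<forall>i j. d \<le> i \<or> d \<le> j \<longrightarrow> f i j = 0" "\<exists>d. \<forall>i j. d \<le> i \<or> d \<le> j \<longrightarrow> g i j = 0"
  then obtain d e where "\<forall>i j. d \<le> i \<or> d \<le> j \<longrightarrow> f i j = 0" "\<forall>i j. e \<le> i \<or> e \<le> j \<longrightarrow> g i j = 0" by auto
  then show "\<exists>d. \<forall>i j. d \<le> i \<or> d \<le> j \<longrightarrow> f i j + g i j = 0" by (intro exI[of _ "max d e"]) auto
qed

lift_definition uminus_fmat :: "fmat \<Rightarrow> fmat" is "\<lambda>f i j. - f i j" by auto

lift_definition minus_fmat :: "fmat \<Rightarrow> fmat \<Rightarrow> fmat" is "\<lambda>f g i j. f i j - g i j"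
proof -
  fix f g :: "nat \<Rightarrow> nat \<Rightarrow> complex"
  assume "\<exists>d. \<forall>i j. d \<le> i \<or> d \<le> j \<longrightarrow> f i j = 0" "\<exists>d. \<forall>i j. d \<le> i \<or> d \<le> j \<longrightarrow> g i j = 0"
  then obtain d e where "\<forall>i j. d \<le> i \<or> d \<le> j \<longrightarrow> f i j = 0" "\<forall>i j. e \<le> i \<or> e \<le> j \<longrightarrow> g i j = 0" by auto
  then show "\<exists>d. \<forall>i j. d \<le> i \<or> d \<le> j \<longrightarrow> f i j - g i j = 0" by (intro exI[of _ "max d e"]) auto
qed

text \<open>Summing over the support of row \<open>i\<close> of the left factor keeps the sum finite
  without naming a size; \<open>ent_mult\<close> replaces this range by any size that bounds one of
  the two factors.\<close>

lift_definition times_fmat :: "fmat \<Rightarrow> fmat \<Rightarrow> fmat" is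
  "\<lambda>f g i j. \<Sum>k | f i k \<noteq> 0. f i k * g k j"
proof -
  fix f g :: "nat \<Rightarrow> nat \<Rightarrow> complex"
  assume "\<exists>d. \<forall>i j. d \<le> i \<or> d \<le> j \<longrightarrow> f i j = 0" "\<exists>d. \<forall>i j. d \<le> i \<or> d \<le> j \<longrightarrow> g i j = 0"
  then obtain d e where "\<forall>i j. d \<le> i \<or> d \<le> j \<longrightarrow> f i j = 0" "\<forall>i j. e \<le> i \<or> e \<le> j \<longrightarrow> g i j = 0" by auto
  then show "\<exists>d. \<forall>i j. d \<le> i \<or> d \<le> j \<longrightarrow> (\<Sum>k | f i k \<noteq> 0. f i k * g k j) = 0"
    by (intro exI[of _ "max d e"]) auto
qed

lemma ent_mult:
  assumes "supp_le d A \<or> supp_le d B"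
  shows "ent (A * B) i j = (\<Sum>k<d. ent A i k * ent B k j)"
proof -
  obtain e where e: "supp_le e A" using supp_le_exists by blast
  have "{k. ent A i k \<noteq> 0} \<subseteq> {..<e}" using supp_leD[OF e] by auto
  then have fin: "finite {k. ent A i k \<noteq> 0}" by (rule finite_subset) simp
  have "ent (A * B) i j = (\<Sum>k | ent A i k \<noteq> 0. ent A i k * ent B k j)" by (simp add: times_fmat.rep_eq)
  also have "\<dots> = (\<Sum>k\<in>{k. ent A i k \<noteq> 0} \<union> {..<d}. ent A i k * ent B k j)"
    by (rule sum.mono_neutral_left) (use fin in auto)
  also have "\<dots> = (\<Sum>k<d. ent A i k * ent B k j)"
    by (rule sum.mono_neutral_right) (use fin assms in \<open>auto simp: supp_le_def\<close>)
  finally show ?thesis .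
qed

instance
proof
  fix a b c :: fmat
  obtain d where d: "supp_le d a" "supp_le d b" "supp_le d c" by (rule supp_le_common3)
  obtain e where e: "supp_le e (a * b)" "supp_le e (b * c)" "supp_le e c" by (rule supp_le_common3)
  show "a * b * c = a * (b * c)"
  proof (rule fmat_eqI)
    fix i j
    have "ent (a * b * c) i j = (\<Sum>k<d. \<Sum>l<d. ent a i l * ent b l k * ent c k j)"
      using d by (simp add: ent_mult[of d] sum_distrib_right)
    also have "\<dots> = (\<Sum>l<d. \<Sum>k<d. ent a i l * ent b l k * ent c k j)" by (rule sum.swap)
    also have "\<dots> = ent (a * (b * c)) i j"
      using d by (simp add: ent_mult[of d] sum_distrib_left mult.assoc)
    finally show "ent (a * b * c) i j = ent (a * (b * c)) i j" .
  qed
  show "(a + b) * c = a * c + b * c"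
    using d by (intro fmat_eqI) (simp add: ent_mult[of d] plus_fmat.rep_eq sum.distrib algebra_simps)
  show "a * (b + c) = a * b + a * c"
    using d by (intro fmat_eqI) (simp add: ent_mult[of d] plus_fmat.rep_eq sum.distrib algebra_simps)
  show "a + b + c = a + (b + c)" by (rule fmat_eqI) (simp add: plus_fmat.rep_eq add.assoc)
  show "a + b = b + a" by (rule fmat_eqI) (simp add: plus_fmat.rep_eq add.commute)
  show "0 + a = a" by (rule fmat_eqI) (simp add: plus_fmat.rep_eq zero_fmat.rep_eq)
  show "- a + a = 0" by (rule fmat_eqI) (simp add: plus_fmat.rep_eq zero_fmat.rep_eq uminus_fmat.rep_eq)
  show "a - b = a + - b" by (rule fmat_eqI) (simp add: plus_fmat.rep_eq minus_fmat.rep_eq uminus_fmat.rep_eq)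
qed

end

lift_definition sc :: "complex \<Rightarrow> fmat \<Rightarrow> fmat" is "\<lambda>a f i j. a * f i j" by auto

lift_definition star :: "fmat \<Rightarrow> fmat" is "\<lambda>f i j. cnj (f j i)" by auto

lemma ent_simps [simp]:
  "ent 0 i j = 0" "ent (A + B) i j = ent A i j + ent B i j" "ent (- A) i j = - ent A i j"
  "ent (A - B) i j = ent A i j - ent B i j" "ent (sc a A) i j = a * ent A i j"
  "ent (star A) i j = cnj (ent A j i)"
  by (simp_all add: zero_fmat.rep_eq plus_fmat.rep_eq uminus_fmat.rep_eq minus_fmat.rep_eq
      sc.rep_eq star.rep_eq)

lemma ent_sum [simp]: "ent (sum f I) i j = (\<Sum>k\<in>I. ent (f k) i j)"
  by (induction I rule: infinite_finite_induct) auto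

lemma supp_le_simps [simp]:
  "supp_le d 0" "supp_le d A \<Longrightarrow> supp_le d B \<Longrightarrow> supp_le d (A + B)"
  "supp_le d A \<Longrightarrow> supp_le d B \<Longrightarrow> supp_le d (A - B)" "supp_le d A \<Longrightarrow> supp_le d (sc a A)"
  "supp_le d A \<Longrightarrow> supp_le d (star A)"
  by (auto simp: supp_le_def)

lemma supp_le_mult [simp]:
  assumes "supp_le d A" "supp_le d B" shows "supp_le d (A * B)"
proof -
  have "ent (A * B) i j = 0" if "d \<le> i \<or> d \<le> j" for i j
    using that assms by (auto simp: ent_mult[of d] supp_le_def)
  then show ?thesis by (auto simp: supp_le_def)
qed

lemma sc_simps [simp]:
  shows sc_add_right: "sc a (A + B) = sc a A + sc a B" and sc_diff_right: "sc a (A - B) = sc a A - sc a B"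
    and sc_sc: "sc a (sc b A) = sc (a * b) A" and sc_1: "sc 1 A = A" and sc_0_left: "sc 0 A = 0"
    and sc_0_right: "sc a 0 = 0" and sc_minus_right: "sc a (- A) = - sc a A"
proof -
  show "sc a (A + B) = sc a A + sc a B" by (rule fmat_eqI) (simp add: distrib_left)
  show "sc a (A - B) = sc a A - sc a B" by (rule fmat_eqI) (simp add: right_diff_distrib)
  show "sc a (sc b A) = sc (a * b) A" by (rule fmat_eqI) (simp add: mult.assoc)
  show "sc 1 A = A" by (rule fmat_eqI) simp
  show "sc 0 A = 0" by (rule fmat_eqI) simp
  show "sc a 0 = 0" by (rule fmat_eqI) simp
  show "sc a (- A) = - sc a A" by (rule fmat_eqI) simp
qed

lemma sc_add_left: "sc (a + b) A = sc a A + sc b A"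
  and sc_diff_left: "sc (a - b) A = sc a A - sc b A"
  and sc_minus_left: "sc (- a) A = - sc a A"
proof -
  show "sc (a + b) A = sc a A + sc b A" by (rule fmat_eqI) (simp add: distrib_right)
  show "sc (a - b) A = sc a A - sc b A" by (rule fmat_eqI) (simp add: left_diff_distrib)
  show "sc (- a) A = - sc a A" by (rule fmat_eqI) simp
qed

lemma sc_mult [simp]: "sc a A * B = sc a (A * B)" "A * sc a B = sc a (A * B)"
proof -
  obtain d where "supp_le d A" "supp_le d B" by (rule supp_le_common)
  then show "sc a A * B = sc a (A * B)" "A * sc a B = sc a (A * B)"
    by (auto intro!: fmat_eqI simp: ent_mult[of d] sum_distrib_left algebra_simps)
qed

lemma sc_sum: "sc a (sum f I) = (\<Sum>k\<in>I. sc a (f k))"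
  by (rule fmat_eqI) (simp add: sum_distrib_left)

lemma sc_eq_0 [simp]: "sc a A = 0 \<longleftrightarrow> a = 0 \<or> A = 0"
proof
  assume "sc a A = 0"
  then have "a * ent A i j = 0" for i j by (metis ent_simps(1,5))
  then show "a = 0 \<or> A = 0" by (auto intro!: fmat_eqI)
qed auto

lemma star_simps [simp]:
  "star 0 = 0" "star (A + B) = star A + star B" "star (A - B) = star A - star B" "star (- A) = - star A"
  "star (sc a A) = sc (cnj a) (star A)" "star (star A) = A"
proof -
  show "star 0 = 0" by (rule fmat_eqI) simp
  show "star (A + B) = star A + star B" by (rule fmat_eqI) simp
  show "star (A - B) = star A - star B" by (rule fmat_eqI) simp
  show "star (- A) = - star A" by (rule fmat_eqI) simp
  show "star (sc a A) = sc (cnj a) (star A)" by (rule fmat_eqI) simp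
  show "star (star A) = A" by (rule fmat_eqI) simp
qed

lemma star_mult [simp]: "star (A * B) = star B * star A"
proof -
  obtain d where "supp_le d A" "supp_le d B" by (rule supp_le_common)
  then show ?thesis by (intro fmat_eqI) (simp add: ent_mult[of d] algebra_simps)
qed

lemma star_sum: "star (sum f I) = (\<Sum>k\<in>I. star (f k))"
  by (rule fmat_eqI) simp

lemma star_eq_0 [simp]: "star A = 0 \<longleftrightarrow> A = 0"
  by (metis star_simps(1,6))

section \<open>The trace and its positivity\<close>

definition ftrace :: "fmat \<Rightarrow> complex" where
  "ftrace A = (\<Sum>i | ent A i i \<noteq> 0. ent A i i)"

lemma ftrace: "supp_le d A \<Longrightarrow> ftrace A = (\<Sum>i<d. ent A i i)"
  unfolding ftrace_def
  by (rule sum.mono_neutral_left) (auto dest: supp_leD)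

lemma ftrace_add: "ftrace (A + B) = ftrace A + ftrace B"
proof -
  obtain d where "supp_le d A" "supp_le d B" by (rule supp_le_common)
  then show ?thesis by (simp add: ftrace[of d] sum.distrib)
qed

lemma ftrace_0 [simp]: "ftrace 0 = 0" by (simp add: ftrace_def)

lemma ftrace_sum: "ftrace (sum f I) = (\<Sum>k\<in>I. ftrace (f k))"
  by (induction I rule: infinite_finite_induct) (auto simp: ftrace_add)

lemma ftrace_sc: "ftrace (sc a A) = a * ftrace A"
proof -
  obtain d where "supp_le d A" using supp_le_exists by blast
  then show ?thesis by (simp add: ftrace[of d] sum_distrib_left)
qed

lemma ftrace_comm: "ftrace (A * B) = ftrace (B * A)"
proof -
  obtain d where d: "supp_le d A" "supp_le d B" by (rule supp_le_common)
  have "ftrace (A * B) = (\<Sum>i<d. \<Sum>k<d. ent A i k * ent B k i)"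
    using d by (simp add: ftrace[of d] ent_mult[of d])
  also have "\<dots> = (\<Sum>k<d. \<Sum>i<d. ent A i k * ent B k i)" by (rule sum.swap)
  also have "\<dots> = ftrace (B * A)" using d by (simp add: ftrace[of d] ent_mult[of d] mult.commute)
  finally show ?thesis .
qed

lemma ent_star_mult_diag:
  assumes "supp_le d A" shows "ent (star A * A) j j = of_real (\<Sum>k<d. (cmod (ent A k j))\<^sup>2)"
proof -
  have "cnj z * z = of_real ((cmod z)\<^sup>2)" for z by (simp only: complex_norm_square mult.commute)
  moreover have "ent (star A * A) j j = (\<Sum>k<d. cnj (ent A k j) * ent A k j)"
    using ent_mult[of d "star A" A] assms by simp
  ultimately show ?thesis by (simp only: of_real_sum)
qed

lemma ftrace_star_mult:
  assumes "supp_le d A" shows "ftrace (star A * A) = of_real (\<Sum>j<d. \<Sum>k<d. (cmod (ent A k j))\<^sup>2)"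
proof -
  have "supp_le d (star A * A)" using assms by simp
  then show ?thesis using assms by (simp add: ftrace[of d] ent_star_mult_diag[of d])
qed

lemma ftrace_star_mult_nonneg: "\<exists>r\<ge>0. ftrace (star A * A) = of_real r"
proof -
  obtain d where "supp_le d A" using supp_le_exists by blast
  then show ?thesis by (intro exI[of _ "\<Sum>j<d. \<Sum>k<d. (cmod (ent A k j))\<^sup>2"])
      (auto simp only: ftrace_star_mult intro!: sum_nonneg zero_le_power2)
qed

text \<open>The trace of \<open>star A * A\<close> is the sum of the squared moduli of all entries.
  Faithfulness of the trace takes the place of the C*-identity: it makes
  \<open>star A * A = 0\<close> equivalent to \<open>A = 0\<close>.\<close>

lemma ftrace_star_mult_eq_0: "ftrace (star A * A) = 0 \<Longrightarrow> A = 0"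
proof (rule fmat_eqI)
  fix i j assume *: "ftrace (star A * A) = 0"
  obtain d where d: "supp_le d A" using supp_le_exists by blast
  then have "(\<Sum>j<d. \<Sum>k<d. (cmod (ent A k j))\<^sup>2) = 0" using * by (metis ftrace_star_mult of_real_eq_0_iff)
  then have "\<forall>j<d. \<forall>k<d. ent A k j = 0" by (simp add: sum_nonneg_eq_0_iff sum_nonneg)
  then show "ent A i j = ent 0 i j" using d by (cases "i < d \<and> j < d") (auto simp: supp_le_def not_less)
qed

lemma star_mult_eq_0 [simp]: "star A * A = 0 \<longleftrightarrow> A = 0"
  using ftrace_star_mult_eq_0[of A] by auto

lemma mult_star_eq_0 [simp]: "A * star A = 0 \<longleftrightarrow> A = 0"
  using star_mult_eq_0[of "star A"] by simp

section \<open>Projections and spectral decomposition\<close>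

definition subalg :: "nat \<Rightarrow> fmat set \<Rightarrow> bool" where
  "subalg d S \<longleftrightarrow> (\<forall>X\<in>S. supp_le d X) \<and> 0 \<in> S \<and> (\<forall>X\<in>S. \<forall>Y\<in>S. X + Y \<in> S) \<and>
     (\<forall>a. \<forall>X\<in>S. sc a X \<in> S) \<and> (\<forall>X\<in>S. \<forall>Y\<in>S. X * Y \<in> S) \<and> (\<forall>X\<in>S. star X \<in> S)"

lemma subalgD:
  assumes "subalg d S"
  shows "X \<in> S \<Longrightarrow> supp_le d X" "0 \<in> S" "X \<in> S \<Longrightarrow> Y \<in> S \<Longrightarrow> X + Y \<in> S"
    "X \<in> S \<Longrightarrow> sc a X \<in> S" "X \<in> S \<Longrightarrow> Y \<in> S \<Longrightarrow> X * Y \<in> S" "X \<in> S \<Longrightarrow> star X \<in> S"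
    "X \<in> S \<Longrightarrow> Y \<in> S \<Longrightarrow> X - Y \<in> S"
proof -
  show *: "X \<in> S \<Longrightarrow> supp_le d X" "0 \<in> S" "X \<in> S \<Longrightarrow> Y \<in> S \<Longrightarrow> X + Y \<in> S"
    "X \<in> S \<Longrightarrow> sc a X \<in> S" "X \<in> S \<Longrightarrow> Y \<in> S \<Longrightarrow> X * Y \<in> S" "X \<in> S \<Longrightarrow> star X \<in> S" for X Y a
    using assms by (auto simp: subalg_def)
  have "X - Y = X + sc (- 1) Y" by (simp add: sc_minus_left)
  then show "X \<in> S \<Longrightarrow> Y \<in> S \<Longrightarrow> X - Y \<in> S" using * by metis
qed

lemma subalg_sum: "subalg d S \<Longrightarrow> (\<And>i. i \<in> I \<Longrightarrow> f i \<in> S) \<Longrightarrow> sum f I \<in> S"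
  by (induction I rule: infinite_finite_induct) (auto intro: subalgD)

section \<open>Counting orthogonal projections by Bessel's inequality\<close>

definition projection :: "fmat \<Rightarrow> bool" where
  "projection p \<longleftrightarrow> p * p = p \<and> star p = p"

lemma projection_ent_diag:
  assumes "projection p" "supp_le d p"
  shows "ent p m m = of_real (\<Sum>k<d. (cmod (ent p k m))\<^sup>2)"
  using ent_star_mult_diag[of d p m] assms by (simp add: projection_def)

text \<open>A diagonal entry of a projection is the squared norm of its column, so dividing column
  \<open>m\<close> by \<open>sqrt r\<close> gives a unit vector in the range of \<open>p\<close>.
  Vectors are extracted from projections in this way, here and later for the code vectors.\<close>

lemma projection_nonzero_column:
  assumes p: "projection p" "p \<noteq> 0"
  obtains m r where "ent p m m = complex_of_real r" "r > 0"
proof -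
  obtain d where d: "supp_le d p" using supp_le_exists by blast
  obtain k m where km: "ent p k m \<noteq> 0" using p(2) fmat_eqI[of p 0] by auto
  then have "k < d" using supp_leD[OF d] by blast
  then have "(\<Sum>k<d. (cmod (ent p k m))\<^sup>2) > 0"
    using km by (intro sum_pos2[of _ k]) auto
  then show ?thesis using that projection_ent_diag[OF p(1) d] by blast
qed

text \<open>\<open>z\<close> is the orthogonal projection of the basis vector at \<open>t\<close>
  onto the span of the \<open>v i\<close>. Its coordinate at \<open>t\<close> equals its squared
  norm \<open>A\<close>, whence \<open>A^2 <= A\<close>.\<close>

lemma bessel_coordinate:
  fixes v :: "'i \<Rightarrow> 't \<Rightarrow> complex"
  assumes fin: "finite I" "finite T" and t: "t \<in> T"
    and orth: "\<And>i j. i \<in> I \<Longrightarrow> j \<in> I \<Longrightarrow> (\<Sum>s\<in>T. v i s * cnj (v j s)) = (if i = j then 1 else 0)"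
  shows "(\<Sum>i\<in>I. (cmod (v i t))\<^sup>2) \<le> 1"
proof -
  define A where "A = (\<Sum>i\<in>I. (cmod (v i t))\<^sup>2)"
  define z where "z s = (\<Sum>i\<in>I. cnj (v i t) * v i s)" for s
  have zt: "z t = of_real A"
    by (simp add: z_def A_def complex_norm_square mult.commute del: of_real_power)
  have "(\<Sum>s\<in>T. z s * cnj (z s)) = (\<Sum>s\<in>T. \<Sum>i\<in>I. \<Sum>j\<in>I. cnj (v i t) * v j t * (v i s * cnj (v j s)))"
    by (simp add: z_def sum_product mult_ac)
  also have "\<dots> = (\<Sum>i\<in>I. \<Sum>j\<in>I. \<Sum>s\<in>T. cnj (v i t) * v j t * (v i s * cnj (v j s)))"
    by (simp add: sum.swap[of _ I T])
  also have "\<dots> = (\<Sum>i\<in>I. \<Sum>j\<in>I. if i = j then cnj (v i t) * v j t else 0)"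
    by (intro sum.cong refl) (simp add: sum_distrib_left[symmetric] orth)
  also have "\<dots> = of_real A"
    using fin by (simp add: A_def complex_norm_square mult.commute del: of_real_power)
  finally have "complex_of_real (\<Sum>s\<in>T. (cmod (z s))\<^sup>2) = of_real A"
    by (simp add: complex_norm_square del: of_real_power)
  then have "(\<Sum>s\<in>T. (cmod (z s))\<^sup>2) = A" by (simp only: of_real_eq_iff)
  moreover have "(cmod (z t))\<^sup>2 \<le> (\<Sum>s\<in>T. (cmod (z s))\<^sup>2)"
    using fin t by (intro member_le_sum) auto
  ultimately have "A\<^sup>2 \<le> A" using zt by simp
  then have "A * (A - 1) \<le> 0" by (simp add: power2_eq_square algebra_simps)
  then show ?thesis unfolding A_def[symmetric] by (auto simp: mult_le_0_iff)
qed

text \<open>One unit column is taken from each projection. These vectors are orthonormal, so their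
  squared entries sum to at most 1 in each of the \<open>d\<close> coordinates and to
  \<open>card F\<close> altogether. The bound guarantees that families of largest size
  exist.\<close>

lemma orthogonal_projections_bound:
  assumes F: "finite F" "\<And>p. p \<in> F \<Longrightarrow> projection p \<and> p \<noteq> 0 \<and> supp_le d p"
    and orth: "\<And>p q. p \<in> F \<Longrightarrow> q \<in> F \<Longrightarrow> p \<noteq> q \<Longrightarrow> p * q = 0"
  shows "card F \<le> d"
proof -
  have "\<forall>p\<in>F. \<exists>m r. ent p m m = complex_of_real r \<and> r > 0"
    using F(2) projection_nonzero_column by metis
  then obtain m r where mr: "ent p (m p) (m p) = complex_of_real (r p)" "r p > 0" if "p \<in> F" for p
    by metis
  define v where "v p s = ent p s (m p) / of_real (sqrt (r p))" for p s
  have orth': "(\<Sum>s<d. v p s * cnj (v q s)) = (if p = q then 1 else 0)" if pq: "p \<in> F" "q \<in> F" for p q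
  proof -
    have "(\<Sum>s<d. v p s * cnj (v q s)) =
       (\<Sum>s<d. cnj (ent q s (m q)) * ent p s (m p)) / of_real (sqrt (r p) * sqrt (r q))"
      by (simp add: v_def sum_divide_distrib mult_ac)
    also have "(\<Sum>s<d. cnj (ent q s (m q)) * ent p s (m p)) = ent (star q * p) (m q) (m p)"
      using F(2) pq by (simp add: ent_mult[of d])
    also have "star q * p = (if p = q then p else 0)"
      using F(2) pq orth by (auto simp: projection_def)
    finally show ?thesis using mr[OF pq(1)] by (auto simp flip: of_real_mult)
  qed
  have norm1: "(\<Sum>s<d. (cmod (v p s))\<^sup>2) = 1" if "p \<in> F" for p
  proof -
    have "complex_of_real (\<Sum>s<d. (cmod (v p s))\<^sup>2) = 1"
      using orth'[OF that that] by (simp add: complex_norm_square del: of_real_power)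
    then show ?thesis by (simp only: of_real_eq_1_iff)
  qed
  have "real (card F) = (\<Sum>p\<in>F. \<Sum>s<d. (cmod (v p s))\<^sup>2)" using norm1 by simp
  also have "\<dots> = (\<Sum>s<d. \<Sum>p\<in>F. (cmod (v p s))\<^sup>2)" by (rule sum.swap)
  also have "\<dots> \<le> (\<Sum>s<d. 1)"
    by (intro sum_mono bessel_coordinate[where T = "{..<d}"] orth') (use F in auto)
  finally show ?thesis by simp
qed

section \<open>Eigenprojections of hermitian elements\<close>

interpretation fmat_vs: vector_space sc
  by unfold_locales (auto simp: sc_add_left)

definition funit :: "nat \<Rightarrow> nat \<Rightarrow> fmat" where
  "funit i j = Abs_fmat (\<lambda>r s. if r = i \<and> s = j then 1 else 0)"

lemma ent_funit [simp]: "ent (funit i j) r s = (if r = i \<and> s = j then 1 else 0)"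
  unfolding funit_def by (subst Abs_fmat_inverse) (auto intro!: exI[of _ "Suc (i + j)"])

lemma fmat_expand:
  assumes "supp_le d A"
  shows "A = (\<Sum>i<d. \<Sum>j<d. sc (ent A i j) (funit i j))"
proof (rule fmat_eqI)
  fix r s
  have "ent (\<Sum>i<d. \<Sum>j<d. sc (ent A i j) (funit i j)) r s
      = (\<Sum>i<d. if r = i then \<Sum>j<d. if s = j then ent A i j else 0 else 0)"
    unfolding ent_sum ent_simps ent_funit by (intro sum.cong refl) (auto simp: if_distrib cong: if_cong)
  also have "\<dots> = ent A r s" using assms by (auto simp: supp_le_def)
  finally show "ent A r s = ent (\<Sum>i<d. \<Sum>j<d. sc (ent A i j) (funit i j)) r s" by (rule sym)
qed

lemma fmat_linear_dependence:
  fixes y :: "nat \<Rightarrow> fmat"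
  assumes y: "\<And>k. supp_le d (y k)"
  obtains a where "\<exists>k\<le>d * d. a k \<noteq> 0" "(\<Sum>k\<le>d * d. sc (a k) (y k)) = 0"
proof (cases "inj_on y {..d * d}")
  case True
  define U where "U = (\<lambda>(i, j). funit i j) ` ({..<d} \<times> {..<d})"
  have U: "finite U" "card U \<le> d * d"
    unfolding U_def using card_image_le[of "{..<d} \<times> {..<d}"] by (auto simp: card_cartesian_product)
  have "funit i j \<in> U" if "i < d" "j < d" for i j using that by (force simp: U_def)
  then have "y k \<in> fmat_vs.span U" for k
    by (subst fmat_expand[OF y]) (intro fmat_vs.span_sum fmat_vs.span_scale fmat_vs.span_base, simp)
  then have "y ` {..d * d} \<subseteq> fmat_vs.span U" by auto
  moreover have "\<not> card (y ` {..d * d}) \<le> card U" using U(2) card_image[OF True] by simp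
  ultimately have "fmat_vs.dependent (y ` {..d * d})" using fmat_vs.independent_span_bound[OF U(1)] by blast
  then obtain u where u: "\<exists>v\<in>y ` {..d * d}. u v \<noteq> 0" "(\<Sum>v\<in>y ` {..d * d}. sc (u v) v) = 0"
    using fmat_vs.dependent_finite[of "y ` {..d * d}"] by auto
  show thesis
    by (rule that[of "u \<circ> y"]) (use u sum.reindex[OF True, of "\<lambda>v. sc (u v) v"] in \<open>auto simp: o_def\<close>)
next
  case False
  then obtain i j where ij: "i \<le> d * d" "j \<le> d * d" "i \<noteq> j" "y i = y j" by (auto simp: inj_on_def)
  \<comment> \<open>Linear dependence of a set does not register repetitions, so two equal members
    are treated on their own, with coefficients 1 and -1.\<close>
  define a :: "nat \<Rightarrow> complex" where "a k = (if k = i then 1 else if k = j then - 1 else 0)" for k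
  have "(\<Sum>k\<le>d * d. sc (a k) (y k)) = (\<Sum>k\<in>{i, j}. sc (a k) (y k))"
    by (rule sum.mono_neutral_right) (use ij in \<open>auto simp: a_def\<close>)
  also have "\<dots> = 0" using ij by (simp add: a_def sc_minus_left)
  finally show thesis using ij by (intro that[of a]) (auto simp: a_def)
qed

text \<open>The powers of \<open>h\<close> are linearly dependent and complex polynomials split.\<close>

lemma annihilating_product:
  assumes h: "supp_le d h"
  shows "\<exists>ms. foldr (\<lambda>m y. h * y - sc m y) ms h = 0"
proof -
  \<comment> \<open>The sequence starts with \<open>h\<close> itself, because the ring has no unit:
    \<open>y k\<close> is the power of exponent \<open>k + 1\<close>. Every polynomial expression
    below therefore carries an additional factor \<open>h\<close>.\<close>
  define y where "y k = ((*) h ^^ k) h" for k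
  have y_Suc: "y (Suc k) = h * y k" for k by (simp add: y_def)
  have "supp_le d (y k)" for k by (induction k) (use h in \<open>auto simp: y_def\<close>)
  then obtain a where a: "\<exists>k\<le>d * d. a k \<noteq> 0" "(\<Sum>k\<le>d * d. sc (a k) (y k)) = 0"
    by (rule fmat_linear_dependence)
  define P where "P = (\<Sum>k\<le>d * d. monom (a k) k)"
  have cP: "coeff P k = (if k \<le> d * d then a k else 0)" for k
    by (simp add: P_def coeff_sum)
  then have P: "P \<noteq> 0" "degree P \<le> d * d"
    using a(1) by (metis coeff_0, simp add: degree_le)
  have split: "\<exists>ms c. c \<noteq> 0 \<and> (\<Sum>k\<le>degree Q. sc (coeff Q k) (y k)) = sc c (foldr (\<lambda>m y. h * y - sc m y) ms h)"
    if "Q \<noteq> 0" for Q :: "complex poly"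
    using that
  proof (induction "degree Q" arbitrary: Q)
    case 0
    then have "coeff Q 0 \<noteq> 0" by (metis leading_coeff_0_iff)
    then show ?case using 0 by (intro exI[of _ "[]"] exI[of _ "coeff Q 0"]) (simp add: y_def flip: 0(1))
  next
    case (Suc n)
    then have "\<not> constant (poly Q)" by (simp add: constant_degree flip: Suc(2))
    \<comment> \<open>A root splits off a linear factor, which becomes the head of the list;
      multiplication by the indeterminate is the index shift \<open>y_Suc\<close>.\<close>
    then obtain z where "poly Q z = 0" using fundamental_theorem_of_algebra by blast
    then obtain R where R: "Q = [:- z, 1:] * R" by (auto simp: poly_eq_0_iff_dvd elim: dvdE)
    then have R0: "R \<noteq> 0" using Suc by auto
    then have dR: "degree Q = Suc (degree R)" unfolding R by (subst degree_mult_eq) auto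
    then obtain ms c where c: "c \<noteq> 0"
      "(\<Sum>k\<le>degree R. sc (coeff R k) (y k)) = sc c (foldr (\<lambda>m y. h * y - sc m y) ms h)"
      using Suc(1)[of R] Suc(2) R0 by auto
    have cQ: "coeff Q k = (case k of 0 \<Rightarrow> 0 | Suc l \<Rightarrow> coeff R l) - z * coeff R k" for k
      by (simp add: R coeff_pCons split: nat.splits)
    have "(\<Sum>k\<le>degree Q. sc (coeff Q k) (y k)) =
        (\<Sum>k\<le>degree Q. sc (case k of 0 \<Rightarrow> 0 | Suc l \<Rightarrow> coeff R l) (y k)) -
        sc z (\<Sum>k\<le>degree Q. sc (coeff R k) (y k))"
      by (simp add: cQ sc_diff_left sum_subtractf sc_sum)
    also have "(\<Sum>k\<le>degree Q. sc (coeff R k) (y k)) = (\<Sum>k\<le>degree R. sc (coeff R k) (y k))"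
      by (simp add: dR coeff_eq_0)
    also have "(\<Sum>k\<le>degree Q. sc (case k of 0 \<Rightarrow> 0 | Suc l \<Rightarrow> coeff R l) (y k)) =
        h * (\<Sum>k\<le>degree R. sc (coeff R k) (y k))"
      unfolding dR by (subst sum.atMost_Suc_shift) (simp add: y_Suc sum_distrib_left)
    finally have "(\<Sum>k\<le>degree Q. sc (coeff Q k) (y k)) =
      sc c (foldr (\<lambda>m y. h * y - sc m y) (z # ms) h)" by (simp add: c(2) mult.commute)
    then show ?case using c(1) by blast
  qed
  have "(\<Sum>k\<le>degree P. sc (coeff P k) (y k)) = (\<Sum>k\<le>d * d. sc (coeff P k) (y k))"
    by (rule sum.mono_neutral_left) (use P coeff_eq_0 in \<open>auto simp: not_le\<close>)
  then have "(\<Sum>k\<le>degree P. sc (coeff P k) (y k)) = 0" using a(2) by (simp add: cP)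
  then show ?thesis using split[OF P(1)] by auto
qed

text \<open>The last nonzero partial product \<open>y\<close> of an annihilating product of linear
  factors is an eigenelement of \<open>h\<close>. It is a polynomial in the hermitian
  \<open>h\<close>, so its adjoint acts as a scalar on eigenelements; thus \<open>star y * y\<close>
  is a multiple of \<open>y\<close>, and a rescaling of \<open>y\<close> is a projection. The
  conclusions about \<open>g\<close> transfer left units and left annihilators of \<open>h\<close>
  to \<open>p\<close>.\<close>

lemma spectral_projection:
  assumes S: "subalg d S" and h: "h \<in> S" "star h = h" "h \<noteq> 0"
  obtains p m where "p \<in> S" "projection p" "p \<noteq> 0" "h * p = sc m p"
    "\<And>g. g * h = h \<Longrightarrow> g * p = p" "\<And>g. g * h = 0 \<Longrightarrow> g * p = 0"
proof -
  \<comment> \<open>The last clause captures that \<open>star y\<close> is a polynomial in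
    \<open>h\<close>, through its action on the eigenelements of \<open>h\<close>.\<close>
  define G where "G y \<longleftrightarrow> y \<in> S \<and> (\<forall>g. g * h = h \<longrightarrow> g * y = y) \<and> (\<forall>g. g * h = 0 \<longrightarrow> g * y = 0) \<and>
     (\<forall>z m. h * z = sc m z \<longrightarrow> (\<exists>b. star y * z = sc b z))" for y
  have Gh: "G h" using h by (auto simp: G_def)
  have Gstep: "G (h * y - sc m y)" if "G y" for y m
  proof -
    have y: "y \<in> S" "\<And>g. g * h = h \<Longrightarrow> g * y = y" "\<And>g. g * h = 0 \<Longrightarrow> g * y = 0"
      "\<And>z m. h * z = sc m z \<Longrightarrow> \<exists>b. star y * z = sc b z" using that by (auto simp: G_def)
    have "h * y - sc m y \<in> S" using S h(1) y(1) by (intro subalgD)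
    moreover have "g * (h * y - sc m y) = h * y - sc m y" if "g * h = h" for g
      using y(2)[OF that] that by (simp add: right_diff_distrib flip: mult.assoc)
    moreover have "g * (h * y - sc m y) = 0" if "g * h = 0" for g
      using y(3)[OF that] that by (simp add: right_diff_distrib flip: mult.assoc)
    moreover have "\<exists>b. star (h * y - sc m y) * z = sc b z" if hz: "h * z = sc m' z" for z m'
    proof -
      obtain b where b: "star y * z = sc b z" using y(4)[OF hz] by blast
      have "star (h * y - sc m y) * z = sc (m' * b - cnj m * b) z"
        using h(2) b hz by (simp add: left_diff_distrib mult.assoc sc_diff_left)
      then show ?thesis by blast
    qed
    ultimately show ?thesis by (auto simp: G_def)
  qed
  let ?F = "\<lambda>m y. h * y - sc m y"
  have GF: "G (foldr ?F ms h)" for ms by (induction ms) (use Gh Gstep in auto)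
  have "\<exists>y m. G y \<and> y \<noteq> 0 \<and> h * y = sc m y" if "foldr ?F ms h = 0" for ms
    using that
  proof (induction ms)
    case (Cons m ms)
    then show ?case using GF[of ms] by (cases "foldr ?F ms h = 0") auto
  qed (use h in simp)
  then obtain y m where y: "G y" "y \<noteq> 0" "h * y = sc m y"
    using annihilating_product subalgD(1)[OF S h(1)] by blast
  then obtain b where b: "star y * y = sc b y" unfolding G_def by blast
  then have b0: "b \<noteq> 0" using y(2) star_mult_eq_0 by force
  define B where "B = star y * y"
  define p where "p = sc (1 / (b * cnj b)) B"
  \<comment> \<open>\<open>B\<close> is both hermitian and a multiple of \<open>y\<close>, so
    \<open>B * B = star B * B\<close> reduces to \<open>star y * y\<close>; this fixes the
    normalisation \<open>b * cnj b\<close>.\<close>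
  have By: "B = sc b y" and sB: "star B = B" by (simp_all add: B_def b[symmetric])
  have "B * B = star B * B" by (simp add: sB)
  also have "\<dots> = sc (b * cnj b) (star y * y)" unfolding By by (simp add: mult.commute)
  finally have BB: "B * B = sc (b * cnj b) B" unfolding B_def[symmetric] .
  have "projection p" using b0 sB by (simp add: projection_def p_def BB mult.commute)
  moreover have "p = sc (1 / cnj b) y" using b0 by (simp add: p_def By)
  moreover have "y \<in> S" "\<And>g. g * h = h \<Longrightarrow> g * y = y" "\<And>g. g * h = 0 \<Longrightarrow> g * y = 0"
    using y(1) by (auto simp: G_def)
  ultimately show thesis
    using that[of p m] y(2,3) b0 subalgD(4)[OF S] by (simp add: mult.commute)
qed

section \<open>Minimal projections\<close>

definition minproj :: "fmat set \<Rightarrow> fmat \<Rightarrow> bool" where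
  "minproj S p \<longleftrightarrow> p \<in> S \<and> projection p \<and> p \<noteq> 0 \<and> (\<forall>X\<in>S. \<exists>a. p * X * p = sc a p)"

lemma projectionD: "projection p \<Longrightarrow> p * p = p" "projection p \<Longrightarrow> star p = p"
  by (auto simp: projection_def)

lemma projection_sub:
  assumes "projection p" "projection q" "p * q = q"
  shows "q * p = q" "projection (p - q)"
proof -
  show *: "q * p = q" using assms by (metis projectionD(2) star_mult)
  show "projection (p - q)" using assms *
    by (simp add: projection_def left_diff_distrib right_diff_distrib)
qed

text \<open>In a family of mutually orthogonal nonzero projections below \<open>e\<close> of largest
  size no member can be split. The spectral projection of a nonzero hermitian element of the corner
  \<open>p S p\<close> lies below \<open>p\<close>, hence equals \<open>p\<close>; so hermitian
  elements of the corner are multiples of \<open>p\<close>, and by real and imaginary parts all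
  elements are.\<close>

lemma minproj_below:
  assumes S: "subalg d S" and e: "e \<in> S" "projection e" "e \<noteq> 0"
  obtains p where "minproj S p" "e * p = p"
proof -
  define Q where "Q F \<longleftrightarrow> finite F \<and> F \<noteq> {} \<and> (\<forall>p\<in>F. p \<in> S \<and> projection p \<and> p \<noteq> 0 \<and> e * p = p) \<and>
    (\<forall>p\<in>F. \<forall>q\<in>F. p \<noteq> q \<longrightarrow> p * q = 0)" for F
  have "Q {e}" using e by (auto simp: Q_def projectionD)
  moreover have "\<forall>F. Q F \<longrightarrow> card F \<le> d"
    using subalgD(1)[OF S] orthogonal_projections_bound by (auto simp: Q_def)
  ultimately obtain F where F: "Q F" and max: "\<And>F'. Q F' \<Longrightarrow> card F' \<le> card F"
    using ex_has_greatest_nat[of Q "{e}" card "Suc d"] by (auto simp: less_Suc_eq_le)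
  obtain p where p: "p \<in> F" using F by (auto simp: Q_def)
  have pS: "p \<in> S" "projection p" "p \<noteq> 0" "e * p = p" using F p by (auto simp: Q_def)
  have whole: "q = p" if q: "q \<in> S" "projection q" "q \<noteq> 0" "p * q = q" for q
  proof (rule ccontr)
    assume "q \<noteq> p"
    have qp: "q * p = q" "projection (p - q)" using projection_sub pS q by auto
    have r0: "r * q = 0" "q * r = 0" "r * (p - q) = 0" "(p - q) * r = 0" if "r \<in> F" "r \<noteq> p" for r
    proof -
      have "r * p = 0" "p * r = 0" using that F p by (auto simp: Q_def)
      then show "r * q = 0" "q * r = 0" "r * (p - q) = 0" "(p - q) * r = 0"
        using qp(1) q(4) by (simp_all add: left_diff_distrib right_diff_distrib)
          (metis mult.assoc mult_zero_left mult_zero_right)+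
    qed
    have e1: "e * q = q" "e * (p - q) = p - q"
      using pS(4) q(4) by (simp_all add: right_diff_distrib) (metis mult.assoc)+
    have o1: "q * (p - q) = 0" "(p - q) * q = 0"
      using qp(1) q by (auto simp: left_diff_distrib right_diff_distrib projectionD)
    have nin: "q \<notin> F - {p}" "p - q \<notin> F - {p}" "q \<noteq> p - q"
    proof -
      show "q \<notin> F - {p}" using r0[of q] q by (auto simp: projectionD)
      show "p - q \<notin> F - {p}" using r0[of "p - q"] qp(2) \<open>q \<noteq> p\<close> by (auto simp: projectionD)
      show "q \<noteq> p - q" using o1 q by (metis projectionD(1))
    qed
    \<comment> \<open>Replacing \<open>p\<close> by its two parts \<open>q\<close> and
      \<open>p - q\<close> would give a larger family.\<close>
    have "Q (insert q (insert (p - q) (F - {p})))"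
      unfolding Q_def using F S pS q qp e1 o1 r0 \<open>q \<noteq> p\<close>
      by (auto simp: Q_def intro: subalgD(7))
    then have "card (insert q (insert (p - q) (F - {p}))) \<le> card F" by (rule max)
    moreover have "finite F" using F by (simp add: Q_def)
    moreover have "card F = Suc (card (F - {p}))" using \<open>finite F\<close> p by (rule card.remove)
    moreover have "card (insert q (insert (p - q) (F - {p}))) = Suc (Suc (card (F - {p})))"
    proof -
      have "card (insert (p - q) (F - {p})) = Suc (card (F - {p}))"
        by (rule card_insert_disjoint) (use \<open>finite F\<close> nin(2) in auto)
      then show ?thesis using \<open>finite F\<close> nin(1,3) by (subst card_insert_disjoint) auto
    qed
    ultimately show False by simp
  qed
  have herm: "\<exists>a. X = sc a p" if X: "X \<in> S" "star X = X" "p * X = X" for X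
  proof (cases "X = 0")
    case False
    then obtain q m where q: "q \<in> S" "projection q" "q \<noteq> 0" "X * q = sc m q" "p * q = q"
      using spectral_projection[OF S X(1,2)] X(3) by metis
    then have "q = p" using whole by blast
    moreover have "X * p = X" using X pS by (metis projectionD(2) star_mult)
    ultimately show ?thesis using q by metis
  qed (auto intro: exI[of _ 0])
  have "\<exists>a. p * X * p = sc a p" if X: "X \<in> S" for X
  proof -
    define A where "A = p * X * p"
    have A: "A \<in> S" "p * A = A" "A * p = A" "p * star A = star A"
      using X pS S by (auto simp: A_def projectionD mult.assoc intro!: subalgD) (auto simp: projectionD simp flip: mult.assoc)
    obtain a b where a: "A + star A = sc a p" and b: "sc \<i> (A - star A) = sc b p"
      using herm[of "A + star A"] herm[of "sc \<i> (A - star A)"] A S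
      by (auto simp: distrib_left right_diff_distrib add.commute intro: subalgD)
    have "A - star A = sc (- \<i> * b) p" using arg_cong[OF b, of "sc (- \<i>)"] by simp
    moreover have "A = sc (1/2) (A + star A) + sc (1/2) (A - star A)"
      by (rule fmat_eqI) (simp add: field_simps)
    ultimately have "A = sc (1/2 * a + 1/2 * (- \<i> * b)) p"
      by (simp only: a sc_sc sc_add_left)
    then show ?thesis unfolding A_def by blast
  qed
  then show thesis using that[of p] pS by (auto simp: minproj_def)
qed

text \<open>What annihilates \<open>X\<close> from the left also annihilates the eigenprojection of
  \<open>X * star X\<close>. So if every member of a family of projections annihilates
  \<open>X\<close>, there is a minimal projection orthogonal to the whole family: this is how
  families are extended.\<close>

lemma minproj_extend:
  assumes S: "subalg d S" and X: "X \<in> S" "X \<noteq> 0"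
  obtains q where "minproj S q" "\<And>g. g * X = 0 \<Longrightarrow> g * q = 0"
proof -
  have "X * star X \<in> S" using S X by (auto intro: subalgD)
  then obtain e m where e: "e \<in> S" "projection e" "e \<noteq> 0"
    "\<And>g. g * (X * star X) = 0 \<Longrightarrow> g * e = 0"
    using spectral_projection[OF S, of "X * star X"] X(2) by (metis mult_star_eq_0 star_mult star_simps(6))
  obtain q where q: "minproj S q" "e * q = q" using minproj_below[OF S e(1-3)] by blast
  have "g * q = 0" if "g * X = 0" for g
  proof -
    have "g * (X * star X) = 0" using that by (simp flip: mult.assoc)
    then have "g * e = 0" by (rule e(4))
    then show ?thesis using q(2) by (metis mult.assoc mult_zero_left)
  qed
  then show thesis using that q by blast
qed

lemma minprojD:
  assumes "minproj S p"
  shows "p \<in> S" "projection p" "p \<noteq> 0" "p * p = p" "star p = p" "X \<in> S \<Longrightarrow> \<exists>a. p * X * p = sc a p"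
  using assms by (auto simp: minproj_def projection_def)

text \<open>Polar decomposition in its simplest case: \<open>star g * g\<close> lies in the scalar
  corner \<open>q S q\<close>, so \<open>g = p * X * q\<close> is a multiple of a partial isometry
  \<open>f\<close> from \<open>q\<close> to \<open>p\<close>. Multiplication by
  \<open>star f\<close> carries \<open>p S q\<close> into the corner \<open>p S p\<close>, so
  \<open>p S q\<close> is spanned by \<open>f\<close>.\<close>

lemma minproj_connect:
  assumes S: "subalg d S" and p: "minproj S p" and q: "minproj S q" and X: "X \<in> S" "p * X * q \<noteq> 0"
  obtains f where "f \<in> S" "star f * f = q" "f * star f = p" "p * f = f" "f * q = f" "\<And>Y. Y \<in> S \<Longrightarrow> \<exists>a. p * Y * q = sc a f"
proof -
  note P = minprojD[OF p] and Q = minprojD[OF q]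
  define g where "g = p * X * q"
  have gS: "g \<in> S" using S P(1) Q(1) X(1) by (auto simp: g_def intro!: subalgD)
  have pg: "p * g = g" "g * q = g" using P Q by (auto simp: g_def mult.assoc) (auto simp flip: mult.assoc)
  have sg: "q * star g = star g" "star g * p = star g" using pg P Q by (metis star_mult)+
  obtain a where a: "star g * g = sc a q"
  proof -
    obtain a where "q * (star g * g) * q = sc a q" using Q(6) S gS by (meson subalgD)
    then show thesis using that pg sg by (metis mult.assoc)
  qed
  have a0: "a \<noteq> 0" using a X(2) by (metis g_def sc_0_left star_mult_eq_0)
  \<comment> \<open>The scalar \<open>a\<close> is a quotient of traces of elements of the form
    \<open>star Y * Y\<close>, hence positive, so its square root can be divided out.\<close>
  obtain r where r: "r > 0" "a = of_real r"
  proof -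
    obtain t where t: "t \<ge> 0" "ftrace (star g * g) = of_real t" using ftrace_star_mult_nonneg by blast
    obtain u where u: "u \<ge> 0" "ftrace (star q * q) = of_real u" using ftrace_star_mult_nonneg by blast
    have "u \<noteq> 0" using u Q(3) ftrace_star_mult_eq_0 by force
    have "of_real t = a * of_real u" using t(2) u(2) Q(4,5) by (simp add: a ftrace_sc)
    then have "a = of_real (t / u)" using \<open>u \<noteq> 0\<close> by (simp add: field_simps)
    then show thesis using that[of "t / u"] a0 t(1) u(1) \<open>u \<noteq> 0\<close> by (auto simp: less_le)
  qed
  define f where "f = sc (of_real (1 / sqrt r)) g"
  have fS: "f \<in> S" using S gS by (auto simp: f_def intro: subalgD)
  have pf: "p * f = f" "f * q = f" "star f * p = star f" using pg sg by (auto simp: f_def)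
  have ff: "star f * f = q"
    using r by (simp add: f_def a flip: of_real_mult)
  have "f \<noteq> 0" using ff Q(3) by auto
  obtain b where b: "f * star f = sc b p"
  proof -
    obtain b where "p * (f * star f) * p = sc b p" using P(6) S fS by (meson subalgD)
    then show thesis using that pf by (metis mult.assoc)
  qed
  \<comment> \<open>Idempotence of \<open>f * star f\<close> forces the scalar \<open>b\<close> to
    be 0 or 1.\<close>
  have "f * star f = (f * (star f * f)) * star f" by (simp add: ff pf)
  also have "\<dots> = (f * star f) * (f * star f)" by (simp add: mult.assoc)
  also have "\<dots> = sc (b * b) p" by (simp only: b sc_mult sc_sc P(4))
  finally have "sc (b * b - b) p = 0" by (simp add: b sc_diff_left)
  then have "b = 0 \<or> b = 1" using P(3) by auto
  then have "b = 1" using b \<open>f \<noteq> 0\<close> mult_star_eq_0[of f] by auto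
  then have fp: "f * star f = p" using b by simp
  have "\<exists>k. p * Y * q = sc k f" if Y: "Y \<in> S" for Y
  proof -
    obtain k where k: "p * (Y * q * star f) * p = sc k p" using P(6) S fS Q(1) Y by (meson subalgD)
    have "p * Y * q = p * Y * q * (star f * f)" by (simp add: ff Q(4) mult.assoc)
    also have "\<dots> = p * (Y * q * star f) * p * f" by (simp add: pf mult.assoc)
    also have "\<dots> = sc k f" by (simp add: k pf)
    finally show ?thesis by blast
  qed
  then show thesis using that fS ff fp pf(1,2) by blast
qed

section \<open>Matrix units\<close>

text \<open>For minimal projections this is Murray--von Neumann equivalence inside \<open>S\<close>,
  since a nonzero \<open>p * X * q\<close> yields a partial isometry by
  \<open>minproj_connect\<close>. Its classes correspond to the simple blocks of
  \<open>S\<close>.\<close>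

definition linked :: "fmat set \<Rightarrow> fmat \<Rightarrow> fmat \<Rightarrow> bool" where
  "linked S p q \<longleftrightarrow> (\<exists>X\<in>S. p * X * q \<noteq> 0)"

lemma linked_refl: "minproj S p \<Longrightarrow> linked S p p"
  unfolding linked_def using minprojD[of S p] by (metis)

lemma linked_sym:
  assumes "subalg d S" "minproj S p" "minproj S q" "linked S p q" shows "linked S q p"
proof -
  obtain X where X: "X \<in> S" "p * X * q \<noteq> 0" using assms(4) by (auto simp: linked_def)
  have "q * star X * p = star (p * X * q)" using assms by (simp add: minprojD(5) mult.assoc)
  then show ?thesis unfolding linked_def using X subalgD(6)[OF assms(1)] by (metis star_eq_0)
qed

text \<open>With \<open>f\<close> the partial isometry from \<open>q\<close> to \<open>p\<close>,
  left multiplication by \<open>star f\<close> undoes the passage from \<open>q * X * r\<close> to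
  \<open>p * (f * X) * r\<close>, so the latter is nonzero.\<close>

lemma linked_trans:
  assumes S: "subalg d S" "minproj S p" "minproj S q" and pq: "linked S p q" and qr: "linked S q r"
  shows "linked S p r"
proof -
  obtain X where X: "X \<in> S" "q * X * r \<noteq> 0" using qr by (auto simp: linked_def)
  obtain f where f: "f \<in> S" "star f * f = q" "p * f = f" "f * q = f"
    using pq minproj_connect[OF S] by (metis linked_def)
  have "star f * (p * (f * X) * r) = q * X * r"
    by (simp add: f(3) flip: mult.assoc f(2))
  then have "p * (f * X) * r \<noteq> 0" using X(2) by auto
  then show ?thesis unfolding linked_def using subalgD(5)[OF S(1) f(1) X(1)] by blast
qed

text \<open>\<open>c i\<close> is the block to which the index \<open>i\<close> belongs; \<open>f i j\<close> is meaningful only if \<open>c i = c j\<close>.\<close>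

definition matrix_units :: "fmat set \<Rightarrow> 'i set \<Rightarrow> ('i \<Rightarrow> 'c) \<Rightarrow> ('i \<Rightarrow> 'i \<Rightarrow> fmat) \<Rightarrow> bool" where
  "matrix_units S I c f \<longleftrightarrow> finite I \<and>
     (\<forall>i\<in>I. \<forall>j\<in>I. c i = c j \<longrightarrow> f i j \<in> S \<and> star (f i j) = f j i) \<and> (\<forall>i\<in>I. f i i \<noteq> 0) \<and>
     (\<forall>i\<in>I. \<forall>j\<in>I. \<forall>k\<in>I. \<forall>l\<in>I. c i = c j \<longrightarrow> c k = c l \<longrightarrow> f i j * f k l = (if j = k then f i l else 0)) \<and>
     (\<forall>i\<in>I. \<forall>j\<in>I. \<forall>X\<in>S. \<exists>a. f i i * X * f j j = (if c i = c j then sc a (f i j) else 0))"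

lemma matrix_unitsD:
  assumes "matrix_units S I c f"
  shows "finite I" "i \<in> I \<Longrightarrow> j \<in> I \<Longrightarrow> c i = c j \<Longrightarrow> f i j \<in> S"
    "i \<in> I \<Longrightarrow> j \<in> I \<Longrightarrow> c i = c j \<Longrightarrow> star (f i j) = f j i" "i \<in> I \<Longrightarrow> f i i \<noteq> 0"
    "i \<in> I \<Longrightarrow> j \<in> I \<Longrightarrow> k \<in> I \<Longrightarrow> l \<in> I \<Longrightarrow> c i = c j \<Longrightarrow> c k = c l \<Longrightarrow>
       f i j * f k l = (if j = k then f i l else 0)"
    "i \<in> I \<Longrightarrow> j \<in> I \<Longrightarrow> X \<in> S \<Longrightarrow> c i = c j \<Longrightarrow> \<exists>a. f i i * X * f j j = sc a (f i j)"
    "i \<in> I \<Longrightarrow> j \<in> I \<Longrightarrow> X \<in> S \<Longrightarrow> c i \<noteq> c j \<Longrightarrow> f i i * X * f j j = 0"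
  using assms unfolding matrix_units_def by (simp_all, metis+)

lemma matrix_units_minproj:
  assumes "matrix_units S I c f" "i \<in> I" shows "minproj S (f i i)"
  using matrix_unitsD[OF assms(1)] assms(2) by (auto simp: minproj_def projection_def)

lemma matrix_units_linked:
  assumes "matrix_units S I c f" "i \<in> I" "j \<in> I" shows "linked S (f i i) (f j j) \<longleftrightarrow> c i = c j"
proof
  assume "c i = c j"
  then have "f i i * f i j * f j j = f i j" "f i j * f j i = f i i" "f i j \<in> S"
    using matrix_unitsD[OF assms(1)] assms(2,3) by auto
  moreover have "f i i \<noteq> 0" using matrix_unitsD(4)[OF assms(1,2)] .
  ultimately show "linked S (f i i) (f j j)" unfolding linked_def by (metis mult_zero_left)
qed (use matrix_unitsD(7)[OF assms(1)] assms(2,3) in \<open>force simp: linked_def\<close>)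

text \<open>Every index \<open>i\<close> is joined to a chosen representative of its class by a
  partial isometry \<open>g i\<close>; the products \<open>g i * star (g j)\<close> are then
  coherent matrix units. The class of an index is encoded as the set of indices linked to
  it.\<close>

lemma matrix_units_exist:
  assumes S: "subalg d S" and I: "finite I" and p: "\<And>i. i \<in> I \<Longrightarrow> minproj S (p i)"
    and orth: "\<And>i j. i \<in> I \<Longrightarrow> j \<in> I \<Longrightarrow> i \<noteq> j \<Longrightarrow> p i * p j = 0"
  obtains f and c :: "'i \<Rightarrow> 'i set" where "matrix_units S I c f" "\<And>i. i \<in> I \<Longrightarrow> f i i = p i"
    "\<And>i j. i \<in> I \<Longrightarrow> j \<in> I \<Longrightarrow> c i = c j \<longleftrightarrow> linked S (p i) (p j)"
proof -
  define c where "c i = {j \<in> I. linked S (p i) (p j)}" for i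
  have c_iff: "c i = c j \<longleftrightarrow> linked S (p i) (p j)" if "i \<in> I" "j \<in> I" for i j
  proof
    assume "c i = c j"
    then have "j \<in> c i" using linked_refl[OF p[OF that(2)]] that by (auto simp: c_def)
    then show "linked S (p i) (p j)" by (simp add: c_def)
  next
    assume ij: "linked S (p i) (p j)"
    then have ji: "linked S (p j) (p i)" using linked_sym[OF S p p] that by blast
    have "linked S (p i) (p k) \<longleftrightarrow> linked S (p j) (p k)" for k
      using linked_trans[OF S p[OF that(1)] p[OF that(2)] ij]
        linked_trans[OF S p[OF that(2)] p[OF that(1)] ji] by blast
    then show "c i = c j" by (simp add: c_def)
  qed
  define r where "r C = (SOME j. j \<in> C)" for C :: "'i set"
  have r: "r (c i) \<in> I \<and> linked S (p i) (p (r (c i)))" if "i \<in> I" for i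
  proof -
    have "i \<in> c i" using linked_refl[OF p[OF that]] that by (simp add: c_def)
    then have "r (c i) \<in> c i" unfolding r_def by (rule someI)
    then show ?thesis by (simp add: c_def)
  qed
  have "\<exists>g. g \<in> S \<and> star g * g = p (r (c i)) \<and> g * star g = p i \<and> p i * g = g \<and> g * p (r (c i)) = g \<and>
      (\<forall>Y\<in>S. \<exists>a. p i * Y * p (r (c i)) = sc a g)" if i: "i \<in> I" for i
  proof -
    obtain X where "X \<in> S" "p i * X * p (r (c i)) \<noteq> 0" using r[OF i] by (auto simp: linked_def)
    then show ?thesis using minproj_connect[OF S p[OF i] p] r[OF i] by metis
  qed
  then have "\<forall>i\<in>I. \<exists>g. g \<in> S \<and> star g * g = p (r (c i)) \<and> g * star g = p i \<and> p i * g = g \<and> g * p (r (c i)) = g \<and>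
      (\<forall>Y\<in>S. \<exists>a. p i * Y * p (r (c i)) = sc a g)" by blast
  then obtain g where g0: "\<forall>i\<in>I. g i \<in> S \<and> star (g i) * g i = p (r (c i)) \<and> g i * star (g i) = p i \<and>
      p i * g i = g i \<and> g i * p (r (c i)) = g i \<and> (\<forall>Y\<in>S. \<exists>a. p i * Y * p (r (c i)) = sc a (g i))"
    by (rule bchoice[THEN exE])
  have g: "g i \<in> S" "star (g i) * g i = p (r (c i))" "g i * star (g i) = p i" "p i * g i = g i"
      "g i * p (r (c i)) = g i" "\<And>Y. Y \<in> S \<Longrightarrow> \<exists>a. p i * Y * p (r (c i)) = sc a (g i)" if "i \<in> I" for i
    using g0 that by blast+
  define f where "f i j = g i * star (g j)" for i j
  have gg: "star (g j) * g k = (if j = k then p (r (c j)) else 0)" if "j \<in> I" "k \<in> I" for j k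
  proof (cases "j = k")
    case False
    have "star (g j) * g k = star (p j * g j) * (p k * g k)" using g(4) that by simp
    also have "\<dots> = star (g j) * (p j * p k) * g k" using minprojD(5)[OF p] that by (simp add: mult.assoc)
    finally show ?thesis using orth that False by simp
  qed (use g that in auto)
  have "matrix_units S I c f"
    unfolding matrix_units_def
  proof (intro conjI ballI impI)
    fix i j assume ij: "i \<in> I" "j \<in> I"
    show "f i j \<in> S" using S g(1) ij by (auto simp: f_def intro!: subalgD)
    show "star (f i j) = f j i" by (simp add: f_def)
    fix k l assume kl: "k \<in> I" "l \<in> I" and c: "c i = c j" "c k = c l"
    have "f i j * f k l = g i * (star (g j) * g k) * star (g l)" by (simp add: f_def mult.assoc)
    then show "f i j * f k l = (if j = k then f i l else 0)"
      using gg[of j k] g(5)[of i] ij kl c by (auto simp: f_def)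
  next
    fix i j X assume ij: "i \<in> I" "j \<in> I" and X: "X \<in> S"
    have fp: "f i i = p i" "f j j = p j" using g(3) ij by (auto simp: f_def)
    show "\<exists>a. f i i * X * f j j = (if c i = c j then sc a (f i j) else 0)"
    proof (cases "c i = c j")
      case True
      have "X * g j \<in> S" using S X g(1)[OF ij(2)] by (auto intro: subalgD)
      then obtain a where "p i * (X * g j) * p (r (c i)) = sc a (g i)" using g(6)[OF ij(1)] by blast
      then have "p i * X * g j = sc a (g i)" using g(5)[OF ij(2)] True by (simp add: mult.assoc)
      then have "p i * X * (g j * star (g j)) = sc a (g i * star (g j))" by (metis mult.assoc sc_mult(1))
      then show ?thesis using True g(3)[OF ij(2)] fp by (auto simp: f_def)
    next
      case False
      then show ?thesis using c_iff[OF ij] X fp by (auto simp: linked_def)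
    qed
  next
    fix i assume "i \<in> I"
    then show "f i i \<noteq> 0" using g(3) minprojD(3)[OF p] by (auto simp: f_def)
  qed (use I in auto)
  moreover have "f i i = p i" if "i \<in> I" for i using g(3) that by (simp add: f_def)
  ultimately show thesis using that c_iff by blast
qed

text \<open>No nonzero element of \<open>S\<close> is annihilated by all diagonal units;
  consequently their sum is the unit of \<open>S\<close>, see
  \<open>full_matrix_units_unit\<close>.\<close>

definition full_matrix_units :: "fmat set \<Rightarrow> 'i set \<Rightarrow> ('i \<Rightarrow> 'c) \<Rightarrow> ('i \<Rightarrow> 'i \<Rightarrow> fmat) \<Rightarrow> bool" where
  "full_matrix_units S I c f \<longleftrightarrow>
     matrix_units S I c f \<and> (\<forall>X\<in>S. (\<forall>i\<in>I. f i i * X = 0) \<longrightarrow> X = 0)"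

text \<open>A largest family of orthogonal minimal projections is full by
  \<open>minproj_extend\<close>. The ranges of \<open>N\<close> and \<open>c\<close> are bounded in
  terms of \<open>d\<close> alone, which later leaves only finitely many isomorphism types.\<close>

lemma full_matrix_units_exist:
  assumes S: "subalg d S"
  obtains N f and c :: "nat \<Rightarrow> nat" where "full_matrix_units S {..<N} c f" "N \<le> d" "c ` {..<N} \<subseteq> {..<N}"
proof -
  define Q where "Q F \<longleftrightarrow> finite F \<and> (\<forall>p\<in>F. minproj S p) \<and> (\<forall>p\<in>F. \<forall>q\<in>F. p \<noteq> q \<longrightarrow> p * q = 0)" for F
  have bound: "card F \<le> d" if "Q F" for F
    using that subalgD(1)[OF S] by (intro orthogonal_projections_bound) (auto simp: Q_def minproj_def)
  have "Q {}" by (simp add: Q_def)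
  then obtain F where F: "Q F" and max: "\<And>F'. Q F' \<Longrightarrow> card F' \<le> card F"
    using ex_has_greatest_nat[of Q "{}" card "Suc d"] bound by (auto simp: less_Suc_eq_le)
  have sep: "X = 0" if X: "X \<in> S" "\<forall>p\<in>F. p * X = 0" for X
  proof (rule ccontr)
    assume "X \<noteq> 0"
    then obtain q where q: "minproj S q" "\<And>g. g * X = 0 \<Longrightarrow> g * q = 0"
      using minproj_extend[OF S X(1)] by blast
    then have pq: "p * q = 0" if "p \<in> F" for p using X(2) that by blast
    then have qp: "q * p = 0" if "p \<in> F" for p
      using that F minprojD(5) q(1) by (metis Q_def star_mult star_simps(1))
    have "q \<notin> F" using pq[of q] minprojD(3,4)[OF q(1)] by auto
    moreover have "Q (insert q F)" using F q pq qp by (auto simp: Q_def)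
    ultimately show False using max[of "insert q F"] F by (auto simp: Q_def)
  qed
  have "finite F" using F by (simp add: Q_def)
  then obtain p where p: "bij_betw p {..<card F} F" using ex_bij_betw_nat_finite[of F] by (auto simp: atLeast0LessThan)
  have pF: "p i \<in> F" if "i < card F" for i using p that by (auto simp: bij_betw_def)
  have pne: "p i \<noteq> p j" if "i < card F" "j < card F" "i \<noteq> j" for i j
    using p that by (auto simp: bij_betw_def inj_on_def)
  obtain f and c :: "nat \<Rightarrow> nat set" where f: "matrix_units S {..<card F} c f"
    "\<And>i. i \<in> {..<card F} \<Longrightarrow> f i i = p i"
    by (rule matrix_units_exist[OF S, of "{..<card F}" p]) (use F pF pne in \<open>auto simp: Q_def\<close>)
  \<comment> \<open>Classes are renamed by their least members, so that the labels are numbers below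
    the number of units.\<close>
  define r where "r i = (LEAST j. j < card F \<and> c j = c i)" for i
  have r: "r i < card F \<and> c (r i) = c i" if "i < card F" for i
    unfolding r_def by (rule LeastI[of _ i]) (use that in auto)
  have "r i = r j \<longleftrightarrow> c i = c j" if "i < card F" "j < card F" for i j
    using r[OF that(1)] r[OF that(2)] by (metis r_def)
  then have "matrix_units S {..<card F} r f" using f(1) unfolding matrix_units_def by simp
  moreover have "\<forall>X\<in>S. (\<forall>i\<in>{..<card F}. f i i * X = 0) \<longrightarrow> X = 0"
    using sep f(2) p by (force simp: bij_betw_def)
  ultimately show thesis using that bound[OF F] r unfolding full_matrix_units_def by blast
qed

section \<open>Coordinates with respect to matrix units\<close>

definition unit_comb :: "'i set \<Rightarrow> ('i \<Rightarrow> 'c) \<Rightarrow> ('i \<Rightarrow> 'i \<Rightarrow> fmat) \<Rightarrow> ('i \<Rightarrow> 'i \<Rightarrow> complex) \<Rightarrow> fmat" where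
  "unit_comb I c f a = (\<Sum>i\<in>I. \<Sum>j\<in>I. if c i = c j then sc (a i j) (f i j) else 0)"

lemma unit_comb_cong:
  "(\<And>i j. i \<in> I \<Longrightarrow> j \<in> I \<Longrightarrow> c i = c j \<Longrightarrow> a i j = b i j) \<Longrightarrow> unit_comb I c f a = unit_comb I c f b"
  unfolding unit_comb_def by (intro sum.cong refl) auto

lemma unit_comb_in:
  "subalg d S \<Longrightarrow> matrix_units S I c f \<Longrightarrow> unit_comb I c f a \<in> S"
  unfolding unit_comb_def by (intro subalg_sum[of d]) (auto intro: subalgD matrix_unitsD(2))

lemma unit_comb_add: "unit_comb I c f a + unit_comb I c f b = unit_comb I c f (\<lambda>i j. a i j + b i j)"
  unfolding unit_comb_def by (simp add: sum.distrib[symmetric] sc_add_left if_distrib cong: if_cong)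

lemma unit_comb_sc: "sc r (unit_comb I c f a) = unit_comb I c f (\<lambda>i j. r * a i j)"
  unfolding unit_comb_def by (simp add: sc_sum if_distrib cong: if_cong)

lemma unit_comb_star:
  assumes "matrix_units S I c f"
  shows "star (unit_comb I c f a) = unit_comb I c f (\<lambda>i j. cnj (a j i))"
proof -
  have "star (unit_comb I c f a) = (\<Sum>i\<in>I. \<Sum>j\<in>I. if c i = c j then sc (cnj (a i j)) (f j i) else 0)"
    unfolding unit_comb_def star_sum by (intro sum.cong refl) (auto simp: matrix_unitsD(3)[OF assms])
  also have "\<dots> = unit_comb I c f (\<lambda>i j. cnj (a j i))"
    unfolding unit_comb_def by (subst sum.swap) (intro sum.cong refl if_cong, auto)
  finally show ?thesis .
qed

lemma unit_comb_mult:
  assumes f: "matrix_units S I c f"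
  shows "unit_comb I c f a * unit_comb I c f b =
     unit_comb I c f (\<lambda>i l. \<Sum>j\<in>I. if c i = c j then a i j * b j l else 0)"
proof -
  have fin: "finite I" by (rule matrix_unitsD(1)[OF f])
  have "unit_comb I c f a * unit_comb I c f b = (\<Sum>i\<in>I. \<Sum>j\<in>I. \<Sum>k\<in>I. \<Sum>l\<in>I.
      (if c i = c j then sc (a i j) (f i j) else 0) * (if c k = c l then sc (b k l) (f k l) else 0))"
    unfolding unit_comb_def by (simp only: sum_distrib_right) (simp only: sum_distrib_left)
  also have "\<dots> = (\<Sum>i\<in>I. \<Sum>j\<in>I. \<Sum>k\<in>I. if j = k then
      (\<Sum>l\<in>I. if c i = c j \<and> c k = c l then sc (a i j * b k l) (f i l) else 0) else 0)"
  proof (intro sum.cong refl)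
    fix i j k assume ijk: "i \<in> I" "j \<in> I" "k \<in> I"
    have "(if c i = c j then sc (a i j) (f i j) else 0) * (if c k = c l then sc (b k l) (f k l) else 0) =
      (if j = k then if c i = c j \<and> c k = c l then sc (a i j * b k l) (f i l) else 0 else 0)" if l: "l \<in> I" for l
    proof (cases "c i = c j \<and> c k = c l")
      case True
      then have "f i j * f k l = (if j = k then f i l else 0)" using matrix_unitsD(5)[OF f ijk l] by blast
      moreover have "sc (a i j) (f i j) * sc (b k l) (f k l) = sc (a i j * b k l) (f i j * f k l)"
        by (simp add: mult.commute)
      ultimately have "sc (a i j) (f i j) * sc (b k l) (f k l) = (if j = k then sc (a i j * b k l) (f i l) else 0)"
        by (cases "j = k") simp_all
      then show ?thesis using True by (simp only: if_True simp_thms conj_absorb)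
    next
      case False
      then have "(if c i = c j then sc (a i j) (f i j) else 0) = 0 \<or> (if c k = c l then sc (b k l) (f k l) else 0) = 0"
        by presburger
      then show ?thesis unfolding if_not_P[OF False] by auto
    qed
    then have "(\<Sum>l\<in>I. (if c i = c j then sc (a i j) (f i j) else 0) * (if c k = c l then sc (b k l) (f k l) else 0)) =
      (\<Sum>l\<in>I. if j = k then if c i = c j \<and> c k = c l then sc (a i j * b k l) (f i l) else 0 else 0)"
      by (rule sum.cong[OF refl])
    then show "(\<Sum>l\<in>I. (if c i = c j then sc (a i j) (f i j) else 0) * (if c k = c l then sc (b k l) (f k l) else 0)) =
      (if j = k then (\<Sum>l\<in>I. if c i = c j \<and> c k = c l then sc (a i j * b k l) (f i l) else 0) else 0)"
      by (cases "j = k") (simp_all only: if_True if_False sum.neutral_const simp_thms)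
  qed
  also have "\<dots> = (\<Sum>i\<in>I. \<Sum>j\<in>I. \<Sum>l\<in>I. if c i = c j \<and> c j = c l then sc (a i j * b j l) (f i l) else 0)"
    unfolding sum.delta'[OF fin] by (intro sum.cong refl if_P)
  also have "\<dots> = (\<Sum>i\<in>I. \<Sum>l\<in>I. \<Sum>j\<in>I. if c i = c j \<and> c j = c l then sc (a i j * b j l) (f i l) else 0)"
    by (rule sum.cong[OF refl]) (rule sum.swap)
  also have "\<dots> = unit_comb I c f (\<lambda>i l. \<Sum>j\<in>I. if c i = c j then a i j * b j l else 0)"
  proof -
    have "(\<Sum>j\<in>I. if c i = c j \<and> c j = c l then sc (a i j * b j l) (f i l) else 0) =
      (if c i = c l then sc (\<Sum>j\<in>I. if c i = c j then a i j * b j l else 0) (f i l) else 0)" for i l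
    proof -
      have *: "sc (sum g I) X = (\<Sum>j\<in>I. sc (g j) X)" for g X
        by (rule fmat_eqI) (simp add: sum_distrib_right)
      have "(if c i = c j \<and> c j = c l then sc (a i j * b j l) (f i l) else 0) =
        (if c i = c l then sc (if c i = c j then a i j * b j l else 0) (f i l) else 0)" for j
        by (cases "c i = c j") simp_all
      then show ?thesis by (cases "c i = c l") (simp_all only: * if_True if_False simp_thms sum.neutral_const)
    qed
    then show ?thesis unfolding unit_comb_def by simp
  qed
  finally show ?thesis .
qed

lemma unit_comb_corner:
  assumes f: "matrix_units S I c f" and kl: "k \<in> I" "l \<in> I" "c k = c l"
  shows "f k k * unit_comb I c f a * f l l = sc (a k l) (f k l)"
proof -
  have fin: "finite I" by (rule matrix_unitsD(1)[OF f])
  have "f k k * unit_comb I c f a * f l l =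
     (\<Sum>i\<in>I. \<Sum>j\<in>I. if c i = c j then sc (a i j) (f k k * f i j * f l l) else 0)"
    unfolding unit_comb_def sum_distrib_left sum_distrib_right by (intro sum.cong refl) auto
  also have "\<dots> = (\<Sum>i\<in>I. if i = k then (\<Sum>j\<in>I. if j = l then sc (a k l) (f k l) else 0) else 0)"
  proof (intro sum.cong refl)
    fix i assume i: "i \<in> I"
    have "(if c i = c j then sc (a i j) (f k k * f i j * f l l) else 0) =
      (if i = k then if j = l then sc (a k l) (f k l) else 0 else 0)" if j: "j \<in> I" for j
      using matrix_unitsD(5)[OF f kl(1,1) i j] matrix_unitsD(5)[OF f kl(1) j kl(2,2)] kl by auto
    then show "(\<Sum>j\<in>I. if c i = c j then sc (a i j) (f k k * f i j * f l l) else 0) =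
      (if i = k then (\<Sum>j\<in>I. if j = l then sc (a k l) (f k l) else 0) else 0)"
      by (cases "i = k") (simp_all cong: sum.cong)
  qed
  also have "\<dots> = sc (a k l) (f k l)" using fin kl by simp
  finally show ?thesis .
qed

lemma matrix_unit_nonzero:
  assumes f: "matrix_units S I c f" and kl: "k \<in> I" "l \<in> I" "c k = c l" shows "f k l \<noteq> 0"
proof
  assume "f k l = 0"
  moreover have "f k l * f l k = f k k" using matrix_unitsD(5)[OF f] kl by simp
  ultimately show False using matrix_unitsD(4)[OF f kl(1)] by simp
qed

lemma unit_comb_inject:
  assumes f: "matrix_units S I c f" and eq: "unit_comb I c f a = unit_comb I c f b"
    and kl: "k \<in> I" "l \<in> I" "c k = c l"
  shows "a k l = b k l"
proof -
  have "sc (a k l - b k l) (f k l) = 0"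
    using unit_comb_corner[OF f kl, of a] unit_comb_corner[OF f kl, of b] eq by (simp only: sc_diff_left) simp
  then show ?thesis using matrix_unit_nonzero[OF f kl] by simp
qed

text \<open>The difference \<open>Y - ?e * Y\<close>, with \<open>?e\<close> the sum of the diagonal
  units, is annihilated by every diagonal unit, so fullness makes it vanish; the identity on the
  other side follows by adjoints.\<close>

lemma full_matrix_units_unit:
  assumes S: "subalg d S" and f: "full_matrix_units S I c f" and X: "X \<in> S"
  shows "(\<Sum>i\<in>I. f i i) * X = X" "X * (\<Sum>i\<in>I. f i i) = X"
proof -
  have mu: "matrix_units S I c f" using f by (simp add: full_matrix_units_def)
  note fin = matrix_unitsD(1)[OF mu]
  let ?e = "\<Sum>i\<in>I. f i i"
  have e: "?e \<in> S" by (intro subalg_sum[OF S] matrix_unitsD(2)[OF mu]) auto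
  have se: "star ?e = ?e" unfolding star_sum using matrix_unitsD(3)[OF mu] by (intro sum.cong) auto
  have left: "?e * Y = Y" if Y: "Y \<in> S" for Y
  proof -
    have "f k k * (Y - ?e * Y) = 0" if k: "k \<in> I" for k
    proof -
      have "f k k * ?e = (\<Sum>i\<in>I. if k = i then f k k else 0)"
        unfolding sum_distrib_left using matrix_unitsD(5)[OF mu k k] by (intro sum.cong) auto
      then have "f k k * ?e = f k k" using fin k by simp
      then show ?thesis by (simp add: right_diff_distrib flip: mult.assoc)
    qed
    moreover have "Y - ?e * Y \<in> S" using S e Y by (intro subalgD)
    ultimately have "Y - ?e * Y = 0" using f unfolding full_matrix_units_def by blast
    then show ?thesis by simp
  qed
  show "?e * X = X" using left X .
  have "?e * star X = star X" using left subalgD(6)[OF S X] .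
  then have "star (?e * star X) = X" by simp
  then show "X * ?e = X" by (simp only: star_mult se star_simps)
qed

lemma full_matrix_units_expand:
  assumes S: "subalg d S" and f: "full_matrix_units S I c f" and X: "X \<in> S"
  obtains a where "X = unit_comb I c f a"
proof -
  have mu: "matrix_units S I c f" using f by (simp add: full_matrix_units_def)
  have "\<forall>i\<in>I. \<forall>j\<in>I. \<exists>a. f i i * X * f j j = (if c i = c j then sc a (f i j) else 0)"
    using mu X unfolding matrix_units_def by blast
  then obtain a where a: "\<And>i j. i \<in> I \<Longrightarrow> j \<in> I \<Longrightarrow> f i i * X * f j j = (if c i = c j then sc (a i j) (f i j) else 0)"
    by metis
  have "X = (\<Sum>i\<in>I. f i i) * X * (\<Sum>i\<in>I. f i i)" using full_matrix_units_unit[OF S f X] by simp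
  also have "\<dots> = (\<Sum>i\<in>I. \<Sum>j\<in>I. f i i * X * f j j)"
    by (simp only: sum_distrib_right) (simp only: sum_distrib_left)
  also have "\<dots> = unit_comb I c f a" unfolding unit_comb_def using a by (intro sum.cong) auto
  finally show thesis using that by blast
qed

section \<open>Homomorphisms and the invariance of block sizes\<close>

definition fmat_hom :: "fmat set \<Rightarrow> fmat set \<Rightarrow> (fmat \<Rightarrow> fmat) \<Rightarrow> bool" where
  "fmat_hom A B h \<longleftrightarrow> (\<forall>X\<in>A. h X \<in> B) \<and> (\<forall>X\<in>A. \<forall>Y\<in>A. h (X + Y) = h X + h Y) \<and>
     (\<forall>a. \<forall>X\<in>A. h (sc a X) = sc a (h X)) \<and> (\<forall>X\<in>A. \<forall>Y\<in>A. h (X * Y) = h X * h Y) \<and>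
     (\<forall>X\<in>A. h (star X) = star (h X))"

lemma fmat_homD:
  assumes "fmat_hom A B h" "X \<in> A"
  shows "h X \<in> B" "Y \<in> A \<Longrightarrow> h (X + Y) = h X + h Y" "h (sc a X) = sc a (h X)"
    "Y \<in> A \<Longrightarrow> h (X * Y) = h X * h Y" "h (star X) = star (h X)"
  using assms by (auto simp: fmat_hom_def)

text \<open>The multiplication table of matrix units depends only on the index set and its classes,
  so copying coefficients is an isomorphism.\<close>

lemma same_units_iso:
  assumes S: "subalg d S" "subalg e T" and f: "full_matrix_units S I c f" and g: "full_matrix_units T I c g"
  obtains h where "fmat_hom S T h" "bij_betw h S T"
proof -
  have mf: "matrix_units S I c f" and mg: "matrix_units T I c g" using f g by (auto simp: full_matrix_units_def)
  \<comment> \<open>The coefficients of \<open>X\<close> are unique inside the blocks and are masked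
    by \<open>unit_comb\<close> outside them, so \<open>h\<close> does not depend on the
    choice.\<close>
  define h where "h X = unit_comb I c g (SOME a. X = unit_comb I c f a)" for X
  have h: "h (unit_comb I c f a) = unit_comb I c g a" for a
    unfolding h_def by (rule someI2[of _ a], rule refl, rule unit_comb_cong) (metis unit_comb_inject[OF mf])
  have ex: "\<exists>a. X = unit_comb I c f a" if "X \<in> S" for X using full_matrix_units_expand[OF S(1) f that] by blast
  have hom: "fmat_hom S T h"
    unfolding fmat_hom_def
  proof (intro conjI ballI allI)
    fix X r assume "X \<in> S"
    then obtain a where a: "X = unit_comb I c f a" using ex by blast
    show "h X \<in> T" unfolding a h using unit_comb_in[OF S(2) mg] .
    show "h (sc r X) = sc r (h X)" unfolding a unit_comb_sc h ..
    show "h (star X) = star (h X)" unfolding a h unit_comb_star[OF mf] unit_comb_star[OF mg] ..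
    fix Y assume "Y \<in> S"
    then obtain b where b: "Y = unit_comb I c f b" using ex by blast
    show "h (X + Y) = h X + h Y" unfolding a b unit_comb_add h ..
    show "h (X * Y) = h X * h Y" unfolding a b h unit_comb_mult[OF mf] unit_comb_mult[OF mg] ..
  qed
  have "bij_betw h S T"
    unfolding bij_betw_def
  proof
    show "inj_on h S"
    proof (rule inj_onI)
      fix X Y assume "X \<in> S" "Y \<in> S" "h X = h Y"
      then obtain a b where ab: "X = unit_comb I c f a" "Y = unit_comb I c f b"
        "unit_comb I c g a = unit_comb I c g b" using ex h by metis
      show "X = Y" unfolding ab(1,2) by (rule unit_comb_cong) (rule unit_comb_inject[OF mg ab(3)])
    qed
    show "h ` S = T"
    proof
      show "h ` S \<subseteq> T" using fmat_homD(1)[OF hom] by blast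
      show "T \<subseteq> h ` S"
      proof
        fix Y assume "Y \<in> T"
        then obtain b where b: "Y = unit_comb I c g b" using full_matrix_units_expand[OF S(2) g] by blast
        then show "Y \<in> h ` S" using h[of b] unit_comb_in[OF S(1) mf, of b] by (metis image_eqI)
      qed
    qed
  qed
  then show thesis using that hom by blast
qed

lemma full_matrix_units_relabel:
  assumes f: "full_matrix_units S I c f" and h: "bij_betw h J I"
    and d: "\<And>i j. i \<in> J \<Longrightarrow> j \<in> J \<Longrightarrow> d i = d j \<longleftrightarrow> c (h i) = c (h j)"
  shows "full_matrix_units S J d (\<lambda>i j. f (h i) (h j))"
proof -
  have "finite J" using f h bij_betw_finite by (auto simp: full_matrix_units_def matrix_units_def)
  moreover have hI: "h i \<in> I" if "i \<in> J" for i using h that by (auto simp: bij_betw_def)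
  moreover have "h i = h j \<longleftrightarrow> i = j" if "i \<in> J" "j \<in> J" for i j using h that by (auto simp: bij_betw_def inj_on_def)
  moreover have "\<forall>i\<in>I. \<exists>j\<in>J. i = h j" using h by (auto simp: bij_betw_def)
  ultimately show ?thesis using f d unfolding full_matrix_units_def matrix_units_def
    apply (intro conjI) apply (simp_all) apply metis done
qed

lemma ftrace_linked:
  assumes S: "subalg d S" "minproj S p" "minproj S q" and l: "linked S p q"
  shows "ftrace p = ftrace q"
proof -
  obtain f where "star f * f = q" "f * star f = p" using l minproj_connect[OF S] by (metis linked_def)
  then show ?thesis using ftrace_comm[of f "star f"] by simp
qed

text \<open>Over matching blocks of the two systems the diagonal units have the same sum, and all
  minimal projections of one block have the same nonzero trace; comparing the traces of the two sums
  compares the numbers of units.\<close>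

lemma full_matrix_units_block_sizes:
  assumes S: "subalg d S" and f: "full_matrix_units S I c f" and g: "full_matrix_units S J b g" and i: "i \<in> I"
  shows "\<exists>j\<in>J. card {k \<in> I. c k = c i} = card {l \<in> J. b l = b j}"
proof -
  have mf: "matrix_units S I c f" and mg: "matrix_units S J b g" using f g by (auto simp: full_matrix_units_def)
  have pf: "minproj S (f k k)" if "k \<in> I" for k using matrix_units_minproj[OF mf that] .
  have pg: "minproj S (g l l)" if "l \<in> J" for l using matrix_units_minproj[OF mg that] .
  have fS: "f k k \<in> S" if "k \<in> I" for k using pf[OF that] minprojD(1) by blast
  have gS: "g k k \<in> S" if "k \<in> J" for k using pg[OF that] minprojD(1) by blast
  \<comment> \<open>Fullness of the second system supplies a unit \<open>g j j\<close> that does not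
    annihilate \<open>f i i\<close>; its block is the matching one.\<close>
  obtain j where j: "j \<in> J" "g j j * f i i \<noteq> 0"
    using g fS[OF i] minprojD(3)[OF pf[OF i]] unfolding full_matrix_units_def by blast
  have "g j j * f i i * f i i \<noteq> 0" using j minprojD(4)[OF pf[OF i]] by (simp add: mult.assoc)
  then have ji: "linked S (g j j) (f i i)" unfolding linked_def using fS[OF i] by blast
  then have ij: "linked S (f i i) (g j j)" using linked_sym[OF S pg[OF j(1)] pf[OF i]] by blast
  have link: "c k = c i \<longleftrightarrow> b l = b j" if kl: "k \<in> I" "l \<in> J" "linked S (f k k) (g l l)" for k l
  proof
    assume "c k = c i"
    then have "linked S (f i i) (f k k)" using matrix_units_linked[OF mf i kl(1)] by simp
    then have "linked S (f i i) (g l l)" using linked_trans[OF S pf[OF i] pf[OF kl(1)]] kl by blast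
    then have "linked S (g j j) (g l l)" using linked_trans[OF S pg[OF j(1)] pf[OF i] ji] by blast
    then show "b l = b j" using matrix_units_linked[OF mg j(1) kl(2)] by simp
  next
    assume "b l = b j"
    then have "linked S (g l l) (g j j)" using matrix_units_linked[OF mg kl(2) j(1)] by simp
    then have "linked S (f k k) (g j j)" using linked_trans[OF S pf[OF kl(1)] pg[OF kl(2)]] kl by blast
    then have "linked S (f k k) (f i i)" using linked_trans[OF S pf[OF kl(1)] pg[OF j(1)] _ ji] by blast
    then show "c k = c i" using matrix_units_linked[OF mf kl(1) i] by simp
  qed
  let ?K = "{k \<in> I. c k = c i}" and ?L = "{l \<in> J. b l = b j}"
  let ?z = "\<Sum>k\<in>?K. f k k" and ?w = "\<Sum>l\<in>?L. g l l"
  have finI: "finite I" and finJ: "finite J" using matrix_unitsD(1)[OF mf] matrix_unitsD(1)[OF mg] by auto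
  \<comment> \<open>Minimal projections of different blocks are unlinked and therefore orthogonal,
    so each class sum is unchanged when multiplied by the matching sum of the other system.\<close>
  have zero: "f k k * g l l = 0" if "k \<in> I" "l \<in> J" "c k = c i \<longleftrightarrow> b l \<noteq> b j" for k l
  proof (rule ccontr)
    assume "f k k * g l l \<noteq> 0"
    then have "f k k * f k k * g l l \<noteq> 0" using minprojD(4)[OF pf[OF that(1)]] by simp
    then have "linked S (f k k) (g l l)" unfolding linked_def using fS[OF that(1)] by blast
    then show False using link[OF that(1,2)] that(3) by blast
  qed
  have zS: "?z \<in> S" and wS: "?w \<in> S" using fS gS by (auto intro!: subalg_sum[OF S])
  have "?z = ?z * (\<Sum>l\<in>J. g l l)" using full_matrix_units_unit(2)[OF S g zS] by simp
  also have "\<dots> = ?z * ?w + ?z * (\<Sum>l\<in>J - ?L. g l l)"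
    using finJ by (subst sum.subset_diff[of ?L J]) (auto simp: distrib_left)
  also have "?z * (\<Sum>l\<in>J - ?L. g l l) = 0"
    unfolding sum_distrib_left sum_distrib_right by (intro sum.neutral ballI) (auto intro: zero)
  finally have z: "?z = ?z * ?w" by simp
  have "?w = (\<Sum>k\<in>I. f k k) * ?w" using full_matrix_units_unit(1)[OF S f wS] by simp
  also have "\<dots> = ?z * ?w + (\<Sum>k\<in>I - ?K. f k k) * ?w"
    using finI by (subst sum.subset_diff[of ?K I]) (auto simp: distrib_right)
  also have "(\<Sum>k\<in>I - ?K. f k k) * ?w = 0"
    unfolding sum_distrib_left sum_distrib_right by (intro sum.neutral ballI) (auto intro: zero)
  finally have "?z = ?w" using z by simp
  then have "(\<Sum>k\<in>?K. ftrace (f k k)) = (\<Sum>l\<in>?L. ftrace (g l l))" by (simp flip: ftrace_sum)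
  moreover have "ftrace (f k k) = ftrace (f i i)" if k: "k \<in> ?K" for k
  proof -
    have kI: "k \<in> I" "c k = c i" using k by auto
    show ?thesis
      by (rule ftrace_linked[OF S pf[OF kI(1)] pf[OF i]]) (simp add: matrix_units_linked[OF mf kI(1) i] kI(2))
  qed
  moreover have "ftrace (g l l) = ftrace (f i i)" if l: "l \<in> ?L" for l
  proof -
    have lJ: "l \<in> J" "b l = b j" using l by auto
    have "ftrace (g l l) = ftrace (g j j)"
      by (rule ftrace_linked[OF S pg[OF lJ(1)] pg[OF j(1)]]) (simp add: matrix_units_linked[OF mg lJ(1) j(1)] lJ(2))
    then show ?thesis using ftrace_linked[OF S pg[OF j(1)] pf[OF i] ji] by simp
  qed
  moreover have "ftrace (f i i) \<noteq> 0"
    using ftrace_star_mult_eq_0[of "f i i"] minprojD(3,4,5)[OF pf[OF i]] by auto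
  ultimately have "card ?K = card ?L" by simp
  then show ?thesis using j(1) by blast
qed

section \<open>Embeddings and superadditive weights\<close>

lemma superadditive_sum:
  fixes s :: "nat \<Rightarrow> nat"
  assumes s0: "s 0 = 0" and sup: "\<And>a b. 0 < a \<Longrightarrow> 0 < b \<Longrightarrow> a + b \<le> L \<Longrightarrow> s a + s b < s (a + b)"
    and "finite K" "\<And>k. k \<in> K \<Longrightarrow> 0 < m k" "sum m K \<le> L"
  shows "(\<Sum>k\<in>K. s (m k)) \<le> s (sum m K) \<and> ((\<Sum>k\<in>K. s (m k)) = s (sum m K) \<longrightarrow> card K \<le> 1)"
  using assms(3-5)
proof (induction K rule: finite_induct)
  case (insert k K)
  then have IH: "(\<Sum>k\<in>K. s (m k)) \<le> s (sum m K)" by simp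
  show ?case
  proof (cases "K = {}")
    case False
    then have "0 < sum m K" using insert by (intro sum_pos) auto
    then have "s (m k) + s (sum m K) < s (m k + sum m K)" using insert by (intro sup) auto
    then show ?thesis using IH insert by simp
  qed (use insert in auto)
qed (simp add: s0)

text \<open>\<open>I\<close> with the classes \<open>b\<close> describes units of a larger algebra,
  \<open>J\<close> with the finer classes \<open>c\<close> those that come from a smaller one.
  Inside a class \<open>D\<close> of \<open>b\<close> two losses are possible: \<open>J\<close> may
  miss members of \<open>D\<close>, or \<open>D\<close> may be cut into several classes of
  \<open>c\<close>. Strict monotonicity and strict superadditivity make either one lower the total,
  against \<open>le\<close>.\<close>

lemma classes_rigid:
  fixes s :: "nat \<Rightarrow> nat"
  assumes s0: "s 0 = 0" and sup: "\<And>a b. 0 < a \<Longrightarrow> 0 < b \<Longrightarrow> a + b \<le> L \<Longrightarrow> s a + s b < s (a + b)"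
    and pos: "\<And>a. 0 < a \<Longrightarrow> a \<le> L \<Longrightarrow> 0 < s a"
    and I: "finite I" "J \<subseteq> I" and ref: "\<And>i j. i \<in> J \<Longrightarrow> j \<in> J \<Longrightarrow> c i = c j \<Longrightarrow> b i = b j"
    and small: "\<And>i. i \<in> I \<Longrightarrow> card {k \<in> I. b k = b i} \<le> L"
    and le: "(\<Sum>D\<in>b ` I. s (card {i \<in> I. b i = D})) \<le> (\<Sum>k\<in>c ` J. s (card {j \<in> J. c j = k}))"
  shows "J = I" "\<And>i j. i \<in> J \<Longrightarrow> j \<in> J \<Longrightarrow> b i = b j \<Longrightarrow> c i = c j"
proof -
  let ?I = "\<lambda>D. {i \<in> I. b i = D}" and ?J = "\<lambda>D. {j \<in> J. b j = D}"
  have finJ: "finite J" using I finite_subset by blast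
  have mono: "s x < s y" if "x < y" "y \<le> L" for x y
    using sup[of x "y - x"] pos[of y] pos[of "y - x"] s0 that by (cases "x = 0") auto
  have mono': "s x \<le> s y" if "x \<le> y" "y \<le> L" for x y using mono[of x y] that by (cases "x = y") auto
  let ?l = "\<lambda>D. \<Sum>k\<in>c ` ?J D. s (card {j \<in> J. c j = k})"
  have "c ` J = (\<Union>D\<in>b ` I. c ` ?J D)" using I by auto
  moreover have "(\<Sum>k\<in>(\<Union>D\<in>b ` I. c ` ?J D). s (card {j \<in> J. c j = k})) = (\<Sum>D\<in>b ` I. ?l D)"
  proof (rule sum.UNION_disjoint)
    show "\<forall>D\<in>b ` I. \<forall>D'\<in>b ` I. D \<noteq> D' \<longrightarrow> c ` ?J D \<inter> c ` ?J D' = {}"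
    proof (intro ballI impI equals0I)
      fix D D' k assume "D \<noteq> D'" "k \<in> c ` ?J D \<inter> c ` ?J D'"
      then obtain x y where "x \<in> J" "y \<in> J" "c x = c y" "b x = D" "b y = D'" by auto
      then show False using ref[of x y] \<open>D \<noteq> D'\<close> by simp
    qed
  qed (simp_all add: I(1) finJ)
  ultimately have split: "(\<Sum>k\<in>c ` J. s (card {j \<in> J. c j = k})) = (\<Sum>D\<in>b ` I. ?l D)" by simp
  have D: "?l D \<le> s (card (?J D))" "?l D = s (card (?J D)) \<longrightarrow> card (c ` ?J D) \<le> 1"
    "s (card (?J D)) \<le> s (card (?I D))" "card (?J D) < card (?I D) \<longrightarrow> s (card (?J D)) < s (card (?I D))"
    if DI: "D \<in> b ` I" for D
  proof -
    have IL: "card (?I D) \<le> L" using small DI by auto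
    have JI: "card (?J D) \<le> card (?I D)" using I by (intro card_mono) auto
    have eq: "{j \<in> J. c j = k} = {j \<in> ?J D. c j = k}" if k: "k \<in> c ` ?J D" for k
    proof -
      obtain x where x: "x \<in> J" "b x = D" "c x = k" using k by auto
      have "b j = D" if "j \<in> J" "c j = k" for j using ref[of j x] that x by simp
      then show ?thesis by auto
    qed
    have "card (?J D) = (\<Sum>k\<in>c ` ?J D. card {j \<in> ?J D. c j = k})"
      using sum.image_gen[of "?J D" "\<lambda>_. 1 :: nat" c] finJ by simp
    also have "\<dots> = (\<Sum>k\<in>c ` ?J D. card {j \<in> J. c j = k})" using eq by simp
    finally have cardJ: "(\<Sum>k\<in>c ` ?J D. card {j \<in> J. c j = k}) = card (?J D)" by simp
    have posk: "0 < card {j \<in> J. c j = k}" if "k \<in> c ` ?J D" for k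
      using that finJ by (auto simp: card_gt_0_iff)
    have sup': "\<And>a b. 0 < a \<Longrightarrow> 0 < b \<Longrightarrow> a + b \<le> L \<Longrightarrow> s a + s b < s (a + b)" by (rule sup)
    show "?l D \<le> s (card (?J D))" "?l D = s (card (?J D)) \<longrightarrow> card (c ` ?J D) \<le> 1"
      using superadditive_sum[of s L "c ` ?J D" "\<lambda>k. card {j \<in> J. c j = k}", OF s0 sup'] finJ posk IL JI
      unfolding cardJ by simp_all
    show "s (card (?J D)) \<le> s (card (?I D))" "card (?J D) < card (?I D) \<longrightarrow> s (card (?J D)) < s (card (?I D))"
      using mono' mono JI IL by auto
  qed
  \<comment> \<open>A single strict inequality between \<open>?l D\<close> and
    \<open>s (card (?I D))\<close> would make the total over all \<open>D\<close> strictly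
    smaller.\<close>
  have eqD: "?l D = s (card (?I D))" if DI: "D \<in> b ` I" for D
  proof (rule ccontr)
    assume "?l D \<noteq> s (card (?I D))"
    then have "?l D < s (card (?I D))" using D[OF DI] by linarith
    moreover have "?l D' \<le> s (card (?I D'))" if "D' \<in> b ` I" for D'
      using D(1,3)[OF that] by (rule order_trans)
    ultimately have "(\<Sum>D\<in>b ` I. ?l D) < (\<Sum>D\<in>b ` I. s (card (?I D)))"
      using I(1) DI by (intro sum_strict_mono_ex1) blast+
    then show False using le split by simp
  qed
  show "J = I"
  proof
    show "I \<subseteq> J"
    proof
      fix i assume i: "i \<in> I"
      then have bi: "b i \<in> b ` I" by blast
      have "card (?J (b i)) \<le> card (?I (b i))" using I by (intro card_mono) auto
      then have "card (?J (b i)) = card (?I (b i))" using D[OF bi] eqD[OF bi] by linarith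
      moreover have "?J (b i) \<subseteq> ?I (b i)" "finite (?I (b i))" using I by auto
      ultimately have "?J (b i) = ?I (b i)" by (intro card_subset_eq) auto
      then show "i \<in> J" using i by blast
    qed
  qed (use I in simp)
  show "c i = c j" if ij: "i \<in> J" "j \<in> J" "b i = b j" for i j
  proof -
    have bI: "b i \<in> b ` I" using ij I by auto
    have "card (c ` ?J (b i)) \<le> 1" using D[OF bI] eqD[OF bI] by linarith
    moreover have "c i \<in> c ` ?J (b i)" "c j \<in> c ` ?J (b i)" using ij by auto
    moreover have "finite (c ` ?J (b i))" using finJ by auto
    ultimately show ?thesis by (metis card_le_Suc0_iff_eq One_nat_def)
  qed
qed

lemma fmat_hom_image_subalg:
  assumes A: "subalg e A" and S: "subalg d S" and h: "fmat_hom A S h"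
  shows "subalg d (h ` A)"
proof -
  note H = fmat_homD[OF h]
  have "h 0 = 0" using H(3)[OF subalgD(2)[OF A], of 0] by simp
  then have "0 \<in> h ` A" using subalgD(2)[OF A] by (metis image_eqI)
  then show ?thesis
    unfolding subalg_def using H(1) subalgD(1)[OF S]
    by (auto simp flip: H(2-5) intro!: imageI subalgD[OF A])
qed

text \<open>On the range of \<open>q\<close> the element \<open>u\<close> is isometric, so it
  transports \<open>q\<close> together with its scalar corner.\<close>

lemma minproj_conjugate:
  assumes S: "subalg d S" and q: "minproj S q" and u: "u \<in> S" "star u * u * q = q"
  shows "minproj S (u * q * star u)"
proof -
  note Q = minprojD[OF q]
  have u': "q * (star u * u) = q" using arg_cong[OF u(2), of star] Q(5) by (simp add: mult.assoc)
  have u'': "star u * (u * q) = q" using u(2) by (simp add: mult.assoc)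
  have "u * q * star u \<in> S" using S Q u by (auto intro!: subalgD)
  moreover have "star u * (u * q * star u) * u = q"
    using u' u'' Q(4) by (metis mult.assoc)
  then have "u * q * star u \<noteq> 0" using Q(3) by auto
  moreover have "u * q * star u * (u * q * star u) = u * (q * (star u * u)) * (q * star u)"
    by (simp add: mult.assoc)
  then have "projection (u * q * star u)"
    unfolding projection_def u' using Q(4,5) by (simp add: mult.assoc flip: mult.assoc[of q q])
  moreover have "\<exists>a. (u * q * star u) * X * (u * q * star u) = sc a (u * q * star u)" if X: "X \<in> S" for X
  proof -
    have "star u * X * u \<in> S" using S X u by (auto intro!: subalgD)
    then obtain a where "q * (star u * X * u) * q = sc a q" using Q(6) by blast
    then have "u * (q * (star u * X * u) * q) * star u = sc a (u * q * star u)" by simp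
    then show ?thesis by (auto simp: mult.assoc)
  qed
  ultimately show ?thesis unfolding minproj_def by blast
qed

text \<open>The image of a minimal projection of \<open>A\<close> may fail to be minimal in
  \<open>S\<close>. So for one representative of each block a minimal projection of \<open>S\<close>
  is chosen below the image, and the images of the matrix units carry it to the other indices.
  Rigidity, applied to this family with and without one more member, shows that it is full and has
  the same blocks as \<open>A\<close>; then it coincides with the images of the diagonal units. The
  type \<open>'j option\<close> leaves room for the additional index \<open>None\<close>.\<close>

lemma embedding_onto:
  fixes s :: "nat \<Rightarrow> nat" and J :: "'j set" and c :: "'j \<Rightarrow> 'c"
  assumes A: "subalg e A" and g: "full_matrix_units A J c g" and S: "subalg d S"
    and h: "fmat_hom A S h" and inj: "inj_on h A"
    and s0: "s 0 = 0" and sup: "\<And>a b. 0 < a \<Longrightarrow> 0 < b \<Longrightarrow> a + b \<le> L \<Longrightarrow> s a + s b < s (a + b)"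
    and pos: "\<And>a. 0 < a \<Longrightarrow> a \<le> L \<Longrightarrow> 0 < s a"
    and bound: "\<And>(I :: 'j option set) (b :: 'j option \<Rightarrow> 'j option set) f. matrix_units S I b f \<Longrightarrow>
       (\<forall>i\<in>I. card {k \<in> I. b k = b i} \<le> L) \<and>
       (\<Sum>D\<in>b ` I. s (card {i \<in> I. b i = D})) \<le> (\<Sum>k\<in>c ` J. s (card {j \<in> J. c j = k}))"
  shows "h ` A = S"
proof -
  have mg: "matrix_units A J c g" using g by (simp add: full_matrix_units_def)
  note G = matrix_unitsD[OF mg] and H = fmat_homD[OF h]
  have h0: "h 0 = 0" using H(3)[OF subalgD(2)[OF A], of 0] by simp
  have h_nz: "h X \<noteq> 0" if "X \<in> A" "X \<noteq> 0" for X
    using inj_onD[OF inj, of X 0] that h0 subalgD(2)[OF A] by auto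
  have hmul: "h (g i j) * h (g k l) = (if j = k then h (g i l) else 0)"
    if "i \<in> J" "j \<in> J" "k \<in> J" "l \<in> J" "c i = c j" "c k = c l" for i j k l
    using H(4)[of "g i j" "g k l"] G(2)[of i j] G(2)[of k l] G(5)[of i j k l] that h0 by auto
  have hstar: "star (h (g i j)) = h (g j i)" if "i \<in> J" "j \<in> J" "c i = c j" for i j
    using H(5)[of "g i j"] G(2,3)[of i j] that by auto
  have hS: "h (g i j) \<in> S" if "i \<in> J" "j \<in> J" "c i = c j" for i j using H(1) G(2) that by blast
  define r where "r k = (SOME j. j \<in> J \<and> c j = k)" for k
  have r: "r (c j) \<in> J" "c (r (c j)) = c j" if "j \<in> J" for j
    using someI[of "\<lambda>i. i \<in> J \<and> c i = c j" j] that by (auto simp: r_def)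
  have "\<forall>k\<in>c ` J. \<exists>q. minproj S q \<and> h (g (r k) (r k)) * q = q"
  proof
    fix k assume "k \<in> c ` J"
    then have rk: "r k \<in> J" using r by auto
    have "projection (h (g (r k) (r k)))" using hmul hstar rk by (simp add: projection_def)
    moreover have "h (g (r k) (r k)) \<noteq> 0" using h_nz G(2,4) rk by blast
    ultimately show "\<exists>q. minproj S q \<and> h (g (r k) (r k)) * q = q"
      using minproj_below[OF S hS[OF rk rk]] by metis
  qed
  then obtain q where q: "\<And>j. j \<in> J \<Longrightarrow> minproj S (q (c j))"
    "\<And>j. j \<in> J \<Longrightarrow> h (g (r (c j)) (r (c j))) * q (c j) = q (c j)"
    by (metis imageI)
  \<comment> \<open>\<open>u j\<close> carries the projection chosen for the block of
    \<open>j\<close> from the representative to the index \<open>j\<close>.\<close>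
  define u where "u j = h (g j (r (c j)))" for j
  define p where "p j = u j * q (c j) * star (u j)" for j
  have uS: "u j \<in> S" if "j \<in> J" for j using hS[OF that r(1)[OF that]] r(2)[OF that] by (simp add: u_def)
  have su: "star (u j) = h (g (r (c j)) j)" if "j \<in> J" for j
    using hstar[OF that r(1)[OF that]] r(2)[OF that] by (simp add: u_def)
  have uu: "star (u i) * u j = (if i = j then h (g (r (c i)) (r (c i))) else 0)" if "i \<in> J" "j \<in> J" for i j
    using hmul[of "r (c i)" i j "r (c j)"] su[of i] r that by (auto simp: u_def)
  have uuq: "star (u j) * u j * q (c j) = q (c j)" if "j \<in> J" for j using uu q(2) that by simp
  have pmin: "minproj S (p j)" if "j \<in> J" for j
    unfolding p_def by (rule minproj_conjugate[OF S q(1)[OF that] uS[OF that] uuq[OF that]])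
  have orth: "p i * p j = 0" if "i \<in> J" "j \<in> J" "i \<noteq> j" for i j
  proof -
    have "p i * p j = u i * q (c i) * (star (u i) * u j) * q (c j) * star (u j)" by (simp add: p_def mult.assoc)
    then show ?thesis using uu that by simp
  qed
  have hu: "h (g j j) * u j = u j" if "j \<in> J" for j
    using hmul[of j j j "r (c j)"] r that by (simp add: u_def)
  have hp: "h (g j j) * p j = p j" if "j \<in> J" for j
    unfolding p_def using hu[OF that] by (simp flip: mult.assoc)
  have ph: "p j * h (g j j) = p j" if "j \<in> J" for j
    using arg_cong[OF hp[OF that], of star] hstar[OF that that] minprojD(5)[OF pmin[OF that]] by simp
  have plink: "linked S (p i) (p j)" if ij: "i \<in> J" "j \<in> J" "c i = c j" for i j
  proof -
    let ?q = "q (c j)"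
    have qq: "?q * (star (u i) * u i) = ?q" "?q * (star (u j) * u j) = ?q"
      using arg_cong[OF uuq[OF ij(1)], of star] arg_cong[OF uuq[OF ij(2)], of star]
        minprojD(5)[OF q(1)[OF ij(2)]] ij(3) by simp_all
    \<comment> \<open>Conjugation back to the representative turns the corner element into
      \<open>?q\<close>, which is nonzero.\<close>
    have "star (u i) * (p i * (u i * ?q * star (u j)) * p j) * u j =
      (star (u i) * u i * ?q) * (star (u i) * u i) * ?q * (star (u j) * u j) * ?q * (star (u j) * u j)"
      by (simp add: p_def ij(3) mult.assoc)
    also have "\<dots> = ?q" using qq uuq[OF ij(1)] uuq[OF ij(2)] minprojD(4)[OF q(1)[OF ij(2)]] ij(3)
      by (simp add: mult.assoc)
    finally have "p i * (u i * ?q * star (u j)) * p j \<noteq> 0" using minprojD(3)[OF q(1)[OF ij(2)]] by auto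
    moreover have "u i * ?q * star (u j) \<in> S" using S uS minprojD(1)[OF q(1)] ij by (auto intro!: subalgD)
    ultimately show ?thesis unfolding linked_def by blast
  qed
  let ?J = "Some ` J"
  have finJ: "finite J" by (rule G(1))
  have cSome: "(\<Sum>k\<in>(c \<circ> the) ` ?J. s (card {j \<in> ?J. (c \<circ> the) j = k})) = (\<Sum>k\<in>c ` J. s (card {j \<in> J. c j = k}))"
  proof -
    have "{j \<in> ?J. (c \<circ> the) j = k} = Some ` {j \<in> J. c j = k}" for k by auto
    then show ?thesis by (simp add: image_image card_image)
  qed
  have sep: "X = 0" if X: "X \<in> S" "\<And>j. j \<in> J \<Longrightarrow> p j * X = 0" for X
  proof (rule ccontr)
    assume "X \<noteq> 0"
    then obtain t where t: "minproj S t" "\<And>y. y * X = 0 \<Longrightarrow> y * t = 0" using minproj_extend[OF S X(1)] by blast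
    have pt: "p j * t = 0" if "j \<in> J" for j using X(2) t(2) that by blast
    have tp: "t * p j = 0" if "j \<in> J" for j
      using arg_cong[OF pt[OF that], of star] minprojD(5)[OF pmin[OF that]] minprojD(5)[OF t(1)] by simp
    \<comment> \<open>If the family were not full, a further minimal projection \<open>t\<close>
      could be added under the index \<open>None\<close>.\<close>
    define P where "P i = (case i of None \<Rightarrow> t | Some j \<Rightarrow> p j)" for i
    have P: "minproj S (P i)" if "i \<in> insert None ?J" for i using that pmin t(1) by (auto simp: P_def)
    have Po: "P i * P j = 0" if "i \<in> insert None ?J" "j \<in> insert None ?J" "i \<noteq> j" for i j
    proof (cases i; cases j)
      fix k l assume kl: "i = Some k" "j = Some l"
      then show ?thesis using orth[of k l] that by (auto simp: P_def)
    qed (use that pt tp in \<open>auto simp: P_def\<close>)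
    obtain f and b :: "'j option \<Rightarrow> 'j option set" where f: "matrix_units S (insert None ?J) b f"
      "\<And>i j. i \<in> insert None ?J \<Longrightarrow> j \<in> insert None ?J \<Longrightarrow> b i = b j \<longleftrightarrow> linked S (P i) (P j)"
      by (rule matrix_units_exist[of d S "insert None ?J" P, OF S _ P Po]) (use finJ in \<open>blast+\<close>)
    have "?J = insert None ?J"
    proof (rule classes_rigid(1)[where c = "c \<circ> the" and b = b and s = s and L = L])
      show "(\<Sum>D\<in>b ` insert None ?J. s (card {i \<in> insert None ?J. b i = D})) \<le>
        (\<Sum>k\<in>(c \<circ> the) ` ?J. s (card {j \<in> ?J. (c \<circ> the) j = k}))" unfolding cSome using bound[OF f(1)] by blast
      show "card {k \<in> insert None ?J. b k = b i} \<le> L" if "i \<in> insert None ?J" for i using bound[OF f(1)] that by blast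
      show "b i = b j" if "i \<in> ?J" "j \<in> ?J" "(c \<circ> the) i = (c \<circ> the) j" for i j
        using that f(2)[of i j] plink by (auto simp: P_def)
    qed (use s0 sup pos finJ in auto)
    then show False by auto
  qed
  have orth': "(p \<circ> the) i * (p \<circ> the) j = 0" if ij: "i \<in> ?J" "j \<in> ?J" "i \<noteq> j" for i j
  proof -
    obtain k l where "i = Some k" "j = Some l" "k \<in> J" "l \<in> J" using ij(1,2) by blast
    then show ?thesis using orth[of k l] ij(3) by simp
  qed
  have pmin': "minproj S ((p \<circ> the) i)" if "i \<in> ?J" for i using pmin that by auto
  obtain f and b :: "'j option \<Rightarrow> 'j option set" where f: "matrix_units S ?J b f"
    "\<And>i. i \<in> ?J \<Longrightarrow> f i i = p (the i)"
    "\<And>i j. i \<in> ?J \<Longrightarrow> j \<in> ?J \<Longrightarrow> b i = b j \<longleftrightarrow> linked S (p (the i)) (p (the j))"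
    by (rule matrix_units_exist[of d S ?J "p \<circ> the", OF S _ pmin' orth'])
      (use finJ in \<open>simp_all add: comp_def\<close>)
  have cb: "c i = c j" if "i \<in> J" "j \<in> J" "b (Some i) = b (Some j)" for i j
  proof -
    have "(c \<circ> the) (Some i) = (c \<circ> the) (Some j)"
    proof (rule classes_rigid(2)[where b = b and s = s and L = L and I = ?J and J = ?J])
      show "(\<Sum>D\<in>b ` ?J. s (card {i \<in> ?J. b i = D})) \<le>
        (\<Sum>k\<in>(c \<circ> the) ` ?J. s (card {j \<in> ?J. (c \<circ> the) j = k}))" unfolding cSome using bound[OF f(1)] by blast
      show "card {k \<in> ?J. b k = b i} \<le> L" if "i \<in> ?J" for i using bound[OF f(1)] that by blast
      show "b i = b j" if "i \<in> ?J" "j \<in> ?J" "(c \<circ> the) i = (c \<circ> the) j" for i j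
        using that f(3)[of i j] plink by auto
    qed (use s0 sup pos finJ that in auto)
    then show ?thesis by simp
  qed
  have ff: "full_matrix_units S ?J b f"
    unfolding full_matrix_units_def using f(1,2) sep by auto
  \<comment> \<open>Every \<open>p i\<close> annihilates \<open>h (g j j) - p j\<close> from the
    left: for \<open>i = j\<close> because \<open>p j\<close> lies below \<open>h (g j j)\<close>,
    otherwise by orthogonality. Fullness makes the difference vanish.\<close>
  have phg: "p j = h (g j j)" if j: "j \<in> J" for j
  proof -
    have "p i * (h (g j j) - p j) = 0" if i: "i \<in> J" for i
    proof (cases "i = j")
      case False
      have "p i * h (g j j) = p i * (h (g i i) * h (g j j))" using ph[OF i] by (simp flip: mult.assoc)
      then show ?thesis using False orth i j hmul[of i i j j] by (simp add: right_diff_distrib)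
    next
      case True
      then show ?thesis using ph[OF j] minprojD(4)[OF pmin[OF j]] by (simp add: right_diff_distrib)
    qed
    moreover have "h (g j j) - p j \<in> S" using S hS[OF j j] minprojD(1)[OF pmin[OF j]] by (intro subalgD) auto
    ultimately show ?thesis using sep by fastforce
  qed
  have hA: "subalg d (h ` A)" by (rule fmat_hom_image_subalg[OF A S h])
  have fA: "f i j \<in> h ` A" if ij: "i \<in> ?J" "j \<in> ?J" "b i = b j" for i j
  proof -
    obtain k l where kl: "i = Some k" "j = Some l" "k \<in> J" "l \<in> J" using ij by auto
    have ckl: "c k = c l" using cb[OF kl(3,4)] ij kl by simp
    \<comment> \<open>The image of an off-diagonal unit lies in the one-dimensional corner spanned
      by \<open>f i j\<close> and is nonzero, so \<open>f i j\<close> is a multiple of it.\<close>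
    obtain a where a: "f i i * h (g k l) * f j j = sc a (f i j)"
      using matrix_unitsD(6)[OF f(1) ij(1,2) hS[OF kl(3,4) ckl] ij(3)] by blast
    have "f i i * h (g k l) * f j j = h (g k l)"
      using f(2)[OF ij(1)] f(2)[OF ij(2)] phg kl hmul[of k k k l] hmul[of k l l l] ckl by simp
    then have *: "h (g k l) = sc a (f i j)" using a by simp
    moreover have "h (g k l) \<noteq> 0" using h_nz G(2)[OF kl(3,4) ckl] matrix_unit_nonzero[OF mg kl(3,4) ckl] by blast
    ultimately have "f i j = sc (1 / a) (h (g k l))" by auto
    then show ?thesis using subalgD(4)[OF hA] G(2)[OF kl(3,4) ckl] by auto
  qed
  have "S \<subseteq> h ` A"
  proof
    fix X assume "X \<in> S"
    then obtain a where X: "X = unit_comb ?J b f a" using full_matrix_units_expand[OF S ff] by blast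
    show "X \<in> h ` A" unfolding X unit_comb_def
      by (intro subalg_sum[OF hA]) (auto intro!: subalgD[OF hA] fA)
  qed
  then show ?thesis using H(1) by blast
qed

section \<open>Codes on the faces of the cube\<close>

definition vertices :: "nat \<Rightarrow> bool list set" where
  "vertices n = {v. length v = n}"

text \<open>Encoding of the faces of the cube: \<open>Some a\<close> fixes a coordinate and
  \<open>None\<close> leaves it free, so these are the faces that contain the vertex
  \<open>v\<close>.\<close>

definition faces_at :: "bool list \<Rightarrow> bool option list set" where
  "faces_at v = {t. list_all2 (\<lambda>a t. t = None \<or> t = Some a) v t}"

definition fdim :: "bool option list \<Rightarrow> nat" where
  "fdim t = count_list t None"

lemma finite_vertices [simp]: "finite (vertices n)"
  using finite_lists_length_eq[of "UNIV :: bool set" n] by (simp add: vertices_def)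

lemma card_vertices: "card (vertices n) = 2 ^ n"
  using card_lists_length_eq[of "UNIV :: bool set" n] by (simp add: vertices_def)

lemma faces_at_Nil [simp]: "faces_at [] = {[]}"
  by (auto simp: faces_at_def)

lemma faces_at_Cons: "faces_at (a # v) = (\<lambda>t. None # t) ` faces_at v \<union> (\<lambda>t. Some a # t) ` faces_at v"
  by (auto simp: faces_at_def list_all2_Cons1)

lemma faces_at_length: "t \<in> faces_at v \<Longrightarrow> length t = length v"
  by (auto simp: faces_at_def list_all2_lengthD)

lemma finite_faces_at [simp]: "finite (faces_at v)"
  by (induction v) (simp_all add: faces_at_Cons)

lemma faces_at_iff_nth:
  "t \<in> faces_at v \<longleftrightarrow> length t = length v \<and> (\<forall>i<length v. t ! i = None \<or> t ! i = Some (v ! i))"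
  by (auto simp: faces_at_def list_all2_conv_all_nth)

text \<open>Each coordinate contributes the factor \<open>1 + 1/2\<close>, for fixed and free. This
  is the capacity of a single vertex in the final count.\<close>

lemma sum_faces_at: "(\<Sum>t\<in>faces_at v. (1 / 2 :: real) ^ fdim t) = (3 / 2) ^ length v"
proof (induction v)
  case (Cons a v)
  have "(\<Sum>t\<in>faces_at (a # v). (1 / 2 :: real) ^ fdim t) =
    (\<Sum>t\<in>(\<lambda>t. None # t) ` faces_at v. (1 / 2) ^ fdim t) + (\<Sum>t\<in>(\<lambda>t. Some a # t) ` faces_at v. (1 / 2) ^ fdim t)"
    unfolding faces_at_Cons by (rule sum.union_disjoint) auto
  also have "\<dots> = (\<Sum>t\<in>faces_at v. (1 / 2) ^ Suc (fdim t)) + (\<Sum>t\<in>faces_at v. (1 / 2) ^ fdim t)"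
    by (subst (1 2) sum.reindex) (auto simp: fdim_def inj_on_def)
  also have "\<dots> = (3 / 2) * (3 / 2) ^ length v"
    using Cons by (simp add: sum_divide_distrib[symmetric])
  finally show ?case by simp
qed (simp add: fdim_def)

section \<open>The edge count on the cube\<close>

definition cube_degree :: "nat \<Rightarrow> bool list set \<Rightarrow> bool list \<Rightarrow> nat" where
  "cube_degree n S v = card {i. i < n \<and> v[i := \<not> v ! i] \<in> S}"

lemma cube_degree_Cons:
  "cube_degree (Suc n) S (a # v) =
     (if (\<not> a) # v \<in> S then 1 else 0) + cube_degree n {w. a # w \<in> S} v"
proof -
  have "{i. i < Suc n \<and> (a # v)[i := \<not> (a # v) ! i] \<in> S} =
     (if (\<not> a) # v \<in> S then {0} else {}) \<union> Suc ` {i. i < n \<and> v[i := \<not> v ! i] \<in> {w. a # w \<in> S}}"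
    by (auto simp: less_Suc_eq_0_disj split: if_splits)
  also have "card \<dots> = (if (\<not> a) # v \<in> S then 1 else 0) + card {i. i < n \<and> v[i := \<not> v ! i] \<in> {w. a # w \<in> S}}"
    by (subst card_Un_disjoint) (auto simp: card_image)
  finally show ?thesis by (simp only: cube_degree_def)
qed

text \<open>Induction on the dimension. If \<open>S\<close> meets both facets orthogonal to the
  first coordinate, passing from a facet to the whole cube raises each degree by at most 1, so each
  facet contributes at least 1/2; if \<open>S\<close> meets only one facet, the degrees do not
  change. Subcubes attain equality.\<close>

lemma sum_cube_degree:
  assumes "S \<subseteq> vertices n" "S \<noteq> {}"
  shows "1 \<le> (\<Sum>v\<in>S. (1 / 2 :: real) ^ cube_degree n S v)"
  using assms
proof (induction n arbitrary: S)
  case 0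
  then have "S = {[]}" by (auto simp: vertices_def)
  then show ?case by (simp add: cube_degree_def)
next
  case (Suc n)
  define H where "H a = {w. a # w \<in> S}" for a
  have H: "H a \<subseteq> vertices n" for a using Suc(2) by (auto simp: H_def vertices_def)
  then have finH: "finite (H a)" for a using finite_vertices finite_subset by blast
  have S: "S = (\<lambda>v. True # v) ` H True \<union> (\<lambda>v. False # v) ` H False"
  proof (intro equalityI subsetI)
    fix v assume v: "v \<in> S"
    then obtain a w where "v = a # w" using Suc(2) by (auto simp: vertices_def length_Suc_conv)
    then show "v \<in> (\<lambda>v. True # v) ` H True \<union> (\<lambda>v. False # v) ` H False" using v by (cases a) (auto simp: H_def)
  qed (auto simp: H_def)
  let ?g = "\<lambda>a v. (1 / 2 :: real) ^ cube_degree (Suc n) S (a # v)"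
  have "(\<Sum>v\<in>S. (1 / 2 :: real) ^ cube_degree (Suc n) S v) =
     (\<Sum>v\<in>(\<lambda>v. True # v) ` H True. (1 / 2) ^ cube_degree (Suc n) S v) +
     (\<Sum>v\<in>(\<lambda>v. False # v) ` H False. (1 / 2) ^ cube_degree (Suc n) S v)"
    by (subst (2) S, rule sum.union_disjoint) (use finH in auto)
  also have "\<dots> = (\<Sum>v\<in>H True. ?g True v) + (\<Sum>v\<in>H False. ?g False v)"
    by (subst (1 2) sum.reindex) (auto simp: inj_on_def)
  finally have split: "(\<Sum>v\<in>S. (1 / 2 :: real) ^ cube_degree (Suc n) S v) =
    (\<Sum>v\<in>H True. ?g True v) + (\<Sum>v\<in>H False. ?g False v)" .
  have IH: "1 \<le> (\<Sum>v\<in>H a. (1 / 2 :: real) ^ cube_degree n (H a) v)" if "H a \<noteq> {}" for a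
    by (rule Suc.IH) (use H that in auto)
  have half: "1 / 2 \<le> (\<Sum>v\<in>H a. ?g a v)" if "H a \<noteq> {}" for a
  proof -
    have "1 / 2 \<le> (\<Sum>v\<in>H a. (1 / 2) * (1 / 2 :: real) ^ cube_degree n (H a) v)"
      unfolding sum_distrib_left[symmetric] using IH[OF that] by simp
    also have "\<dots> \<le> (\<Sum>v\<in>H a. ?g a v)"
      by (intro sum_mono) (auto simp: cube_degree_Cons H_def)
    finally show ?thesis .
  qed
  have whole: "1 \<le> (\<Sum>v\<in>H a. ?g a v)" if "H a \<noteq> {}" "H (\<not> a) = {}" for a
  proof -
    have "?g a v = (1 / 2) ^ cube_degree n (H a) v" for v
      using that(2) by (auto simp: cube_degree_Cons H_def)
    then show ?thesis using IH[OF that(1)] by simp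
  qed
  have "H True \<noteq> {} \<or> H False \<noteq> {}" using S Suc(3) by auto
  then show ?case
    unfolding split using half[of True] half[of False] whole[of True] whole[of False]
    by (cases "H True = {}"; cases "H False = {}") auto
qed

text \<open>A linear cost is minimised under the capacities \<open>q z <= 1\<close> by filling the
  cheapest words completely. With \<open>h\<close> the cost of the \<open>d\<close>-th word, no mass
  beyond the first \<open>d\<close> words is cheaper than \<open>h\<close> and no mass on them is
  dearer.\<close>

lemma fractional_weight_bound:
  assumes e: "weight_enumeration n e" and q: "\<And>z. z \<in> vertices n \<Longrightarrow> 0 \<le> q z \<and> q z \<le> (1 :: real)"
    and sum: "(\<Sum>z\<in>vertices n. q z) = real d"
  shows "d \<le> 2 ^ n \<and> real (weight_sum e d) \<le> (\<Sum>z\<in>vertices n. q z * 2 ^ hamming_weight z)"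
proof -
  have "real d \<le> (\<Sum>z\<in>vertices n. 1)" unfolding sum[symmetric] using q by (intro sum_mono) auto
  then have d: "d \<le> 2 ^ n" by (simp add: card_vertices)
  have bij: "bij_betw e {1..2 ^ n} (vertices n)" and mono: "mono_on {1..2 ^ n} (\<lambda>i. hamming_weight (e i))"
    using e by (auto simp: weight_enumeration_def vertices_def)
  show ?thesis
  proof (cases "d = 0")
    case True
    then show ?thesis using q by (auto simp: weight_sum_def intro!: sum_nonneg)
  next
    case False
    define h where "h = (2 :: real) ^ hamming_weight (e d)"
    define A where "A = e ` {1..d}"
    have inj: "inj_on e {1..d}" using bij d by (auto simp: bij_betw_def intro: inj_on_subset)
    have AV: "A \<subseteq> vertices n" using bij d by (auto simp: A_def bij_betw_def)
    \<comment> \<open>After the threshold \<open>h\<close> is subtracted, the costs are nonpositive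
      on the first \<open>d\<close> words and nonnegative on the others, so the indicator of
      \<open>A\<close> minimises every term separately. Both sides have total mass \<open>d\<close>,
      so the subtraction changes both by \<open>d * h\<close>.\<close>
    have term_le: "(if z \<in> A then 2 ^ hamming_weight z - h else 0) \<le> q z * (2 ^ hamming_weight z - h)"
      if z: "z \<in> vertices n" for z
    proof -
      obtain i where i: "i \<in> {1..2 ^ n}" "z = e i" using z bij_betw_imp_surj_on[OF bij] by blast
      show ?thesis
      proof (cases "i \<le> d")
        case True
        then have "hamming_weight z \<le> hamming_weight (e d)"
          using mono_onD[OF mono, of i d] i d False by auto
        then have "2 ^ hamming_weight z - h \<le> 0" by (simp add: h_def)
        moreover have "z \<in> A" using True i by (auto simp: A_def)
        ultimately show ?thesis using q[OF z] mult_right_mono_neg[of "q z" 1 "2 ^ hamming_weight z - h"] by simp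
      next
        case False
        then have "hamming_weight (e d) \<le> hamming_weight z"
          using mono_onD[OF mono, of d i] i d \<open>d \<noteq> 0\<close> by auto
        then have "0 \<le> 2 ^ hamming_weight z - h" by (simp add: h_def)
        moreover have "z \<notin> A"
          using False i d bij_betw_imp_inj_on[OF bij] by (auto simp: A_def dest!: inj_onD)
        ultimately show ?thesis using q[OF z] by simp
      qed
    qed
    have "real (weight_sum e d) - real d * h = (\<Sum>z\<in>A. 2 ^ hamming_weight z - h)"
      unfolding A_def by (subst sum.reindex[OF inj]) (simp add: weight_sum_def sum_subtractf)
    also have "\<dots> = (\<Sum>z\<in>vertices n. if z \<in> A then 2 ^ hamming_weight z - h else 0)"
      using AV by (simp add: sum.inter_restrict[symmetric] Int_absorb1)
    also have "\<dots> \<le> (\<Sum>z\<in>vertices n. q z * (2 ^ hamming_weight z - h))" by (intro sum_mono term_le)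
    also have "\<dots> = (\<Sum>z\<in>vertices n. q z * 2 ^ hamming_weight z) - real d * h"
      by (simp add: right_diff_distrib sum_subtractf flip: sum sum_distrib_right)
    finally show ?thesis using d by simp
  qed
qed

lemma count_list_card: "count_list xs y = card {i. i < length xs \<and> xs ! i = y}"
  by (simp add: count_list_eq_length_filter length_filter_conv_card eq_commute)

text \<open>A used face that is free in direction \<open>i\<close> contains the neighbour of
  \<open>v\<close> in this direction, which therefore lies in \<open>S\<close>. So used faces are
  free only in the directions \<open>U\<close> towards \<open>S\<close>, and such a face is
  determined by the directions of \<open>U\<close> that it fixes. Their number and the dimension of
  the face add up to the degree, so \<open>fractional_weight_bound\<close> applies once the factor
  \<open>2^(-deg)\<close> is taken out.\<close>

lemma local_weight_bound:
  assumes e: "weight_enumeration n e" and v: "v \<in> vertices n" "S \<subseteq> vertices n"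
    and m: "\<And>t. t \<in> faces_at v \<Longrightarrow> 0 \<le> m t \<and> m t \<le> (1 :: real)"
    and supp: "\<And>t w. t \<in> faces_at v \<Longrightarrow> m t \<noteq> 0 \<Longrightarrow> t \<in> faces_at w \<Longrightarrow> w \<in> S"
    and sum: "(\<Sum>t\<in>faces_at v. m t) = real d"
  shows "d \<le> 2 ^ n \<and>
    (1 / 2) ^ cube_degree n S v * real (weight_sum e d) \<le> (\<Sum>t\<in>faces_at v. m t * (1 / 2) ^ fdim t)"
proof -
  define U where "U = {i. i < n \<and> v[i := \<not> v ! i] \<in> S}"
  define F where "F = {t \<in> faces_at v. m t \<noteq> 0}"
  \<comment> \<open>Coordinates outside \<open>U\<close> are entered as \<open>False\<close>, so
    that \<open>zf t\<close> is a full word of length \<open>n\<close> whose Hamming weight counts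
    only the fixed directions in \<open>U\<close>.\<close>
  define zf where "zf t = map (\<lambda>i. i \<in> U \<and> t ! i \<noteq> None) [0..<n]" for t :: "bool option list"
  have len: "length v = n" using v by (simp add: vertices_def)
  have finF: "finite F" by (simp add: F_def)
  have free: "i \<in> U" if t: "t \<in> F" "i < n" "t ! i = None" for t i
  proof -
    have "t \<in> faces_at (v[i := \<not> v ! i])"
      using t len by (auto simp: F_def faces_at_iff_nth nth_list_update)
    then show ?thesis using supp[of t] t by (auto simp: F_def U_def)
  qed
  have inj: "inj_on zf F"
  proof (rule inj_onI)
    fix t t' assume tt: "t \<in> F" "t' \<in> F" "zf t = zf t'"
    have "t ! i = t' ! i" if i: "i < n" for i
    proof -
      have "(i \<in> U \<and> t ! i \<noteq> None) = (i \<in> U \<and> t' ! i \<noteq> None)"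
        using arg_cong[OF tt(3), of "\<lambda>z. z ! i"] i by (simp add: zf_def)
      then have "t ! i = None \<longleftrightarrow> t' ! i = None" using free[OF tt(1) i] free[OF tt(2) i] by blast
      moreover have "t ! i = None \<or> t ! i = Some (v ! i)" "t' ! i = None \<or> t' ! i = Some (v ! i)"
        using tt i len by (auto simp: F_def faces_at_iff_nth)
      ultimately show ?thesis by auto
    qed
    then show "t = t'" using tt len by (intro nth_equalityI) (auto simp: F_def faces_at_length)
  qed
  have finU: "finite U" by (simp add: U_def)
  have weight: "hamming_weight (zf t) + fdim t = cube_degree n S v" if t: "t \<in> F" for t
  proof -
    have lt: "length t = n" using t len faces_at_length by (auto simp: F_def)
    have "hamming_weight (zf t) = card {i \<in> U. t ! i \<noteq> None}"
      unfolding hamming_weight_def count_list_card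
      by (rule arg_cong[of _ _ card]) (auto simp: zf_def U_def)
    moreover have "fdim t = card {i \<in> U. t ! i = None}"
      unfolding fdim_def count_list_card lt
      by (rule arg_cong[of _ _ card]) (use free[OF t] in \<open>auto simp: U_def\<close>)
    moreover have "card U = card {i \<in> U. t ! i \<noteq> None} + card {i \<in> U. t ! i = None}"
      using finU by (subst card_Un_disjoint[symmetric]) (auto intro!: arg_cong[of _ _ card])
    ultimately show ?thesis by (simp add: cube_degree_def U_def)
  qed
  \<comment> \<open>Since \<open>zf\<close> is injective on \<open>F\<close>, every
    \<open>q z\<close> is a single mass or 0.\<close>
  define q where "q z = (\<Sum>t\<in>{t \<in> F. zf t = z}. m t)" for z
  have zV: "zf ` F \<subseteq> vertices n" by (auto simp: zf_def vertices_def)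
  have q01: "0 \<le> q z \<and> q z \<le> 1" for z
  proof (cases "\<exists>t\<in>F. zf t = z")
    case True
    then obtain t where t: "t \<in> F" "zf t = z" by blast
    then have "{t \<in> F. zf t = z} = {t}" using inj by (auto dest: inj_onD)
    then show ?thesis using m t by (simp add: q_def F_def)
  next
    case False
    then have "{t \<in> F. zf t = z} = {}" by blast
    then show ?thesis unfolding q_def by (simp only: sum.empty) simp
  qed
  have group: "(\<Sum>z\<in>vertices n. q z * g z) = (\<Sum>t\<in>F. m t * g (zf t))" for g :: "bool list \<Rightarrow> real"
  proof -
    have "(\<Sum>z\<in>vertices n. q z * g z) = (\<Sum>z\<in>vertices n. \<Sum>t\<in>{t \<in> F. zf t = z}. m t * g (zf t))"
      by (simp add: q_def sum_distrib_right)
    also have "\<dots> = (\<Sum>t\<in>F. m t * g (zf t))" by (rule sum.group[OF finF finite_vertices zV])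
    finally show ?thesis .
  qed
  have toF: "(\<Sum>t\<in>F. m t * g t) = (\<Sum>t\<in>faces_at v. m t * g t)" for g :: "bool option list \<Rightarrow> real"
    unfolding F_def by (rule sum.mono_neutral_left) auto
  have "(\<Sum>z\<in>vertices n. q z) = real d" using group[of "\<lambda>_. 1"] toF[of "\<lambda>_. 1"] sum by simp
  then have fb: "d \<le> 2 ^ n" "real (weight_sum e d) \<le> (\<Sum>t\<in>F. m t * 2 ^ hamming_weight (zf t))"
    using fractional_weight_bound[of n e q d, OF e q01] group[of "\<lambda>z. 2 ^ hamming_weight z"] by auto
  have "(1 / 2) ^ cube_degree n S v * real (weight_sum e d) \<le>
      (1 / 2) ^ cube_degree n S v * (\<Sum>t\<in>F. m t * 2 ^ hamming_weight (zf t))"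
    using fb by (intro mult_left_mono) auto
  also have "\<dots> = (\<Sum>t\<in>F. m t * (1 / 2) ^ fdim t)"
  proof -
    have "(1 / 2) ^ cube_degree n S v * (m t * 2 ^ hamming_weight (zf t)) = m t * (1 / 2) ^ fdim t" if "t \<in> F" for t
      unfolding weight[OF that, symmetric] by (simp add: power_add power_divide)
    then show ?thesis unfolding sum_distrib_left by (rule sum.cong[OF refl])
  qed
  finally show ?thesis using fb(1) toF by simp
qed

lemma sum_vertices_faces_at: "(\<Sum>v\<in>vertices n. \<Sum>t\<in>faces_at v. (1 / 2 :: real) ^ fdim t) = 3 ^ n"
proof -
  have "(\<Sum>v\<in>vertices n. \<Sum>t\<in>faces_at v. (1 / 2 :: real) ^ fdim t) = (\<Sum>v\<in>vertices n. (3 / 2) ^ n)"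
    by (intro sum.cong refl) (simp add: sum_faces_at vertices_def)
  also have "\<dots> = 3 ^ n" by (simp add: card_vertices power_divide)
  finally show ?thesis .
qed

text \<open>For a fixed vertex \<open>(y, v)\<close> the vectors \<open>E\<^sub>v u\<^sub>i / sqrt \<lambda>\<close> are orthonormal, so Bessel's inequality bounds
  what all codes together may use of each face; \<open>sum_cube_degree\<close> bounds from below what a single code uses.\<close>

lemma code_bound:
  fixes u :: "'i \<Rightarrow> 'y \<Rightarrow> bool option list \<Rightarrow> complex" and lam :: "'c \<Rightarrow> 'y \<Rightarrow> bool list \<Rightarrow> real"
  assumes e: "weight_enumeration n e" and fin: "finite Y" "finite I"
    and orth: "\<And>i j y v. i \<in> I \<Longrightarrow> j \<in> I \<Longrightarrow> y \<in> Y \<Longrightarrow> v \<in> vertices n \<Longrightarrow>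
       (\<Sum>t\<in>faces_at v. of_real ((1 / 2) ^ fdim t) * (u i y t * cnj (u j y t))) =
       (if i = j then of_real (lam (b i) y v) else 0)"
    and nz: "\<And>i. i \<in> I \<Longrightarrow> \<exists>y\<in>Y. \<exists>v\<in>vertices n. lam (b i) y v \<noteq> 0"
  shows "(\<forall>i\<in>I. card {k \<in> I. b k = b i} \<le> 2 ^ n) \<and>
    (\<Sum>D\<in>b ` I. weight_sum e (card {i \<in> I. b i = D})) \<le> card Y * 3 ^ n"
proof -
  define w where "w t = (1 / 2 :: real) ^ fdim t" for t
  have w0: "0 < w t" for t by (simp add: w_def)
  define a where "a i y t = w t * (cmod (u i y t))\<^sup>2" for i y t
  have a0: "0 \<le> a i y t" for i y t using w0[of t] by (simp add: a_def)
  have lam: "lam (b i) y v = (\<Sum>t\<in>faces_at v. a i y t)" if "i \<in> I" "y \<in> Y" "v \<in> vertices n" for i y v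
  proof -
    have "complex_of_real (\<Sum>t\<in>faces_at v. a i y t) = of_real (lam (b i) y v)"
      using orth[OF that(1) that(1) that(2,3)]
      by (simp add: a_def w_def complex_norm_square del: of_real_power)
    then show ?thesis by (simp only: of_real_eq_iff)
  qed
  \<comment> \<open>Where \<open>lam\<close> is positive, \<open>m D y v t\<close> is the squared
    length of the projection of the basis vector of \<open>t\<close> onto the image of the code
    \<open>D\<close> under the Kraus operator of \<open>(y, v)\<close>. Where \<open>lam\<close>
    vanishes, division by zero gives 0 and the vertex does not count.\<close>
  define m where "m D y v t = (\<Sum>i\<in>{i \<in> I. b i = D}. a i y t / lam D y v)" for D y v t
  have lam0: "0 \<le> lam D y v" if "D \<in> b ` I" "y \<in> Y" "v \<in> vertices n" for D y v
    using that lam by (auto intro!: sum_nonneg[OF a0])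
  have m0: "0 \<le> m D y v t" if "D \<in> b ` I" "y \<in> Y" "v \<in> vertices n" for D y v t
    unfolding m_def using lam0[OF that] a0 by (intro sum_nonneg) auto
  have bessel: "(\<Sum>D\<in>b ` I. m D y v t) \<le> 1" if y: "y \<in> Y" and v: "v \<in> vertices n" and t: "t \<in> faces_at v" for y v t
  proof -
    let ?I = "{i \<in> I. lam (b i) y v \<noteq> 0}"
    define x where "x i t = of_real (sqrt (w t / lam (b i) y v)) * u i y t" for i t
    have lp: "0 < lam (b i) y v" if "i \<in> ?I" for i using lam0[of "b i" y v] that y v by fastforce
    have "(\<Sum>t\<in>faces_at v. x i t * cnj (x j t)) = (if i = j then 1 else 0)" if ij: "i \<in> ?I" "j \<in> ?I" for i j
    proof -
      have "x i t * cnj (x j t) = of_real (1 / (sqrt (lam (b i) y v) * sqrt (lam (b j) y v))) *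
          (of_real (w t) * (u i y t * cnj (u j y t)))" for t
      proof -
        have "of_real (sqrt (w t / lam (b i) y v)) * of_real (sqrt (w t / lam (b j) y v)) =
          complex_of_real (1 / (sqrt (lam (b i) y v) * sqrt (lam (b j) y v)) * w t)"
          using w0[of t] by (simp add: real_sqrt_divide flip: of_real_mult)
        then show ?thesis by (simp add: x_def mult_ac)
      qed
      then have "(\<Sum>t\<in>faces_at v. x i t * cnj (x j t)) = of_real (1 / (sqrt (lam (b i) y v) * sqrt (lam (b j) y v))) *
          (\<Sum>t\<in>faces_at v. of_real (w t) * (u i y t * cnj (u j y t)))"
        by (simp only: sum_distrib_left)
      also have "(\<Sum>t\<in>faces_at v. of_real (w t) * (u i y t * cnj (u j y t))) =
          (if i = j then of_real (lam (b i) y v) else 0)"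
        unfolding w_def by (rule orth) (use ij y v in auto)
      finally have "(\<Sum>t\<in>faces_at v. x i t * cnj (x j t)) = of_real (1 / (sqrt (lam (b i) y v) * sqrt (lam (b j) y v))) *
          (if i = j then of_real (lam (b i) y v) else 0)" .
      then show ?thesis using lp[OF ij(1)] by (auto simp flip: of_real_mult)
    qed
    then have "(\<Sum>i\<in>?I. (cmod (x i t))\<^sup>2) \<le> 1"
      using fin t by (intro bessel_coordinate[where T = "faces_at v"]) auto
    moreover have "(cmod (x i t))\<^sup>2 = a i y t / lam (b i) y v" if "i \<in> ?I" for i
      using w0[of t] lp[OF that] by (simp add: x_def a_def norm_mult power_mult_distrib)
    moreover have "(\<Sum>D\<in>b ` I. m D y v t) = (\<Sum>i\<in>I. a i y t / lam (b i) y v)"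
    proof -
      have "(\<Sum>D\<in>b ` I. m D y v t) = (\<Sum>D\<in>b ` I. \<Sum>i\<in>{i \<in> I. b i = D}. a i y t / lam (b i) y v)"
        unfolding m_def by (intro sum.cong refl) auto
      then show ?thesis using sum.image_gen[OF fin(2), of "\<lambda>i. a i y t / lam (b i) y v" b] by simp
    qed
    moreover have "(\<Sum>i\<in>I. a i y t / lam (b i) y v) = (\<Sum>i\<in>?I. a i y t / lam (b i) y v)"
      using fin by (intro sum.mono_neutral_right) auto
    ultimately show ?thesis by simp
  qed
  have m1: "m D y v t \<le> 1" if "D \<in> b ` I" "y \<in> Y" "v \<in> vertices n" "t \<in> faces_at v" for D y v t
    using bessel[OF that(2-4)] member_le_sum[of D "b ` I" "\<lambda>D. m D y v t"] m0 that fin by fastforce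
  have single: "card {k \<in> I. b k = D} \<le> 2 ^ n \<and>
    real (weight_sum e (card {i \<in> I. b i = D})) \<le> (\<Sum>y\<in>Y. \<Sum>v\<in>vertices n. \<Sum>t\<in>faces_at v. m D y v t * w t)"
    if D: "D \<in> b ` I" for D
  proof -
    let ?d = "card {i \<in> I. b i = D}"
    \<comment> \<open>The lower bound is drawn from one classical value \<open>y\<close> that sees
      the code; the terms of the other values are nonnegative.\<close>
    obtain y v0 where y: "y \<in> Y" and v0: "v0 \<in> vertices n" "lam D y v0 \<noteq> 0" using nz D by blast
    define S where "S = {v \<in> vertices n. lam D y v \<noteq> 0}"
    have S: "S \<subseteq> vertices n" "S \<noteq> {}" using v0 by (auto simp: S_def)
    have loc: "?d \<le> 2 ^ n \<and> (1 / 2) ^ cube_degree n S v * real (weight_sum e ?d) \<le> (\<Sum>t\<in>faces_at v. m D y v t * (1 / 2) ^ fdim t)"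
      if v: "v \<in> S" for v
    proof (rule local_weight_bound[OF e])
      have vV: "v \<in> vertices n" using v by (simp add: S_def)
      then show "v \<in> vertices n" "S \<subseteq> vertices n" using S by auto
      show "0 \<le> m D y v t \<and> m D y v t \<le> 1" if "t \<in> faces_at v" for t using m0 m1 D y vV that by blast
      \<comment> \<open>The squared amplitude \<open>a i y t\<close> of a face enters
        \<open>lam\<close> at every vertex of the face, so a face in use makes all its vertices
        members of \<open>S\<close>.\<close>
      show "v' \<in> S" if t: "t \<in> faces_at v" "m D y v t \<noteq> 0" "t \<in> faces_at v'" for t v'
      proof -
        have "length v' = n" using faces_at_length[OF t(1)] faces_at_length[OF t(3)] vV by (simp add: vertices_def)
        then have v': "v' \<in> vertices n" by (simp add: vertices_def)
        obtain i where i: "i \<in> I" "b i = D" "a i y t / lam D y v \<noteq> 0"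
          using t(2) unfolding m_def by (auto elim: sum.not_neutral_contains_not_neutral)
        then have "0 < a i y t" using a0[of i y t] by (auto simp: less_le)
        moreover have "a i y t \<le> (\<Sum>t\<in>faces_at v'. a i y t)" using a0 t(3) by (intro member_le_sum) auto
        ultimately have "lam D y v' \<noteq> 0" using lam[OF i(1) y v'] i(2) by auto
        then show ?thesis using v' by (simp add: S_def)
      qed
      have "(\<Sum>t\<in>faces_at v. m D y v t) = (\<Sum>i\<in>{i \<in> I. b i = D}. \<Sum>t\<in>faces_at v. a i y t / lam D y v)"
        unfolding m_def by (rule sum.swap)
      also have "\<dots> = (\<Sum>i\<in>{i \<in> I. b i = D}. 1)"
      proof (intro sum.cong refl)
        fix i assume "i \<in> {i \<in> I. b i = D}"
        then have "(\<Sum>t\<in>faces_at v. a i y t) = lam D y v" using lam[of i y v] y vV by simp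
        then show "(\<Sum>t\<in>faces_at v. a i y t / lam D y v) = 1"
          using v by (simp add: S_def flip: sum_divide_distrib)
      qed
      finally show "(\<Sum>t\<in>faces_at v. m D y v t) = real ?d" by simp
    qed
    have mw: "0 \<le> (\<Sum>t\<in>faces_at v. m D y v t * w t)" if "y \<in> Y" "v \<in> vertices n" for y v
      using m0[OF D that] w0 by (intro sum_nonneg mult_nonneg_nonneg less_imp_le[OF w0])
    obtain v where "v \<in> S" using S by blast
    then have d: "?d \<le> 2 ^ n" using loc by blast
    \<comment> \<open>When the local estimates are summed over \<open>S\<close>, the factors
      \<open>2^(-deg)\<close> add up to at least 1.\<close>
    have "real (weight_sum e ?d) \<le> (\<Sum>v\<in>S. (1 / 2) ^ cube_degree n S v) * real (weight_sum e ?d)"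
      using mult_right_mono[OF sum_cube_degree[OF S], of "real (weight_sum e ?d)"] by simp
    also have "\<dots> \<le> (\<Sum>v\<in>S. \<Sum>t\<in>faces_at v. m D y v t * w t)"
      unfolding sum_distrib_right w_def by (intro sum_mono) (use loc in blast)
    also have "\<dots> \<le> (\<Sum>v\<in>vertices n. \<Sum>t\<in>faces_at v. m D y v t * w t)"
      by (rule sum_mono2[OF finite_vertices S(1)]) (use mw[OF y] in simp)
    also have "\<dots> \<le> (\<Sum>y\<in>Y. \<Sum>v\<in>vertices n. \<Sum>t\<in>faces_at v. m D y v t * w t)"
    proof (rule member_le_sum[OF y])
      show "0 \<le> (\<Sum>v\<in>vertices n. \<Sum>t\<in>faces_at v. m D x v t * w t)" if "x \<in> Y - {y}" for x
        by (rule sum_nonneg) (use mw that in blast)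
    qed (rule fin)
    finally show ?thesis using d by blast
  qed
  have "real (\<Sum>D\<in>b ` I. weight_sum e (card {i \<in> I. b i = D})) \<le>
     (\<Sum>D\<in>b ` I. \<Sum>y\<in>Y. \<Sum>v\<in>vertices n. \<Sum>t\<in>faces_at v. m D y v t * w t)"
    unfolding of_nat_sum by (intro sum_mono) (use single in blast)
  also have "\<dots> = (\<Sum>y\<in>Y. \<Sum>v\<in>vertices n. \<Sum>t\<in>faces_at v. (\<Sum>D\<in>b ` I. m D y v t) * w t)"
  proof -
    have "(\<Sum>D\<in>b ` I. \<Sum>y\<in>Y. \<Sum>v\<in>vertices n. \<Sum>t\<in>faces_at v. m D y v t * w t) =
      (\<Sum>y\<in>Y. \<Sum>D\<in>b ` I. \<Sum>v\<in>vertices n. \<Sum>t\<in>faces_at v. m D y v t * w t)" by (rule sum.swap)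
    also have "\<dots> = (\<Sum>y\<in>Y. \<Sum>v\<in>vertices n. \<Sum>D\<in>b ` I. \<Sum>t\<in>faces_at v. m D y v t * w t)"
      by (rule sum.cong[OF refl], rule sum.swap)
    also have "\<dots> = (\<Sum>y\<in>Y. \<Sum>v\<in>vertices n. \<Sum>t\<in>faces_at v. \<Sum>D\<in>b ` I. m D y v t * w t)"
      by (rule sum.cong[OF refl], rule sum.cong[OF refl], rule sum.swap)
    finally show ?thesis by (simp only: sum_distrib_right)
  qed
  \<comment> \<open>Bessel's inequality caps the joint use of a face at 1, separately at each of its
    vertices.\<close>
  also have "\<dots> \<le> (\<Sum>y\<in>Y. \<Sum>v\<in>vertices n. \<Sum>t\<in>faces_at v. 1 * w t)"
    by (intro sum_mono mult_right_mono bessel) (use w0 in \<open>auto intro: less_imp_le\<close>)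
  also have "\<dots> = real (card Y * 3 ^ n)" by (simp add: w_def sum_vertices_faces_at)
  finally have "(\<Sum>D\<in>b ` I. weight_sum e (card {i \<in> I. b i = D})) \<le> card Y * 3 ^ n"
    by (simp only: of_nat_le_iff)
  then show ?thesis using single by blast
qed

section \<open>Channels, adjoints and positivity\<close>

lemma index_mult_sum:
  assumes "A \<in> carrier_mat a b" "B \<in> carrier_mat b c" "i < a" "j < c"
  shows "(A * B) $$ (i, j) = (\<Sum>k<b. A $$ (i, k) * B $$ (k, j))"
  using assms by (simp add: scalar_prod_def atLeast0LessThan)

lemma index_adjoint:
  assumes "A \<in> carrier_mat a b" "i < b" "j < a"
  shows "mat_adjoint A $$ (i, j) = cnj (A $$ (j, i))"
  using assms by (simp add: mat_adjoint_def mat_of_rows_def)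

lemma carrier_adjoint: "A \<in> carrier_mat a b \<Longrightarrow> mat_adjoint A \<in> carrier_mat b a"
  by (auto simp: mat_adjoint_def mat_of_rows_def)

lemma mtrace_sum: "A \<in> carrier_mat d d \<Longrightarrow> mtrace A = (\<Sum>i<d. A $$ (i, i))"
  unfolding mtrace_def diag_mat_def by (simp add: interv_sum_list_conv_sum_set_nat atLeast0LessThan)

lemma mtrace_mult:
  assumes "A \<in> carrier_mat a b" "B \<in> carrier_mat b a"
  shows "mtrace (A * B) = (\<Sum>i<a. \<Sum>j<b. A $$ (i, j) * B $$ (j, i))"
proof -
  have "A * B \<in> carrier_mat a a" using assms by simp
  then have "mtrace (A * B) = (\<Sum>i<a. (A * B) $$ (i, i))" by (rule mtrace_sum)
  also have "\<dots> = (\<Sum>i<a. \<Sum>j<b. A $$ (i, j) * B $$ (j, i))"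
    by (rule sum.cong[OF refl]) (rule index_mult_sum[OF assms], auto)
  finally show ?thesis .
qed

lemma sum_delta2:
  assumes "a < (m :: nat)" "b < (n :: nat)"
  shows "(\<Sum>i<m. \<Sum>j<n. if i = a \<and> j = b then f i j else 0) = (f a b :: 'a :: comm_monoid_add)"
proof -
  have "(\<Sum>i<m. \<Sum>j<n. if i = a \<and> j = b then f i j else 0) = (\<Sum>i<m. if i = a then (\<Sum>j<n. if j = b then f i j else 0) else 0)"
    by (rule sum.cong[OF refl]) simp
  then show ?thesis using assms by (simp only: sum.delta finite_lessThan lessThan_iff if_True)
qed

section \<open>Rank-one matrices and positive forms\<close>

definition outer :: "nat \<Rightarrow> (nat \<Rightarrow> complex) \<Rightarrow> (nat \<Rightarrow> complex) \<Rightarrow> complex mat" where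
  "outer d u v = mat d d (\<lambda>(i, j). u i * cnj (v j))"

lemma outer_carrier [simp]: "outer d u v \<in> carrier_mat d d"
  by (simp add: outer_def)

text \<open>The sesquilinear form of \<open>A\<close>, linear in \<open>u\<close> and conjugate
  linear in \<open>v\<close>. Vectors are functions of which only the values below \<open>d\<close>
  matter.\<close>

definition qform :: "nat \<Rightarrow> complex mat \<Rightarrow> (nat \<Rightarrow> complex) \<Rightarrow> (nat \<Rightarrow> complex) \<Rightarrow> complex" where
  "qform d A u v = (\<Sum>i<d. \<Sum>j<d. A $$ (i, j) * u j * cnj (v i))"

lemma qform_mtrace:
  assumes "A \<in> carrier_mat d d" shows "mtrace (A * outer d u v) = qform d A u v"
  by (subst mtrace_mult[OF assms outer_carrier]) (simp add: qform_def outer_def mult.assoc)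

lemma psd_qform: "psd d A \<longleftrightarrow> A \<in> carrier_mat d d \<and> (\<forall>u. 0 \<le> qform d A u u)"
proof -
  have eq: "(A *\<^sub>v v) \<bullet>c v = qform d A (\<lambda>i. v $ i) (\<lambda>i. v $ i)" if "A \<in> carrier_mat d d" "v \<in> carrier_vec d" for v
    using that by (simp add: qform_def scalar_prod_def atLeast0LessThan sum_distrib_right)
  have "qform d A u u = (A *\<^sub>v vec d u) \<bullet>c vec d u" if "A \<in> carrier_mat d d" for u
    using eq[OF that, of "vec d u"] by (simp add: qform_def)
  then show ?thesis unfolding psd_def using eq by (metis vec_carrier)
qed

lemma qform_outer: "qform d (outer d u u) v v = of_real ((cmod (\<Sum>i<d. u i * cnj (v i)))\<^sup>2)"
proof -
  have "qform d (outer d u u) v v = (\<Sum>i<d. u i * cnj (v i)) * cnj (\<Sum>i<d. u i * cnj (v i))"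
    by (simp add: qform_def outer_def sum_product mult_ac)
  then show ?thesis by (simp only: complex_norm_square)
qed

lemma psd_outer: "psd d (outer d u u)"
  by (auto simp: psd_qform qform_outer less_eq_complex_def simp del: of_real_power)

text \<open>A vector on which a positive form vanishes is in its radical (Cauchy--Schwarz).\<close>

lemma psd_radical:
  fixes Q :: "'v \<Rightarrow> 'v \<Rightarrow> complex" and add :: "complex \<Rightarrow> 'v \<Rightarrow> 'v \<Rightarrow> 'v"
  assumes pos: "\<And>u. 0 \<le> Q u u" and zero: "Q z z = 0"
    and lin: "\<And>c u. Q (add c z u) (add c z u) = c * cnj c * Q z z + c * Q z u + cnj c * Q u z + Q u u"
  shows "Q z u = 0" "Q u z = 0"
proof -
  have p: "0 \<le> c * Q z u + cnj c * Q u z + Q u u" for c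
    using pos[of "add c z u"] lin zero by simp
  have real: "Im (Q u u) = 0" "0 \<le> Re (Q u u)" using pos[of u] by (auto simp: less_eq_complex_def)
  \<comment> \<open>Testing with 1 and with the imaginary unit shows that \<open>Q u z\<close> is
    the complex conjugate of \<open>Q z u\<close>.\<close>
  have im: "Im (Q z u) = - Im (Q u z)" using p[of 1] real by (simp add: less_eq_complex_def)
  have re: "Re (Q z u) = Re (Q u z)" using p[of \<i>] real by (simp add: less_eq_complex_def)
  have b: "0 \<le> 2 * (Re c * Re (Q z u) - Im c * Im (Q z u)) + Re (Q u u)" for c
    using p[of c] im re by (simp add: less_eq_complex_def algebra_simps)
  have "Re (Q z u) = 0"
  proof (rule ccontr)
    assume "Re (Q z u) \<noteq> 0"
    \<comment> \<open>The scalar is chosen so that the linear term becomes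
      \<open>-2 (Re (Q u u) + 1)\<close> and outweighs \<open>Re (Q u u)\<close>.\<close>
    then show False using b[of "of_real (- (Re (Q u u) + 1) / Re (Q z u))"] real by simp
  qed
  moreover have "Im (Q z u) = 0"
  proof (rule ccontr)
    assume "Im (Q z u) \<noteq> 0"
    then show False using b[of "\<i> * of_real ((Re (Q u u) + 1) / Im (Q z u))"] real by simp
  qed
  ultimately show "Q z u = 0" "Q u z = 0" using re im by (simp_all add: complex_eq_iff)
qed

lemma qform_lincomb:
  "qform d A (\<lambda>i. c * z i + u i) (\<lambda>i. c * z i + u i) =
     c * cnj c * qform d A z z + c * qform d A z u + cnj c * qform d A u z + qform d A u u"
  by (simp add: qform_def sum.distrib sum_distrib_left algebra_simps)

text \<open>The entries of \<open>Z\<close> are read off from the values of the map on matrix units.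
  Existence here and uniqueness in \<open>mtrace_nondegenerate\<close> give meaning to the definite
  description in \<open>adj_super\<close>.\<close>

lemma linear_super_pairing:
  assumes lin: "linear_super \<Phi>" and Y: "Y \<in> carrier_mat (odim \<Phi>) (odim \<Phi>)"
  obtains Z where "Z \<in> carrier_mat (idim \<Phi>) (idim \<Phi>)"
    "\<And>X. X \<in> carrier_mat (idim \<Phi>) (idim \<Phi>) \<Longrightarrow> mtrace (Y * app \<Phi> X) = mtrace (Z * X)"
proof -
  let ?d = "idim \<Phi>" and ?e = "odim \<Phi>"
  let ?E = "\<lambda>i j. app \<Phi> (ketbra (unit_vec ?d i) (unit_vec ?d j))"
  define Z where "Z = mat ?d ?d (\<lambda>(j, i). \<Sum>a<?e. \<Sum>b<?e. Y $$ (a, b) * ?E i j $$ (b, a))"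
  have cod: "app \<Phi> X \<in> carrier_mat ?e ?e" if "X \<in> carrier_mat ?d ?d" for X
    using lin that unfolding linear_super_def by blast
  have "mtrace (Y * app \<Phi> X) = mtrace (Z * X)" if X: "X \<in> carrier_mat ?d ?d" for X
  proof -
    have "mtrace (Y * app \<Phi> X) = (\<Sum>a<?e. \<Sum>b<?e. Y $$ (a, b) * (\<Sum>i<?d. \<Sum>j<?d. X $$ (i, j) * ?E i j $$ (b, a)))"
      unfolding mtrace_mult[OF Y cod[OF X]]
      by (intro sum.cong refl) (simp add: linear_super_expand[OF lin X])
    also have "\<dots> = (\<Sum>a<?e. \<Sum>b<?e. \<Sum>i<?d. \<Sum>j<?d. Y $$ (a, b) * ?E i j $$ (b, a) * X $$ (i, j))"
      by (simp add: sum_distrib_left mult_ac)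
    also have "\<dots> = (\<Sum>a<?e. \<Sum>i<?d. \<Sum>j<?d. \<Sum>b<?e. Y $$ (a, b) * ?E i j $$ (b, a) * X $$ (i, j))"
      by (rule sum.cong[OF refl], subst sum.swap, rule sum.cong[OF refl], rule sum.swap)
    also have "\<dots> = (\<Sum>i<?d. \<Sum>j<?d. \<Sum>a<?e. \<Sum>b<?e. Y $$ (a, b) * ?E i j $$ (b, a) * X $$ (i, j))"
      by (subst sum.swap, rule sum.cong[OF refl], rule sum.swap)
    also have "\<dots> = (\<Sum>j<?d. \<Sum>i<?d. Z $$ (j, i) * X $$ (i, j))"
      by (subst sum.swap) (simp add: Z_def sum_distrib_right)
    also have "\<dots> = mtrace (Z * X)" by (subst mtrace_mult[of _ ?d ?d]) (use X in \<open>auto simp: Z_def\<close>)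
    finally show ?thesis .
  qed
  then show thesis using that[of Z] by (simp add: Z_def)
qed

lemma mtrace_nondegenerate:
  assumes "Z \<in> carrier_mat d d" "Z' \<in> carrier_mat d d"
    and eq: "\<And>X. X \<in> carrier_mat d d \<Longrightarrow> mtrace (Z * X) = mtrace (Z' * X)"
  shows "Z = Z'"
proof (rule eq_matI)
  fix i j assume ij: "i < dim_row Z'" "j < dim_col Z'"
  let ?u = "\<lambda>k l :: nat. if l = k then 1 else 0 :: complex"
  have "qform d M (?u j) (?u i) = M $$ (i, j)" if "M \<in> carrier_mat d d" for M
  proof -
    have "qform d M (?u j) (?u i) = (\<Sum>k<d. \<Sum>l<d. if k = i \<and> l = j then M $$ (k, l) else 0)"
      unfolding qform_def by (intro sum.cong refl) auto
    also have "\<dots> = M $$ (i, j)" by (rule sum_delta2) (use ij assms in auto)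
    finally show ?thesis .
  qed
  then show "Z $$ (i, j) = Z' $$ (i, j)"
    using eq[OF outer_carrier[of d "?u j" "?u i"]] assms by (simp add: qform_mtrace)
qed (use assms in auto)

lemma adj_super_eqI:
  assumes "Z \<in> carrier_mat (idim \<Phi>) (idim \<Phi>)"
    and "\<And>X. X \<in> carrier_mat (idim \<Phi>) (idim \<Phi>) \<Longrightarrow> mtrace (Y * app \<Phi> X) = mtrace (Z * X)"
  shows "app (adj_super \<Phi>) Y = Z"
  unfolding adj_super_def using assms
  by (auto intro!: the_equality intro: mtrace_nondegenerate)

lemma adj_super_pairing:
  assumes "linear_super \<Phi>" "Y \<in> carrier_mat (odim \<Phi>) (odim \<Phi>)" "X \<in> carrier_mat (idim \<Phi>) (idim \<Phi>)"
  shows "mtrace (Y * app \<Phi> X) = mtrace (app (adj_super \<Phi>) Y * X)"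
proof -
  obtain Z where Z: "Z \<in> carrier_mat (idim \<Phi>) (idim \<Phi>)"
    "\<And>X. X \<in> carrier_mat (idim \<Phi>) (idim \<Phi>) \<Longrightarrow> mtrace (Y * app \<Phi> X) = mtrace (Z * X)"
    using linear_super_pairing[OF assms(1,2)] by blast
  then have "app (adj_super \<Phi>) Y = Z" by (rule adj_super_eqI)
  then show ?thesis using Z assms(3) by simp
qed

text \<open>Complete positivity with an ancilla of dimension 1: tensoring with the 1 by 1 identity
  changes nothing.\<close>

lemma channel_positive:
  assumes R: "channel R" and X: "psd (idim R) X"
  shows "psd (odim R) (app R X)"
proof -
  have lin: "linear_super R" and cp: "completely_positive R" using R by (auto simp: channel_def)
  have Xc: "X \<in> carrier_mat (idim R) (idim R)" using X by (simp add: psd_def)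
  then have c: "app R X \<in> carrier_mat (odim R) (odim R)" using lin by (simp add: linear_super_def)
  have "kron (1\<^sub>m 1) X = X" using Xc by (intro eq_matI) (auto simp: kron_def)
  moreover have "kron (1\<^sub>m 1) (app R X) = app R X" using c by (intro eq_matI) (auto simp: kron_def)
  moreover have "linear_super (id_super 1)" by (simp add: linear_super_def id_super_def)
  then have "app (tensor_super (id_super 1) R) (kron (1\<^sub>m 1) X) = kron (app (id_super 1) (1\<^sub>m 1)) (app R X)"
    by (rule tensor_super_kron) (use lin Xc in \<open>auto simp: id_super_def\<close>)
  ultimately have "app (tensor_super (id_super 1) R) X = app R X" by (simp add: id_super_def)
  then show ?thesis using cp X unfolding completely_positive_def by (metis mult_1)
qed

text \<open>The Kraus operators are \<open>E\<^sub>x = \<Sum>\<^bsub>r. \<chi> r = x\<^esub> \<alpha> r |r\<rangle>\<langle>\<tau> r|\<close>.\<close>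

definition comb_channel :: "supermap \<Rightarrow> (nat \<Rightarrow> nat) \<Rightarrow> (nat \<Rightarrow> 'x) \<Rightarrow> (nat \<Rightarrow> real) \<Rightarrow> bool" where
  "comb_channel \<Lambda> \<tau> \<chi> \<alpha> \<longleftrightarrow> (\<forall>r<odim \<Lambda>. \<tau> r < idim \<Lambda>) \<and>
     (\<forall>X\<in>carrier_mat (idim \<Lambda>) (idim \<Lambda>). app \<Lambda> X = mat (odim \<Lambda>) (odim \<Lambda>)
        (\<lambda>(r, s). if \<chi> r = \<chi> s then of_real (\<alpha> r * \<alpha> s) * X $$ (\<tau> r, \<tau> s) else 0))"

lemma comb_channel_linear: "comb_channel \<Lambda> \<tau> \<chi> \<alpha> \<Longrightarrow> linear_super \<Lambda>"
  unfolding linear_super_def comb_channel_def by (auto intro!: eq_matI simp: algebra_simps)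

lemma div_mod_less_mult: "r < m * n \<Longrightarrow> r div n < m \<and> r mod n < (n :: nat)"
  by (metis less_mult_imp_div_less mod_less_divisor mult_0_right not_gr_zero not_less_zero)

lemma mult_add_less_mult: "a < m \<Longrightarrow> b < n \<Longrightarrow> a * n + b < m * (n :: nat)"
proof -
  assume "a < m" "b < n"
  then have "a * n + b < Suc a * n" by simp
  also have "\<dots> \<le> m * n" using \<open>a < m\<close> by (intro mult_le_mono) auto
  finally show ?thesis .
qed

text \<open>Families of Kraus operators with at most one nonzero entry in each row are closed under
  tensor products: source indices and labels of the factors are paired, amplitudes are multiplied.
  The pairing of indices is the one fixed by \<open>kron\<close>.\<close>

lemma comb_channel_tensor:
  assumes 1: "comb_channel \<Lambda> \<tau> \<chi> \<alpha>" and 2: "comb_channel \<Lambda>' \<tau>' \<chi>' \<alpha>'"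
  shows "comb_channel (tensor_super \<Lambda> \<Lambda>') (\<lambda>r. \<tau> (r div odim \<Lambda>') * idim \<Lambda>' + \<tau>' (r mod odim \<Lambda>'))
    (\<lambda>r. (\<chi> (r div odim \<Lambda>'), \<chi>' (r mod odim \<Lambda>'))) (\<lambda>r. \<alpha> (r div odim \<Lambda>') * \<alpha>' (r mod odim \<Lambda>'))"
  unfolding comb_channel_def
proof (intro conjI allI impI ballI)
  let ?d = "idim \<Lambda>" and ?d' = "idim \<Lambda>'" and ?e = "odim \<Lambda>" and ?e' = "odim \<Lambda>'"
  have io: "idim (tensor_super \<Lambda> \<Lambda>') = ?d * ?d'" "odim (tensor_super \<Lambda> \<Lambda>') = ?e * ?e'"
    by (simp_all add: tensor_super_def)
  have tau: "\<tau> r < ?d" if "r < ?e" for r using 1 that by (simp add: comb_channel_def)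
  have tau': "\<tau>' r < ?d'" if "r < ?e'" for r using 2 that by (simp add: comb_channel_def)
  show "\<tau> (r div ?e') * ?d' + \<tau>' (r mod ?e') < idim (tensor_super \<Lambda> \<Lambda>')" if "r < odim (tensor_super \<Lambda> \<Lambda>')" for r
    using that div_mod_less_mult[of r ?e ?e'] by (auto simp: io intro!: mult_add_less_mult tau tau')
  fix X :: "complex mat" assume "X \<in> carrier_mat (idim (tensor_super \<Lambda> \<Lambda>')) (idim (tensor_super \<Lambda> \<Lambda>'))"
  let ?E = "\<lambda>i j. app \<Lambda> (ketbra (unit_vec ?d i) (unit_vec ?d j))"
  let ?F = "\<lambda>k l. app \<Lambda>' (ketbra (unit_vec ?d' k) (unit_vec ?d' l))"
  have E: "?E i j = mat ?e ?e (\<lambda>(r, s). if i = \<tau> r \<and> j = \<tau> s then if \<chi> r = \<chi> s then of_real (\<alpha> r * \<alpha> s) else 0 else 0)"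
    if "i < ?d" "j < ?d" for i j
    using 1 that unfolding comb_channel_def by (auto simp: ketbra_def intro!: eq_matI)
  have F: "?F i j = mat ?e' ?e' (\<lambda>(r, s). if i = \<tau>' r \<and> j = \<tau>' s then if \<chi>' r = \<chi>' s then of_real (\<alpha>' r * \<alpha>' s) else 0 else 0)"
    if "i < ?d'" "j < ?d'" for i j
    using 2 that unfolding comb_channel_def by (auto simp: ketbra_def intro!: eq_matI)
  show "app (tensor_super \<Lambda> \<Lambda>') X = mat (odim (tensor_super \<Lambda> \<Lambda>')) (odim (tensor_super \<Lambda> \<Lambda>'))
    (\<lambda>(r, s). if (\<chi> (r div ?e'), \<chi>' (r mod ?e')) = (\<chi> (s div ?e'), \<chi>' (s mod ?e'))
       then of_real (\<alpha> (r div ?e') * \<alpha>' (r mod ?e') * (\<alpha> (s div ?e') * \<alpha>' (s mod ?e'))) *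
         X $$ (\<tau> (r div ?e') * ?d' + \<tau>' (r mod ?e'), \<tau> (s div ?e') * ?d' + \<tau>' (s mod ?e')) else 0)"
  proof (rule eq_matI)
    fix r s assume "r < dim_row (mat (odim (tensor_super \<Lambda> \<Lambda>')) (odim (tensor_super \<Lambda> \<Lambda>'))
      (\<lambda>(r, s). if (\<chi> (r div ?e'), \<chi>' (r mod ?e')) = (\<chi> (s div ?e'), \<chi>' (s mod ?e'))
       then of_real (\<alpha> (r div ?e') * \<alpha>' (r mod ?e') * (\<alpha> (s div ?e') * \<alpha>' (s mod ?e'))) *
         X $$ (\<tau> (r div ?e') * ?d' + \<tau>' (r mod ?e'), \<tau> (s div ?e') * ?d' + \<tau>' (s mod ?e')) else 0))"
      "s < dim_col (mat (odim (tensor_super \<Lambda> \<Lambda>')) (odim (tensor_super \<Lambda> \<Lambda>'))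
      (\<lambda>(r, s). if (\<chi> (r div ?e'), \<chi>' (r mod ?e')) = (\<chi> (s div ?e'), \<chi>' (s mod ?e'))
       then of_real (\<alpha> (r div ?e') * \<alpha>' (r mod ?e') * (\<alpha> (s div ?e') * \<alpha>' (s mod ?e'))) *
         X $$ (\<tau> (r div ?e') * ?d' + \<tau>' (r mod ?e'), \<tau> (s div ?e') * ?d' + \<tau>' (s mod ?e')) else 0))"
    then have rs: "r < ?e * ?e'" "s < ?e * ?e'" by (simp_all add: io)
    define r1 r2 s1 s2 where "r1 = r div ?e'" and "r2 = r mod ?e'" and "s1 = s div ?e'" and "s2 = s mod ?e'"
    have b: "r1 < ?e" "r2 < ?e'" "s1 < ?e" "s2 < ?e'"
      using div_mod_less_mult[OF rs(1)] div_mod_less_mult[OF rs(2)] by (auto simp: r1_def r2_def s1_def s2_def)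
    define c where "c = (if \<chi> r1 = \<chi> s1 then complex_of_real (\<alpha> r1 * \<alpha> s1) else 0)"
    define c' where "c' = (if \<chi>' r2 = \<chi>' s2 then complex_of_real (\<alpha>' r2 * \<alpha>' s2) else 0)"
    have K: "kron (?E i j) (?F k l) $$ (r, s) = (if i = \<tau> r1 \<and> j = \<tau> s1 then if k = \<tau>' r2 \<and> l = \<tau>' s2 then c * c' else 0 else 0)"
      if "i < ?d" "j < ?d" "k < ?d'" "l < ?d'" for i j k l
      using rs b by (simp add: E[OF that(1,2)] F[OF that(3,4)] kron_index r1_def[symmetric] r2_def[symmetric]
          s1_def[symmetric] s2_def[symmetric] c_def c'_def)
    have "app (tensor_super \<Lambda> \<Lambda>') X $$ (r, s) = (\<Sum>i<?d. \<Sum>j<?d. \<Sum>k<?d'. \<Sum>l<?d'.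
        X $$ (i * ?d' + k, j * ?d' + l) * kron (?E i j) (?F k l) $$ (r, s))"
      using rs by (simp add: tensor_super_def)
    also have "\<dots> = (\<Sum>i<?d. \<Sum>j<?d. if i = \<tau> r1 \<and> j = \<tau> s1 then
        (\<Sum>k<?d'. \<Sum>l<?d'. if k = \<tau>' r2 \<and> l = \<tau>' s2 then X $$ (i * ?d' + k, j * ?d' + l) * (c * c') else 0) else 0)"
    proof (intro sum.cong refl)
      fix i j assume "i \<in> {..<?d}" "j \<in> {..<?d}"
      then have "(\<Sum>k<?d'. \<Sum>l<?d'. X $$ (i * ?d' + k, j * ?d' + l) * kron (?E i j) (?F k l) $$ (r, s)) =
        (\<Sum>k<?d'. \<Sum>l<?d'. if i = \<tau> r1 \<and> j = \<tau> s1 then if k = \<tau>' r2 \<and> l = \<tau>' s2 then X $$ (i * ?d' + k, j * ?d' + l) * (c * c') else 0 else 0)"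
        by (intro sum.cong refl) (auto simp: K)
      then show "(\<Sum>k<?d'. \<Sum>l<?d'. X $$ (i * ?d' + k, j * ?d' + l) * kron (?E i j) (?F k l) $$ (r, s)) =
        (if i = \<tau> r1 \<and> j = \<tau> s1 then
        (\<Sum>k<?d'. \<Sum>l<?d'. if k = \<tau>' r2 \<and> l = \<tau>' s2 then X $$ (i * ?d' + k, j * ?d' + l) * (c * c') else 0) else 0)"
        by (cases "i = \<tau> r1 \<and> j = \<tau> s1") (simp_all only: if_True if_False simp_thms sum.neutral_const)
    qed
    also have "\<dots> = X $$ (\<tau> r1 * ?d' + \<tau>' r2, \<tau> s1 * ?d' + \<tau>' s2) * (c * c')"
      using b by (simp only: sum_delta2 tau tau')
    finally show "app (tensor_super \<Lambda> \<Lambda>') X $$ (r, s) = mat (odim (tensor_super \<Lambda> \<Lambda>')) (odim (tensor_super \<Lambda> \<Lambda>'))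
    (\<lambda>(r, s). if (\<chi> (r div ?e'), \<chi>' (r mod ?e')) = (\<chi> (s div ?e'), \<chi>' (s mod ?e'))
       then of_real (\<alpha> (r div ?e') * \<alpha>' (r mod ?e') * (\<alpha> (s div ?e') * \<alpha>' (s mod ?e'))) *
         X $$ (\<tau> (r div ?e') * ?d' + \<tau>' (r mod ?e'), \<tau> (s div ?e') * ?d' + \<tau>' (s mod ?e')) else 0) $$ (r, s)"
      using rs by (simp add: io r1_def[symmetric] r2_def[symmetric] s1_def[symmetric] s2_def[symmetric] c_def c'_def)
  qed (simp_all add: tensor_super_def)
qed

section \<open>Correctable algebras\<close>

lemma mtrace_comm:
  assumes "A \<in> carrier_mat a b" "B \<in> carrier_mat b a"
  shows "mtrace (A * B) = mtrace (B * A)"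
  unfolding mtrace_mult[OF assms] mtrace_mult[OF assms(2,1)] by (subst sum.swap) (simp add: mult.commute)

text \<open>The trace of \<open>x * M\<close> is that of \<open>x * M * x\<close>, a sum of values
  of the form of \<open>M\<close> on the columns of \<open>x\<close>.\<close>

lemma mtrace_projection_nonneg:
  assumes x: "x \<in> carrier_mat m m" "x * x = x" "mat_adjoint x = x" and M: "psd m M"
  shows "0 \<le> mtrace (x * M)"
proof -
  have Mc: "M \<in> carrier_mat m m" using M by (simp add: psd_def)
  have "mtrace (x * M) = mtrace (x * (x * M))" using x Mc by (simp add: assoc_mult_mat[of x m m x m M m, symmetric])
  also have "\<dots> = mtrace ((x * M) * x)" by (rule mtrace_comm[of _ m m]) (use x Mc in auto)
  also have "\<dots> = (\<Sum>k<m. \<Sum>j<m. (x * M) $$ (k, j) * x $$ (j, k))"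
    by (rule mtrace_mult) (use x Mc in auto)
  also have "\<dots> = (\<Sum>k<m. qform m M (\<lambda>j. x $$ (j, k)) (\<lambda>j. x $$ (j, k)))"
  proof (rule sum.cong[OF refl])
    fix k assume "k \<in> {..<m}"
    then have k: "k < m" by simp
    have adj: "x $$ (k, i) = cnj (x $$ (i, k))" if "i < m" for i
      using index_adjoint[OF x(1) k that] x(3) by simp
    have "(\<Sum>j<m. (x * M) $$ (k, j) * x $$ (j, k)) = (\<Sum>j<m. \<Sum>i<m. x $$ (k, i) * M $$ (i, j) * x $$ (j, k))"
      by (intro sum.cong refl) (use k in \<open>simp add: index_mult_sum[OF x(1) Mc] sum_distrib_right\<close>)
    also have "\<dots> = (\<Sum>i<m. \<Sum>j<m. x $$ (k, i) * M $$ (i, j) * x $$ (j, k))" by (rule sum.swap)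
    also have "\<dots> = qform m M (\<lambda>j. x $$ (j, k)) (\<lambda>j. x $$ (j, k))"
      unfolding qform_def by (intro sum.cong refl) (simp add: adj mult_ac)
    finally show "(\<Sum>j<m. (x * M) $$ (k, j) * x $$ (j, k)) = qform m M (\<lambda>j. x $$ (j, k)) (\<lambda>j. x $$ (j, k))" .
  qed
  also have "0 \<le> \<dots>" using M by (intro sum_nonneg) (simp add: psd_qform)
  finally show ?thesis .
qed

lemma complex_nonneg_sum_eq_0:
  fixes f :: "'a \<Rightarrow> complex"
  assumes "finite X" "\<And>x. x \<in> X \<Longrightarrow> 0 \<le> f x" "sum f X = 0" "x \<in> X"
  shows "f x = 0"
  using sum_nonneg_eq_0_iff[of X f] assms by blast

text \<open>The Knill--Laflamme condition, tested on projections. The adjoint of the decoder turns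
  \<open>p\<close> into an effect on the output that answers yes with certainty on the range of
  \<open>p\<close> and no on the range of \<open>P - p\<close>. Images under one Kraus operator that
  are separated with certainty are orthogonal. Hence \<open>p * W * (P - p) = 0\<close>, written in
  entries, where \<open>W\<close> is the diagonal matrix of the squared amplitudes of the label
  \<open>\<xi>\<close>.\<close>

lemma correctable_commute:
  assumes comb: "comb_channel \<Lambda> \<tau> \<chi> \<alpha>" and cor: "correctable \<Lambda> A"
  obtains P where "unit_projection A P"
    "\<And>p \<xi> k l. p \<in> A \<Longrightarrow> p * p = p \<Longrightarrow> mat_adjoint p = p \<Longrightarrow> k < idim \<Lambda> \<Longrightarrow> l < idim \<Lambda> \<Longrightarrow>
      (\<Sum>r | r < odim \<Lambda> \<and> \<chi> r = \<xi>. of_real ((\<alpha> r)\<^sup>2) * (p $$ (k, \<tau> r) * (P - p) $$ (\<tau> r, l))) = 0"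
proof -
  let ?d = "idim \<Lambda>" and ?e = "odim \<Lambda>"
  obtain P m V R where P: "unit_projection A P" and V: "V \<in> carrier_mat ?d m" "mat_adjoint V * V = 1\<^sub>m m" "V * mat_adjoint V = P"
    and R: "channel R" "idim R = ?e" "odim R = m"
    and corr: "\<And>X. X \<in> A \<Longrightarrow> app (adj_super (comp_super R (restrict_super \<Lambda> V))) (mat_adjoint V * X * V) = mat_adjoint V * X * V"
    and A: "star_subalgebra ?d A"
    using cor unfolding correctable_def by blast
  have Ac: "X \<in> carrier_mat ?d ?d" if "X \<in> A" for X using A that by (auto simp: star_subalgebra_def)
  have V': "mat_adjoint V \<in> carrier_mat m ?d" by (rule carrier_adjoint[OF V(1)])
  have PA: "P \<in> A" and Pc: "P \<in> carrier_mat ?d ?d" using P Ac by (auto simp: unit_projection_def)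
  have linR: "linear_super R" and tpR: "trace_preserving R" using R by (auto simp: channel_def)
  have lin: "linear_super \<Lambda>" by (rule comb_channel_linear[OF comb])
  let ?Xi = "comp_super R (restrict_super \<Lambda> V)"
  have VWV: "V * W * mat_adjoint V \<in> carrier_mat ?d ?d" if "W \<in> carrier_mat m m" for W using V(1) V' that by (meson mult_carrier_mat)
  have io: "idim ?Xi = m" "odim ?Xi = m" "app ?Xi W = app R (app \<Lambda> (V * W * mat_adjoint V))" for W
    using V(1) R by (auto simp: comp_super_def restrict_super_def)
  have appL: "app \<Lambda> X \<in> carrier_mat ?e ?e" if "X \<in> carrier_mat ?d ?d" for X using lin that by (simp add: linear_super_def)
  have linXi: "linear_super ?Xi"
  proof -
    have 1: "V * (X + Y) * mat_adjoint V = V * X * mat_adjoint V + V * Y * mat_adjoint V"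
      if "X \<in> carrier_mat m m" "Y \<in> carrier_mat m m" for X Y
      using V(1) V' that by (simp add: mult_add_distrib_mat[of V ?d m] add_mult_distrib_mat[of "V * X" ?d m])
    have 2: "V * (c \<cdot>\<^sub>m X) * mat_adjoint V = c \<cdot>\<^sub>m (V * X * mat_adjoint V)" if "X \<in> carrier_mat m m" for c X
      using V(1) V' that by (simp add: mult_smult_distrib[of V ?d m] mult_smult_assoc_mat[of _ ?d m])
    have l: "X \<in> carrier_mat ?d ?d \<Longrightarrow> Y \<in> carrier_mat ?d ?d \<Longrightarrow> app \<Lambda> (X + Y) = app \<Lambda> X + app \<Lambda> Y"
      "X \<in> carrier_mat ?d ?d \<Longrightarrow> app \<Lambda> (c \<cdot>\<^sub>m X) = c \<cdot>\<^sub>m app \<Lambda> X" for X Y c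
      using lin by (auto simp: linear_super_def)
    have r: "X \<in> carrier_mat ?e ?e \<Longrightarrow> Y \<in> carrier_mat ?e ?e \<Longrightarrow> app R (X + Y) = app R X + app R Y"
      "X \<in> carrier_mat ?e ?e \<Longrightarrow> app R (c \<cdot>\<^sub>m X) = c \<cdot>\<^sub>m app R X"
      "X \<in> carrier_mat ?e ?e \<Longrightarrow> app R X \<in> carrier_mat m m" for X Y c
      using linR R(2,3) by (auto simp: linear_super_def)
    show ?thesis unfolding linear_super_def io using VWV appL r by (simp add: 1 2 l)
  qed
  \<comment> \<open>For \<open>a\<close> in the code space the decoded state gives every
    \<open>X\<close> of the algebra the expectation value that it has in the state of
    \<open>a\<close>.\<close>
  have pair: "mtrace ((mat_adjoint V * X * V) * app R (app \<Lambda> (outer ?d a a))) = qform ?d X a a"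
    if X: "X \<in> A" and a: "\<And>i. i < ?d \<Longrightarrow> (\<Sum>k<?d. P $$ (i, k) * a k) = a i" for X a
  proof -
    define v where "v i = (\<Sum>k<?d. cnj (V $$ (k, i)) * a k)" for i
    have Vv: "(\<Sum>i<m. V $$ (k, i) * v i) = a k" if k: "k < ?d" for k
    proof -
      have "(\<Sum>i<m. V $$ (k, i) * v i) = (\<Sum>l<?d. (\<Sum>i<m. V $$ (k, i) * mat_adjoint V $$ (i, l)) * a l)"
        by (simp add: v_def index_adjoint[OF V(1)] sum_distrib_left sum_distrib_right mult.assoc) (rule sum.swap)
      also have "\<dots> = (\<Sum>l<?d. P $$ (k, l) * a l)"
        by (intro sum.cong refl) (use k in \<open>simp add: index_mult_sum[OF V(1) V', symmetric] V(3)\<close>)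
      finally show ?thesis using a[OF k] by simp
    qed
    let ?W = "outer m v v"
    have outer: "V * ?W * mat_adjoint V = outer ?d a a"
    proof (rule eq_matI)
      fix k l assume "k < dim_row (outer ?d a a)" "l < dim_col (outer ?d a a)"
      then have kl: "k < ?d" "l < ?d" by (simp_all add: outer_def)
      have VW: "V * ?W \<in> carrier_mat ?d m" using V(1) by simp
      have "(V * ?W * mat_adjoint V) $$ (k, l) = (\<Sum>j<m. (\<Sum>i<m. V $$ (k, i) * ?W $$ (i, j)) * cnj (V $$ (l, j)))"
        using kl by (simp add: index_mult_sum[OF VW V'] index_mult_sum[OF V(1) outer_carrier] index_adjoint[OF V(1)])
      also have "\<dots> = (\<Sum>j<m. (\<Sum>i<m. V $$ (k, i) * v i) * cnj (V $$ (l, j) * v j))"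
        by (intro sum.cong refl) (simp add: outer_def sum_distrib_left sum_distrib_right mult_ac)
      also have "\<dots> = a k * cnj (\<Sum>j<m. V $$ (l, j) * v j)"
        using Vv[OF kl(1)] by (simp add: sum_distrib_left)
      finally show "(V * ?W * mat_adjoint V) $$ (k, l) = outer ?d a a $$ (k, l)"
        using Vv[OF kl(2)] kl by (simp add: outer_def)
    qed (use V(1) V' in \<open>auto simp: outer_def\<close>)
    have Xc: "X \<in> carrier_mat ?d ?d" by (rule Ac[OF X])
    have "mtrace ((mat_adjoint V * X * V) * app R (app \<Lambda> (outer ?d a a))) = mtrace ((mat_adjoint V * X * V) * ?W)"
      using adj_super_pairing[OF linXi, of "mat_adjoint V * X * V" ?W] V(1) V' Xc corr[OF X] by (simp add: io outer)
    also have "(mat_adjoint V * X * V) * ?W = mat_adjoint V * (X * (V * ?W))"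
      using V(1) V' Xc
      by (simp add: assoc_mult_mat[of _ m ?d X ?d V m] assoc_mult_mat[of _ m ?d "X * V" m ?W m] assoc_mult_mat[of X ?d ?d V m ?W m])
    also have "mtrace \<dots> = mtrace ((X * (V * ?W)) * mat_adjoint V)"
      by (rule mtrace_comm[of _ m ?d]) (use V(1) V' Xc in auto)
    also have "(X * (V * ?W)) * mat_adjoint V = X * outer ?d a a"
      unfolding outer[symmetric] using V(1) V' Xc by (simp add: assoc_mult_mat[of X ?d ?d "V * ?W" m "mat_adjoint V" ?d])
    finally show ?thesis by (simp add: qform_mtrace[OF Xc])
  qed
  have VPV: "mat_adjoint V * P * V = 1\<^sub>m m"
    unfolding V(3)[symmetric] using V(1,2) V'
    by (simp add: assoc_mult_mat[of "mat_adjoint V" m ?d V m "mat_adjoint V" ?d, symmetric] assoc_mult_mat[of _ m ?d])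
  \<comment> \<open>\<open>z a \<xi>\<close> is the image of \<open>a\<close> under the Kraus
    operator with label \<open>\<xi>\<close>.\<close>
  define z where "z a \<xi> r = (if \<chi> r = \<xi> then of_real (\<alpha> r) * a (\<tau> r) else 0)" for a :: "nat \<Rightarrow> complex" and \<xi> r
  define X where "X = \<chi> ` {..<?e}"
  have finX: "finite X" by (simp add: X_def)
  have outs: "mtrace (Y * app \<Lambda> (outer ?d a a)) = (\<Sum>\<xi>\<in>X. qform ?e Y (z a \<xi>) (z a \<xi>))"
    if Y: "Y \<in> carrier_mat ?e ?e" for Y a
  proof -
    have tau: "\<tau> r < ?d" if "r < ?e" for r using comb that by (simp add: comb_channel_def)
    have "app \<Lambda> (outer ?d a a) = mat ?e ?e (\<lambda>(r, s). if \<chi> r = \<chi> s then of_real (\<alpha> r * \<alpha> s) * outer ?d a a $$ (\<tau> r, \<tau> s) else 0)"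
      using comb unfolding comb_channel_def by simp
    then have L: "app \<Lambda> (outer ?d a a) $$ (s, r) = (\<Sum>\<xi>\<in>X. z a \<xi> s * cnj (z a \<xi> r))" if "r < ?e" "s < ?e" for r s
    proof -
      have "(\<Sum>\<xi>\<in>X. z a \<xi> s * cnj (z a \<xi> r)) = (\<Sum>\<xi>\<in>X. if \<xi> = \<chi> s then
          (if \<chi> r = \<chi> s then of_real (\<alpha> s) * a (\<tau> s) * cnj (of_real (\<alpha> r) * a (\<tau> r)) else 0) else 0)"
        by (rule sum.cong[OF refl]) (auto simp: z_def)
      also have "\<dots> = (if \<chi> r = \<chi> s then of_real (\<alpha> s) * a (\<tau> s) * cnj (of_real (\<alpha> r) * a (\<tau> r)) else 0)"
        unfolding sum.delta[OF finX] using that by (simp add: X_def)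
      finally show ?thesis
        using \<open>app \<Lambda> (outer ?d a a) = _\<close> that tau by (auto simp: outer_def)
    qed
    have "mtrace (Y * app \<Lambda> (outer ?d a a)) = (\<Sum>r<?e. \<Sum>s<?e. \<Sum>\<xi>\<in>X. Y $$ (r, s) * (z a \<xi> s * cnj (z a \<xi> r)))"
      unfolding mtrace_mult[OF Y appL[OF outer_carrier]]
      by (intro sum.cong refl) (simp add: L sum_distrib_left)
    also have "\<dots> = (\<Sum>r<?e. \<Sum>\<xi>\<in>X. \<Sum>s<?e. Y $$ (r, s) * (z a \<xi> s * cnj (z a \<xi> r)))"
      by (rule sum.cong[OF refl], rule sum.swap)
    also have "\<dots> = (\<Sum>\<xi>\<in>X. \<Sum>r<?e. \<Sum>s<?e. Y $$ (r, s) * (z a \<xi> s * cnj (z a \<xi> r)))" by (rule sum.swap)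
    finally show ?thesis by (simp add: qform_def mult.assoc)
  qed
  have main: "(\<Sum>r | r < ?e \<and> \<chi> r = \<xi>. of_real ((\<alpha> r)\<^sup>2) * (p $$ (k, \<tau> r) * (P - p) $$ (\<tau> r, l))) = 0"
    if p: "p \<in> A" "p * p = p" "mat_adjoint p = p" and kl: "k < ?d" "l < ?d" for p \<xi> k l
  proof (cases "\<xi> \<in> X")
    case False
    then have "{r. r < ?e \<and> \<chi> r = \<xi>} = {}" by (auto simp: X_def)
    then show ?thesis by (simp only: sum.empty)
  next
    case xi: True
    define x where "x = mat_adjoint V * p * V"
    have pc: "p \<in> carrier_mat ?d ?d" by (rule Ac[OF p(1)])
    have xc: "x \<in> carrier_mat m m" using V(1) V' pc by (simp add: x_def)
    have Pp: "P * p = p" "p * P = p" using P p(1) by (auto simp: unit_projection_def)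
    have xx: "x * x = x"
    proof -
      have pV: "p * V \<in> carrier_mat ?d m" using pc V(1) by simp
      have x': "x = mat_adjoint V * (p * V)" unfolding x_def by (rule assoc_mult_mat[OF V' pc V(1)])
      have "x * x = mat_adjoint V * ((p * V) * (mat_adjoint V * (p * V)))"
        unfolding x' by (rule assoc_mult_mat[OF V' pV]) (rule mult_carrier_mat[OF V' pV])
      also have "(p * V) * (mat_adjoint V * (p * V)) = p * (V * (mat_adjoint V * (p * V)))"
        by (rule assoc_mult_mat[OF pc V(1)]) (rule mult_carrier_mat[OF V' pV])
      also have "V * (mat_adjoint V * (p * V)) = P * (p * V)"
        unfolding V(3)[symmetric] by (rule assoc_mult_mat[OF V(1) V' pV, symmetric])
      also have "p * (P * (p * V)) = (p * P) * (p * V)" by (rule assoc_mult_mat[OF pc Pc pV, symmetric])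
      also have "\<dots> = (p * p) * V" unfolding Pp by (rule assoc_mult_mat[OF pc pc V(1), symmetric])
      finally show ?thesis unfolding p(2) x' .
    qed
    have xs: "mat_adjoint x = x"
    proof (rule eq_matI)
      fix i j assume "i < dim_row x" "j < dim_col x"
      then have ij: "i < m" "j < m" using xc by auto
      have Vp: "mat_adjoint V * p \<in> carrier_mat m ?d" using V' pc by simp
      have xij: "x $$ (i, j) = (\<Sum>b<?d. \<Sum>a<?d. cnj (V $$ (a, i)) * p $$ (a, b) * V $$ (b, j))" if "i < m" "j < m" for i j
        unfolding x_def using that
        by (simp add: index_mult_sum[OF Vp V(1)] index_mult_sum[OF V' pc] index_adjoint[OF V(1)] sum_distrib_right)
      have pab: "cnj (p $$ (a, b)) = p $$ (b, a)" if "a < ?d" "b < ?d" for a b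
        using index_adjoint[OF pc that(2,1)] p(3) by simp
      have "mat_adjoint x $$ (i, j) = (\<Sum>b<?d. \<Sum>a<?d. cnj (V $$ (b, i)) * p $$ (b, a) * V $$ (a, j))"
        using ij by (simp add: index_adjoint[OF xc] xij pab mult_ac)
      also have "\<dots> = x $$ (i, j)" unfolding xij[OF ij] by (rule sum.swap)
      finally show "mat_adjoint x $$ (i, j) = x $$ (i, j)" .
    qed (use xc carrier_adjoint[OF xc] in auto)
    \<comment> \<open>\<open>Y\<close> is the Heisenberg picture of \<open>x\<close> under the
      decoder. \<open>Q\<close> and \<open>Q'\<close> are the forms of \<open>Y\<close> and of its
      complement; both are positive, since \<open>x\<close> and \<open>1 - x\<close> are projections
      and the decoder is positive.\<close>
    obtain Y where Y: "Y \<in> carrier_mat ?e ?e" "\<And>Z. Z \<in> carrier_mat ?e ?e \<Longrightarrow> mtrace (x * app R Z) = mtrace (Y * Z)"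
      using linear_super_pairing[OF linR, of x] xc R(2,3) by auto
    define Q where "Q = qform ?e Y"
    define Q' where "Q' = qform ?e (1\<^sub>m ?e - Y)"
    have Rpsd: "psd m (app R (outer ?e u u))" for u using channel_positive[OF R(1)] psd_outer R(2,3) by metis
    have Q0: "0 \<le> Q u u" for u
    proof -
      have "Q u u = mtrace (x * app R (outer ?e u u))" by (simp add: Q_def Y(2) flip: qform_mtrace[OF Y(1)])
      then show ?thesis using mtrace_projection_nonneg[OF xc xx xs Rpsd] by simp
    qed
    have Y'c: "1\<^sub>m ?e - Y \<in> carrier_mat ?e ?e" using Y(1) by (simp add: minus_carrier_mat)
    have one: "mtrace (1\<^sub>m ?e * Z) = mtrace (1\<^sub>m m * app R Z)" if "Z \<in> carrier_mat ?e ?e" for Z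
    proof -
      have "app R Z \<in> carrier_mat m m" using linR that R(2,3) by (simp add: linear_super_def)
      then show ?thesis using tpR that R(2) by (simp add: trace_preserving_def)
    qed
    have trdiff: "mtrace ((A - B) * C) = mtrace (A * C) - mtrace (B * C)"
      if "A \<in> carrier_mat a a" "B \<in> carrier_mat a a" "C \<in> carrier_mat a a" for A B C and a :: nat
      using that minus_carrier_mat[OF that(2), of A]
      by (simp add: mtrace_mult[of _ a a] left_diff_distrib sum_subtractf)
    have Q'0: "0 \<le> Q' u u" for u
    proof -
      have Rc: "app R (outer ?e u u) \<in> carrier_mat m m" using Rpsd by (simp add: psd_def)
      have 1: "1\<^sub>m m - x \<in> carrier_mat m m" using xc by (simp add: minus_carrier_mat)
      have "Q' u u = mtrace ((1\<^sub>m m - x) * app R (outer ?e u u))"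
        unfolding Q'_def qform_mtrace[OF Y'c, symmetric]
        using trdiff[OF one_carrier_mat Y(1) outer_carrier] trdiff[OF one_carrier_mat xc Rc]
          one[OF outer_carrier] Y(2)[OF outer_carrier] by simp
      moreover have "(1\<^sub>m m - x) * (1\<^sub>m m - x) = 1\<^sub>m m - x"
      proof -
        have "(1\<^sub>m m - x) * (1\<^sub>m m - x) = 1\<^sub>m m * (1\<^sub>m m - x) - x * (1\<^sub>m m - x)"
          by (rule minus_mult_distrib_mat[OF one_carrier_mat xc 1])
        moreover have "x * (1\<^sub>m m - x) = x * 1\<^sub>m m - x * x"
          by (rule mult_minus_distrib_mat[OF xc one_carrier_mat xc])
        moreover have "x * 1\<^sub>m m - x * x = 0\<^sub>m m m" using xc xx by auto
        moreover have "1\<^sub>m m * (1\<^sub>m m - x) = 1\<^sub>m m - x" using 1 by (rule left_mult_one_mat)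
        moreover have "1\<^sub>m m - x - 0\<^sub>m m m = 1\<^sub>m m - x" using xc by (intro eq_matI) auto
        ultimately show ?thesis by simp
      qed
      moreover have "mat_adjoint (1\<^sub>m m - x) = 1\<^sub>m m - x"
      proof (rule eq_matI)
        fix i j assume "i < dim_row (1\<^sub>m m - x)" "j < dim_col (1\<^sub>m m - x)"
        then have ij: "i < m" "j < m" using xc by auto
        have "cnj (x $$ (j, i)) = x $$ (i, j)" using index_adjoint[OF xc ij] xs by simp
        then show "mat_adjoint (1\<^sub>m m - x) $$ (i, j) = (1\<^sub>m m - x) $$ (i, j)"
          using ij xc by (simp add: index_adjoint[OF 1])
      qed (use carrier_adjoint[OF 1] xc in auto)
      ultimately show ?thesis using mtrace_projection_nonneg[OF 1 _ _ Rpsd] by simp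
    qed
    have QQ: "Q u w + Q' u w = (\<Sum>r<?e. u r * cnj (w r))" for u w
    proof -
      have "Q u w + Q' u w = qform ?e (1\<^sub>m ?e) u w"
        unfolding Q_def Q'_def qform_def sum.distrib[symmetric] using Y(1)
        by (intro sum.cong refl) (auto simp: algebra_simps)
      also have "\<dots> = (\<Sum>r<?e. \<Sum>s<?e. if s = r then u s * cnj (w r) else 0)"
        unfolding qform_def by (intro sum.cong refl) auto
      finally show ?thesis by simp
    qed
    have rad: "Q u w = 0" if "Q w w = 0" for u w
      by (rule psd_radical(2)[of Q w "\<lambda>c z u i. c * z i + u i"]) (use Q0 that in \<open>auto simp: Q_def qform_lincomb\<close>)
    have rad': "Q' u w = 0" if "Q' u u = 0" for u w
      by (rule psd_radical(1)[of Q' u "\<lambda>c z u i. c * z i + u i"]) (use Q'0 that in \<open>auto simp: Q'_def qform_lincomb\<close>)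
    have sumQ: "(\<Sum>\<xi>\<in>X. Q (z a \<xi>) (z a \<xi>)) = qform ?d p a a"
      "(\<Sum>\<xi>\<in>X. Q' (z a \<xi>) (z a \<xi>)) = qform ?d P a a - qform ?d p a a"
      if a: "\<And>i. i < ?d \<Longrightarrow> (\<Sum>k<?d. P $$ (i, k) * a k) = a i" for a
    proof -
      have Lc: "app \<Lambda> (outer ?d a a) \<in> carrier_mat ?e ?e" by (rule appL) simp
      show 1: "(\<Sum>\<xi>\<in>X. Q (z a \<xi>) (z a \<xi>)) = qform ?d p a a"
        using outs[OF Y(1), of a] Y(2)[OF Lc] pair[OF p(1) a] by (simp add: Q_def x_def)
      have "(\<Sum>\<xi>\<in>X. qform ?e (1\<^sub>m ?e) (z a \<xi>) (z a \<xi>)) = qform ?d P a a"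
        using outs[of "1\<^sub>m ?e" a] one[OF Lc] pair[OF PA a] by (simp add: VPV)
      moreover have "qform ?e (1\<^sub>m ?e) u u = Q u u + Q' u u" for u
        unfolding Q_def Q'_def qform_def sum.distrib[symmetric] using Y(1)
        by (intro sum.cong refl) (auto simp: algebra_simps)
      ultimately show "(\<Sum>\<xi>\<in>X. Q' (z a \<xi>) (z a \<xi>)) = qform ?d P a a - qform ?d p a a"
        using 1 by (simp add: sum.distrib eq_diff_eq add.commute)
    qed
    \<comment> \<open>The columns of \<open>p\<close> and of \<open>P - p\<close> span the two
      ranges, so the identity is tested on them entry by entry.\<close>
    define a where "a t = p $$ (t, k)" for t
    define b where "b t = (P - p) $$ (t, l)" for t
    have mulcol: "(\<Sum>j<?d. M $$ (i, j) * N $$ (j, k)) = (M * N) $$ (i, k)"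
      if "M \<in> carrier_mat ?d ?d" "N \<in> carrier_mat ?d ?d" "i < ?d" "k < ?d" for M N i k
      using index_mult_sum[OF that] by simp
    have Pa: "(\<Sum>j<?d. P $$ (i, j) * a j) = a i" and pa: "(\<Sum>j<?d. p $$ (i, j) * a j) = a i" if "i < ?d" for i
      unfolding a_def using mulcol[OF Pc pc that kl(1)] mulcol[OF pc pc that kl(1)] Pp p(2) by simp_all
    have PP: "P * P = P" using P PA by (auto simp: unit_projection_def)
    have Pmc: "P - p \<in> carrier_mat ?d ?d" using pc by (simp add: minus_carrier_mat)
    have PPm: "P * (P - p) = P - p" "p * (P - p) = 0\<^sub>m ?d ?d"
      using mult_minus_distrib_mat[OF Pc Pc pc] mult_minus_distrib_mat[OF pc Pc pc] PP Pp p(2) pc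
      by auto
    have Pb: "(\<Sum>j<?d. P $$ (i, j) * b j) = b i" and pb: "(\<Sum>j<?d. p $$ (i, j) * b j) = 0" if "i < ?d" for i
      unfolding b_def mulcol[OF Pc Pmc that kl(2)] mulcol[OF pc Pmc that kl(2)] PPm using that kl by simp_all
    have qf: "qform ?d M u u = (\<Sum>i<?d. (\<Sum>j<?d. M $$ (i, j) * u j) * cnj (u i))" for M u
      by (simp add: qform_def sum_distrib_right)
    \<comment> \<open>The sum over all labels vanishes and its terms are nonnegative, so
      \<open>Q'\<close> vanishes on the image under each single Kraus operator.\<close>
    have "Q' (z a \<xi>) (z a \<xi>) = 0"
    proof (rule complex_nonneg_sum_eq_0[OF finX _ _ xi, of "\<lambda>\<xi>. Q' (z a \<xi>) (z a \<xi>)"])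
      show "(\<Sum>\<xi>\<in>X. Q' (z a \<xi>) (z a \<xi>)) = 0" using sumQ(2)[of a] Pa pa by (simp add: qf)
    qed (rule Q'0)
    then have 1: "Q' (z a \<xi>) (z b \<xi>) = 0" by (rule rad')
    have "Q (z b \<xi>) (z b \<xi>) = 0"
    proof (rule complex_nonneg_sum_eq_0[OF finX _ _ xi, of "\<lambda>\<xi>. Q (z b \<xi>) (z b \<xi>)"])
      show "(\<Sum>\<xi>\<in>X. Q (z b \<xi>) (z b \<xi>)) = 0" using sumQ(1)[of b] Pb pb by (simp add: qf)
    qed (rule Q0)
    then have "Q (z a \<xi>) (z b \<xi>) = 0" by (rule rad)
    then have 0: "(\<Sum>r<?e. z a \<xi> r * cnj (z b \<xi> r)) = 0" using 1 QQ[of "z a \<xi>" "z b \<xi>"] by simp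
    have tau: "\<tau> r < ?d" if "r < ?e" for r using comb that by (simp add: comb_channel_def)
    have ca: "cnj (a t) = p $$ (k, t)" if "t < ?d" for t
      using index_adjoint[OF pc kl(1) that] p(3) by (simp add: a_def)
    have "(\<Sum>r | r < ?e \<and> \<chi> r = \<xi>. complex_of_real ((\<alpha> r)\<^sup>2) * (p $$ (k, \<tau> r) * (P - p) $$ (\<tau> r, l))) =
      (\<Sum>r | r < ?e \<and> \<chi> r = \<xi>. cnj (z a \<xi> r * cnj (z b \<xi> r)))"
      by (rule sum.cong[OF refl]) (simp add: z_def ca tau b_def power2_eq_square mult_ac)
    also have "\<dots> = (\<Sum>r<?e. cnj (z a \<xi> r * cnj (z b \<xi> r)))"
      by (rule sum.mono_neutral_left) (auto simp: z_def)
    also have "\<dots> = cnj 0" unfolding 0[symmetric] by (simp only: cnj_sum)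
    finally show ?thesis by simp
  qed
  show thesis by (rule that[OF P main])
qed

section \<open>Passage from matrices of a given size to \<open>fmat\<close>\<close>

definition to_fmat :: "complex mat \<Rightarrow> fmat" where
  "to_fmat X = Abs_fmat (\<lambda>i j. if i < dim_row X \<and> j < dim_col X then X $$ (i, j) else 0)"

lemma ent_to_fmat [simp]:
  "ent (to_fmat X) i j = (if i < dim_row X \<and> j < dim_col X then X $$ (i, j) else 0)"
  unfolding to_fmat_def by (subst Abs_fmat_inverse) (auto intro!: exI[of _ "dim_row X + dim_col X"])

lemma supp_le_to_fmat: "X \<in> carrier_mat d d \<Longrightarrow> supp_le d (to_fmat X)"
  by (auto simp: supp_le_def)

lemma to_fmat_inject:
  assumes "X \<in> carrier_mat d d" "Y \<in> carrier_mat d d" "to_fmat X = to_fmat Y" shows "X = Y"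
proof (rule eq_matI)
  fix i j assume "i < dim_row Y" "j < dim_col Y"
  then show "X $$ (i, j) = Y $$ (i, j)" using arg_cong[OF assms(3), of "\<lambda>A. ent A i j"] assms(1,2) by simp
qed (use assms in auto)

lemma to_fmat_add: "X \<in> carrier_mat d d \<Longrightarrow> Y \<in> carrier_mat d d \<Longrightarrow> to_fmat (X + Y) = to_fmat X + to_fmat Y"
  by (rule fmat_eqI) auto

lemma to_fmat_smult: "to_fmat (c \<cdot>\<^sub>m X) = sc c (to_fmat X)"
  by (rule fmat_eqI) auto

lemma to_fmat_mult:
  assumes "X \<in> carrier_mat d d" "Y \<in> carrier_mat d d"
  shows "to_fmat (X * Y) = to_fmat X * to_fmat Y"
proof (rule fmat_eqI)
  fix i j
  have "ent (to_fmat X * to_fmat Y) i j = (\<Sum>k<d. ent (to_fmat X) i k * ent (to_fmat Y) k j)"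
    by (rule ent_mult) (simp add: supp_le_to_fmat[OF assms(1)])
  then show "ent (to_fmat (X * Y)) i j = ent (to_fmat X * to_fmat Y) i j"
    using assms by (cases "i < d \<and> j < d") (auto simp: index_mult_sum[OF assms] simp del: index_mult_mat(1))
qed

lemma to_fmat_adjoint:
  assumes "X \<in> carrier_mat d d" shows "to_fmat (mat_adjoint X) = star (to_fmat X)"
  using assms carrier_adjoint[OF assms] by (intro fmat_eqI) (auto simp: index_adjoint[OF assms])

lemma to_fmat_zero: "to_fmat (0\<^sub>m d d) = 0"
  by (rule fmat_eqI) auto

lemma subalg_to_fmat:
  assumes "star_subalgebra d A" shows "subalg d (to_fmat ` A)"
proof -
  have A: "X \<in> carrier_mat d d" if "X \<in> A" for X using assms that by (auto simp: star_subalgebra_def)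
  have "0\<^sub>m d d \<in> A" using assms by (simp add: star_subalgebra_def)
  then have "0 \<in> to_fmat ` A" using to_fmat_zero by (metis image_eqI)
  then show ?thesis
    using assms A unfolding subalg_def star_subalgebra_def
    by (auto simp: supp_le_to_fmat simp flip: to_fmat_add[of _ d] to_fmat_smult to_fmat_mult[of _ d] to_fmat_adjoint[of _ d])
qed

lemma supp_le_funit: "i < d \<Longrightarrow> j < d \<Longrightarrow> supp_le d (funit i j)"
  by (auto simp: supp_le_def)

lemma ent_mult_funit:
  assumes "supp_le d X" "supp_le d Z" "a < d"
  shows "ent (X * funit a a * Z) k l = ent X k a * ent Z a l"
proof -
  have "ent (X * funit a a) k j = (if j = a then ent X k a else 0)" for j
  proof -
    have "ent (X * funit a a) k j = (\<Sum>i<d. if i = a then (if j = a then ent X k a else 0) else 0)"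
      unfolding ent_mult[OF disjI1[OF assms(1)]] by (rule sum.cong[OF refl]) auto
    then show ?thesis using assms(3) by simp
  qed
  then have "ent (X * funit a a * Z) k l = (\<Sum>i<d. if i = a then ent X k a * ent Z a l else 0)"
    unfolding ent_mult[OF disjI2[OF assms(2)]] by (intro sum.cong refl) auto
  then show ?thesis using assms(3) by simp
qed

lemma star_funit [simp]: "star (funit i j) = funit j i"
  by (rule fmat_eqI) auto

text \<open>\<open>W\<close> is a diagonal effect \<open>E\<^sup>* E\<close>; compressed to the unit of the algebra it commutes with all
  projections of the algebra, hence with the off-diagonal matrix units, which are combinations of projections.\<close>

lemma matrix_units_commute:
  assumes S: "subalg d S" and f: "matrix_units S I b f" and P: "\<And>X. X \<in> S \<Longrightarrow> P * X = X \<and> X * P = X"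
    and PS: "P \<in> S" and W: "star W = W" and zero: "\<And>p. p \<in> S \<Longrightarrow> projection p \<Longrightarrow> p * W * (P - p) = 0"
    and ij: "i \<in> I" "j \<in> I" "b i = b j"
  shows "f i j * (P * W * P) = (P * W * P) * f i j"
proof -
  define Z where "Z = P * W * P"
  note F = matrix_unitsD[OF f]
  have "star P = P" using P[OF subalgD(6)[OF S PS]] P[OF PS] by (metis star_mult star_simps(6))
  have comm: "p * Z = Z * p" if p: "p \<in> S" "projection p" for p
  proof -
    \<comment> \<open>The vanishing of \<open>p * W * (P - p)\<close>, together with its adjoint,
      gives \<open>p * Z\<close> and \<open>Z * p\<close> the common value
      \<open>p * W * p\<close>.\<close>
    have 1: "p * W * P = p * W * p" using zero[OF p] by (simp add: right_diff_distrib)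
    then have "star (p * W * P) = star (p * W * p)" by simp
    then have 2: "P * W * p = p * W * p" using p(2) W \<open>star P = P\<close> by (simp add: projection_def mult.assoc)
    have "p * Z = p * W * P" using P[OF p(1)] by (simp add: Z_def flip: mult.assoc)
    moreover have "Z * p = P * W * p" using P[OF p(1)] by (simp add: Z_def mult.assoc)
    ultimately show ?thesis using 1 2 by simp
  qed
  have diag: "f k k * Z = Z * f k k" if "k \<in> I" for k
    using comm minprojD(1,2)[OF matrix_units_minproj[OF f that]] by blast
  show ?thesis unfolding Z_def[symmetric]
  proof (cases "i = j")
    case True then show "f i j * Z = Z * f i j" using diag ij by simp
  next
    case False
    have m: "f i i * f i i = f i i" "f i i * f j j = 0" "f i i * f i j = f i j" "f i i * f j i = 0"
      "f j j * f i i = 0" "f j j * f j j = f j j" "f j j * f i j = 0" "f j j * f j i = f j i"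
      "f i j * f i i = 0" "f i j * f j j = f i j" "f i j * f i j = 0" "f i j * f j i = f i i"
      "f j i * f i i = f j i" "f j i * f j j = 0" "f j i * f i j = f j j" "f j i * f j i = 0"
      using F(5) ij False by auto
    have st: "star (f i i) = f i i" "star (f j j) = f j j" "star (f i j) = f j i" "star (f j i) = f i j"
      using F(3) ij by auto
    have inS: "f i i \<in> S" "f j j \<in> S" "f i j \<in> S" "f j i \<in> S" using F(2) ij by auto
    \<comment> \<open>In the 2 by 2 matrix algebra of the units of \<open>i\<close> and
      \<open>j\<close> this is, for \<open>|c| = 1\<close>, the rank-one projection with
      off-diagonal coefficient \<open>c / 2\<close>. The values 1 and the imaginary unit for
      \<open>c\<close> recover \<open>f i j\<close> by polarisation.\<close>
    define q where "q c = sc (1 / 2) (f i i + f j j + sc c (f i j) + sc (cnj c) (f j i))" for c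
    have q: "q c \<in> S" "projection (q c)" if "c * cnj c = 1" for c
    proof -
      show "q c \<in> S" unfolding q_def using inS by (intro subalgD[OF S])
      have c': "cnj c * c = 1" using that by (simp add: mult.commute)
      have two: "X = sc (1 / 2) X + sc (1 / 2) X" for X by (rule fmat_eqI) simp
      have "q c * q c = sc (1 / 4) ((f i i + f j j + sc c (f i j) + sc (cnj c) (f j i)) + (f i i + f j j + sc c (f i j) + sc (cnj c) (f j i)))"
        unfolding q_def by (simp add: distrib_left distrib_right m that c' add_ac)
      also have "\<dots> = q c" unfolding q_def by (rule fmat_eqI) simp
      finally have "q c * q c = q c" .
      moreover have "star (q c) = q c" unfolding q_def by (simp add: st add_ac)
      ultimately show "projection (q c)" by (simp add: projection_def)
    qed
    define K where "K X \<longleftrightarrow> X * Z = Z * X" for X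
    have K: "K (X + Y)" "K (X - Y)" "K (sc c X)" if "K X" "K Y" for X Y c
      using that by (auto simp: K_def distrib_left distrib_right left_diff_distrib right_diff_distrib)
    have "K (q 1)" "K (q \<i>)" "K (f i i)" "K (f j j)" unfolding K_def using comm q diag ij by auto
    then have "K (sc 1 (q 1 - sc (1 / 2) (f i i + f j j)) - sc \<i> (q \<i> - sc (1 / 2) (f i i + f j j)))"
      by (intro K) auto
    also have "sc 1 (q 1 - sc (1 / 2) (f i i + f j j)) - sc \<i> (q \<i> - sc (1 / 2) (f i i + f j j)) = f i j"
      unfolding q_def by (rule fmat_eqI) (simp add: algebra_simps)
    finally show "f i j * Z = Z * f i j" by (simp add: K_def)
  qed
qed

text \<open>\<open>\<beta>\<close> labels the input basis by a classical value and a face, where \<open>None\<close> marks a free coordinate; the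
  output basis vector \<open>r\<close> comes from the input \<open>\<tau> r\<close> through the Kraus operator of the vertex \<open>\<chi> r\<close>.\<close>

definition cube_channel ::
  "nat \<Rightarrow> 'y set \<Rightarrow> supermap \<Rightarrow> (nat \<Rightarrow> 'y \<times> bool option list) \<Rightarrow> (nat \<Rightarrow> nat) \<Rightarrow> (nat \<Rightarrow> 'y \<times> bool list) \<Rightarrow> bool" where
  "cube_channel n Y \<Lambda> \<beta> \<tau> \<chi> \<longleftrightarrow>
     bij_betw \<beta> {..<idim \<Lambda>} (Y \<times> {t. length t = n}) \<and>
     bij_betw (\<lambda>r. (\<chi> r, snd (\<beta> (\<tau> r)))) {..<odim \<Lambda>}
       {(\<xi>, t). fst \<xi> \<in> Y \<and> snd \<xi> \<in> vertices n \<and> t \<in> faces_at (snd \<xi>)} \<and>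
     (\<forall>r<odim \<Lambda>. fst (\<beta> (\<tau> r)) = fst (\<chi> r)) \<and>
     comb_channel \<Lambda> \<tau> \<chi> (\<lambda>r. sqrt ((1 / 2) ^ fdim (snd (\<beta> (\<tau> r)))))"

text \<open>For a fixed label the outputs correspond bijectively to the faces through
  \<open>v\<close>, so sums over one Kraus operator become sums over these faces.\<close>

lemma cube_channel_sum:
  assumes C: "cube_channel n Y \<Lambda> \<beta> \<tau> \<chi>" and yv: "y \<in> Y" "v \<in> vertices n"
  shows "(\<Sum>r | r < odim \<Lambda> \<and> \<chi> r = (y, v). g (\<tau> r)) =
    (\<Sum>t\<in>faces_at v. g (inv_into {..<idim \<Lambda>} \<beta> (y, t)))"
proof -
  let ?R = "{r. r < odim \<Lambda> \<and> \<chi> r = (y, v)}"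
  let ?h = "\<lambda>r. (\<chi> r, snd (\<beta> (\<tau> r)))"
  have bij: "bij_betw ?h {..<odim \<Lambda>} {(\<xi>, t). fst \<xi> \<in> Y \<and> snd \<xi> \<in> vertices n \<and> t \<in> faces_at (snd \<xi>)}"
    using C by (simp add: cube_channel_def)
  have "bij_betw (\<lambda>r. snd (\<beta> (\<tau> r))) ?R (faces_at v)"
    unfolding bij_betw_def
  proof
    show "inj_on (\<lambda>r. snd (\<beta> (\<tau> r))) ?R"
      using bij_betw_imp_inj_on[OF bij] by (auto simp: inj_on_def)
    show "(\<lambda>r. snd (\<beta> (\<tau> r))) ` ?R = faces_at v"
    proof (intro equalityI subsetI)
      fix t assume "t \<in> (\<lambda>r. snd (\<beta> (\<tau> r))) ` ?R"
      then show "t \<in> faces_at v" using bij_betwE[OF bij] by force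
    next
      fix t assume "t \<in> faces_at v"
      then have "((y, v), t) \<in> ?h ` {..<odim \<Lambda>}" using bij_betw_imp_surj_on[OF bij] yv by auto
      then show "t \<in> (\<lambda>r. snd (\<beta> (\<tau> r))) ` ?R" by force
    qed
  qed
  note reindex = sum.reindex_bij_betw[OF this, of "\<lambda>t. g (inv_into {..<idim \<Lambda>} \<beta> (y, t))"]
  have "inv_into {..<idim \<Lambda>} \<beta> (y, snd (\<beta> (\<tau> r))) = \<tau> r" if "r \<in> ?R" for r
  proof -
    have "\<tau> r < idim \<Lambda>" using C that by (auto simp: cube_channel_def comb_channel_def)
    moreover have "(y, snd (\<beta> (\<tau> r))) = \<beta> (\<tau> r)" using C that by (auto simp: cube_channel_def prod_eq_iff)
    ultimately show ?thesis using C inv_into_f_f[of \<beta> "{..<idim \<Lambda>}" "\<tau> r"]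
      by (simp add: cube_channel_def bij_betw_def)
  qed
  then show ?thesis using reindex by simp
qed

text \<open>The code vector of an index \<open>i\<close> in the block \<open>D\<close> is a
  normalised column of \<open>f i (rep D)\<close>, with the same column number \<open>m D\<close>
  for the whole block. The compressed diagonal operators commute with the matrix units, so the
  images of the code vectors under the Kraus operator of a vertex are orthogonal and have the same
  length within each block. This is what \<open>code_bound\<close> asks for.\<close>

lemma correctable_bound:
  fixes b :: "'i \<Rightarrow> 'c"
  assumes C: "cube_channel n Y \<Lambda> \<beta> \<tau> \<chi>" and Y: "finite Y" and e: "weight_enumeration n e"
    and cor: "correctable \<Lambda> A" and f: "matrix_units (to_fmat ` A) I b f"
  shows "(\<forall>i\<in>I. card {k \<in> I. b k = b i} \<le> 2 ^ n) \<and>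
    (\<Sum>D\<in>b ` I. weight_sum e (card {i \<in> I. b i = D})) \<le> card Y * 3 ^ n"
proof -
  let ?d = "idim \<Lambda>" and ?e = "odim \<Lambda>" and ?S = "to_fmat ` A"
  let ?\<alpha> = "\<lambda>r. sqrt ((1 / 2) ^ fdim (snd (\<beta> (\<tau> r))))"
  have comb: "comb_channel \<Lambda> \<tau> \<chi> ?\<alpha>" using C by (simp add: cube_channel_def)
  have tau: "\<tau> r < ?d" if "r < ?e" for r using comb that by (simp add: comb_channel_def)
  have A: "star_subalgebra ?d A" using cor by (simp add: correctable_def)
  have Ac: "X \<in> carrier_mat ?d ?d" if "X \<in> A" for X using A that by (auto simp: star_subalgebra_def)
  note S = subalg_to_fmat[OF A]
  note F = matrix_unitsD[OF f]
  obtain P where P: "unit_projection A P"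
    and KL: "\<And>p \<xi> k l. p \<in> A \<Longrightarrow> p * p = p \<Longrightarrow> mat_adjoint p = p \<Longrightarrow> k < ?d \<Longrightarrow> l < ?d \<Longrightarrow>
      (\<Sum>r | r < ?e \<and> \<chi> r = \<xi>. of_real ((?\<alpha> r)\<^sup>2) * (p $$ (k, \<tau> r) * (P - p) $$ (\<tau> r, l))) = 0"
    using correctable_commute[OF comb cor] by blast
  have PA: "P \<in> A" and Pc: "P \<in> carrier_mat ?d ?d" using P Ac by (auto simp: unit_projection_def)
  let ?P = "to_fmat P"
  have unit: "?P * X = X \<and> X * ?P = X" if "X \<in> ?S" for X
    using P Ac PA that by (auto simp: unit_projection_def simp flip: to_fmat_mult[of _ ?d])
  define R where "R \<xi> = {r. r < ?e \<and> \<chi> r = \<xi>}" for \<xi>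
  \<comment> \<open>\<open>W \<xi>\<close> is the adjoint of the Kraus operator with label
    \<open>\<xi>\<close> times that operator; it is diagonal in the standard basis.\<close>
  define W where "W \<xi> = (\<Sum>r\<in>R \<xi>. sc (of_real ((?\<alpha> r)\<^sup>2)) (funit (\<tau> r) (\<tau> r)))" for \<xi>
  have entW: "ent (X * W \<xi> * Z) k l = (\<Sum>r\<in>R \<xi>. of_real ((?\<alpha> r)\<^sup>2) * (ent X k (\<tau> r) * ent Z (\<tau> r) l))"
    if XZ: "supp_le ?d X" "supp_le ?d Z" for X Z \<xi> k l
  proof -
    have "X * W \<xi> * Z = (\<Sum>r\<in>R \<xi>. sc (of_real ((?\<alpha> r)\<^sup>2)) (X * funit (\<tau> r) (\<tau> r) * Z))"
      unfolding W_def by (simp only: sum_distrib_left sum_distrib_right sc_mult)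
    then show ?thesis by (simp only: ent_sum ent_simps) (intro sum.cong refl, simp add: R_def ent_mult_funit[OF XZ] tau)
  qed
  have starW: "star (W \<xi>) = W \<xi>" for \<xi> by (simp add: W_def star_sum)
  have zero: "p * W \<xi> * (?P - p) = 0" if p: "p \<in> ?S" "projection p" for p \<xi>
  proof (rule fmat_eqI)
    fix k l
    obtain p0 where p0: "p0 \<in> A" "p = to_fmat p0" using p by blast
    have pc: "p0 \<in> carrier_mat ?d ?d" by (rule Ac[OF p0(1)])
    have pp: "p0 * p0 = p0" "mat_adjoint p0 = p0"
      using p(2) p0 pc carrier_adjoint[OF pc] unfolding projection_def
      by (auto intro!: to_fmat_inject[of _ ?d] simp: to_fmat_mult[of _ ?d] to_fmat_adjoint[of _ ?d])
    have sp: "supp_le ?d p" "supp_le ?d (?P - p)" using p0 pc Pc by (auto intro!: supp_le_simps supp_le_to_fmat)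
    show "ent (p * W \<xi> * (?P - p)) k l = ent 0 k l"
    proof (cases "k < ?d \<and> l < ?d")
      case True
      have "ent (p * W \<xi> * (?P - p)) k l = (\<Sum>r\<in>R \<xi>. of_real ((?\<alpha> r)\<^sup>2) * (p0 $$ (k, \<tau> r) * (P - p0) $$ (\<tau> r, l)))"
        unfolding entW[OF sp] by (intro sum.cong refl) (use True pc Pc p0 tau in \<open>auto simp: R_def\<close>)
      then show ?thesis using KL[OF p0(1) pp, of k l \<xi>] True by (simp add: R_def)
    next
      case False
      have "ent p k (\<tau> r) * ent (?P - p) (\<tau> r) l = 0" for r
        using False sp unfolding supp_le_def by (metis mult_zero_left mult_zero_right not_le)
      then show ?thesis unfolding entW[OF sp] by (simp only: mult_zero_right sum.neutral_const ent_simps(1))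
    qed
  qed
  define Z where "Z \<xi> = ?P * W \<xi> * ?P" for \<xi>
  have comm: "f i j * Z \<xi> = Z \<xi> * f i j" if "i \<in> I" "j \<in> I" "b i = b j" for i j \<xi>
    unfolding Z_def by (rule matrix_units_commute[OF S f unit _ starW zero that]) (use PA in auto)
  \<comment> \<open>Between elements of the algebra \<open>W\<close> may be replaced by its
    compression \<open>Z\<close>, which moves past the units and lets them multiply as
    usual.\<close>
  have fW: "f i j * W \<xi> * f k l = Z \<xi> * (f i j * f k l)"
    if "i \<in> I" "j \<in> I" "b i = b j" "k \<in> I" "l \<in> I" "b k = b l" for i j k l \<xi>
  proof -
    have "f i j * W \<xi> * f k l = (f i j * ?P) * W \<xi> * (?P * f k l)"
      using unit[OF F(2)[OF that(1-3)]] unit[OF F(2)[OF that(4-6)]] by simp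
    also have "\<dots> = f i j * Z \<xi> * f k l" by (simp add: Z_def mult.assoc)
    also have "\<dots> = Z \<xi> * (f i j * f k l)" using comm[OF that(1-3)] by (simp add: mult.assoc)
    finally show ?thesis .
  qed
  define rep where "rep D = (SOME i. i \<in> I \<and> b i = D)" for D
  have rep: "rep (b i) \<in> I" "b (rep (b i)) = b i" if "i \<in> I" for i
    using someI[of "\<lambda>k. k \<in> I \<and> b k = b i" i] that by (auto simp: rep_def)
  have "\<exists>m \<rho>. ent (f (rep D) (rep D)) m m = complex_of_real \<rho> \<and> \<rho> > 0" if "D \<in> b ` I" for D
  proof -
    have "rep D \<in> I" using that rep by auto
    then show ?thesis using projection_nonzero_column minprojD(2,3)[OF matrix_units_minproj[OF f]] by metis
  qed
  then obtain m \<rho> where m: "\<And>D. D \<in> b ` I \<Longrightarrow> ent (f (rep D) (rep D)) (m D) (m D) = complex_of_real (\<rho> D) \<and> \<rho> D > 0"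
    by metis
  \<comment> \<open>Column \<open>m D\<close> of \<open>f (rep D) (rep D)\<close> has squared norm
    \<open>\<rho> D\<close>, and \<open>f i (rep D)\<close> maps it isometrically, hence the
    normalisation.\<close>
  define U where "U i k = ent (f i (rep (b i))) k (m (b i)) / of_real (sqrt (\<rho> (b i)))" for i k
  define u where "u i y t = U i (inv_into {..<?d} \<beta> (y, t))" for i y t
  define lam where "lam D y v = Re (ent (Z (y, v) * f (rep D) (rep D)) (m D) (m D)) / \<rho> D" for D y v
  have fS: "supp_le ?d (f i j)" if "i \<in> I" "j \<in> I" "b i = b j" for i j using subalgD(1)[OF S F(2)[OF that]] .
  have faces: "(\<Sum>t\<in>faces_at v. of_real ((1 / 2) ^ fdim t) * (u i y t * cnj (u j y t))) =
      (\<Sum>r\<in>R (y, v). of_real ((?\<alpha> r)\<^sup>2) * (U i (\<tau> r) * cnj (U j (\<tau> r))))"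
    if "y \<in> Y" "v \<in> vertices n" for i j y v
  proof -
    have inv: "\<beta> (inv_into {..<?d} \<beta> (y, t)) = (y, t)" if "t \<in> faces_at v" for t
    proof -
      have "(y, t) \<in> \<beta> ` {..<?d}"
        using C \<open>y \<in> Y\<close> \<open>v \<in> vertices n\<close> faces_at_length[OF that]
        by (auto simp: cube_channel_def bij_betw_def vertices_def)
      then show ?thesis by (rule f_inv_into_f)
    qed
    have "(\<Sum>r\<in>R (y, v). of_real ((?\<alpha> r)\<^sup>2) * (U i (\<tau> r) * cnj (U j (\<tau> r)))) =
      (\<Sum>r | r < ?e \<and> \<chi> r = (y, v). (\<lambda>k. of_real ((1 / 2) ^ fdim (snd (\<beta> k))) * (U i k * cnj (U j k))) (\<tau> r))"
      unfolding R_def by (intro sum.cong refl) simp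
    also have "\<dots> = (\<Sum>t\<in>faces_at v. (\<lambda>k. of_real ((1 / 2) ^ fdim (snd (\<beta> k))) * (U i k * cnj (U j k))) (inv_into {..<?d} \<beta> (y, t)))"
      by (rule cube_channel_sum[OF C that])
    also have "\<dots> = (\<Sum>t\<in>faces_at v. of_real ((1 / 2) ^ fdim t) * (u i y t * cnj (u j y t)))"
      by (intro sum.cong refl) (simp add: inv u_def)
    finally show ?thesis by simp
  qed
  have orth: "(\<Sum>t\<in>faces_at v. of_real ((1 / 2) ^ fdim t) * (u i y t * cnj (u j y t))) =
      (if i = j then of_real (lam (b i) y v) else 0)"
    if ij: "i \<in> I" "j \<in> I" and yv: "y \<in> Y" "v \<in> vertices n" for i j y v
  proof -
    let ?ri = "rep (b i)" and ?rj = "rep (b j)"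
    let ?c = "complex_of_real (sqrt (\<rho> (b i)) * sqrt (\<rho> (b j)))"
    have "(\<Sum>r\<in>R (y, v). of_real ((?\<alpha> r)\<^sup>2) * (U i (\<tau> r) * cnj (U j (\<tau> r)))) =
      (\<Sum>r\<in>R (y, v). of_real ((?\<alpha> r)\<^sup>2) * (ent (f ?rj j) (m (b j)) (\<tau> r) * ent (f i ?ri) (\<tau> r) (m (b i)))) / ?c"
      unfolding sum_divide_distrib
    proof (intro sum.cong refl)
      fix r
      have "star (f j ?rj) = f ?rj j" using F(3) ij rep by simp
      then have "ent (f ?rj j) (m (b j)) (\<tau> r) = cnj (ent (f j ?rj) (\<tau> r) (m (b j)))" by (metis ent_simps(6))
      then show "of_real ((?\<alpha> r)\<^sup>2) * (U i (\<tau> r) * cnj (U j (\<tau> r))) =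
        of_real ((?\<alpha> r)\<^sup>2) * (ent (f ?rj j) (m (b j)) (\<tau> r) * ent (f i ?ri) (\<tau> r) (m (b i))) / ?c"
        by (simp add: U_def)
    qed
    also have "(\<Sum>r\<in>R (y, v). of_real ((?\<alpha> r)\<^sup>2) * (ent (f ?rj j) (m (b j)) (\<tau> r) * ent (f i ?ri) (\<tau> r) (m (b i)))) =
      ent (f ?rj j * W (y, v) * f i ?ri) (m (b j)) (m (b i))"
      by (rule entW[symmetric]) (use fS rep ij in auto)
    also have "f ?rj j * W (y, v) * f i ?ri = Z (y, v) * (f ?rj j * f i ?ri)"
      by (rule fW) (use rep ij in auto)
    also have "f ?rj j * f i ?ri = (if j = i then f ?rj ?ri else 0)"
      by (rule F(5)) (use rep ij in auto)
    finally have eq: "(\<Sum>t\<in>faces_at v. of_real ((1 / 2) ^ fdim t) * (u i y t * cnj (u j y t))) =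
      ent (Z (y, v) * (if j = i then f ?rj ?ri else 0)) (m (b j)) (m (b i)) / ?c" unfolding faces[OF yv] .
    show ?thesis
    proof (cases "i = j")
      case True
      have rho: "\<rho> (b i) > 0" using m ij by blast
      have re: "(\<Sum>t\<in>faces_at v. of_real ((1 / 2) ^ fdim t) * (u i y t * cnj (u i y t))) =
        complex_of_real (\<Sum>t\<in>faces_at v. (1 / 2) ^ fdim t * (cmod (u i y t))\<^sup>2)"
        by (simp add: complex_norm_square del: of_real_power)
      have "?c = of_real (\<rho> (b i))" using True rho by simp
      then have e1: "ent (Z (y, v) * f ?ri ?ri) (m (b i)) (m (b i)) / of_real (\<rho> (b i)) =
        complex_of_real (\<Sum>t\<in>faces_at v. (1 / 2) ^ fdim t * (cmod (u i y t))\<^sup>2)" using eq True re by simp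
      then have "lam (b i) y v = (\<Sum>t\<in>faces_at v. (1 / 2) ^ fdim t * (cmod (u i y t))\<^sup>2)"
        unfolding lam_def by (metis Re_complex_of_real Re_divide_of_real)
      then show ?thesis using True re by simp
    next
      case False
      then show ?thesis using eq by simp
    qed
  qed
  have nz: "\<exists>y\<in>Y. \<exists>v\<in>vertices n. lam (b i) y v \<noteq> 0" if i: "i \<in> I" for i
  proof -
    let ?ri = "rep (b i)"
    have rho: "\<rho> (b i) > 0" "ent (f ?ri ?ri) (m (b i)) (m (b i)) = of_real (\<rho> (b i))" using m i by blast+
    have si: "supp_le ?d (f i ?ri)" using fS rep i by simp
    have "star (f i ?ri) * f i ?ri = f ?ri ?ri" using F(3,5) rep i by simp
    then have "(\<Sum>k<?d. ent (star (f i ?ri)) (m (b i)) k * ent (f i ?ri) k (m (b i))) \<noteq> 0"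
      using ent_mult[OF disjI2[OF si], of "star (f i ?ri)" "m (b i)" "m (b i)"] rho
      by (metis less_irrefl of_real_eq_0_iff)
    then obtain k where "k \<in> {..<?d}" "ent (star (f i ?ri)) (m (b i)) k * ent (f i ?ri) k (m (b i)) \<noteq> 0"
      by (rule sum.not_neutral_contains_not_neutral)
    then have k: "k < ?d" "ent (f i ?ri) k (m (b i)) \<noteq> 0" by auto
    obtain y t where yt: "\<beta> k = (y, t)" by (cases "\<beta> k")
    have "\<beta> k \<in> Y \<times> {t. length t = n}" using C k(1) by (auto simp: cube_channel_def dest: bij_betwE)
    then have y: "y \<in> Y" and t: "length t = n" using yt by auto
    \<comment> \<open>Any vertex of the face \<open>t\<close> serves; here the free coordinates are
      set to \<open>False\<close>.\<close>
    define v where "v = map (\<lambda>x. x = Some True) t"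
    have "x = None \<or> x = Some (x = Some True)" for x :: "bool option" by (cases x) auto
    then have v: "v \<in> vertices n" "t \<in> faces_at v" using t
      by (simp_all add: v_def vertices_def faces_at_iff_nth)
    have "inv_into {..<?d} \<beta> (y, t) = k"
      unfolding yt[symmetric] using C k(1) by (auto simp: cube_channel_def bij_betw_def intro: inv_into_f_f)
    then have u: "u i y t \<noteq> 0" using k(2) rho by (simp add: u_def U_def)
    have "complex_of_real (\<Sum>t\<in>faces_at v. (1 / 2) ^ fdim t * (cmod (u i y t))\<^sup>2) = of_real (lam (b i) y v)"
      using orth[OF i i y v(1)] by (simp add: complex_norm_square del: of_real_power)
    then have l: "lam (b i) y v = (\<Sum>t\<in>faces_at v. (1 / 2) ^ fdim t * (cmod (u i y t))\<^sup>2)" by (simp only: of_real_eq_iff)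
    have "0 < lam (b i) y v"
      unfolding l by (rule sum_pos2[OF finite_faces_at v(2)]) (use u in auto)
    then show ?thesis using y v by force
  qed
  show ?thesis by (rule code_bound[where u = u and lam = lam and b = b, OF e Y F(1) orth nz])
qed

section \<open>Decoders and block algebras\<close>

lemma sum_lessThan_mult:
  fixes g :: "nat \<Rightarrow> 'a :: comm_monoid_add"
  shows "(\<Sum>x<k * m. g x) = (\<Sum>a<k. \<Sum>r<m. g (a * m + r))"
proof (induction k)
  case (Suc k)
  have "{..<Suc k * m} = {..<k * m} \<union> (\<lambda>r. k * m + r) ` {..<m}"
  proof (intro equalityI subsetI)
    fix x assume "x \<in> {..<Suc k * m}"
    then show "x \<in> {..<k * m} \<union> (\<lambda>r. k * m + r) ` {..<m}"
      by (cases "x < k * m") (auto intro!: image_eqI[of x _ "x - k * m"])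
  qed auto
  then have "(\<Sum>x<Suc k * m. g x) = (\<Sum>x<k * m. g x) + (\<Sum>x\<in>(\<lambda>r. k * m + r) ` {..<m}. g x)"
    by (simp only:) (rule sum.union_disjoint, auto)
  then show ?case using Suc by (simp add: sum.reindex)
qed simp

text \<open>The decoder measures \<open>\<kappa>\<close> and renames the basis vector
  \<open>r\<close> as \<open>\<theta> r\<close>. Its Kraus operator for the outcome \<open>k\<close>
  is the sum of \<open>|\<theta> r><r|\<close> over the \<open>r\<close> with
  \<open>\<kappa> r = k\<close>.\<close>

definition decoder :: "nat \<Rightarrow> nat \<Rightarrow> (nat \<Rightarrow> 'k) \<Rightarrow> (nat \<Rightarrow> nat) \<Rightarrow> supermap" where
  "decoder e m \<kappa> \<theta> = \<lparr>idim = e, odim = m, app = (\<lambda>Z. mat m m (\<lambda>(i, j).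
     \<Sum>r<e. \<Sum>s<e. if \<kappa> r = \<kappa> s \<and> \<theta> r = i \<and> \<theta> s = j then Z $$ (r, s) else 0))\<rparr>"

text \<open>Injectivity of the pair of labels makes each Kraus operator isometric on the span of the
  basis vectors of its outcome, whence trace preservation. Complete positivity is the Kraus form
  written out: the form of the output is a sum of forms of \<open>X\<close> at pulled back
  vectors.\<close>

lemma decoder_channel:
  assumes th: "\<And>r. r < e \<Longrightarrow> \<theta> r < m" and inj: "inj_on (\<lambda>r. (\<kappa> r, \<theta> r)) {..<e}"
  shows "channel (decoder e m \<kappa> \<theta>)"
proof -
  let ?R = "decoder e m \<kappa> \<theta>"
  let ?c = "\<lambda>r s i j. \<kappa> r = \<kappa> s \<and> \<theta> r = i \<and> \<theta> s = j"
  have io [simp]: "idim ?R = e" "odim ?R = m" by (simp_all add: decoder_def)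
  have R: "app ?R Z $$ (i, j) = (\<Sum>r<e. \<Sum>s<e. if ?c r s i j then Z $$ (r, s) else 0)" if "i < m" "j < m" for Z i j
    using that by (simp add: decoder_def)
  have Rc: "app ?R Z \<in> carrier_mat m m" for Z by (simp add: decoder_def)
  have lin: "linear_super ?R"
    unfolding linear_super_def io
  proof (intro conjI ballI allI Rc)
    fix X Y :: "complex mat" assume XY: "X \<in> carrier_mat e e" "Y \<in> carrier_mat e e"
    show "app ?R (X + Y) = app ?R X + app ?R Y"
    proof (rule eq_matI)
      fix i j assume "i < dim_row (app ?R X + app ?R Y)" "j < dim_col (app ?R X + app ?R Y)"
      then have ij: "i < m" "j < m" using Rc[of Y] by auto
      have "app ?R (X + Y) $$ (i, j) = (\<Sum>r<e. \<Sum>s<e. (if ?c r s i j then X $$ (r, s) else 0) + (if ?c r s i j then Y $$ (r, s) else 0))"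
        unfolding R[OF ij] by (intro sum.cong refl) (use XY in auto)
      then show "app ?R (X + Y) $$ (i, j) = (app ?R X + app ?R Y) $$ (i, j)"
        using ij Rc[of X] Rc[of Y] by (simp add: R sum.distrib)
    qed (use Rc[of Y] Rc[of "X + Y"] in auto)
  next
    fix c and X :: "complex mat" assume X: "X \<in> carrier_mat e e"
    show "app ?R (c \<cdot>\<^sub>m X) = c \<cdot>\<^sub>m app ?R X"
    proof (rule eq_matI)
      fix i j assume "i < dim_row (c \<cdot>\<^sub>m app ?R X)" "j < dim_col (c \<cdot>\<^sub>m app ?R X)"
      then have ij: "i < m" "j < m" using Rc[of X] by auto
      have "app ?R (c \<cdot>\<^sub>m X) $$ (i, j) = (\<Sum>r<e. \<Sum>s<e. c * (if ?c r s i j then X $$ (r, s) else 0))"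
        unfolding R[OF ij] by (intro sum.cong refl) (use X in auto)
      then show "app ?R (c \<cdot>\<^sub>m X) $$ (i, j) = (c \<cdot>\<^sub>m app ?R X) $$ (i, j)"
        using ij Rc[of X] by (simp add: R sum_distrib_left)
    qed (use Rc[of X] Rc[of "c \<cdot>\<^sub>m X"] in auto)
  qed
  have tp: "trace_preserving ?R"
    unfolding trace_preserving_def io
  proof
    fix Z :: "complex mat" assume Z: "Z \<in> carrier_mat e e"
    have "mtrace (app ?R Z) = (\<Sum>i<m. \<Sum>r<e. \<Sum>s<e. if ?c r s i i then Z $$ (r, s) else 0)"
      by (simp add: mtrace_sum[OF Rc] R)
    also have "\<dots> = (\<Sum>r<e. \<Sum>i<m. \<Sum>s<e. if ?c r s i i then Z $$ (r, s) else 0)" by (rule sum.swap)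
    also have "\<dots> = (\<Sum>r<e. \<Sum>s<e. \<Sum>i<m. if ?c r s i i then Z $$ (r, s) else 0)"
      by (rule sum.cong[OF refl], rule sum.swap)
    also have "\<dots> = (\<Sum>r<e. \<Sum>s<e. if s = r then Z $$ (r, s) else 0)"
    proof (intro sum.cong refl)
      fix r s assume rs: "r \<in> {..<e}" "s \<in> {..<e}"
      have "(\<Sum>i<m. if ?c r s i i then Z $$ (r, s) else 0) = (\<Sum>i<m. if i = \<theta> r then (if \<kappa> r = \<kappa> s \<and> \<theta> s = \<theta> r then Z $$ (r, s) else 0) else 0)"
        by (rule sum.cong[OF refl]) auto
      also have "\<dots> = (if \<kappa> r = \<kappa> s \<and> \<theta> s = \<theta> r then Z $$ (r, s) else 0)" using th rs by simp
      finally show "(\<Sum>i<m. if ?c r s i i then Z $$ (r, s) else 0) = (if s = r then Z $$ (r, s) else 0)"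
        using inj_onD[OF inj, of r s] rs by auto
    qed
    also have "\<dots> = mtrace Z" by (simp add: mtrace_sum[OF Z])
    finally show "mtrace (app ?R Z) = mtrace Z" .
  qed
  have cp: "completely_positive ?R"
    unfolding completely_positive_def io
  proof (intro allI impI)
    fix k X assume X: "psd (k * e) X"
    let ?T = "app (tensor_super (id_super k) ?R) X"
    have Tc: "?T \<in> carrier_mat (k * m) (k * m)" by (simp add: tensor_super_def id_super_def decoder_def)
    have T: "?T $$ (a * m + i, b * m + j) = (\<Sum>r<e. \<Sum>s<e. if ?c r s i j then X $$ (a * e + r, b * e + s) else 0)"
      if ab: "a < k" "b < k" and ij: "i < m" "j < m" for a b i j
    proof -
      have K: "kron (ketbra (unit_vec k a') (unit_vec k b')) (app ?R (ketbra (unit_vec e r) (unit_vec e s))) $$ (a * m + i, b * m + j) =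
        (if a' = a \<and> b' = b then if ?c r s i j then 1 else 0 else 0)"
        if "a' < k" "b' < k" "r < e" "s < e" for a' b' r s
      proof -
        have "app ?R (ketbra (unit_vec e r) (unit_vec e s)) $$ (i, j) =
            (\<Sum>r'<e. \<Sum>s'<e. if r' = r \<and> s' = s then if ?c r' s' i j then 1 else 0 else 0)"
          unfolding R[OF ij] by (intro sum.cong refl) (use that in \<open>auto simp: ketbra_def\<close>)
        also have "\<dots> = (if ?c r s i j then 1 else 0)" by (rule sum_delta2) (use that in auto)
        finally have 1: "app ?R (ketbra (unit_vec e r) (unit_vec e s)) $$ (i, j) = (if ?c r s i j then 1 else 0)" .
        have lt: "a * m + i < k * m" "b * m + j < k * m" using ab ij by (auto intro: mult_add_less_mult)
        have Rd: "dim_row (app ?R Z) = m" "dim_col (app ?R Z) = m" for Z using Rc[of Z] by auto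
        have dm: "(a * m + i) div m = a" "(a * m + i) mod m = i" "(b * m + j) div m = b" "(b * m + j) mod m = j"
          using ij by auto
        have Ed: "dim_row (ketbra (unit_vec k a') (unit_vec k b')) = k" "dim_col (ketbra (unit_vec k a') (unit_vec k b')) = k"
          by (simp_all add: ketbra_def)
        have E: "ketbra (unit_vec k a') (unit_vec k b') $$ (a, b) = (if a' = a \<and> b' = b then 1 else 0)"
          using ab that by (simp add: ketbra_def)
        have "kron (ketbra (unit_vec k a') (unit_vec k b')) (app ?R (ketbra (unit_vec e r) (unit_vec e s))) $$ (a * m + i, b * m + j) =
          ketbra (unit_vec k a') (unit_vec k b') $$ (a, b) * app ?R (ketbra (unit_vec e r) (unit_vec e s)) $$ (i, j)"
          by (subst kron_index) (use lt in \<open>simp_all only: Rd Ed dm\<close>)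
        then show ?thesis unfolding E 1 by simp
      qed
      have lt: "a * m + i < k * m" "b * m + j < k * m" using ab ij by (auto intro: mult_add_less_mult)
      have "?T $$ (a * m + i, b * m + j) = (\<Sum>a'<k. \<Sum>b'<k. \<Sum>r<e. \<Sum>s<e. X $$ (a' * e + r, b' * e + s) *
          kron (ketbra (unit_vec k a') (unit_vec k b')) (app ?R (ketbra (unit_vec e r) (unit_vec e s))) $$ (a * m + i, b * m + j))"
        using lt by (simp add: tensor_super_def id_super_def)
      also have "\<dots> = (\<Sum>a'<k. \<Sum>b'<k. if a' = a \<and> b' = b then (\<Sum>r<e. \<Sum>s<e. if ?c r s i j then X $$ (a' * e + r, b' * e + s) else 0) else 0)"
      proof (intro sum.cong refl)
        fix a' b' assume ab': "a' \<in> {..<k}" "b' \<in> {..<k}"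
        have "(\<Sum>r<e. \<Sum>s<e. X $$ (a' * e + r, b' * e + s) *
          kron (ketbra (unit_vec k a') (unit_vec k b')) (app ?R (ketbra (unit_vec e r) (unit_vec e s))) $$ (a * m + i, b * m + j)) =
          (\<Sum>r<e. \<Sum>s<e. if a' = a \<and> b' = b then if ?c r s i j then X $$ (a' * e + r, b' * e + s) else 0 else 0)"
          by (intro sum.cong refl) (use ab' in \<open>auto simp: K\<close>)
        then show "(\<Sum>r<e. \<Sum>s<e. X $$ (a' * e + r, b' * e + s) *
          kron (ketbra (unit_vec k a') (unit_vec k b')) (app ?R (ketbra (unit_vec e r) (unit_vec e s))) $$ (a * m + i, b * m + j)) =
          (if a' = a \<and> b' = b then (\<Sum>r<e. \<Sum>s<e. if ?c r s i j then X $$ (a' * e + r, b' * e + s) else 0) else 0)"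
          by (cases "a' = a \<and> b' = b") (simp_all only: if_True if_False simp_thms sum.neutral_const)
      qed
      also have "\<dots> = (\<Sum>r<e. \<Sum>s<e. if ?c r s i j then X $$ (a * e + r, b * e + s) else 0)"
        by (rule sum_delta2[OF ab])
      finally show ?thesis .
    qed
    \<comment> \<open>\<open>w u c\<close> is the adjoint of the Kraus operator of outcome
      \<open>c\<close>, tensored with the identity of the ancilla, applied to
      \<open>u\<close>.\<close>
    define w where "w u c x = (if \<kappa> (x mod e) = c then u ((x div e) * m + \<theta> (x mod e)) else 0)"
      for u :: "nat \<Rightarrow> complex" and c x
    let ?C = "\<kappa> ` {..<e}"
    have form: "qform (k * m) ?T u u = (\<Sum>c\<in>?C. qform (k * e) X (w u c) (w u c))" for u
    proof -
      let ?g = "\<lambda>a r b s. if \<kappa> r = \<kappa> s then X $$ (a * e + r, b * e + s) * u (b * m + \<theta> s) * cnj (u (a * m + \<theta> r)) else 0"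
      have "(\<Sum>c\<in>?C. qform (k * e) X (w u c) (w u c)) =
        (\<Sum>c\<in>?C. \<Sum>a<k. \<Sum>r<e. \<Sum>b<k. \<Sum>s<e. X $$ (a * e + r, b * e + s) * w u c (b * e + s) * cnj (w u c (a * e + r)))"
        unfolding qform_def sum_lessThan_mult ..
      also have "\<dots> = (\<Sum>a<k. \<Sum>r<e. \<Sum>b<k. \<Sum>s<e. \<Sum>c\<in>?C. X $$ (a * e + r, b * e + s) * w u c (b * e + s) * cnj (w u c (a * e + r)))"
        by (subst sum.swap, rule sum.cong[OF refl], subst sum.swap, rule sum.cong[OF refl],
            subst sum.swap, rule sum.cong[OF refl], rule sum.swap)
      also have "\<dots> = (\<Sum>a<k. \<Sum>r<e. \<Sum>b<k. \<Sum>s<e. ?g a r b s)"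
      proof (intro sum.cong refl)
        fix a r b s assume rs: "r \<in> {..<e}" "s \<in> {..<e}"
        then have dm: "(a * e + r) div e = a" "(a * e + r) mod e = r" "(b * e + s) div e = b" "(b * e + s) mod e = s" by auto
        have "(\<Sum>c\<in>?C. X $$ (a * e + r, b * e + s) * w u c (b * e + s) * cnj (w u c (a * e + r))) =
          (\<Sum>c\<in>?C. if c = \<kappa> r then ?g a r b s else 0)"
          unfolding w_def dm by (rule sum.cong[OF refl]) auto
        also have "\<dots> = ?g a r b s" using rs by (subst sum.delta) auto
        finally show "(\<Sum>c\<in>?C. X $$ (a * e + r, b * e + s) * w u c (b * e + s) * cnj (w u c (a * e + r))) = ?g a r b s" .
      qed
      finally have rhs: "(\<Sum>c\<in>?C. qform (k * e) X (w u c) (w u c)) = (\<Sum>a<k. \<Sum>r<e. \<Sum>b<k. \<Sum>s<e. ?g a r b s)" .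
      let ?f = "\<lambda>a i b j r s. if ?c r s i j then X $$ (a * e + r, b * e + s) * u (b * m + j) * cnj (u (a * m + i)) else 0"
      have "qform (k * m) ?T u u = (\<Sum>a<k. \<Sum>i<m. \<Sum>b<k. \<Sum>j<m. ?T $$ (a * m + i, b * m + j) * u (b * m + j) * cnj (u (a * m + i)))"
        unfolding qform_def sum_lessThan_mult ..
      also have "\<dots> = (\<Sum>a<k. \<Sum>i<m. \<Sum>b<k. \<Sum>j<m. \<Sum>r<e. \<Sum>s<e. ?f a i b j r s)"
      proof (intro sum.cong refl)
        fix a i b j assume "a \<in> {..<k}" "i \<in> {..<m}" "b \<in> {..<k}" "j \<in> {..<m}"
        then show "?T $$ (a * m + i, b * m + j) * u (b * m + j) * cnj (u (a * m + i)) = (\<Sum>r<e. \<Sum>s<e. ?f a i b j r s)"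
          by (simp add: T sum_distrib_right) (intro sum.cong refl, simp)
      qed
      also have "\<dots> = (\<Sum>a<k. \<Sum>b<k. \<Sum>i<m. \<Sum>j<m. \<Sum>r<e. \<Sum>s<e. ?f a i b j r s)"
        by (rule sum.cong[OF refl], rule sum.swap)
      also have "\<dots> = (\<Sum>a<k. \<Sum>b<k. \<Sum>i<m. \<Sum>r<e. \<Sum>s<e. \<Sum>j<m. ?f a i b j r s)"
        by (rule sum.cong[OF refl], rule sum.cong[OF refl], rule sum.cong[OF refl], subst sum.swap, rule sum.cong[OF refl], rule sum.swap)
      also have "\<dots> = (\<Sum>a<k. \<Sum>b<k. \<Sum>r<e. \<Sum>s<e. \<Sum>i<m. \<Sum>j<m. ?f a i b j r s)"
        by (rule sum.cong[OF refl], rule sum.cong[OF refl], subst sum.swap, rule sum.cong[OF refl], rule sum.swap)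
      also have "\<dots> = (\<Sum>a<k. \<Sum>b<k. \<Sum>r<e. \<Sum>s<e. ?g a r b s)"
      proof (intro sum.cong refl)
        fix a b r s assume rs: "r \<in> {..<e}" "s \<in> {..<e}"
        have "(\<Sum>i<m. \<Sum>j<m. ?f a i b j r s) = (\<Sum>i<m. \<Sum>j<m. if i = \<theta> r \<and> j = \<theta> s then ?g a r b s else 0)"
          by (intro sum.cong refl) auto
        also have "\<dots> = ?g a r b s" by (rule sum_delta2) (use rs th in auto)
        finally show "(\<Sum>i<m. \<Sum>j<m. ?f a i b j r s) = ?g a r b s" .
      qed
      also have "\<dots> = (\<Sum>a<k. \<Sum>r<e. \<Sum>b<k. \<Sum>s<e. ?g a r b s)"
        by (rule sum.cong[OF refl], rule sum.swap)
      finally show ?thesis unfolding rhs .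
    qed
    have "0 \<le> qform (k * m) ?T u u" for u
      unfolding form using X by (intro sum_nonneg) (simp add: psd_qform)
    then show "psd (k * m) ?T" using Tc by (simp add: psd_qform)
  qed
  show ?thesis unfolding channel_def using lin cp tp by blast
qed

text \<open>A direct sum of full matrix algebras, one for each value that \<open>c\<close> takes
  below \<open>N\<close>; the basis vectors of a block need not be contiguous.\<close>

definition block_alg :: "nat \<Rightarrow> (nat \<Rightarrow> 'c) \<Rightarrow> complex mat set" where
  "block_alg N c = {X \<in> carrier_mat N N. \<forall>i<N. \<forall>j<N. c i \<noteq> c j \<longrightarrow> X $$ (i, j) = 0}"

lemma star_subalgebra_block_alg: "star_subalgebra N (block_alg N c)"
proof -
  have mult: "X * Y \<in> block_alg N c" if XY: "X \<in> block_alg N c" "Y \<in> block_alg N c" for X Y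
  proof -
    have c: "X \<in> carrier_mat N N" "Y \<in> carrier_mat N N" using XY by (auto simp: block_alg_def)
    have "(X * Y) $$ (i, j) = 0" if ij: "i < N" "j < N" "c i \<noteq> c j" for i j
      unfolding index_mult_sum[OF c ij(1,2)]
    proof (rule sum.neutral, rule ballI)
      fix k assume k: "k \<in> {..<N}"
      have "c i \<noteq> c k \<or> c k \<noteq> c j" using ij by auto
      then show "X $$ (i, k) * Y $$ (k, j) = 0" using XY ij k by (auto simp: block_alg_def)
    qed
    then show ?thesis using c by (simp add: block_alg_def)
  qed
  have adj: "mat_adjoint X \<in> block_alg N c" if X: "X \<in> block_alg N c" for X
  proof -
    have c: "X \<in> carrier_mat N N" using X by (simp add: block_alg_def)
    then show ?thesis using X carrier_adjoint[OF c] by (auto simp: block_alg_def index_adjoint[OF c])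
  qed
  show ?thesis unfolding star_subalgebra_def
    using mult adj by (auto simp: block_alg_def)
qed

lemma one_in_block_alg: "1\<^sub>m N \<in> block_alg N c"
  by (auto simp: block_alg_def)

lemma cstar_algebra_block_alg: "0 < N \<Longrightarrow> cstar_algebra (block_alg N c)"
  unfolding cstar_algebra_def using star_subalgebra_block_alg[of N c] one_in_block_alg[of N c]
  by (intro exI[of _ N]) (metis index_one_mat(1) index_zero_mat(1) singletonD zero_neq_one)

lemma matrix_units_block_alg:
  "full_matrix_units (to_fmat ` block_alg N c) {..<N} c funit"
proof -
  have "funit i j * funit k l = (if j = k then funit i l else 0)" if "k < N" "l < N" for i j k l
  proof (rule fmat_eqI)
    fix r s
    have "ent (funit i j * funit k l) r s = (\<Sum>x<N. if x = k then ent (funit i j) r k * ent (funit k l) k s else 0)"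
      unfolding ent_mult[OF disjI2[OF supp_le_funit[OF that]]] by (rule sum.cong[OF refl]) auto
    then show "ent (funit i j * funit k l) r s = ent (if j = k then funit i l else 0) r s" using that by auto
  qed
  note mult = this
  have one: "funit i j \<in> to_fmat ` block_alg N c" if ij: "i < N" "j < N" "c i = c j" for i j
  proof
    show "funit i j = to_fmat (mat N N (\<lambda>(r, s). if r = i \<and> s = j then 1 else 0))"
      by (rule fmat_eqI) (use ij in auto)
  qed (use ij in \<open>auto simp: block_alg_def\<close>)
  have corner: "funit i i * to_fmat X * funit j j = sc (X $$ (i, j)) (funit i j)"
    if "X \<in> carrier_mat N N" "i < N" "j < N" for X i j
  proof (rule fmat_eqI)
    fix r s
    have sX: "supp_le N (to_fmat X)" by (rule supp_le_to_fmat[OF that(1)])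
    have 1: "ent (funit i i * to_fmat X) r k = (if r = i then ent (to_fmat X) i k else 0)" for k
    proof -
      have "ent (funit i i * to_fmat X) r k = (\<Sum>x<N. if x = i then (if r = i then ent (to_fmat X) i k else 0) else 0)"
        unfolding ent_mult[OF disjI2[OF sX]] by (rule sum.cong[OF refl]) auto
      then show ?thesis using that by simp
    qed
    have "ent (funit i i * to_fmat X * funit j j) r s = (\<Sum>x<N. if x = j then ent (funit i i * to_fmat X) r j * (if s = j then 1 else 0) else 0)"
      unfolding ent_mult[OF disjI2[OF supp_le_funit[OF that(3,3)]]] by (rule sum.cong[OF refl]) auto
    then show "ent (funit i i * to_fmat X * funit j j) r s = ent (sc (X $$ (i, j)) (funit i j)) r s"
      using that by (simp add: 1)
  qed
  have nz: "funit i j \<noteq> 0" for i j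
  proof
    assume "funit i j = 0"
    then have "ent (funit i j) i j = 0" by (simp only: ent_simps)
    then show False by simp
  qed
  have sep: "X = 0" if X: "X \<in> to_fmat ` block_alg N c" "\<And>i. i < N \<Longrightarrow> funit i i * X = 0" for X
  proof (rule fmat_eqI)
    fix i j
    obtain X0 where X0: "X0 \<in> carrier_mat N N" "X = to_fmat X0" using X(1) by (auto simp: block_alg_def)
    show "ent X i j = ent 0 i j"
    proof (cases "i < N \<and> j < N")
      case True
      then have "sc (X0 $$ (i, j)) (funit i j) = 0" using corner[OF X0(1), of i j] X(2)[of i] X0(2) by simp
      then have "X0 $$ (i, j) = 0" using nz by simp
      then show ?thesis using X0 by simp
    qed (use X0 in auto)
  qed
  show ?thesis
    unfolding full_matrix_units_def matrix_units_def
    using one nz mult corner sep by (fastforce simp: block_alg_def)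
qed

text \<open>The code vector \<open>i\<close> combines the input basis vectors \<open>t\<close> with
  \<open>\<iota> t = i\<close>, with amplitudes \<open>\<beta> t\<close>. By \<open>inj\<close> a
  Kraus operator maps it to a multiple of a single basis vector, and by \<open>ex\<close> the factor
  is the same for all code vectors of a block. So on each block every Kraus operator is a multiple
  of a renaming of basis vectors, which the decoder reverses after measuring the label and the
  block.\<close>

lemma transmittable_block:
  fixes \<iota> :: "nat \<Rightarrow> nat" and \<beta> :: "nat \<Rightarrow> real" and c :: "nat \<Rightarrow> 'c" and \<chi> :: "nat \<Rightarrow> 'x"
  assumes comb: "comb_channel \<Lambda> \<tau> \<chi> \<alpha>" and N: "0 < N"
    and io: "\<And>t. t < idim \<Lambda> \<Longrightarrow> \<iota> t < N"
    and inj: "inj_on (\<lambda>r. (\<chi> r, \<iota> (\<tau> r))) {..<odim \<Lambda>}"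
    and ex: "\<And>r j. r < odim \<Lambda> \<Longrightarrow> j < N \<Longrightarrow> c j = c (\<iota> (\<tau> r)) \<Longrightarrow>
      \<exists>s<odim \<Lambda>. \<chi> s = \<chi> r \<and> \<iota> (\<tau> s) = j \<and> \<alpha> s * \<beta> (\<tau> s) = \<alpha> r * \<beta> (\<tau> r)"
    and norm: "\<And>i. i < N \<Longrightarrow> (\<Sum>t | t < idim \<Lambda> \<and> \<iota> t = i. (\<beta> t)\<^sup>2) = 1"
    and tp: "\<And>t. t < idim \<Lambda> \<Longrightarrow> (\<Sum>r | r < odim \<Lambda> \<and> \<tau> r = t. (\<alpha> r)\<^sup>2) = 1"
  shows "transmittable \<Lambda> (block_alg N c)"
proof -
  let ?d = "idim \<Lambda>" and ?e = "odim \<Lambda>"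
  have tau: "\<tau> r < ?d" if "r < ?e" for r using comb that by (simp add: comb_channel_def)
  define V where "V = mat ?d N (\<lambda>(t, i). if \<iota> t = i then complex_of_real (\<beta> t) else 0)"
  have V: "V \<in> carrier_mat ?d N" by (simp add: V_def)
  note V' = carrier_adjoint[OF V]
  have Vt: "V $$ (t, i) = (if \<iota> t = i then complex_of_real (\<beta> t) else 0)" if "t < ?d" "i < N" for t i
    using that by (simp add: V_def)
  have V'V: "mat_adjoint V * V = 1\<^sub>m N"
  proof (rule eq_matI)
    fix i j assume "i < dim_row (1\<^sub>m N :: complex mat)" "j < dim_col (1\<^sub>m N :: complex mat)"
    then have ij: "i < N" "j < N" by auto
    have "(mat_adjoint V * V) $$ (i, j) = (\<Sum>t<?d. cnj (V $$ (t, i)) * V $$ (t, j))"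
      unfolding index_mult_sum[OF V' V ij] by (intro sum.cong refl) (simp add: index_adjoint[OF V] ij)
    also have "\<dots> = (\<Sum>t<?d. if \<iota> t = i \<and> i = j then of_real ((\<beta> t)\<^sup>2) else 0)"
      by (intro sum.cong refl) (use ij in \<open>auto simp: V_def power2_eq_square\<close>)
    also have "\<dots> = (if i = j then of_real (\<Sum>t | t < ?d \<and> \<iota> t = i. (\<beta> t)\<^sup>2) else 0)"
    proof (cases "i = j")
      case True
      have "(\<Sum>t<?d. if \<iota> t = i then complex_of_real ((\<beta> t)\<^sup>2) else 0) = (\<Sum>t\<in>{t \<in> {..<?d}. \<iota> t = i}. of_real ((\<beta> t)\<^sup>2))"
        by (rule sum.inter_filter[symmetric]) simp
      then show ?thesis using True by simp
    qed simp
    finally show "(mat_adjoint V * V) $$ (i, j) = 1\<^sub>m N $$ (i, j)" using ij norm by simp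
  qed (use V V' in auto)
  define \<pi> where "\<pi> X = V * X * mat_adjoint V" for X
  have pic: "\<pi> X \<in> carrier_mat ?d ?d" if "X \<in> carrier_mat N N" for X
    unfolding \<pi>_def using V V' that by (meson mult_carrier_mat)
  have recov: "mat_adjoint V * \<pi> X * V = X" if X: "X \<in> carrier_mat N N" for X
  proof -
    have VX: "V * X \<in> carrier_mat ?d N" using V X by simp
    have "mat_adjoint V * \<pi> X = (mat_adjoint V * (V * X)) * mat_adjoint V"
      unfolding \<pi>_def by (rule assoc_mult_mat[OF V' VX V', symmetric])
    also have "mat_adjoint V * (V * X) = X"
      using assoc_mult_mat[OF V' V X] V'V X by simp
    finally show ?thesis using assoc_mult_mat[OF X V' V] V'V X by simp
  qed
  have pimul: "\<pi> (X * Y) = \<pi> X * \<pi> Y" if XY: "X \<in> carrier_mat N N" "Y \<in> carrier_mat N N" for X Y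
  proof -
    have VX: "V * X \<in> carrier_mat ?d N" and VY: "V * Y \<in> carrier_mat ?d N" and YV: "Y * mat_adjoint V \<in> carrier_mat N ?d"
      using V V' XY by auto
    have piY: "\<pi> Y = V * (Y * mat_adjoint V)" unfolding \<pi>_def by (rule assoc_mult_mat[OF V XY(2) V'])
    have "\<pi> X * \<pi> Y = (V * X) * (mat_adjoint V * \<pi> Y)"
      unfolding \<pi>_def[of X] by (rule assoc_mult_mat[OF VX V' pic[OF XY(2)]])
    also have "mat_adjoint V * \<pi> Y = Y * mat_adjoint V"
      unfolding piY assoc_mult_mat[OF V' V YV, symmetric] V'V by (rule left_mult_one_mat[OF YV])
    also have "(V * X) * (Y * mat_adjoint V) = (V * X * Y) * mat_adjoint V"
      by (rule assoc_mult_mat[OF VX XY(2) V', symmetric])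
    also have "V * X * Y = V * (X * Y)" by (rule assoc_mult_mat[OF V XY])
    finally show ?thesis by (simp add: \<pi>_def)
  qed
  have piadd: "\<pi> (X + Y) = \<pi> X + \<pi> Y" if XY: "X \<in> carrier_mat N N" "Y \<in> carrier_mat N N" for X Y
    unfolding \<pi>_def using mult_add_distrib_mat[OF V XY] add_mult_distrib_mat[of "V * X" ?d N "V * Y" "mat_adjoint V" ?d] V V' XY by simp
  have pisc: "\<pi> (a \<cdot>\<^sub>m X) = a \<cdot>\<^sub>m \<pi> X" if X: "X \<in> carrier_mat N N" for a X
    unfolding \<pi>_def using mult_smult_distrib[OF V X, of a] mult_smult_assoc_mat[of "V * X" ?d N "mat_adjoint V" ?d a] V V' X by simp
  have pient: "\<pi> X $$ (t, t') = of_real (\<beta> t * \<beta> t') * X $$ (\<iota> t, \<iota> t')" if X: "X \<in> carrier_mat N N" and t: "t < ?d" "t' < ?d" for X t t'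
  proof -
    have VX: "V * X \<in> carrier_mat ?d N" using V X by simp
    have 1: "(V * X) $$ (t, j) = of_real (\<beta> t) * X $$ (\<iota> t, j)" if j: "j < N" for j
    proof -
      have "(V * X) $$ (t, j) = (\<Sum>i<N. if i = \<iota> t then of_real (\<beta> t) * X $$ (\<iota> t, j) else 0)"
        unfolding index_mult_sum[OF V X t(1) j] by (intro sum.cong refl) (use t in \<open>auto simp: V_def\<close>)
      then show ?thesis using io[OF t(1)] by simp
    qed
    have "\<pi> X $$ (t, t') = (\<Sum>j<N. if j = \<iota> t' then of_real (\<beta> t) * X $$ (\<iota> t, \<iota> t') * of_real (\<beta> t') else 0)"
      unfolding \<pi>_def index_mult_sum[OF VX V' t]
      by (intro sum.cong refl) (use t in \<open>auto simp: 1 index_adjoint[OF V] Vt simp del: index_mult_mat(1)\<close>)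
    then show ?thesis using io[OF t(2)] by simp
  qed
  have piadj: "\<pi> (mat_adjoint X) = mat_adjoint (\<pi> X)" if X: "X \<in> carrier_mat N N" for X
  proof (rule eq_matI)
    fix i j assume "i < dim_row (mat_adjoint (\<pi> X))" "j < dim_col (mat_adjoint (\<pi> X))"
    then have ij: "i < ?d" "j < ?d" using carrier_adjoint[OF pic[OF X]] by auto
    then show "\<pi> (mat_adjoint X) $$ (i, j) = mat_adjoint (\<pi> X) $$ (i, j)"
      using X by (simp add: pient[OF carrier_adjoint[OF X]] index_adjoint[OF pic[OF X]] pient index_adjoint[OF X] io mult_ac)
  qed (use carrier_adjoint[OF pic[OF X]] pic[OF carrier_adjoint[OF X]] in auto)
  let ?B = "block_alg N c"
  have Bc: "X \<in> carrier_mat N N" if "X \<in> ?B" for X using that by (simp add: block_alg_def)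
  note B = star_subalgebra_block_alg[of N c]
  have hom: "star_hom ?B (full_matrix_algebra ?d) \<pi>"
    unfolding star_hom_def full_matrix_algebra_def
    by (intro conjI ballI allI) (simp_all add: pic piadd pisc pimul piadj Bc)
  have injpi: "inj_on \<pi> ?B" by (rule inj_on_inverseI[of _ "\<lambda>Y. mat_adjoint V * Y * V"]) (use recov Bc in blast)
  have "star_subalgebra ?d (\<pi> ` ?B)"
  proof -
    have "\<pi> (0\<^sub>m N N) = 0\<^sub>m ?d ?d" using V V' by (simp add: \<pi>_def)
    then have "0\<^sub>m ?d ?d \<in> \<pi> ` ?B" using B by (metis image_eqI star_subalgebra_def)
    moreover have "\<pi> X + \<pi> Y \<in> \<pi> ` ?B" "\<pi> X * \<pi> Y \<in> \<pi> ` ?B" if "X \<in> ?B" "Y \<in> ?B" for X Y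
      using B that piadd[OF Bc Bc] pimul[OF Bc Bc] unfolding star_subalgebra_def by (metis image_eqI)+
    moreover have "a \<cdot>\<^sub>m \<pi> X \<in> \<pi> ` ?B" "mat_adjoint (\<pi> X) \<in> \<pi> ` ?B" if "X \<in> ?B" for a X
      using B that pisc[OF Bc] piadj[OF Bc] unfolding star_subalgebra_def by (metis image_eqI)+
    ultimately show ?thesis unfolding star_subalgebra_def
      using pic Bc by (intro conjI ballI allI) blast+
  qed
  moreover have "unit_projection (\<pi> ` ?B) (\<pi> (1\<^sub>m N))"
    unfolding unit_projection_def
  proof (intro conjI ballI)
    show "\<pi> (1\<^sub>m N) \<in> \<pi> ` ?B" using one_in_block_alg by blast
    fix Y assume "Y \<in> \<pi> ` ?B"
    then obtain X where X: "X \<in> carrier_mat N N" "Y = \<pi> X" using Bc by blast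
    show "\<pi> (1\<^sub>m N) * Y = Y" "Y * \<pi> (1\<^sub>m N) = Y"
      using pimul[OF one_carrier_mat X(1)] pimul[OF X(1) one_carrier_mat] X by simp_all
  qed
  moreover have "V * mat_adjoint V = \<pi> (1\<^sub>m N)" using V by (simp add: \<pi>_def)
  moreover have "\<exists>D. channel D \<and> idim D = ?e \<and> odim D = N \<and>
     (\<forall>X\<in>(\<lambda>X. mat_adjoint V * X * V) ` \<pi> ` ?B. app (adj_super (comp_super D (restrict_super \<Lambda> V))) X = X)"
  proof -
    define \<theta> where "\<theta> r = \<iota> (\<tau> r)" for r
    define \<kappa> where "\<kappa> r = (\<chi> r, c (\<theta> r))" for r
    define \<gamma> where "\<gamma> r = \<alpha> r * \<beta> (\<tau> r)" for r
    let ?D = "decoder ?e N \<kappa> \<theta>"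
    let ?Xi = "comp_super ?D (restrict_super \<Lambda> V)"
    have th: "\<theta> r < N" if "r < ?e" for r using io tau that by (simp add: \<theta>_def)
    have chD: "channel ?D"
    proof (rule decoder_channel[OF th])
      show "inj_on (\<lambda>r. (\<kappa> r, \<theta> r)) {..<?e}" using inj by (auto simp: inj_on_def \<kappa>_def \<theta>_def)
    qed
    have ioX: "idim ?Xi = N" "odim ?Xi = N" "app ?Xi W = app ?D (app \<Lambda> (\<pi> W))" for W
      using V by (auto simp: comp_super_def restrict_super_def decoder_def \<pi>_def)
    \<comment> \<open>The probabilities of all outcomes for the code vector \<open>i\<close> add up
      to 1, by trace preservation of the channel and normalisation of the code vector.\<close>
    have gsum: "(\<Sum>r | r < ?e \<and> \<theta> r = i. (\<gamma> r)\<^sup>2) = 1" if i: "i < N" for i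
    proof -
      have "(\<Sum>t | t < ?d \<and> \<iota> t = i. \<Sum>r\<in>{r \<in> {r. r < ?e \<and> \<theta> r = i}. \<tau> r = t}. (\<gamma> r)\<^sup>2) = (\<Sum>r | r < ?e \<and> \<theta> r = i. (\<gamma> r)\<^sup>2)"
        by (rule sum.group) (use tau in \<open>auto simp: \<theta>_def\<close>)
      moreover have "(\<Sum>r\<in>{r \<in> {r. r < ?e \<and> \<theta> r = i}. \<tau> r = t}. (\<gamma> r)\<^sup>2) = (\<beta> t)\<^sup>2" if "t < ?d" "\<iota> t = i" for t
      proof -
        have "(\<Sum>r\<in>{r \<in> {r. r < ?e \<and> \<theta> r = i}. \<tau> r = t}. (\<gamma> r)\<^sup>2) = (\<Sum>r | r < ?e \<and> \<tau> r = t. (\<alpha> r)\<^sup>2 * (\<beta> t)\<^sup>2)"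
          by (rule sum.cong) (use that in \<open>auto simp: \<theta>_def \<gamma>_def power_mult_distrib\<close>)
        then show ?thesis using tp[OF that(1)] by (simp flip: sum_distrib_right)
      qed
      ultimately show ?thesis using norm[OF i] by simp
    qed
    \<comment> \<open>Encoding, channel and decoder together erase the entries between different
      blocks and keep the others; the adjoint of this pinching fixes every block matrix.\<close>
    have Xi: "app ?Xi W $$ (i, j) = (if c i = c j then W $$ (i, j) else 0)"
      if W: "W \<in> carrier_mat N N" and ij: "i < N" "j < N" for W i j
    proof -
      have L: "app \<Lambda> (\<pi> W) $$ (r, s) = (if \<chi> r = \<chi> s then of_real (\<gamma> r * \<gamma> s) * W $$ (\<theta> r, \<theta> s) else 0)"
        if "r < ?e" "s < ?e" for r s
        using comb pic[OF W] that pient[OF W tau[OF that(1)] tau[OF that(2)]]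
        by (simp add: comb_channel_def \<gamma>_def \<theta>_def mult_ac)
      have "app ?Xi W $$ (i, j) = (\<Sum>r<?e. \<Sum>s<?e. if \<kappa> r = \<kappa> s \<and> \<theta> r = i \<and> \<theta> s = j then app \<Lambda> (\<pi> W) $$ (r, s) else 0)"
        unfolding ioX using ij by (simp add: decoder_def)
      also have "\<dots> = (\<Sum>r<?e. if \<theta> r = i then (if c i = c j then of_real ((\<gamma> r)\<^sup>2) * W $$ (i, j) else 0) else 0)"
      proof (rule sum.cong[OF refl])
        fix r assume "r \<in> {..<?e}"
        then have r: "r < ?e" by simp
        show "(\<Sum>s<?e. if \<kappa> r = \<kappa> s \<and> \<theta> r = i \<and> \<theta> s = j then app \<Lambda> (\<pi> W) $$ (r, s) else 0) =
          (if \<theta> r = i then (if c i = c j then of_real ((\<gamma> r)\<^sup>2) * W $$ (i, j) else 0) else 0)"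
        proof (cases "\<theta> r = i \<and> c i = c j")
          case True
          \<comment> \<open>\<open>s0\<close> is the only output that contributes to the entry
            \<open>(i, j)\<close> together with \<open>r\<close>.\<close>
          obtain s0 where s0: "s0 < ?e" "\<chi> s0 = \<chi> r" "\<theta> s0 = j" "\<gamma> s0 = \<gamma> r"
            using ex[OF r ij(2)] True by (auto simp: \<theta>_def \<gamma>_def)
          have "(if \<kappa> r = \<kappa> s \<and> \<theta> r = i \<and> \<theta> s = j then app \<Lambda> (\<pi> W) $$ (r, s) else 0) =
            (if s = s0 then of_real ((\<gamma> r)\<^sup>2) * W $$ (i, j) else 0)" if s: "s < ?e" for s
          proof (cases "s = s0")
            case True': True
            then show ?thesis using s0 True r by (auto simp: L \<kappa>_def power2_eq_square)
          next
            case False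
            then have "\<not> (\<chi> s = \<chi> r \<and> \<theta> s = j)" using inj_onD[OF inj, of s s0] s s0 by (auto simp: \<theta>_def)
            then show ?thesis using False by (auto simp: \<kappa>_def)
          qed
          then have "(\<Sum>s<?e. if \<kappa> r = \<kappa> s \<and> \<theta> r = i \<and> \<theta> s = j then app \<Lambda> (\<pi> W) $$ (r, s) else 0) =
            (\<Sum>s<?e. if s = s0 then of_real ((\<gamma> r)\<^sup>2) * W $$ (i, j) else 0)" by (intro sum.cong refl) auto
          then show ?thesis using s0(1) True by simp
        next
          case False
          then have "(\<Sum>s<?e. if \<kappa> r = \<kappa> s \<and> \<theta> r = i \<and> \<theta> s = j then app \<Lambda> (\<pi> W) $$ (r, s) else 0) = 0"
            by (intro sum.neutral) (auto simp: \<kappa>_def)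
          then show ?thesis using False by auto
        qed
      qed
      also have "\<dots> = (\<Sum>r\<in>{r \<in> {..<?e}. \<theta> r = i}. (if c i = c j then of_real ((\<gamma> r)\<^sup>2) * W $$ (i, j) else 0))"
        by (rule sum.inter_filter[symmetric]) simp
      also have "\<dots> = (if c i = c j then of_real (\<Sum>r | r < ?e \<and> \<theta> r = i. (\<gamma> r)\<^sup>2) * W $$ (i, j) else 0)"
        by (simp add: sum_distrib_right)
      finally show ?thesis using gsum[OF ij(1)] by simp
    qed
    have "app (adj_super ?Xi) X = X" if X: "X \<in> ?B" for X
    proof (rule adj_super_eqI)
      show "X \<in> carrier_mat (idim ?Xi) (idim ?Xi)" using Bc[OF X] ioX by simp
      fix W :: "complex mat" assume "W \<in> carrier_mat (idim ?Xi) (idim ?Xi)"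
      then have W: "W \<in> carrier_mat N N" using ioX by simp
      have XW: "app ?Xi W \<in> carrier_mat N N" unfolding ioX by (simp add: decoder_def)
      have "X $$ (i, j) * app ?Xi W $$ (j, i) = X $$ (i, j) * W $$ (j, i)" if "i < N" "j < N" for i j
        unfolding Xi[OF W that(2,1)] using X that by (auto simp: block_alg_def)
      then show "mtrace (X * app ?Xi W) = mtrace (X * W)"
        unfolding mtrace_mult[OF Bc[OF X] W] mtrace_mult[OF Bc[OF X] XW] by (intro sum.cong refl) auto
    qed
    then show ?thesis using chD recov Bc by (intro exI[of _ ?D]) (auto simp: decoder_def)
  qed
  ultimately have "correctable \<Lambda> (\<pi> ` ?B)"
    unfolding correctable_def using V V'V by blast
  then show ?thesis unfolding transmittable_def using hom injpi cstar_algebra_block_alg[OF N] by blast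
qed

text \<open>\<open>e\<close> only enumerates the index set \<open>I\<close>. Direct sums can thus be
  indexed by meaningful labels, and a change of labels is a bijection that respects classes.\<close>

definition is_block :: "complex mat set \<Rightarrow> 'i set \<Rightarrow> ('i \<Rightarrow> 'c) \<Rightarrow> bool" where
  "is_block A I c \<longleftrightarrow> (\<exists>N e. bij_betw e {..<N} I \<and> A = block_alg N (c \<circ> e))"

lemma block_alg_cong:
  "(\<And>i j. i < N \<Longrightarrow> j < N \<Longrightarrow> c i = c j \<longleftrightarrow> d i = d j) \<Longrightarrow> block_alg N c = block_alg N d"
  unfolding block_alg_def by (intro Collect_cong) auto

lemma is_block_relabel:
  assumes A: "is_block A I c" and h: "bij_betw h I J"
    and cd: "\<And>i j. i \<in> I \<Longrightarrow> j \<in> I \<Longrightarrow> c i = c j \<longleftrightarrow> d (h i) = d (h j)"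
  shows "is_block A J d"
proof -
  obtain N e where e: "bij_betw e {..<N} I" "A = block_alg N (c \<circ> e)" using A by (auto simp: is_block_def)
  have eI: "e k \<in> I" if "k < N" for k using e(1) that by (auto simp: bij_betw_def)
  have "block_alg N (c \<circ> e) = block_alg N (d \<circ> (h \<circ> e))"
    by (rule block_alg_cong) (simp add: cd eI)
  then show ?thesis unfolding is_block_def using bij_betw_trans[OF e(1) h] e(2) by blast
qed

lemma is_block_units:
  assumes "is_block A I c" obtains f where "full_matrix_units (to_fmat ` A) I c f"
proof -
  obtain N e where e: "bij_betw e {..<N} I" "A = block_alg N (c \<circ> e)" using assms by (auto simp: is_block_def)
  have h: "bij_betw (inv_into {..<N} e) I {..<N}" by (rule bij_betw_inv_into[OF e(1)])
  have inv: "e (inv_into {..<N} e i) = i" if "i \<in> I" for i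
    using e(1) that by (auto simp: bij_betw_def intro: f_inv_into_f)
  have "full_matrix_units (to_fmat ` A) I c (\<lambda>i j. funit (inv_into {..<N} e i) (inv_into {..<N} e j))"
    unfolding e(2) by (rule full_matrix_units_relabel[OF matrix_units_block_alg h]) (simp add: inv)
  then show thesis by (rule that)
qed

lemma is_block_star_subalgebra: "is_block A I c \<Longrightarrow> \<exists>N. star_subalgebra N A"
  unfolding is_block_def using star_subalgebra_block_alg by blast

lemma is_block_full: "is_block (full_matrix_algebra q) {..<q} (\<lambda>_. 0 :: nat)"
  unfolding is_block_def by (intro exI[of _ q] exI[of _ id]) (auto simp: full_matrix_algebra_def block_alg_def)

lemma is_block_Nil: "is_block (direct_sum []) {} c"
proof -
  have "direct_sum [] = block_alg 0 (c \<circ> (\<lambda>_. undefined))"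
    by (auto simp: direct_sum_def block_alg_def intro!: eq_matI)
  then show ?thesis unfolding is_block_def by (intro exI[of _ 0] exI[of _ "\<lambda>_. undefined"]) (auto simp: bij_betw_def)
qed

lemma direct_sum_Cons:
  "direct_sum (A # As) = {four_block_mat X (0\<^sub>m (dim_row X) (dim_col Y)) (0\<^sub>m (dim_row Y) (dim_col X)) Y |
     X Y. X \<in> A \<and> Y \<in> direct_sum As}"
  (is "?L = ?R")
proof (intro equalityI subsetI)
  fix Z assume "Z \<in> ?L"
  then obtain Xs where "list_all2 (\<in>) Xs (A # As)" "Z = diag_block_mat Xs" unfolding direct_sum_def by blast
  then obtain X Xs' where X: "X \<in> A" "list_all2 (\<in>) Xs' As" "Z = diag_block_mat (X # Xs')"
    unfolding list_all2_Cons2 by blast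
  moreover have "diag_block_mat Xs' \<in> direct_sum As" using X(2) unfolding direct_sum_def by blast
  ultimately show "Z \<in> ?R" unfolding diag_block_mat.simps Let_def by blast
next
  fix Z assume "Z \<in> ?R"
  then obtain X Y where X: "X \<in> A" "Y \<in> direct_sum As"
    "Z = four_block_mat X (0\<^sub>m (dim_row X) (dim_col Y)) (0\<^sub>m (dim_row Y) (dim_col X)) Y" by blast
  then obtain Xs where "list_all2 (\<in>) Xs As" "Y = diag_block_mat Xs" unfolding direct_sum_def by blast
  then have "list_all2 (\<in>) (X # Xs) (A # As)" "Z = diag_block_mat (X # Xs)"
    using X by (simp_all add: Let_def)
  then show "Z \<in> ?L" unfolding direct_sum_def by blast
qed

text \<open>\<open>map_sum\<close> tags the classes of the two summands, so that their blocks stay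
  apart in the block-diagonal matrices.\<close>

lemma is_block_Cons:
  assumes A: "is_block A I c" and As: "is_block (direct_sum As) J b"
  shows "is_block (direct_sum (A # As)) (I <+> J) (map_sum c b)"
proof -
  obtain N e where e: "bij_betw e {..<N} I" "A = block_alg N (c \<circ> e)" using A by (auto simp: is_block_def)
  obtain M g where g: "bij_betw g {..<M} J" "direct_sum As = block_alg M (b \<circ> g)" using As by (auto simp: is_block_def)
  define h where "h k = (if k < N then Inl (e k) else Inr (g (k - N)))" for k
  have h: "bij_betw h {..<N + M} (I <+> J)"
    unfolding bij_betw_def
  proof
    show "inj_on h {..<N + M}"
    proof (rule inj_onI)
      fix k l assume kl: "k \<in> {..<N + M}" "l \<in> {..<N + M}" "h k = h l"
      show "k = l"
      proof (cases "k < N")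
        case True
        then have "l < N" "e k = e l" using kl by (auto simp: h_def split: if_splits)
        then show ?thesis using e(1) True by (auto simp: bij_betw_def dest: inj_onD)
      next
        case False
        then have "\<not> l < N" "g (k - N) = g (l - N)" using kl by (auto simp: h_def split: if_splits)
        then have "k - N = l - N" using g(1) False kl by (intro inj_onD[of g "{..<M}"]) (auto simp: bij_betw_def)
        then show ?thesis using False \<open>\<not> l < N\<close> by simp
      qed
    qed
    show "h ` {..<N + M} = I <+> J"
    proof (intro equalityI subsetI)
      fix x assume "x \<in> h ` {..<N + M}"
      then show "x \<in> I <+> J" using e(1) g(1) by (auto simp: h_def bij_betw_def split: if_splits)
    next
      fix x assume "x \<in> I <+> J"
      then show "x \<in> h ` {..<N + M}"
      proof (elim PlusE)
        fix i assume "i \<in> I" "x = Inl i"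
        moreover then obtain k where "k < N" "i = e k" using e(1) by (auto simp: bij_betw_def)
        ultimately show ?thesis by (intro image_eqI[of _ _ k]) (auto simp: h_def)
      next
        fix j assume "j \<in> J" "x = Inr j"
        moreover then obtain k where "k < M" "j = g k" using g(1) by (auto simp: bij_betw_def)
        ultimately show ?thesis by (intro image_eqI[of _ _ "N + k"]) (auto simp: h_def)
      qed
    qed
  qed
  have cls: "(map_sum c b \<circ> h) k = (if k < N then Inl ((c \<circ> e) k) else Inr ((b \<circ> g) (k - N)))" for k
    by (simp add: h_def)
  have "direct_sum (A # As) = block_alg (N + M) (map_sum c b \<circ> h)"
  proof (intro equalityI subsetI)
    fix Z assume "Z \<in> direct_sum (A # As)"
    then obtain X Y where XY: "X \<in> block_alg N (c \<circ> e)" "Y \<in> block_alg M (b \<circ> g)"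
      "Z = four_block_mat X (0\<^sub>m (dim_row X) (dim_col Y)) (0\<^sub>m (dim_row Y) (dim_col X)) Y"
      unfolding direct_sum_Cons e(2) g(2) by blast
    then have dims: "dim_row X = N" "dim_col X = N" "dim_row Y = M" "dim_col Y = M" by (auto simp: block_alg_def)
    have X0: "X $$ (i, j) = 0" if "i < N" "j < N" "(c \<circ> e) i \<noteq> (c \<circ> e) j" for i j
      using XY(1) that by (simp add: block_alg_def)
    have Y0: "Y $$ (i, j) = 0" if "i < M" "j < M" "(b \<circ> g) i \<noteq> (b \<circ> g) j" for i j
      using XY(2) that by (simp add: block_alg_def)
    have "Z $$ (i, j) = 0" if ij: "i < N + M" "j < N + M" "(map_sum c b \<circ> h) i \<noteq> (map_sum c b \<circ> h) j" for i j
    proof -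
      have "Z $$ (i, j) = (if i < N then if j < N then X $$ (i, j) else 0 else if j < N then 0 else Y $$ (i - N, j - N))"
        unfolding XY(3) using ij(1,2) by (simp add: dims)
      moreover have "i - N < M" if "\<not> i < N" using that ij(1) by arith
      moreover have "j - N < M" if "\<not> j < N" using that ij(2) by arith
      ultimately show ?thesis using ij(3) X0[of i j] Y0[of "i - N" "j - N"] unfolding cls
        by (cases "i < N"; cases "j < N") simp_all
    qed
    then show "Z \<in> block_alg (N + M) (map_sum c b \<circ> h)"
      unfolding block_alg_def using XY(3) dims by auto
  next
    fix Z assume Z: "Z \<in> block_alg (N + M) (map_sum c b \<circ> h)"
    define X where "X = mat N N (\<lambda>(i, j). Z $$ (i, j))"
    define Y where "Y = mat M M (\<lambda>(i, j). Z $$ (i + N, j + N))"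
    have Z0: "Z $$ (i, j) = 0" if "i < N + M" "j < N + M" "(map_sum c b \<circ> h) i \<noteq> (map_sum c b \<circ> h) j" for i j
      using Z that by (auto simp: block_alg_def)
    have "X $$ (i, j) = 0" if "i < N" "j < N" "(c \<circ> e) i \<noteq> (c \<circ> e) j" for i j
      using Z0[of i j] that unfolding cls by (simp add: X_def)
    then have "X \<in> A" unfolding e(2) block_alg_def by (simp add: X_def)
    moreover have "Y $$ (i, j) = 0" if "i < M" "j < M" "(b \<circ> g) i \<noteq> (b \<circ> g) j" for i j
      using Z0[of "i + N" "j + N"] that unfolding cls by (simp add: Y_def)
    then have "Y \<in> direct_sum As" unfolding g(2) block_alg_def by (simp add: Y_def)
    moreover have "Z = four_block_mat X (0\<^sub>m (dim_row X) (dim_col Y)) (0\<^sub>m (dim_row Y) (dim_col X)) Y"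
    proof (rule eq_matI)
      fix i j assume "i < dim_row (four_block_mat X (0\<^sub>m (dim_row X) (dim_col Y)) (0\<^sub>m (dim_row Y) (dim_col X)) Y)"
        "j < dim_col (four_block_mat X (0\<^sub>m (dim_row X) (dim_col Y)) (0\<^sub>m (dim_row Y) (dim_col X)) Y)"
      then have ij: "i < N + M" "j < N + M" by (auto simp: X_def Y_def)
      have "four_block_mat X (0\<^sub>m (dim_row X) (dim_col Y)) (0\<^sub>m (dim_row Y) (dim_col X)) Y $$ (i, j) =
          (if i < N then if j < N then Z $$ (i, j) else 0 else if j < N then 0 else Z $$ (i, j))"
        using ij by (simp add: X_def Y_def)
      then show "Z $$ (i, j) = four_block_mat X (0\<^sub>m (dim_row X) (dim_col Y)) (0\<^sub>m (dim_row Y) (dim_col X)) Y $$ (i, j)"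
        using Z0[OF ij] unfolding cls by (cases "i < N"; cases "j < N") simp_all
    qed (use Z in \<open>auto simp: X_def Y_def block_alg_def\<close>)
    ultimately show "Z \<in> direct_sum (A # As)" unfolding direct_sum_Cons by blast
  qed
  then show ?thesis unfolding is_block_def using h by blast
qed

lemma is_block_direct_sum:
  assumes "\<And>p. p < length As \<Longrightarrow> is_block (As ! p) (I p) (c p)"
  shows "is_block (direct_sum As) (SIGMA p:{..<length As}. I p) (\<lambda>(p, i). (p, c p i))"
  using assms
proof (induction As arbitrary: I c)
  case Nil
  show ?case by (simp add: is_block_Nil)
next
  case (Cons A As)
  have 1: "is_block A (I 0) (c 0)" using Cons(2)[of 0] by simp
  have "is_block (direct_sum As) (SIGMA p:{..<length As}. I (Suc p)) (\<lambda>(p, i). (p, c (Suc p) i))"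
    by (rule Cons(1)) (use Cons(2) in force)
  from is_block_Cons[OF 1 this] show ?case
  proof (rule is_block_relabel)
    let ?h = "case_sum (\<lambda>i. (0 :: nat, i)) (\<lambda>(p, i). (Suc p, i))"
    let ?L = "I 0 <+> (SIGMA p:{..<length As}. I (Suc p))" and ?R = "SIGMA p:{..<length (A # As)}. I p"
    show "bij_betw ?h ?L ?R"
      unfolding bij_betw_def
    proof
      show "inj_on ?h ?L" by (auto simp: inj_on_def)
      show "?h ` ?L = ?R"
      proof (intro equalityI subsetI)
        fix x assume "x \<in> ?R"
        then obtain p i where x: "x = (p, i)" "p < Suc (length As)" "i \<in> I p" by auto
        show "x \<in> ?h ` ?L"
        proof (cases p)
          case 0 then show ?thesis using x by (intro image_eqI[of _ _ "Inl i"]) auto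
        next
          case (Suc r) then show ?thesis using x by (intro image_eqI[of _ _ "Inr (r, i)"]) auto
        qed
      qed auto
    qed
    show "(map_sum (c 0) (\<lambda>(p, i). (p, c (Suc p) i)) i = map_sum (c 0) (\<lambda>(p, i). (p, c (Suc p) i)) j) =
      ((\<lambda>(p, i). (p, c p i)) (?h i) = (\<lambda>(p, i). (p, c p i)) (?h j))" for i j
      by (cases i; cases j) auto
  qed
qed

section \<open>Classes of parallel faces, recorded by their fixed coordinates\<close>

definition pattern :: "bool option list \<Rightarrow> bool list" where
  "pattern t = map (\<lambda>x. x \<noteq> None) t"

lemma fdim_pattern: "fdim t + hamming_weight (pattern t) = length t"
  by (induction t) (auto simp: fdim_def hamming_weight_def pattern_def)

text \<open>A parallel class has one face for each assignment of values to the fixed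
  coordinates.\<close>

lemma card_pattern: "finite {t. pattern t = z} \<and> card {t. pattern t = z} = 2 ^ hamming_weight z"
proof (induction z)
  case Nil
  have "{t. pattern t = []} = {[]}" by (auto simp: pattern_def)
  then show ?case by (simp add: hamming_weight_def)
next
  case (Cons b z)
  let ?S = "{t. pattern t = z}"
  show ?case
  proof (cases b)
    case True
    have "{t. pattern t = b # z} = (\<lambda>t. Some True # t) ` ?S \<union> (\<lambda>t. Some False # t) ` ?S"
      using True by (auto simp: pattern_def map_eq_Cons_conv)
    moreover have "card ((\<lambda>t. Some True # t) ` ?S \<union> (\<lambda>t. Some False # t) ` ?S) = card ?S + card ?S"
      using Cons by (subst card_Un_disjoint) (auto simp: card_image)
    ultimately show ?thesis using Cons True by (simp add: hamming_weight_def)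
  next
    case False
    have "{t. pattern t = b # z} = (\<lambda>t. None # t) ` ?S"
      using False by (auto simp: pattern_def map_eq_Cons_conv)
    then show ?thesis using Cons False by (simp add: card_image hamming_weight_def)
  qed
qed

lemma card_vertices_of_face: "finite {v. t \<in> faces_at v} \<and> card {v. t \<in> faces_at v} = 2 ^ fdim t"
proof (induction t)
  case Nil
  have "{v. [] \<in> faces_at v} = {[]}" by (auto simp: faces_at_def)
  then show ?case by (simp add: fdim_def)
next
  case (Cons x t)
  let ?S = "{v. t \<in> faces_at v}"
  show ?case
  proof (cases x)
    case None
    have "{v. x # t \<in> faces_at v} = (\<lambda>v. True # v) ` ?S \<union> (\<lambda>v. False # v) ` ?S"
      using None by (auto simp: faces_at_def list_all2_Cons2)
    moreover have "card ((\<lambda>v. True # v) ` ?S \<union> (\<lambda>v. False # v) ` ?S) = card ?S + card ?S"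
      using Cons by (subst card_Un_disjoint) (auto simp: card_image)
    ultimately show ?thesis using Cons None by (simp add: fdim_def)
  next
    case (Some a)
    have "{v. x # t \<in> faces_at v} = (\<lambda>v. a # v) ` ?S"
      using Some by (auto simp: faces_at_def list_all2_Cons2)
    then show ?thesis using Cons Some by (simp add: card_image fdim_def)
  qed
qed

text \<open>A vertex determines the values of the fixed coordinates, so exactly one face of each
  parallel class passes through it; \<open>face_exists\<close> is the other half. This makes the
  decoding of the superpositions unambiguous.\<close>

lemma face_unique:
  assumes "t \<in> faces_at v" "t' \<in> faces_at v" "pattern t = pattern t'" shows "t = t'"
proof (rule nth_equalityI)
  show "length t = length t'" using assms by (simp add: faces_at_length)
  fix i assume i: "i < length t"
  then have "(t ! i \<noteq> None) = (t' ! i \<noteq> None)"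
    using arg_cong[OF assms(3), of "\<lambda>z. z ! i"] assms(1,2) by (simp add: pattern_def faces_at_length)
  moreover have "t ! i = None \<or> t ! i = Some (v ! i)" "t' ! i = None \<or> t' ! i = Some (v ! i)"
    using assms(1,2) i by (auto simp: faces_at_iff_nth)
  ultimately show "t ! i = t' ! i" by auto
qed

lemma face_exists:
  assumes "length z = length v"
  obtains t where "t \<in> faces_at v" "pattern t = z"
proof -
  let ?t = "map (\<lambda>i. if z ! i then Some (v ! i) else None) [0..<length v]"
  have "?t \<in> faces_at v" by (auto simp: faces_at_iff_nth)
  moreover have "pattern ?t = z" using assms by (auto simp: pattern_def intro!: nth_equalityI split: if_splits)
  ultimately show thesis by (rule that)
qed

text \<open>The first \<open>q\<close> patterns index the basis of the matrix block; every face of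
  another pattern (\<open>Tset\<close>) spans a one-dimensional summand of its own. The block uses
  up \<open>s_n(q)\<close> faces, since the pattern \<open>z\<close> has \<open>2^|z|\<close> of
  them.\<close>

definition Zset :: "(nat \<Rightarrow> bool list) \<Rightarrow> nat \<Rightarrow> bool list set" where
  "Zset x q = x ` {1..q}"

definition Tset :: "(nat \<Rightarrow> bool list) \<Rightarrow> nat \<Rightarrow> nat \<Rightarrow> bool option list set" where
  "Tset x n q = {t. length t = n \<and> pattern t \<notin> Zset x q}"

lemma card_option_lists: "finite {t :: bool option list. length t = n} \<and> card {t :: bool option list. length t = n} = 3 ^ n"
proof -
  have "x \<in> {None, Some True, Some False}" for x :: "bool option" by (cases x) auto
  then have U: "(UNIV :: bool option set) = {None, Some True, Some False}" by blast
  have "card (UNIV :: bool option set) = 3" unfolding U by simp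
  then show ?thesis
    using finite_lists_length_eq[of "UNIV :: bool option set" n] card_lists_length_eq[of "UNIV :: bool option set" n] by simp
qed

lemma card_Tset:
  assumes x: "weight_enumeration n x" and q: "q \<le> 2 ^ n"
  shows "finite (Tset x n q)" "card (Tset x n q) + weight_sum x q = 3 ^ n"
proof -
  have bij: "bij_betw x {1..2 ^ n} {b. length b = n}" using x by (simp add: weight_enumeration_def)
  have inj: "inj_on x {1..q}" using bij q by (auto simp: bij_betw_def intro: inj_on_subset)
  have len: "length z = n" if "z \<in> Zset x q" for z using that bij q by (auto simp: Zset_def bij_betw_def)
  have len': "length t = n" if "pattern t \<in> Zset x q" for t using len[OF that] by (simp add: pattern_def)
  have "{t. pattern t \<in> Zset x q} = (\<Union>z\<in>Zset x q. {t. pattern t = z})" by auto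
  moreover have "card (\<Union>z\<in>Zset x q. {t. pattern t = z}) = (\<Sum>z\<in>Zset x q. 2 ^ hamming_weight z)"
    by (subst card_UN_disjoint) (use card_pattern in \<open>auto simp: Zset_def\<close>)
  moreover have "(\<Sum>z\<in>Zset x q. 2 ^ hamming_weight z) = weight_sum x q"
    unfolding Zset_def by (subst sum.reindex[OF inj]) (simp add: weight_sum_def)
  ultimately have c: "card {t. pattern t \<in> Zset x q} = weight_sum x q" by simp
  have split: "{t. length t = n} = Tset x n q \<union> {t. pattern t \<in> Zset x q}" using len' by (auto simp: Tset_def)
  have fin: "finite {t :: bool option list. length t = n}" using card_option_lists by blast
  then show f1: "finite (Tset x n q)" by (rule rev_finite_subset) (auto simp: Tset_def)
  have f2: "finite {t. pattern t \<in> Zset x q}" using fin by (rule rev_finite_subset) (use len' in auto)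
  have "card {t :: bool option list. length t = n} = card (Tset x n q) + card {t. pattern t \<in> Zset x q}"
    unfolding split by (rule card_Un_disjoint[OF f1 f2]) (auto simp: Tset_def)
  then show "card (Tset x n q) + weight_sum x q = 3 ^ n" using card_option_lists[of n] c by simp
qed

text \<open>\<open>None\<close> names the matrix block and \<open>Some t\<close> the one-dimensional
  summand of the face \<open>t\<close>.\<close>

definition block_class :: "bool list + bool option list \<Rightarrow> bool option list option" where
  "block_class i = (case i of Inl z \<Rightarrow> None | Inr t \<Rightarrow> Some t)"

lemma is_block_B_alg:
  assumes x: "weight_enumeration n x" and q: "q \<le> 2 ^ n"
  shows "is_block (B_alg x n q) (Zset x q <+> Tset x n q) block_class"
proof -
  let ?r = "3 ^ n - weight_sum x q"
  have bij: "bij_betw x {1..2 ^ n} {b. length b = n}" using x by (simp add: weight_enumeration_def)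
  have inj: "inj_on x {1..q}" using bij q by (auto simp: bij_betw_def intro: inj_on_subset)
  have "bij_betw (\<lambda>i. x (Suc i)) {..<q} (Zset x q)"
    unfolding bij_betw_def
  proof
    show "inj_on (\<lambda>i. x (Suc i)) {..<q}"
    proof (rule inj_onI)
      fix i j assume "i \<in> {..<q}" "j \<in> {..<q}" "x (Suc i) = x (Suc j)"
      then show "i = j" using inj_onD[OF inj, of "Suc i" "Suc j"] by simp
    qed
    have "{1..q} = Suc ` {..<q}" by (simp add: image_Suc_lessThan)
    then show "(\<lambda>i. x (Suc i)) ` {..<q} = Zset x q" unfolding Zset_def by (simp add: image_image)
  qed
  then have 1: "is_block (full_matrix_algebra q) (Zset x q) (\<lambda>_. 0 :: nat)"
    by (rule is_block_relabel[OF is_block_full]) simp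
  have "card (Tset x n q) = ?r" using card_Tset(2)[OF x q] by simp
  then obtain g where g: "bij_betw g {..<?r} (Tset x n q)"
    using ex_bij_betw_nat_finite[OF card_Tset(1)[OF x q]] by (auto simp: atLeast0LessThan)
  have "is_block (complex_power_algebra ?r) (SIGMA p:{..<length (replicate ?r (full_matrix_algebra 1))}. {..<1 :: nat}) (\<lambda>(p, i). (p, 0 :: nat))"
    unfolding complex_power_algebra_def by (rule is_block_direct_sum) (simp add: is_block_full[of 1, simplified])
  then have 2: "is_block (complex_power_algebra ?r) (Tset x n q) (\<lambda>t. t)"
  proof (rule is_block_relabel)
    let ?P = "SIGMA p:{..<length (replicate ?r (full_matrix_algebra 1))}. {..<1 :: nat}"
    have gi: "p < ?r \<Longrightarrow> inv_into {..<?r} g (g p) = p" "p < ?r \<Longrightarrow> g p \<in> Tset x n q" for p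
      using bij_betw_inv_into_left[OF g] bij_betwE[OF g] by simp_all
    have ig: "t \<in> Tset x n q \<Longrightarrow> g (inv_into {..<?r} g t) = t" "t \<in> Tset x n q \<Longrightarrow> inv_into {..<?r} g t < ?r" for t
      using bij_betw_inv_into_right[OF g] bij_betwE[OF bij_betw_inv_into[OF g]] by simp_all
    show "bij_betw (\<lambda>(p, i). g p) ?P (Tset x n q)"
      by (rule bij_betw_byWitness[where f' = "\<lambda>t. (inv_into {..<?r} g t, 0)"]) (use gi ig in force)+
    show "((\<lambda>(p, i). (p, 0 :: nat)) i = (\<lambda>(p, i). (p, 0)) j) = ((\<lambda>(p, i). g p) i = (\<lambda>(p, i). g p) j)"
      if "i \<in> ?P" "j \<in> ?P" for i j
      using that inj_on_eq_iff[OF bij_betw_imp_inj_on[OF g], of "fst i" "fst j"] by (cases i; cases j) simp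
  qed
  have 3: "is_block (direct_sum [complex_power_algebra ?r]) (Tset x n q <+> ({} :: nat set)) (map_sum (\<lambda>t. t) (\<lambda>_. 0 :: nat))"
    by (rule is_block_Cons[OF 2 is_block_Nil])
  have "is_block (B_alg x n q) (Zset x q <+> (Tset x n q <+> ({} :: nat set)))
     (map_sum (\<lambda>_. 0 :: nat) (map_sum (\<lambda>t. t) (\<lambda>_. 0 :: nat)))"
    unfolding B_alg_def by (rule is_block_Cons[OF 1 3])
  then show ?thesis
  proof (rule is_block_relabel)
    \<comment> \<open>The innermost summand comes from the end of the list of direct summands; it is
      empty, so its value \<open>Inl []\<close> is arbitrary.\<close>
    let ?h = "case_sum Inl (case_sum Inr (\<lambda>_. Inl [])) :: bool list + (bool option list + nat) \<Rightarrow> bool list + bool option list"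
    show "bij_betw ?h (Zset x q <+> (Tset x n q <+> {})) (Zset x q <+> Tset x n q)"
      by (rule bij_betw_byWitness[where f' = "case_sum Inl (\<lambda>t. Inr (Inl t))"]) auto
    show "(map_sum (\<lambda>_. 0 :: nat) (map_sum (\<lambda>t. t) (\<lambda>_. 0 :: nat)) i = map_sum (\<lambda>_. 0 :: nat) (map_sum (\<lambda>t. t) (\<lambda>_. 0 :: nat)) j) =
      (block_class (?h i) = block_class (?h j))"
      if "i \<in> Zset x q <+> (Tset x n q <+> {})" "j \<in> Zset x q <+> (Tset x n q <+> {})" for i j
      using that by (auto simp: block_class_def)
  qed
qed

abbreviation code_labels :: "(nat \<Rightarrow> bool list) \<Rightarrow> nat \<Rightarrow> 'y set \<Rightarrow> ('y \<Rightarrow> nat) \<Rightarrow> ('y \<times> (bool list + bool option list)) set" where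
  "code_labels x n Y Q \<equiv> (SIGMA y:Y. Zset x (Q y) <+> Tset x n (Q y))"

abbreviation code_class :: "'y \<times> (bool list + bool option list) \<Rightarrow> 'y \<times> bool option list option" where
  "code_class \<equiv> (\<lambda>(y, i). (y, block_class i))"

text \<open>The bijection \<open>k\<close> replaces positions in the list by classical values, so
  that each value of the register carries one summand.\<close>

lemma is_block_sum_B_alg:
  assumes x: "weight_enumeration n x" and qs: "\<And>q. q \<in> set qs \<Longrightarrow> q \<le> 2 ^ n"
    and k: "bij_betw k Y {..<length qs}"
  shows "is_block (direct_sum (map (B_alg x n) qs)) (code_labels x n Y (\<lambda>y. qs ! k y)) code_class"
proof -
  have "is_block (direct_sum (map (B_alg x n) qs))
    (SIGMA p:{..<length (map (B_alg x n) qs)}. Zset x (qs ! p) <+> Tset x n (qs ! p)) (\<lambda>(p, i). (p, block_class i))"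
    by (rule is_block_direct_sum) (use is_block_B_alg[OF x] qs in auto)
  then show ?thesis
  proof (rule is_block_relabel)
    have inv: "inv_into Y k p \<in> Y" "k (inv_into Y k p) = p" if "p < length qs" for p
      using k that by (auto simp: bij_betw_def intro: inv_into_into f_inv_into_f)
    have inv': "inv_into Y k (k y) = y" "k y < length qs" if "y \<in> Y" for y
      using k that by (auto simp: bij_betw_def)
    show "bij_betw (\<lambda>(p, i). (inv_into Y k p, i)) (SIGMA p:{..<length (map (B_alg x n) qs)}. Zset x (qs ! p) <+> Tset x n (qs ! p))
      (code_labels x n Y (\<lambda>y. qs ! k y))"
      by (rule bij_betw_byWitness[where f' = "\<lambda>(y, i). (k y, i)"]) (auto simp: inv inv')
    show "((\<lambda>(p, i). (p, block_class i)) i = (\<lambda>(p, i). (p, block_class i)) j) =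
      (code_class ((\<lambda>(p, i). (inv_into Y k p, i)) i) = code_class ((\<lambda>(p, i). (inv_into Y k p, i)) j))"
      if "i \<in> (SIGMA p:{..<length (map (B_alg x n) qs)}. Zset x (qs ! p) <+> Tset x n (qs ! p))"
        "j \<in> (SIGMA p:{..<length (map (B_alg x n) qs)}. Zset x (qs ! p) <+> Tset x n (qs ! p))" for i j
      using that by (auto dest: arg_cong[of _ _ k] simp: inv)
  qed
qed

text \<open>The decoder measures the vertex \<open>v\<close> and the block: \<open>E\<^sub>v\<close> maps the uniform superposition of the faces
  with a given pattern to (a multiple of) the basis vector of the only such face that contains \<open>v\<close>.\<close>

lemma cube_transmittable:
  assumes C: "cube_channel n Y \<Lambda> \<beta> \<tau> \<chi>" and x: "weight_enumeration n x"
    and Q: "\<And>y. y \<in> Y \<Longrightarrow> 1 \<le> Q y \<and> Q y \<le> 2 ^ n" and Y: "Y \<noteq> {}"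
    and A: "is_block A (code_labels x n Y Q) code_class"
  shows "transmittable \<Lambda> A"
proof -
  let ?J = "code_labels x n Y Q" and ?d = "idim \<Lambda>" and ?e = "odim \<Lambda>"
  let ?\<alpha> = "\<lambda>r. sqrt ((1 / 2) ^ fdim (snd (\<beta> (\<tau> r))))"
  obtain N e where e: "bij_betw e {..<N} ?J" "A = block_alg N (code_class \<circ> e)" using A by (auto simp: is_block_def)
  have bijx: "bij_betw x {1..2 ^ n} {b. length b = n}" using x by (simp add: weight_enumeration_def)
  have Zlen: "length z = n" if "z \<in> Zset x (Q y)" "y \<in> Y" for z y
    using that bijx Q[OF that(2)] by (auto simp: Zset_def bij_betw_def)
  have comb: "comb_channel \<Lambda> \<tau> \<chi> ?\<alpha>" using C by (simp add: cube_channel_def)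
  have tau: "\<tau> r < ?d" if "r < ?e" for r using comb that by (simp add: comb_channel_def)
  have bb: "bij_betw \<beta> {..<?d} (Y \<times> {t. length t = n})"
    and bs: "bij_betw (\<lambda>r. (\<chi> r, snd (\<beta> (\<tau> r)))) {..<?e} {(\<xi>, t). fst \<xi> \<in> Y \<and> snd \<xi> \<in> vertices n \<and> t \<in> faces_at (snd \<xi>)}"
    and fs: "\<And>r. r < ?e \<Longrightarrow> fst (\<beta> (\<tau> r)) = fst (\<chi> r)"
    using C by (auto simp: cube_channel_def)
  have bY: "fst (\<beta> t) \<in> Y" "length (snd (\<beta> t)) = n" if "t < ?d" for t using bij_betwE[OF bb] that by force+
  have chi: "fst (\<chi> r) \<in> Y" "snd (\<chi> r) \<in> vertices n" "snd (\<beta> (\<tau> r)) \<in> faces_at (snd (\<chi> r))" if "r < ?e" for r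
    using bij_betwE[OF bs] that by force+
  have get: "\<exists>r<?e. \<chi> r = (y, v) \<and> \<beta> (\<tau> r) = (y, t)" if "y \<in> Y" "v \<in> vertices n" "t \<in> faces_at v" for y v t
  proof -
    have "((y, v), t) \<in> (\<lambda>r. (\<chi> r, snd (\<beta> (\<tau> r)))) ` {..<?e}" using bij_betw_imp_surj_on[OF bs] that by auto
    then obtain r where "r < ?e" "\<chi> r = (y, v)" "snd (\<beta> (\<tau> r)) = t" by auto
    then show ?thesis using fs[of r] by (intro exI[of _ r]) (auto simp: prod_eq_iff)
  qed
  have eqr: "r = s" if "r < ?e" "s < ?e" "\<chi> r = \<chi> s" "snd (\<beta> (\<tau> r)) = snd (\<beta> (\<tau> s))" for r s
    using bij_betw_imp_inj_on[OF bs] that by (auto dest: inj_onD)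
  \<comment> \<open>Each input basis vector belongs to exactly one code vector: faces with a used
    pattern are merged, all others stay alone.\<close>
  define lab :: "'a \<times> bool option list \<Rightarrow> 'a \<times> (bool list + bool option list)"
    where "lab p = (fst p, if pattern (snd p) \<in> Zset x (Q (fst p)) then Inl (pattern (snd p)) else Inr (snd p))" for p
  have labJ: "lab (\<beta> t) \<in> ?J" if "t < ?d" for t using bY[OF that] by (auto simp: lab_def Tset_def)
  define \<iota> where "\<iota> t = inv_into {..<N} e (lab (\<beta> t))" for t
  have io: "\<iota> t < N" "e (\<iota> t) = lab (\<beta> t)" if "t < ?d" for t
    using labJ[OF that] e(1) inv_into_into[of "lab (\<beta> t)" e "{..<N}"] f_inv_into_f[of "lab (\<beta> t)" e "{..<N}"]
    by (auto simp: \<iota>_def bij_betw_def)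
  have eJ: "e i \<in> ?J" if "i < N" for i using e(1) that by (auto simp: bij_betw_def)
  have einj: "i = j" if "i < N" "j < N" "e i = e j" for i j
    using bij_betw_imp_inj_on[OF e(1)] that by (auto dest: inj_onD)
  \<comment> \<open>A parallel class has \<open>2^|z|\<close> members, which gives the amplitude of
    its uniform superposition.\<close>
  define b where "b t = (if pattern (snd (\<beta> t)) \<in> Zset x (Q (fst (\<beta> t))) then sqrt ((1 / 2) ^ hamming_weight (pattern (snd (\<beta> t)))) else 1)" for t
  have "transmittable \<Lambda> (block_alg N (code_class \<circ> e))"
  proof (rule transmittable_block[where \<iota> = \<iota> and \<beta> = b, OF comb])
    obtain y where "y \<in> Y" using Y by blast
    then have "(y, Inl (x 1)) \<in> ?J" using Q by (auto simp: Zset_def)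
    then show "0 < N" using e(1) by (cases N) (auto simp: bij_betw_def)
    show "\<iota> t < N" if "t < ?d" for t using io that by blast
    show "inj_on (\<lambda>r. (\<chi> r, \<iota> (\<tau> r))) {..<?e}"
    proof (rule inj_onI)
      fix r s assume rs: "r \<in> {..<?e}" "s \<in> {..<?e}" "(\<chi> r, \<iota> (\<tau> r)) = (\<chi> s, \<iota> (\<tau> s))"
      then have c: "\<chi> r = \<chi> s" and "lab (\<beta> (\<tau> r)) = lab (\<beta> (\<tau> s))" using io(2)[OF tau] by (auto, metis)
      then have "pattern (snd (\<beta> (\<tau> r))) = pattern (snd (\<beta> (\<tau> s)))" by (auto simp: lab_def split: if_splits)
      then have "snd (\<beta> (\<tau> r)) = snd (\<beta> (\<tau> s))" using face_unique chi(3)[of r] chi(3)[of s] rs c by auto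
      then show "r = s" using eqr rs c by auto
    qed
    show "\<exists>s<?e. \<chi> s = \<chi> r \<and> \<iota> (\<tau> s) = j \<and> ?\<alpha> s * b (\<tau> s) = ?\<alpha> r * b (\<tau> r)"
      if r: "r < ?e" and j: "j < N" and cl: "(code_class \<circ> e) j = (code_class \<circ> e) (\<iota> (\<tau> r))" for r j
    proof -
      obtain y v where yv: "\<chi> r = (y, v)" by (cases "\<chi> r")
      define t where "t = snd (\<beta> (\<tau> r))"
      have bt: "\<beta> (\<tau> r) = (y, t)" using fs[OF r] yv by (auto simp: t_def prod_eq_iff)
      have y: "y \<in> Y" and v: "v \<in> vertices n" and t: "t \<in> faces_at v" using chi[OF r] yv by (auto simp: t_def)
      obtain y' i where ej: "e j = (y', i)" by (cases "e j")
      have cl': "y' = y" "block_class i = block_class (snd (lab (y, t)))"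
        using cl io(2)[OF tau[OF r]] bt ej by (auto simp: lab_def)
      show ?thesis
      proof (cases "pattern t \<in> Zset x (Q y)")
        case False
        then have "i = Inr t" using cl' by (auto simp: lab_def block_class_def split: sum.splits)
        then have "e j = e (\<iota> (\<tau> r))" using io(2)[OF tau[OF r]] bt ej cl' False by (simp add: lab_def)
        then have "\<iota> (\<tau> r) = j" using einj j io(1)[OF tau[OF r]] by metis
        then show ?thesis using r by blast
      next
        case True
        then obtain z where z: "i = Inl z" using cl' by (cases i) (auto simp: lab_def block_class_def)
        then have zZ: "z \<in> Zset x (Q y)" using eJ[OF j] ej cl' by auto
        have "length z = length v" using Zlen[OF zZ y] v by (simp add: vertices_def)
        then obtain t' where t': "t' \<in> faces_at v" "pattern t' = z" by (rule face_exists)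
        obtain s where s: "s < ?e" "\<chi> s = (y, v)" "\<beta> (\<tau> s) = (y, t')" using get[OF y v t'(1)] by blast
        have "e (\<iota> (\<tau> s)) = e j" using io(2)[OF tau[OF s(1)]] s(3) t'(2) zZ ej cl'(1) z by (simp add: lab_def)
        then have 1: "\<iota> (\<tau> s) = j" using einj j io(1)[OF tau[OF s(1)]] by metis
        \<comment> \<open>The dimension of a face and the weight of its pattern add up to
          \<open>n\<close>, so the amplitude after the channel is \<open>2^(-n/2)\<close> for every
          pattern: all members of the block look alike at every vertex.\<close>
        have uni: "sqrt ((1 / 2) ^ fdim t) * sqrt ((1 / 2) ^ hamming_weight (pattern t)) = sqrt ((1 / 2 :: real) ^ n)"
          if "length t = n" for t
          using fdim_pattern[of t] that by (simp add: real_sqrt_mult[symmetric] power_add[symmetric])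
        have "length t = n" "length t' = n" using t t'(1) v by (auto simp: vertices_def faces_at_length)
        then have "?\<alpha> s * b (\<tau> s) = ?\<alpha> r * b (\<tau> r)"
          using uni[of t] uni[of t'] True zZ t'(2) by (simp add: bt s(3) b_def)
        then show ?thesis using s(1,2) 1 yv by auto
      qed
    qed
    show "(\<Sum>t | t < ?d \<and> \<iota> t = i. (b t)\<^sup>2) = 1" if i: "i < N" for i
    proof -
      obtain y k where ei: "e i = (y, k)" by (cases "e i")
      then have y: "y \<in> Y" and k: "k \<in> Zset x (Q y) <+> Tset x n (Q y)" using eJ[OF i] by auto
      have iff: "\<iota> t = i \<longleftrightarrow> lab (\<beta> t) = (y, k)" if "t < ?d" for t using io[OF that] einj[OF io(1)[OF that] i] ei by metis
      let ?S = "{t. length t = n \<and> snd (lab (y, t)) = k}"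
      have bijS: "bij_betw (\<lambda>t. snd (\<beta> t)) {t. t < ?d \<and> \<iota> t = i} ?S"
        unfolding bij_betw_def
      proof
        have fy: "fst (\<beta> t) = y" if "t < ?d" "\<iota> t = i" for t using iff that by (auto simp: lab_def)
        show "inj_on (\<lambda>t. snd (\<beta> t)) {t. t < ?d \<and> \<iota> t = i}"
        proof (rule inj_onI)
          fix t t' assume *: "t \<in> {t. t < ?d \<and> \<iota> t = i}" "t' \<in> {t. t < ?d \<and> \<iota> t = i}" "snd (\<beta> t) = snd (\<beta> t')"
          then have "\<beta> t = \<beta> t'" using fy by (auto simp: prod_eq_iff)
          then show "t = t'" using bij_betw_imp_inj_on[OF bb] * by (auto dest: inj_onD)
        qed
        show "(\<lambda>t. snd (\<beta> t)) ` {t. t < ?d \<and> \<iota> t = i} = ?S"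
        proof (intro equalityI subsetI)
          fix w assume "w \<in> (\<lambda>t. snd (\<beta> t)) ` {t. t < ?d \<and> \<iota> t = i}"
          then obtain t where t: "t < ?d" "\<iota> t = i" "w = snd (\<beta> t)" by auto
          then have "\<beta> t = (y, w)" using fy by (auto simp: prod_eq_iff)
          then show "w \<in> ?S" using iff[OF t(1)] t bY(2)[OF t(1)] by auto
        next
          fix w assume w: "w \<in> ?S"
          then have "(y, w) \<in> \<beta> ` {..<?d}" using bij_betw_imp_surj_on[OF bb] y by simp
          then obtain t where t: "t < ?d" "\<beta> t = (y, w)" by auto
          then have "\<iota> t = i" using iff[OF t(1)] w by (auto simp: lab_def)
          then show "w \<in> (\<lambda>t. snd (\<beta> t)) ` {t. t < ?d \<and> \<iota> t = i}" using t by (intro image_eqI[of _ _ t]) auto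
        qed
      qed
      define G where "G t = (if pattern t \<in> Zset x (Q y) then (1 / 2 :: real) ^ hamming_weight (pattern t) else 1)" for t
      have "(\<Sum>t | t < ?d \<and> \<iota> t = i. (b t)\<^sup>2) = (\<Sum>t | t < ?d \<and> \<iota> t = i. G (snd (\<beta> t)))"
        by (intro sum.cong refl) (use iff in \<open>auto simp: b_def G_def lab_def\<close>)
      also have "\<dots> = (\<Sum>t\<in>?S. G t)" by (rule sum.reindex_bij_betw[OF bijS])
      also have "\<dots> = 1"
      proof (cases k)
        case (Inl z)
        then have zZ: "z \<in> Zset x (Q y)" using k by auto
        have "?S = {t. pattern t = z}"
          using Inl zZ Zlen[OF zZ y] by (auto simp: lab_def pattern_def)
        then show ?thesis using card_pattern[of z] zZ by (simp add: G_def power_divide)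
      next
        case (Inr t)
        then have "?S = {t}" using k by (auto simp: lab_def Tset_def)
        then show ?thesis using Inr k by (auto simp: G_def Tset_def)
      qed
      finally show ?thesis .
    qed
    \<comment> \<open>A face of dimension \<open>k\<close> has \<open>2^k\<close> vertices, each
      reached with squared amplitude \<open>2^(-k)\<close>.\<close>
    show "(\<Sum>r | r < ?e \<and> \<tau> r = t. (?\<alpha> r)\<^sup>2) = 1" if t: "t < ?d" for t
    proof -
      obtain y w where yw: "\<beta> t = (y, w)" by (cases "\<beta> t")
      then have y: "y \<in> Y" and w: "length w = n" using bY[OF t] by auto
      have "bij_betw (\<lambda>r. snd (\<chi> r)) {r. r < ?e \<and> \<tau> r = t} {v. w \<in> faces_at v}"
        unfolding bij_betw_def
      proof
        show "inj_on (\<lambda>r. snd (\<chi> r)) {r. r < ?e \<and> \<tau> r = t}"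
        proof (rule inj_onI)
          fix r s assume *: "r \<in> {r. r < ?e \<and> \<tau> r = t}" "s \<in> {r. r < ?e \<and> \<tau> r = t}" "snd (\<chi> r) = snd (\<chi> s)"
          then have "\<chi> r = \<chi> s" using fs[of r] fs[of s] by (auto simp: prod_eq_iff)
          then show "r = s" using eqr * by auto
        qed
        show "(\<lambda>r. snd (\<chi> r)) ` {r. r < ?e \<and> \<tau> r = t} = {v. w \<in> faces_at v}"
        proof (intro equalityI subsetI)
          fix v assume "v \<in> (\<lambda>r. snd (\<chi> r)) ` {r. r < ?e \<and> \<tau> r = t}"
          then show "v \<in> {v. w \<in> faces_at v}" using chi(3) yw by force
        next
          fix v assume "v \<in> {v. w \<in> faces_at v}"
          then have v: "w \<in> faces_at v" by simp
          then have "v \<in> vertices n" using faces_at_length[OF v] w by (simp add: vertices_def)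
          then obtain r where r: "r < ?e" "\<chi> r = (y, v)" "\<beta> (\<tau> r) = (y, w)" using get y v by blast
          then have "\<tau> r = t" using inj_onD[OF bij_betw_imp_inj_on[OF bb], of "\<tau> r" t] tau[OF r(1)] t yw by simp
          then show "v \<in> (\<lambda>r. snd (\<chi> r)) ` {r. r < ?e \<and> \<tau> r = t}" using r by (intro image_eqI[of _ _ r]) auto
        qed
      qed
      then have "card {r. r < ?e \<and> \<tau> r = t} = 2 ^ fdim w" using card_vertices_of_face[of w] by (simp add: bij_betw_same_card)
      moreover have "(\<Sum>r | r < ?e \<and> \<tau> r = t. (?\<alpha> r)\<^sup>2) = (\<Sum>r | r < ?e \<and> \<tau> r = t. (1 / 2) ^ fdim w)"
        by (intro sum.cong refl) (auto simp: yw)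
      ultimately show ?thesis by (simp add: power_divide)
    qed
  qed
  then show ?thesis using e(2) by simp
qed

section \<open>Tensor powers of the channels\<close>

text \<open>The case of one coordinate: an edge and its two endpoints, together with a classical
  register with values in \<open>Y\<close>. The trivial register \<open>{False}\<close> is used for
  \<open>Phi\<close>, the full one for \<open>Psi\<close>.\<close>

definition base_cube ::
  "bool set \<Rightarrow> supermap \<Rightarrow> (nat \<Rightarrow> bool \<times> bool option) \<Rightarrow> (nat \<Rightarrow> nat) \<Rightarrow> (nat \<Rightarrow> bool \<times> bool) \<Rightarrow> bool" where
  "base_cube Y \<Lambda> \<beta> \<tau> \<chi> \<longleftrightarrow>
     bij_betw \<beta> {..<idim \<Lambda>} (Y \<times> UNIV) \<and>
     bij_betw (\<lambda>r. (\<chi> r, snd (\<beta> (\<tau> r)))) {..<odim \<Lambda>} {(\<xi>, t). fst \<xi> \<in> Y \<and> (t = None \<or> t = Some (snd \<xi>))} \<and>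
     (\<forall>r<odim \<Lambda>. fst (\<beta> (\<tau> r)) = fst (\<chi> r)) \<and>
     comb_channel \<Lambda> \<tau> \<chi> (\<lambda>r. if snd (\<beta> (\<tau> r)) = None then sqrt (1 / 2) else 1)"

definition words :: "bool set \<Rightarrow> nat \<Rightarrow> bool list set" where
  "words Y n = {ys. set ys \<subseteq> Y \<and> length ys = n}"

lemma comb_channel_cong:
  assumes "comb_channel \<Lambda> \<tau> \<chi> \<alpha>"
    and "\<And>r s. r < odim \<Lambda> \<Longrightarrow> s < odim \<Lambda> \<Longrightarrow> \<chi> r = \<chi> s \<longleftrightarrow> \<chi>' r = \<chi>' s"
    and "\<And>r. r < odim \<Lambda> \<Longrightarrow> \<alpha> r = \<alpha>' r"
  shows "comb_channel \<Lambda> \<tau> \<chi>' \<alpha>'"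
  using assms(1) unfolding comb_channel_def
  by (auto intro!: eq_matI simp: assms(2,3))

lemma bij_betw_div_mod: "bij_betw (\<lambda>t. (t div D, t mod D)) {..<A * D} ({..<A} \<times> {..<D :: nat})"
proof (rule bij_betw_byWitness[where f' = "\<lambda>(a, b). a * D + b"])
  show "(\<lambda>t. (t div D, t mod D)) ` {..<A * D} \<subseteq> {..<A} \<times> {..<D}"
    using div_mod_less_mult by auto
  show "(\<lambda>(a, b). a * D + b) ` ({..<A} \<times> {..<D}) \<subseteq> {..<A * D}"
    using mult_add_less_mult by auto
qed auto

lemma bij_betw_map_prod':
  "bij_betw f A B \<Longrightarrow> bij_betw g C D \<Longrightarrow> bij_betw (map_prod f g) (A \<times> C) (B \<times> D)"
  unfolding bij_betw_def by (auto intro: map_prod_inj_on simp: map_prod_surj_on)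

text \<open>The new coordinate stands at the head of the lists that describe faces, vertices and
  register words, in accordance with \<open>tensor_power\<close>, which multiplies on the left.
  Dimensions of faces add, amplitudes multiply.\<close>

lemma tensor_power_cube:
  assumes B: "base_cube Y \<Lambda> \<beta> \<tau> \<chi>"
  shows "\<exists>\<beta>' \<tau>' \<chi>'. cube_channel n (words Y n) (tensor_power \<Lambda> n) \<beta>' \<tau>' \<chi>'"
proof (induction n)
  case 0
  have "bij_betw (\<lambda>_ :: nat. ([] :: bool list, [] :: bool option list)) {..<1} (words Y 0 \<times> {t. length t = 0})"
    by (auto simp: bij_betw_def words_def inj_on_def)
  moreover have "bij_betw (\<lambda>_ :: nat. (([] :: bool list, [] :: bool list), [] :: bool option list)) {..<1}
    {(\<xi>, t). fst \<xi> \<in> words Y 0 \<and> snd \<xi> \<in> vertices 0 \<and> t \<in> faces_at (snd \<xi>)}"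
    by (auto simp: bij_betw_def words_def vertices_def inj_on_def)
  moreover have "comb_channel (id_super 1) (\<lambda>_. 0) (\<lambda>_. ([] :: bool list, [] :: bool list)) (\<lambda>_. sqrt ((1 / 2) ^ fdim []))"
    by (auto simp: comb_channel_def id_super_def fdim_def intro!: eq_matI)
  ultimately have "cube_channel 0 (words Y 0) (tensor_power \<Lambda> 0) (\<lambda>_. ([], [])) (\<lambda>_. 0) (\<lambda>_. ([], []))"
    by (simp add: cube_channel_def id_super_def)
  then show ?case by blast
next
  case (Suc n)
  let ?\<Lambda>' = "tensor_power \<Lambda> n"
  obtain \<beta>' \<tau>' \<chi>' where C: "cube_channel n (words Y n) ?\<Lambda>' \<beta>' \<tau>' \<chi>'" using Suc by blast
  let ?D = "idim ?\<Lambda>'" and ?E = "odim ?\<Lambda>'"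
  have io: "idim (tensor_power \<Lambda> (Suc n)) = idim \<Lambda> * ?D" "odim (tensor_power \<Lambda> (Suc n)) = odim \<Lambda> * ?E"
    by (simp_all add: tensor_super_def)
  have cB: "comb_channel \<Lambda> \<tau> \<chi> (\<lambda>r. if snd (\<beta> (\<tau> r)) = None then sqrt (1 / 2) else 1)"
    and cC: "comb_channel ?\<Lambda>' \<tau>' \<chi>' (\<lambda>r. sqrt ((1 / 2) ^ fdim (snd (\<beta>' (\<tau>' r)))))"
    using B C by (auto simp: base_cube_def cube_channel_def)
  have tau: "\<tau> r < idim \<Lambda>" if "r < odim \<Lambda>" for r using cB that by (simp add: comb_channel_def)
  have tau': "\<tau>' r < ?D" if "r < ?E" for r using cC that by (simp add: comb_channel_def)
  let ?g = "\<lambda>(p, q). (fst p # fst q, snd p # snd q)"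
  let ?b = "\<lambda>t. (fst (\<beta> (t div ?D)) # fst (\<beta>' (t mod ?D)), snd (\<beta> (t div ?D)) # snd (\<beta>' (t mod ?D)))"
  let ?t = "\<lambda>r. \<tau> (r div ?E) * ?D + \<tau>' (r mod ?E)"
  let ?x = "\<lambda>r. (fst (\<chi> (r div ?E)) # fst (\<chi>' (r mod ?E)), snd (\<chi> (r div ?E)) # snd (\<chi>' (r mod ?E)))"
  have dm: "?t r div ?D = \<tau> (r div ?E)" "?t r mod ?D = \<tau>' (r mod ?E)" "r div ?E < odim \<Lambda>" "r mod ?E < ?E"
    if "r < odim \<Lambda> * ?E" for r
    using tau'[of "r mod ?E"] div_mod_less_mult[OF that] by auto
  have 1: "bij_betw ?b {..<idim \<Lambda> * ?D} (words Y (Suc n) \<times> {t. length t = Suc n})"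
  proof -
    have "bij_betw (map_prod \<beta> \<beta>') ({..<idim \<Lambda>} \<times> {..<?D}) ((Y \<times> UNIV) \<times> (words Y n \<times> {t. length t = n}))"
      by (rule bij_betw_map_prod') (use B C in \<open>auto simp: base_cube_def cube_channel_def\<close>)
    from bij_betw_trans[OF bij_betw_div_mod this]
    have 2: "bij_betw (map_prod \<beta> \<beta>' \<circ> (\<lambda>t. (t div ?D, t mod ?D))) {..<idim \<Lambda> * ?D} ((Y \<times> UNIV) \<times> (words Y n \<times> {t. length t = n}))" .
    have "bij_betw ?g ((Y \<times> UNIV) \<times> (words Y n \<times> {t. length t = n})) (words Y (Suc n) \<times> {t. length t = Suc n})"
      by (rule bij_betw_byWitness[where f' = "\<lambda>(l, m). ((hd l, hd m), (tl l, tl m))"])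
        (auto simp: words_def length_Suc_conv)
    from bij_betw_trans[OF 2 this] show ?thesis by (simp add: comp_def case_prod_beta)
  qed
  have 2: "bij_betw (\<lambda>r. (?x r, snd (?b (?t r)))) {..<odim \<Lambda> * ?E}
    {(\<xi>, t). fst \<xi> \<in> words Y (Suc n) \<and> snd \<xi> \<in> vertices (Suc n) \<and> t \<in> faces_at (snd \<xi>)}"
  proof -
    let ?f = "\<lambda>r. (\<chi> r, snd (\<beta> (\<tau> r)))" and ?f' = "\<lambda>r. (\<chi>' r, snd (\<beta>' (\<tau>' r)))"
    let ?S = "{(\<xi>, t). fst \<xi> \<in> Y \<and> (t = None \<or> t = Some (snd \<xi>))}"
    let ?S' = "{(\<xi>, t). fst \<xi> \<in> words Y n \<and> snd \<xi> \<in> vertices n \<and> t \<in> faces_at (snd \<xi>)}"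
    have "bij_betw (map_prod ?f ?f') ({..<odim \<Lambda>} \<times> {..<?E}) (?S \<times> ?S')"
      by (rule bij_betw_map_prod') (use B C in \<open>auto simp: base_cube_def cube_channel_def\<close>)
    from bij_betw_trans[OF bij_betw_div_mod this]
    have 3: "bij_betw (map_prod ?f ?f' \<circ> (\<lambda>t. (t div ?E, t mod ?E))) {..<odim \<Lambda> * ?E} (?S \<times> ?S')" .
    let ?k = "\<lambda>(p, q). ((fst (fst p) # fst (fst q), snd (fst p) # snd (fst q)), snd p # snd q)"
    have "bij_betw ?k (?S \<times> ?S') {(\<xi>, t). fst \<xi> \<in> words Y (Suc n) \<and> snd \<xi> \<in> vertices (Suc n) \<and> t \<in> faces_at (snd \<xi>)}"
      by (rule bij_betw_byWitness[where f' = "\<lambda>(\<xi>, t). (((hd (fst \<xi>), hd (snd \<xi>)), hd t), ((tl (fst \<xi>), tl (snd \<xi>)), tl t))"])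
        (auto simp: words_def vertices_def length_Suc_conv faces_at_Cons)
    from bij_betw_trans[OF 3 this]
    show ?thesis by (rule bij_betw_cong[THEN iffD1, rotated]) (use dm in \<open>auto simp: comp_def\<close>)
  qed
  have 3: "fst (?b (?t r)) = fst (?x r)" if "r < odim \<Lambda> * ?E" for r
    using dm[OF that] B C by (auto simp: base_cube_def cube_channel_def)
  have 4: "comb_channel (tensor_power \<Lambda> (Suc n)) ?t ?x (\<lambda>r. sqrt ((1 / 2) ^ fdim (snd (?b (?t r)))))"
    unfolding tensor_power.simps
  proof (rule comb_channel_cong[OF comb_channel_tensor[OF cB cC]])
    fix r assume "r < odim (tensor_super \<Lambda> ?\<Lambda>')"
    then have r: "r < odim \<Lambda> * ?E" using io by simp
    show "(if snd (\<beta> (\<tau> (r div ?E))) = None then sqrt (1 / 2) else 1) * sqrt ((1 / 2) ^ fdim (snd (\<beta>' (\<tau>' (r mod ?E))))) =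
      sqrt ((1 / 2) ^ fdim (snd (?b (?t r))))"
      unfolding snd_conv dm(1,2)[OF r]
      by (cases "snd (\<beta> (\<tau> (r div ?E)))") (simp_all add: fdim_def flip: real_sqrt_mult)
  qed (auto simp: prod_eq_iff)
  show ?case
    unfolding cube_channel_def io by (intro exI[of _ ?b] exI[of _ ?t] exI[of _ ?x] conjI allI impI 1 2 3 4)
qed

text \<open>The Kraus operator has at most one nonzero entry in row \<open>r\<close>, namely at
  column \<open>\<tau> r\<close>; \<open>g\<close> selects the rows that belong to it.\<close>

lemma kraus_entry:
  assumes E: "E \<in> carrier_mat e d" and X: "X \<in> carrier_mat d d" and tau: "\<And>r. r < e \<Longrightarrow> \<tau> r < d"
    and entry: "\<And>r k. r < e \<Longrightarrow> k < d \<Longrightarrow> E $$ (r, k) = (if g r \<and> k = \<tau> r then complex_of_real (\<alpha> r) else 0)"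
    and rs: "r < e" "s < e"
  shows "(E * X * mat_adjoint E) $$ (r, s) = (if g r \<and> g s then of_real (\<alpha> r * \<alpha> s) * X $$ (\<tau> r, \<tau> s) else 0)"
proof -
  have EX: "E * X \<in> carrier_mat e d" using E X by simp
  have 1: "(E * X) $$ (r, l) = (if g r then of_real (\<alpha> r) * X $$ (\<tau> r, l) else 0)" if l: "l < d" for l
  proof -
    have "(E * X) $$ (r, l) = (\<Sum>k<d. if k = \<tau> r then (if g r then of_real (\<alpha> r) * X $$ (\<tau> r, l) else 0) else 0)"
      unfolding index_mult_sum[OF E X rs(1) l] by (intro sum.cong refl) (use rs in \<open>auto simp: entry\<close>)
    then show ?thesis using tau[OF rs(1)] by simp
  qed
  have "(E * X * mat_adjoint E) $$ (r, s) =
    (\<Sum>l<d. if l = \<tau> s then (if g r \<and> g s then of_real (\<alpha> r * \<alpha> s) * X $$ (\<tau> r, \<tau> s) else 0) else 0)"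
    unfolding index_mult_sum[OF EX carrier_adjoint[OF E] rs]
    by (intro sum.cong refl) (use rs in \<open>auto simp: 1 index_adjoint[OF E] entry simp del: index_mult_mat(1)\<close>)
  then show ?thesis using tau[OF rs(2)] by simp
qed

section \<open>The two channels on a single coordinate\<close>

definition phi_in :: "nat \<Rightarrow> bool option" where
  "phi_in t = (if t = 0 then Some False else if t = 1 then None else Some True)"

text \<open>The edge vector \<open>e_1\<close> reaches output 1 through \<open>E0\<close> and output
  2 through \<open>E1\<close>. Outputs 0 and 1 belong to \<open>E0\<close>, outputs 2 and 3 to
  \<open>E1\<close>, hence the label \<open>2 \<le> r\<close> below.\<close>

definition phi_tau :: "nat \<Rightarrow> nat" where
  "phi_tau r = (if r = 0 then 0 else if r = 3 then 2 else 1)"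

abbreviation phi_amp :: "nat \<Rightarrow> real" where
  "phi_amp r \<equiv> (if phi_in (phi_tau r) = None then sqrt (1 / 2) else 1)"

lemma less_4_cases: "r < (4 :: nat) \<Longrightarrow> r = 0 \<or> r = 1 \<or> r = 2 \<or> r = 3" by arith
lemma less_3_cases: "r < (3 :: nat) \<Longrightarrow> r = 0 \<or> r = 1 \<or> r = 2" by arith

lemma comb_channel_Phi: "comb_channel Phi phi_tau (\<lambda>r. 2 \<le> r) phi_amp"
proof -
  have s2: "1 / complex_of_real (sqrt 2) = complex_of_real (sqrt (1 / 2))" by (simp add: real_sqrt_divide)
  have tau: "phi_tau r < 3" for r by (simp add: phi_tau_def)
  have E0: "E0 \<in> carrier_mat 4 3" and E1: "E1 \<in> carrier_mat 4 3" by (auto simp: E0_def E1_def ketbra_def)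
  have E0e: "E0 $$ (r, k) = (if \<not> 2 \<le> r \<and> k = phi_tau r then complex_of_real (phi_amp r) else 0)" if "r < 4" "k < 3" for r k
    using less_4_cases[OF that(1)] less_3_cases[OF that(2)]
    by (elim disjE) (simp_all add: E0_def ketbra_def phi_tau_def phi_in_def s2)
  have E1e: "E1 $$ (r, k) = (if 2 \<le> r \<and> k = phi_tau r then complex_of_real (phi_amp r) else 0)" if "r < 4" "k < 3" for r k
    using less_4_cases[OF that(1)] less_3_cases[OF that(2)]
    by (elim disjE) (simp_all add: E1_def ketbra_def phi_tau_def phi_in_def s2)
  have "E0 * X * mat_adjoint E0 + E1 * X * mat_adjoint E1 =
     mat 4 4 (\<lambda>(r, s). if (2 \<le> r) = (2 \<le> s) then of_real (phi_amp r * phi_amp s) * X $$ (phi_tau r, phi_tau s) else 0)"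
    if X: "X \<in> carrier_mat 3 3" for X
  proof (rule eq_matI)
    have c: "E0 * X * mat_adjoint E0 \<in> carrier_mat 4 4" "E1 * X * mat_adjoint E1 \<in> carrier_mat 4 4"
      using E0 E1 X carrier_adjoint[OF E0] carrier_adjoint[OF E1] by (meson mult_carrier_mat)+
    fix r s assume "r < dim_row (mat 4 4 (\<lambda>(r, s). if (2 \<le> r) = (2 \<le> s) then of_real (phi_amp r * phi_amp s) * X $$ (phi_tau r, phi_tau s) else 0))"
      "s < dim_col (mat 4 4 (\<lambda>(r, s). if (2 \<le> r) = (2 \<le> s) then of_real (phi_amp r * phi_amp s) * X $$ (phi_tau r, phi_tau s) else 0))"
    then have rs: "r < 4" "s < 4" by simp_all
    have k0: "(E0 * X * mat_adjoint E0) $$ (r, s) =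
        (if \<not> 2 \<le> r \<and> \<not> 2 \<le> s then of_real (phi_amp r * phi_amp s) * X $$ (phi_tau r, phi_tau s) else 0)"
      by (rule kraus_entry[OF E0 X tau E0e rs])
    have k1: "(E1 * X * mat_adjoint E1) $$ (r, s) =
        (if 2 \<le> r \<and> 2 \<le> s then of_real (phi_amp r * phi_amp s) * X $$ (phi_tau r, phi_tau s) else 0)"
      by (rule kraus_entry[OF E1 X tau E1e rs])
    have "(E0 * X * mat_adjoint E0 + E1 * X * mat_adjoint E1) $$ (r, s) =
      (E0 * X * mat_adjoint E0) $$ (r, s) + (E1 * X * mat_adjoint E1) $$ (r, s)"
      by (rule index_add_mat(1)) (use rs c in auto)
    also have "\<dots> = (if (2 \<le> r) = (2 \<le> s) then of_real (phi_amp r * phi_amp s) * X $$ (phi_tau r, phi_tau s) else 0)"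
      unfolding k0 k1 by (cases "2 \<le> r"; cases "2 \<le> s") (simp_all only: simp_thms if_True if_False add_0_left add_0_right)
    finally show "(E0 * X * mat_adjoint E0 + E1 * X * mat_adjoint E1) $$ (r, s) =
      mat 4 4 (\<lambda>(r, s). if (2 \<le> r) = (2 \<le> s) then of_real (phi_amp r * phi_amp s) * X $$ (phi_tau r, phi_tau s) else 0) $$ (r, s)"
      using rs by simp
  next
    have c: "E1 * X * mat_adjoint E1 \<in> carrier_mat 4 4"
      using E1 X carrier_adjoint[OF E1] by (meson mult_carrier_mat)
    then show "dim_row (E0 * X * mat_adjoint E0 + E1 * X * mat_adjoint E1) = dim_row (mat 4 4 (\<lambda>(r, s). if (2 \<le> r) = (2 \<le> s) then complex_of_real (phi_amp r * phi_amp s) * X $$ (phi_tau r, phi_tau s) else 0))"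
      "dim_col (E0 * X * mat_adjoint E0 + E1 * X * mat_adjoint E1) = dim_col (mat 4 4 (\<lambda>(r, s). if (2 \<le> r) = (2 \<le> s) then complex_of_real (phi_amp r * phi_amp s) * X $$ (phi_tau r, phi_tau s) else 0))"
      by auto
  qed
  then show ?thesis unfolding comb_channel_def using tau by (simp add: Phi_def)
qed

lemma comb_channel_Delta2: "comb_channel Delta2 (\<lambda>r. r) (\<lambda>r. r) (\<lambda>_. 1)"
proof -
  let ?K = "\<lambda>i. ketbra (unit_vec 2 i) (unit_vec 2 i)"
  have K: "?K i \<in> carrier_mat 2 2" for i by (simp add: ketbra_def)
  have Ke: "?K i $$ (r, k) = (if r = i \<and> k = r then complex_of_real 1 else 0)" if "r < 2" "k < 2" "i < 2" for r k i
    using that by (auto simp: ketbra_def)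
  have Ka: "mat_adjoint (?K i) = ?K i" if "i < 2" for i
  proof (rule eq_matI)
    fix r k assume "r < dim_row (?K i)" "k < dim_col (?K i)"
    then have rk: "r < 2" "k < 2" by (simp_all add: ketbra_def)
    show "mat_adjoint (?K i) $$ (r, k) = ?K i $$ (r, k)"
      unfolding index_adjoint[OF K rk] Ke[OF rk that] Ke[OF rk(2,1) that] by auto
  qed (use carrier_adjoint[OF K[of i]] K[of i] in auto)
  have "?K 0 * X * ?K 0 + ?K 1 * X * ?K 1 = mat 2 2 (\<lambda>(r, s). if r = s then of_real (1 * 1) * X $$ (r, s) else 0)"
    if X: "X \<in> carrier_mat 2 2" for X :: "complex mat"
  proof (rule eq_matI)
    have c: "?K i * X * ?K i \<in> carrier_mat 2 2" for i using K X by (meson mult_carrier_mat)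
    fix r s assume "r < dim_row (mat 2 2 (\<lambda>(r, s). if r = s then of_real (1 * 1) * X $$ (r, s) else 0))"
      "s < dim_col (mat 2 2 (\<lambda>(r, s). if r = s then of_real (1 * 1) * X $$ (r, s) else 0))"
    then have rs: "r < 2" "s < 2" by simp_all
    have e: "(?K i * X * ?K i) $$ (r, s) = (if r = i \<and> s = i then of_real (1 * 1) * X $$ (r, s) else 0)" if "i < 2" for i
      using kraus_entry[of "?K i" 2 2 X "\<lambda>r. r" "\<lambda>r. r = i" "\<lambda>_. 1", OF K X _ Ke[OF _ _ that] rs] Ka[OF that] by simp
    have "(?K 0 * X * ?K 0 + ?K 1 * X * ?K 1) $$ (r, s) = (?K 0 * X * ?K 0) $$ (r, s) + (?K 1 * X * ?K 1) $$ (r, s)"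
      by (rule index_add_mat(1)) (use rs c[of 1] in auto)
    then show "(?K 0 * X * ?K 0 + ?K 1 * X * ?K 1) $$ (r, s) = mat 2 2 (\<lambda>(r, s). if r = s then of_real (1 * 1) * X $$ (r, s) else 0) $$ (r, s)"
      using rs e[of 0] e[of 1] by (auto simp del: index_mult_mat(1))
  qed (auto simp: ketbra_def)
  then show ?thesis unfolding comb_channel_def by (simp add: Delta2_def)
qed

lemma bool_option_UNIV: "(UNIV :: bool option set) = {Some False, None, Some True}"
proof -
  have "x \<in> {Some False, None, Some True}" for x :: "bool option" by (cases x) auto
  then show ?thesis by blast
qed

lemma base_cube_Phi: "base_cube {False} Phi (\<lambda>t. (False, phi_in t)) phi_tau (\<lambda>r. (False, 2 \<le> r))"
proof -
  have io: "idim Phi = 3" "odim Phi = 4" by (simp_all add: Phi_def)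
  have n3: "{..<3 :: nat} = {0, 1, 2}" and n4: "{..<4 :: nat} = {0, 1, 2, 3}" by auto
  have 1: "bij_betw (\<lambda>t. (False, phi_in t)) {..<3} ({False} \<times> UNIV)"
    unfolding bij_betw_def n3 bool_option_UNIV by (auto simp: phi_in_def)
  have 2: "bij_betw (\<lambda>r :: nat. ((False, 2 \<le> r), phi_in (phi_tau r))) {..<4} {(\<xi>, t). fst \<xi> \<in> {False} \<and> (t = None \<or> t = Some (snd \<xi>))}"
  proof -
    have "{(\<xi>, t). fst \<xi> \<in> {False} \<and> (t = None \<or> t = Some (snd \<xi>))} =
      {((False, False), Some False), ((False, False), None), ((False, True), None), ((False, True), Some True)}"
      by auto
    then show ?thesis unfolding bij_betw_def n4 by (simp add: phi_in_def phi_tau_def)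
  qed
  have 3: "comb_channel Phi phi_tau (\<lambda>r. (False, 2 \<le> r)) phi_amp"
    by (rule comb_channel_cong[OF comb_channel_Phi]) auto
  show ?thesis unfolding base_cube_def io using 1 2 3 by simp
qed

text \<open>An input index of \<open>Psi\<close> is three times the register value plus an index of
  \<open>Phi\<close>, an output index four times it. Dephasing makes the register value part of the
  Kraus label.\<close>

lemma base_cube_Psi:
  "base_cube UNIV Psi (\<lambda>t. (t div 3 = 1, phi_in (t mod 3))) (\<lambda>r. (r div 4) * 3 + phi_tau (r mod 4)) (\<lambda>r. (r div 4 = 1, 2 \<le> r mod 4))"
proof -
  have io: "idim Psi = 6" "odim Psi = 8" "idim Phi = 3" "odim Phi = 4"
    by (simp_all add: Psi_def tensor_super_def Phi_def Delta2_def)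
  have n6: "{..<6 :: nat} = {0, 1, 2, 3, 4, 5}" and n8: "{..<8 :: nat} = {0, 1, 2, 3, 4, 5, 6, 7}" by auto
  have dm: "(r div 4 * 3 + phi_tau (r mod 4)) div 3 = r div 4" "(r div 4 * 3 + phi_tau (r mod 4)) mod 3 = phi_tau (r mod 4)" for r
    by (auto simp: phi_tau_def)
  have 1: "bij_betw (\<lambda>t :: nat. (t div 3 = 1, phi_in (t mod 3))) {..<6} (UNIV \<times> UNIV)"
    unfolding bij_betw_def n6 bool_option_UNIV UNIV_bool by (auto simp: phi_in_def)
  have 2: "bij_betw (\<lambda>r :: nat. ((r div 4 = 1, 2 \<le> r mod 4), phi_in (phi_tau (r mod 4)))) {..<8}
    {(\<xi>, t). fst \<xi> \<in> UNIV \<and> (t = None \<or> t = Some (snd \<xi>))}"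
  proof -
    have "{(\<xi> :: bool \<times> bool, t). fst \<xi> \<in> UNIV \<and> (t = None \<or> t = Some (snd \<xi>))} =
      {((False, False), Some False), ((False, False), None), ((False, True), None), ((False, True), Some True),
       ((True, False), Some False), ((True, False), None), ((True, True), None), ((True, True), Some True)}"
      by auto
    then show ?thesis unfolding bij_betw_def n8 by (simp add: phi_in_def phi_tau_def)
  qed
  have 3: "comb_channel Psi (\<lambda>r. r div 4 * 3 + phi_tau (r mod 4)) (\<lambda>r. (r div 4 = 1, 2 \<le> r mod 4)) (\<lambda>r. phi_amp (r mod 4))"
    using comb_channel_tensor[OF comb_channel_Delta2 comb_channel_Phi] unfolding Psi_def[symmetric] io
  proof (rule comb_channel_cong)
    fix r s assume "r < odim Psi" "s < odim Psi"
    then have "r div 4 < 2" "s div 4 < 2" by (auto simp: io)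
    then show "((r div 4, 2 \<le> r mod 4) = (s div 4, 2 \<le> s mod 4)) = ((r div 4 = 1, 2 \<le> r mod 4) = (s div 4 = 1, 2 \<le> s mod 4))"
      by (auto simp: less_2_cases_iff)
  qed simp
  show ?thesis unfolding base_cube_def io dm snd_conv fst_conv using 1 2 3 by simp
qed

section \<open>Isomorphism classes of transmittable algebras\<close>

text \<open>Along an isomorphism a full system of matrix units is carried into the target, so that
  block sizes can be compared inside one algebra.\<close>

lemma fmat_hom_transport:
  assumes S: "subalg d S" and h: "fmat_hom S T h" "bij_betw h S T" and f: "full_matrix_units S I c f"
  shows "full_matrix_units T I c (\<lambda>i j. h (f i j))"
proof -
  have mu: "matrix_units S I c f" using f by (simp add: full_matrix_units_def)
  note F = matrix_unitsD[OF mu] and H = fmat_homD[OF h(1)]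
  have h0: "h 0 = 0" using H(3)[OF subalgD(2)[OF S], of 0] by simp
  have hz: "X = 0" if "X \<in> S" "h X = 0" for X
    using inj_onD[OF bij_betw_imp_inj_on[OF h(2)], of X 0] that h0 subalgD(2)[OF S] by simp
  have surj: "\<exists>X\<in>S. Z = h X" if "Z \<in> T" for Z using bij_betw_imp_surj_on[OF h(2)] that by blast
  have fS: "f i j \<in> S" if "i \<in> I" "j \<in> I" "c i = c j" for i j using F(2) that by blast
  have "h (f i j) * h (f k l) = (if j = k then h (f i l) else 0)"
    if "i \<in> I" "j \<in> I" "k \<in> I" "l \<in> I" "c i = c j" "c k = c l" for i j k l
    by (subst H(4)[OF fS[OF that(1,2,5)] fS[OF that(3,4,6)], symmetric], subst F(5)[OF that]) (simp only: h0 if_distrib[of h])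
  moreover have "star (h (f i j)) = h (f j i)" if "i \<in> I" "j \<in> I" "c i = c j" for i j
    using H(5)[OF fS[OF that]] F(3)[OF that] by simp
  moreover have "h (f i i) \<noteq> 0" if "i \<in> I" for i using hz[OF fS] F(4) that by blast
  moreover have "\<exists>a. h (f i i) * Z * h (f j j) = (if c i = c j then sc a (h (f i j)) else 0)"
    if ij: "i \<in> I" "j \<in> I" and Z: "Z \<in> T" for i j Z
  proof -
    obtain X where X: "X \<in> S" "Z = h X" using surj Z by blast
    have m: "h (f i i) * Z * h (f j j) = h (f i i * X * f j j)"
      using H(4)[OF fS[OF ij(1) ij(1) refl] X(1)] H(4)[OF subalgD(5)[OF S fS[OF ij(1) ij(1) refl] X(1)] fS[OF ij(2) ij(2) refl]] X(2) by simp
    show ?thesis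
    proof (cases "c i = c j")
      case True
      then obtain a where "f i i * X * f j j = sc a (f i j)" using F(6)[OF ij X(1)] by blast
      then show ?thesis using m True H(3)[OF fS[OF ij True]] by auto
    next
      case False
      then show ?thesis using m F(7)[OF ij X(1)] h0 by simp
    qed
  qed
  moreover have "Z = 0" if Z: "Z \<in> T" "\<forall>i\<in>I. h (f i i) * Z = 0" for Z
  proof -
    obtain X where X: "X \<in> S" "Z = h X" using surj Z by blast
    have "f i i * X = 0" if i: "i \<in> I" for i
    proof (rule hz)
      show "f i i * X \<in> S" using subalgD(5)[OF S fS X(1)] i by blast
      show "h (f i i * X) = 0" using H(4)[OF fS X(1), of i i] Z(2) X(2) i by simp
    qed
    then have "X = 0" using f X(1) unfolding full_matrix_units_def by blast
    then show ?thesis using X(2) h0 by simp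
  qed
  ultimately show ?thesis
    unfolding full_matrix_units_def matrix_units_def using F(1) H(1)[OF fS] by (intro conjI ballI allI impI) blast+
qed

lemma star_subalgebraD:
  assumes "star_subalgebra d A"
  shows "X \<in> A \<Longrightarrow> X \<in> carrier_mat d d" "0\<^sub>m d d \<in> A" "X \<in> A \<Longrightarrow> Y \<in> A \<Longrightarrow> X + Y \<in> A"
    "X \<in> A \<Longrightarrow> c \<cdot>\<^sub>m X \<in> A" "X \<in> A \<Longrightarrow> Y \<in> A \<Longrightarrow> X * Y \<in> A" "X \<in> A \<Longrightarrow> mat_adjoint X \<in> A"
  using assms by (auto simp: star_subalgebra_def)

lemma star_homD:
  assumes "star_hom A B \<pi>" "X \<in> A"
  shows "\<pi> X \<in> B" "Y \<in> A \<Longrightarrow> \<pi> (X + Y) = \<pi> X + \<pi> Y" "\<pi> (c \<cdot>\<^sub>m X) = c \<cdot>\<^sub>m \<pi> X"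
    "Y \<in> A \<Longrightarrow> \<pi> (X * Y) = \<pi> X * \<pi> Y" "\<pi> (mat_adjoint X) = mat_adjoint (\<pi> X)"
  using assms by (auto simp: star_hom_def)

lemma inj_on_to_fmat: "star_subalgebra d A \<Longrightarrow> inj_on to_fmat A"
  by (rule inj_onI) (rule to_fmat_inject[of _ d], simp_all add: star_subalgebraD(1))

lemma star_hom_to_fmat:
  assumes A: "star_subalgebra d A" and B: "star_subalgebra e B" and \<pi>: "star_hom A B \<pi>"
  obtains h where "fmat_hom (to_fmat ` A) (to_fmat ` B) h" "\<And>X. X \<in> A \<Longrightarrow> h (to_fmat X) = to_fmat (\<pi> X)"
proof -
  define h where "h Z = to_fmat (\<pi> (inv_into A to_fmat Z))" for Z
  have h: "h (to_fmat X) = to_fmat (\<pi> X)" if "X \<in> A" for X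
    using inv_into_f_f[OF inj_on_to_fmat[OF A] that] by (simp add: h_def)
  note DA = star_subalgebraD[OF A] and DB = star_subalgebraD[OF B] and P = star_homD[OF \<pi>]
  have "fmat_hom (to_fmat ` A) (to_fmat ` B) h"
    unfolding fmat_hom_def
  proof (intro conjI ballI allI)
    fix Z a assume "Z \<in> to_fmat ` A"
    then obtain X where X: "X \<in> A" "Z = to_fmat X" by blast
    show "h Z \<in> to_fmat ` B" using h P(1) X by simp
    show "h (sc a Z) = sc a (h Z)"
      unfolding X(2) to_fmat_smult[symmetric] h[OF X(1)] h[OF DA(4)[OF X(1)]] P(3)[OF X(1)] ..
    show "h (star Z) = star (h Z)"
      unfolding X(2) to_fmat_adjoint[OF DA(1)[OF X(1)], symmetric] h[OF X(1)] h[OF DA(6)[OF X(1)]] P(5)[OF X(1)]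
      by (rule to_fmat_adjoint[OF DB(1)[OF P(1)[OF X(1)]]])
    fix W assume "W \<in> to_fmat ` A"
    then obtain Y where Y: "Y \<in> A" "W = to_fmat Y" by blast
    show "h (Z + W) = h Z + h W"
      unfolding X(2) Y(2) to_fmat_add[OF DA(1)[OF X(1)] DA(1)[OF Y(1)], symmetric] h[OF X(1)] h[OF Y(1)] h[OF DA(3)[OF X(1) Y(1)]]
        P(2)[OF X(1) Y(1)] by (rule to_fmat_add[OF DB(1)[OF P(1)[OF X(1)]] DB(1)[OF P(1)[OF Y(1)]]])
    show "h (Z * W) = h Z * h W"
      unfolding X(2) Y(2) to_fmat_mult[OF DA(1)[OF X(1)] DA(1)[OF Y(1)], symmetric] h[OF X(1)] h[OF Y(1)] h[OF DA(5)[OF X(1) Y(1)]]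
        P(4)[OF X(1) Y(1)] by (rule to_fmat_mult[OF DB(1)[OF P(1)[OF X(1)]] DB(1)[OF P(1)[OF Y(1)]]])
  qed
  then show thesis using that h by blast
qed

lemma fmat_hom_star_iso:
  assumes A: "star_subalgebra d A" and B: "star_subalgebra e B"
    and h: "fmat_hom (to_fmat ` A) (to_fmat ` B) h" "bij_betw h (to_fmat ` A) (to_fmat ` B)"
  shows "star_iso A B"
proof -
  note DA = star_subalgebraD[OF A] and DB = star_subalgebraD[OF B] and H = fmat_homD[OF h(1)]
  define \<pi> where "\<pi> X = inv_into B to_fmat (h (to_fmat X))" for X
  have \<pi>: "\<pi> X \<in> B" "to_fmat (\<pi> X) = h (to_fmat X)" if "X \<in> A" for X
  proof -
    have im: "h (to_fmat X) \<in> to_fmat ` B" by (rule H(1)[OF imageI[OF that]])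
    show "\<pi> X \<in> B" unfolding \<pi>_def by (rule inv_into_into[OF im])
    show "to_fmat (\<pi> X) = h (to_fmat X)" unfolding \<pi>_def by (rule f_inv_into_f[OF im])
  qed
  have eqB: "U = W" if "U \<in> B" "W \<in> B" "to_fmat U = to_fmat W" for U W
    by (rule inj_onD[OF inj_on_to_fmat[OF B] that(3,1,2)])
  have "star_hom A B \<pi>"
    unfolding star_hom_def
  proof (intro conjI ballI allI)
    fix X a assume X: "X \<in> A"
    show "\<pi> X \<in> B" by (rule \<pi>(1)[OF X])
    show "\<pi> (a \<cdot>\<^sub>m X) = a \<cdot>\<^sub>m \<pi> X"
    proof (rule eqB)
      show "to_fmat (\<pi> (a \<cdot>\<^sub>m X)) = to_fmat (a \<cdot>\<^sub>m \<pi> X)"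
        unfolding \<pi>(2)[OF DA(4)[OF X]] to_fmat_smult \<pi>(2)[OF X] by (rule H(3)[OF imageI[OF X]])
    qed (use \<pi>(1) DA(4) DB(4) X in auto)
    show "\<pi> (mat_adjoint X) = mat_adjoint (\<pi> X)"
    proof (rule eqB)
      show "to_fmat (\<pi> (mat_adjoint X)) = to_fmat (mat_adjoint (\<pi> X))"
        unfolding \<pi>(2)[OF DA(6)[OF X]] to_fmat_adjoint[OF DA(1)[OF X]] to_fmat_adjoint[OF DB(1)[OF \<pi>(1)[OF X]]] \<pi>(2)[OF X]
        by (rule H(5)[OF imageI[OF X]])
    qed (use \<pi>(1) DA(6) DB(6) X in auto)
    fix Y assume Y: "Y \<in> A"
    show "\<pi> (X + Y) = \<pi> X + \<pi> Y"
    proof (rule eqB)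
      show "to_fmat (\<pi> (X + Y)) = to_fmat (\<pi> X + \<pi> Y)"
        unfolding \<pi>(2)[OF DA(3)[OF X Y]] to_fmat_add[OF DA(1)[OF X] DA(1)[OF Y]]
          to_fmat_add[OF DB(1)[OF \<pi>(1)[OF X]] DB(1)[OF \<pi>(1)[OF Y]]] \<pi>(2)[OF X] \<pi>(2)[OF Y]
        by (rule H(2)[OF imageI[OF X] imageI[OF Y]])
    qed (use \<pi>(1) DA(3) DB(3) X Y in auto)
    show "\<pi> (X * Y) = \<pi> X * \<pi> Y"
    proof (rule eqB)
      show "to_fmat (\<pi> (X * Y)) = to_fmat (\<pi> X * \<pi> Y)"
        unfolding \<pi>(2)[OF DA(5)[OF X Y]] to_fmat_mult[OF DA(1)[OF X] DA(1)[OF Y]]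
          to_fmat_mult[OF DB(1)[OF \<pi>(1)[OF X]] DB(1)[OF \<pi>(1)[OF Y]]] \<pi>(2)[OF X] \<pi>(2)[OF Y]
        by (rule H(4)[OF imageI[OF X] imageI[OF Y]])
    qed (use \<pi>(1) DA(5) DB(5) X Y in auto)
  qed
  moreover have "bij_betw \<pi> A B"
  proof -
    have "bij_betw to_fmat A (to_fmat ` A)" using inj_on_to_fmat[OF A] by (rule inj_on_imp_bij_betw)
    moreover have "bij_betw (inv_into B to_fmat) (to_fmat ` B) B"
      by (rule bij_betw_inv_into[OF inj_on_imp_bij_betw[OF inj_on_to_fmat[OF B]]])
    ultimately have "bij_betw (inv_into B to_fmat \<circ> (h \<circ> to_fmat)) A B" using h(2) by (blast intro: bij_betw_trans)
    then show ?thesis by (simp add: \<pi>_def[abs_def] comp_def)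
  qed
  ultimately show ?thesis unfolding star_iso_def by blast
qed

section \<open>Isomorphism as an equivalence relation and the counting of classes\<close>

lemma star_hom_comp: "star_hom A B \<pi> \<Longrightarrow> star_hom B C \<rho> \<Longrightarrow> star_hom A C (\<rho> \<circ> \<pi>)"
  unfolding star_hom_def by simp

lemma star_iso_trans: "star_iso A B \<Longrightarrow> star_iso B C \<Longrightarrow> star_iso A C"
  unfolding star_iso_def by (elim exE conjE, rule exI, rule conjI, erule (1) star_hom_comp, erule (1) bij_betw_trans)

lemma star_iso_refl: "star_iso A A"
  unfolding star_iso_def by (intro exI[of _ "\<lambda>X. X"]) (auto simp: star_hom_def bij_betw_def)

lemma star_iso_sym:
  assumes A: "star_subalgebra d A" and "star_iso A B"
  shows "star_iso B A"
proof -
  note DA = star_subalgebraD[OF A]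
  obtain \<pi> where \<pi>: "star_hom A B \<pi>" "bij_betw \<pi> A B" using assms(2) by (auto simp: star_iso_def)
  note P = star_homD[OF \<pi>(1)]
  let ?i = "inv_into A \<pi>"
  have i: "?i (\<pi> X) = X" if "X \<in> A" for X using bij_betw_inv_into_left[OF \<pi>(2) that] .
  have ex: "\<exists>X\<in>A. Z = \<pi> X" if "Z \<in> B" for Z using bij_betw_imp_surj_on[OF \<pi>(2)] that by blast
  have "star_hom B A ?i"
    unfolding star_hom_def
  proof (intro conjI ballI allI)
    fix Z a assume "Z \<in> B"
    then obtain X where X: "X \<in> A" "Z = \<pi> X" using ex by blast
    show "?i Z \<in> A" using i X by simp
    show "?i (a \<cdot>\<^sub>m Z) = a \<cdot>\<^sub>m ?i Z" unfolding X(2) P(3)[OF X(1), symmetric] i[OF X(1)] by (rule i[OF DA(4)[OF X(1)]])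
    show "?i (mat_adjoint Z) = mat_adjoint (?i Z)" unfolding X(2) P(5)[OF X(1), symmetric] i[OF X(1)] by (rule i[OF DA(6)[OF X(1)]])
    fix W assume "W \<in> B"
    then obtain Y where Y: "Y \<in> A" "W = \<pi> Y" using ex by blast
    show "?i (Z + W) = ?i Z + ?i W"
      unfolding X(2) Y(2) P(2)[OF X(1) Y(1), symmetric] i[OF X(1)] i[OF Y(1)] by (rule i[OF DA(3)[OF X(1) Y(1)]])
    show "?i (Z * W) = ?i Z * ?i W"
      unfolding X(2) Y(2) P(4)[OF X(1) Y(1), symmetric] i[OF X(1)] i[OF Y(1)] by (rule i[OF DA(5)[OF X(1) Y(1)]])
  qed
  then show ?thesis unfolding star_iso_def using bij_betw_inv_into[OF \<pi>(2)] by blast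
qed

lemma equiv_star_iso_rel: "equiv {A. cstar_algebra A} star_iso_rel"
proof (rule equivI)
  show "star_iso_rel \<subseteq> {A. cstar_algebra A} \<times> {A. cstar_algebra A}" by (auto simp: star_iso_rel_def)
  show "refl_on {A. cstar_algebra A} star_iso_rel" by (auto simp: refl_on_def star_iso_rel_def star_iso_refl)
  show "sym star_iso_rel" unfolding sym_def star_iso_rel_def cstar_algebra_def using star_iso_sym by blast
  show "trans star_iso_rel" unfolding trans_def star_iso_rel_def using star_iso_trans by blast
qed

lemma maximal_cstar: "maximal_transmittable \<Lambda> A \<Longrightarrow> cstar_algebra A"
  by (simp add: maximal_transmittable_def transmittable_def)

text \<open>The list holds the block labels of a full system of matrix units in an isomorphic copy
  \<open>A'\<close>. It determines the algebra up to isomorphism, though one algebra may have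
  several such lists.\<close>

definition shape :: "complex mat set \<Rightarrow> nat list \<Rightarrow> bool" where
  "shape A xs \<longleftrightarrow> (\<exists>d A' f. star_subalgebra d A' \<and> star_iso A A' \<and>
     full_matrix_units (to_fmat ` A') {..<length xs} (\<lambda>i. xs ! i) f)"

lemma same_shape_iso:
  assumes "cstar_algebra A" "cstar_algebra B" "shape A xs" "shape B xs"
  shows "star_iso A B"
proof -
  obtain d A' f where A': "star_subalgebra d A'" "star_iso A A'" "full_matrix_units (to_fmat ` A') {..<length xs} (\<lambda>i. xs ! i) f"
    using assms(3) by (auto simp: shape_def)
  obtain e B' g where B': "star_subalgebra e B'" "star_iso B B'" "full_matrix_units (to_fmat ` B') {..<length xs} (\<lambda>i. xs ! i) g"
    using assms(4) by (auto simp: shape_def)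
  obtain h where "fmat_hom (to_fmat ` A') (to_fmat ` B') h" "bij_betw h (to_fmat ` A') (to_fmat ` B')"
    using same_units_iso[OF subalg_to_fmat[OF A'(1)] subalg_to_fmat[OF B'(1)] A'(3) B'(3)] by blast
  then have "star_iso A' B'" by (rule fmat_hom_star_iso[OF A'(1) B'(1)])
  moreover have "star_iso B' B" using star_iso_sym B'(2) assms(2) by (auto simp: cstar_algebra_def)
  ultimately show ?thesis using A'(2) star_iso_trans by blast
qed

lemma transmittable_shape:
  assumes "transmittable \<Lambda> A"
  shows "\<exists>xs. set xs \<subseteq> {..<idim \<Lambda>} \<and> length xs \<le> idim \<Lambda> \<and> shape A xs"
proof -
  obtain \<pi> where \<pi>: "star_hom A (full_matrix_algebra (idim \<Lambda>)) \<pi>" "inj_on \<pi> A" "correctable \<Lambda> (\<pi> ` A)"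
    using assms by (auto simp: transmittable_def)
  have S: "star_subalgebra (idim \<Lambda>) (\<pi> ` A)" using \<pi>(3) by (simp add: correctable_def)
  have "star_hom A (\<pi> ` A) \<pi>" using \<pi>(1) by (auto simp: star_hom_def)
  then have iso: "star_iso A (\<pi> ` A)" unfolding star_iso_def using \<pi>(2) inj_on_imp_bij_betw by blast
  obtain N f and c :: "nat \<Rightarrow> nat" where f: "full_matrix_units (to_fmat ` \<pi> ` A) {..<N} c f"
    and N: "N \<le> idim \<Lambda>" and c: "c ` {..<N} \<subseteq> {..<N}"
    by (rule full_matrix_units_exist[OF subalg_to_fmat[OF S]])
  let ?xs = "map c [0..<N]"
  have "full_matrix_units (to_fmat ` \<pi> ` A) {..<length ?xs} (\<lambda>i. ?xs ! i) (\<lambda>i j. f (id i) (id j))"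
    by (rule full_matrix_units_relabel[OF f, of id]) simp_all
  then have "shape A ?xs" unfolding shape_def using S iso by blast
  moreover have "set ?xs \<subseteq> {..<idim \<Lambda>}" using c N by fastforce
  moreover have "length ?xs \<le> idim \<Lambda>" using N by simp
  ultimately show ?thesis by blast
qed

text \<open>\<open>card\<close> of an infinite set is 0, so a lower bound for the width presupposes
  finitely many classes. A transmittable algebra has a shape of length at most
  \<open>idim \<Lambda>\<close> over a finite alphabet, and the shape determines the class.\<close>

lemma finite_max_classes: "finite (max_classes \<Lambda>)"
proof -
  let ?M = "{A. maximal_transmittable \<Lambda> A}"
  let ?L = "{xs. set xs \<subseteq> {..<idim \<Lambda>} \<and> length xs \<le> idim \<Lambda>}"
  let ?F = "\<lambda>xs. star_iso_rel `` {SOME A. A \<in> ?M \<and> shape A xs}"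
  have "max_classes \<Lambda> \<subseteq> ?F ` ?L"
  proof
    fix X assume "X \<in> max_classes \<Lambda>"
    then obtain A where A: "A \<in> ?M" "X = star_iso_rel `` {A}" by (auto simp: max_classes_def quotient_def)
    then have "transmittable \<Lambda> A" by (simp add: maximal_transmittable_def)
    from transmittable_shape[OF this] obtain xs where xs: "xs \<in> ?L" "shape A xs" by blast
    define B where "B = (SOME A. A \<in> ?M \<and> shape A xs)"
    have B: "B \<in> ?M \<and> shape B xs" unfolding B_def by (rule someI[of _ A]) (use A xs in auto)
    have cs: "cstar_algebra A" "cstar_algebra B" using A B maximal_cstar by auto
    then have "(A, B) \<in> star_iso_rel" using same_shape_iso xs(2) B by (auto simp: star_iso_rel_def)
    then have "X = ?F xs" unfolding A(2) B_def[symmetric] by (rule equiv_class_eq[OF equiv_star_iso_rel])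
    then show "X \<in> ?F ` ?L" using xs(1) by blast
  qed
  then show ?thesis using finite_lists_length_le[of "{..<idim \<Lambda>}" "idim \<Lambda>"] finite_subset by blast
qed

lemma card_max_classes_ge:
  assumes K: "finite K" and max: "\<And>k. k \<in> K \<Longrightarrow> maximal_transmittable \<Lambda> (A k)"
    and inj: "\<And>k l. k \<in> K \<Longrightarrow> l \<in> K \<Longrightarrow> star_iso (A k) (A l) \<Longrightarrow> k = l"
  shows "card K \<le> card (max_classes \<Lambda>)"
proof (rule card_inj_on_le[OF _ _ finite_max_classes])
  show "inj_on (\<lambda>k. star_iso_rel `` {A k}) K"
  proof (rule inj_onI)
    fix k l assume kl: "k \<in> K" "l \<in> K" "star_iso_rel `` {A k} = star_iso_rel `` {A l}"
    have "(A l, A l) \<in> star_iso_rel" using maximal_cstar[OF max[OF kl(2)]] by (simp add: star_iso_rel_def star_iso_refl)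
    then have "(A k, A l) \<in> star_iso_rel" using kl(3) by blast
    then show "k = l" using inj kl by (auto simp: star_iso_rel_def)
  qed
  show "(\<lambda>k. star_iso_rel `` {A k}) ` K \<subseteq> max_classes \<Lambda>"
    using max by (auto simp: max_classes_def quotient_def)
qed

text \<open>Transport along the isomorphism places both systems of units in the same algebra, where
  \<open>full_matrix_units_block_sizes\<close> compares them.\<close>

lemma is_block_sizes_iso:
  assumes A: "is_block A I c" and B: "is_block B J b" and iso: "star_iso A B" and i: "i \<in> I"
  shows "\<exists>j\<in>J. card {k \<in> I. c k = c i} = card {l \<in> J. b l = b j}"
proof -
  obtain d e where d: "star_subalgebra d A" and e: "star_subalgebra e B" using is_block_star_subalgebra[OF A] is_block_star_subalgebra[OF B] by blast
  obtain \<pi> where \<pi>: "star_hom A B \<pi>" "bij_betw \<pi> A B" using iso by (auto simp: star_iso_def)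
  obtain h where h: "fmat_hom (to_fmat ` A) (to_fmat ` B) h" "\<And>X. X \<in> A \<Longrightarrow> h (to_fmat X) = to_fmat (\<pi> X)"
    by (rule star_hom_to_fmat[OF d e \<pi>(1)]) blast
  have "bij_betw h (to_fmat ` A) (to_fmat ` B)"
    unfolding bij_betw_def
  proof
    show "inj_on h (to_fmat ` A)"
    proof (rule inj_onI)
      fix U W assume "U \<in> to_fmat ` A" "W \<in> to_fmat ` A" "h U = h W"
      then obtain X Y where X: "X \<in> A" "Y \<in> A" "U = to_fmat X" "W = to_fmat Y" "to_fmat (\<pi> X) = to_fmat (\<pi> Y)" using h(2) by auto
      then have "\<pi> X = \<pi> Y" using inj_onD[OF inj_on_to_fmat[OF e]] star_homD(1)[OF \<pi>(1)] by blast
      then show "U = W" using X inj_onD[OF bij_betw_imp_inj_on[OF \<pi>(2)]] by blast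
    qed
    have "h ` to_fmat ` A = to_fmat ` \<pi> ` A" using h(2) by (auto simp: image_iff)
    then show "h ` to_fmat ` A = to_fmat ` B" using bij_betw_imp_surj_on[OF \<pi>(2)] by simp
  qed
  moreover obtain f where f: "full_matrix_units (to_fmat ` A) I c f" by (rule is_block_units[OF A])
  ultimately have "full_matrix_units (to_fmat ` B) I c (\<lambda>i j. h (f i j))"
    by (intro fmat_hom_transport[OF subalg_to_fmat[OF d] h(1)])
  moreover obtain g where g: "full_matrix_units (to_fmat ` B) J b g" by (rule is_block_units[OF B])
  ultimately show ?thesis by (intro full_matrix_units_block_sizes[OF subalg_to_fmat[OF e] _ g i])
qed

section \<open>Maximality\<close>

lemma hamming_weight_eq_0: "hamming_weight z = 0 \<longleftrightarrow> z = replicate (length z) False"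
  by (induction z) (auto simp: hamming_weight_def)

lemma weight_enumeration_first:
  assumes x: "weight_enumeration n x" shows "hamming_weight (x 1) = 0"
proof -
  have bij: "bij_betw x {1..2 ^ n} {b. length b = n}" and mono: "mono_on {1..2 ^ n} (\<lambda>i. hamming_weight (x i))"
    using x by (auto simp: weight_enumeration_def)
  have "replicate n False \<in> x ` {1..2 ^ n}" using bij_betw_imp_surj_on[OF bij] by simp
  then obtain i where i: "i \<in> {1..2 ^ n}" "x i = replicate n False" by force
  have "hamming_weight (x 1) \<le> hamming_weight (x i)" using mono_onD[OF mono, of 1 i] i(1) by simp
  then show ?thesis using i(2) hamming_weight_eq_0[of "replicate n False"] by simp
qed

text \<open>The last \<open>b\<close> of the first \<open>a + b\<close> words dominate the first
  \<open>b\<close> words term by term, since the enumeration is monotone. The gain is strict at the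
  first term, because \<open>x 1\<close> is the only word of weight 0.\<close>

lemma weight_sum_strict_superadditive:
  assumes x: "weight_enumeration n x" and ab: "0 < a" "0 < b" "a + b \<le> 2 ^ n"
  shows "weight_sum x a + weight_sum x b < weight_sum x (a + b)"
proof -
  have bij: "bij_betw x {1..2 ^ n} {b. length b = n}" and mono: "mono_on {1..2 ^ n} (\<lambda>i. hamming_weight (x i))"
    using x by (auto simp: weight_enumeration_def)
  have len: "length (x i) = n" if "i \<in> {1..2 ^ n}" for i using bij_betwE[OF bij] that by blast
  have split: "weight_sum x (a + b) = weight_sum x a + (\<Sum>i = 1..b. 2 ^ hamming_weight (x (a + i)))"
  proof -
    have "{1..a + b} = {1..a} \<union> (\<lambda>i. a + i) ` {1..b}"
      unfolding image_add_atLeastAtMost by auto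
    then have "weight_sum x (a + b) = weight_sum x a + (\<Sum>i\<in>(\<lambda>i. a + i) ` {1..b}. 2 ^ hamming_weight (x i))"
      unfolding weight_sum_def by (simp only:) (rule sum.union_disjoint, auto)
    moreover have "inj_on (\<lambda>i. a + i) {1..b}" by simp
    ultimately show ?thesis by (simp only: sum.reindex comp_def)
  qed
  have "weight_sum x b < (\<Sum>i = 1..b. 2 ^ hamming_weight (x (a + i)))"
    unfolding weight_sum_def
  proof (rule sum_strict_mono_ex1)
    show "\<forall>i\<in>{1..b}. 2 ^ hamming_weight (x i) \<le> (2 :: nat) ^ hamming_weight (x (a + i))"
      using mono_onD[OF mono] ab by auto
    have "hamming_weight (x (a + 1)) \<noteq> 0"
    proof
      assume "hamming_weight (x (a + 1)) = 0"
      then have "x (a + 1) = x 1"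
        using weight_enumeration_first[OF x] hamming_weight_eq_0 len[of 1] len[of "a + 1"] ab by simp
      then show False using inj_onD[OF bij_betw_imp_inj_on[OF bij], of "a + 1" 1] ab by simp
    qed
    then have "2 ^ hamming_weight (x 1) < (2 :: nat) ^ hamming_weight (x (a + 1))"
      unfolding weight_enumeration_first[OF x] by (intro power_strict_increasing) simp_all
    then show "\<exists>i\<in>{1..b}. 2 ^ hamming_weight (x i) < (2 :: nat) ^ hamming_weight (x (a + i))"
      using ab by (intro bexI[of _ 1]) auto
  qed simp
  then show ?thesis using split by simp
qed

lemma code_label_classes:
  assumes x: "weight_enumeration n x" and Q: "\<And>y. y \<in> Y \<Longrightarrow> 1 \<le> Q y \<and> Q y \<le> 2 ^ n" and y: "y \<in> Y"
  shows "card {j \<in> code_labels x n Y Q. code_class j = (y, None)} = Q y"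
    and "t \<in> Tset x n (Q y) \<Longrightarrow> card {j \<in> code_labels x n Y Q. code_class j = (y, Some t)} = 1"
proof -
  have bij: "bij_betw x {1..2 ^ n} {b. length b = n}" using x by (simp add: weight_enumeration_def)
  have inj: "inj_on x {1..Q y}" using inj_on_subset[OF bij_betw_imp_inj_on[OF bij]] Q[OF y] by simp
  have "{j \<in> code_labels x n Y Q. code_class j = (y, None)} = (\<lambda>z. (y, Inl z)) ` Zset x (Q y)"
    using y by (auto simp: block_class_def split: sum.splits)
  then show "card {j \<in> code_labels x n Y Q. code_class j = (y, None)} = Q y"
    using card_image[OF inj] by (simp add: card_image inj_on_def Zset_def)
  assume "t \<in> Tset x n (Q y)"
  then have "{j \<in> code_labels x n Y Q. code_class j = (y, Some t)} = {(y, Inr t)}"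
    using y by (auto simp: block_class_def split: sum.splits)
  then show "card {j \<in> code_labels x n Y Q. code_class j = (y, Some t)} = 1" by simp
qed

text \<open>For each classical value the block of size \<open>Q y\<close> contributes
  \<open>s_n(Q y)\<close>, and each of the \<open>3^n - s_n(Q y)\<close> one-dimensional summands
  contributes \<open>s_n(1) = 1\<close>; the total is independent of \<open>Q\<close>.\<close>

lemma code_label_total:
  assumes x: "weight_enumeration n x" and Y: "finite Y" and Q: "\<And>y. y \<in> Y \<Longrightarrow> 1 \<le> Q y \<and> Q y \<le> 2 ^ n"
  shows "(\<Sum>k\<in>code_class ` code_labels x n Y Q. weight_sum x (card {j \<in> code_labels x n Y Q. code_class j = k})) = card Y * 3 ^ n"
proof -
  let ?J = "code_labels x n Y Q"
  have img: "code_class ` ?J = (SIGMA y:Y. insert None (Some ` Tset x n (Q y)))"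
  proof (intro equalityI subsetI)
    fix k assume "k \<in> (SIGMA y:Y. insert None (Some ` Tset x n (Q y)))"
    then obtain y o' where k: "k = (y, o')" "y \<in> Y" "o' = None \<or> o' \<in> Some ` Tset x n (Q y)" by auto
    show "k \<in> code_class ` ?J"
    proof (cases o')
      case None
      have "x 1 \<in> Zset x (Q y)" using Q[OF k(2)] by (auto simp: Zset_def)
      then show ?thesis using k None by (intro image_eqI[of _ _ "(y, Inl (x 1))"]) (auto simp: block_class_def)
    next
      case (Some t)
      then show ?thesis using k by (intro image_eqI[of _ _ "(y, Inr t)"]) (auto simp: block_class_def)
    qed
  qed (auto simp: block_class_def split: sum.splits)
  have s1: "weight_sum x 1 = 1" using weight_enumeration_first[OF x] by (simp add: weight_sum_def)
  have "(\<Sum>k\<in>code_class ` ?J. weight_sum x (card {j \<in> ?J. code_class j = k})) =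
    (\<Sum>y\<in>Y. \<Sum>o'\<in>insert None (Some ` Tset x n (Q y)). weight_sum x (card {j \<in> ?J. code_class j = (y, o')}))"
    unfolding img using Y card_Tset(1)[OF x] Q by (subst sum.Sigma) auto
  also have "\<dots> = (\<Sum>y\<in>Y. 3 ^ n)"
  proof (rule sum.cong[OF refl])
    fix y assume y: "y \<in> Y"
    have T: "finite (Tset x n (Q y))" "card (Tset x n (Q y)) + weight_sum x (Q y) = 3 ^ n" using card_Tset[OF x] Q[OF y] by auto
    have "(\<Sum>o'\<in>insert None (Some ` Tset x n (Q y)). weight_sum x (card {j \<in> ?J. code_class j = (y, o')})) =
      weight_sum x (card {j \<in> ?J. code_class j = (y, None)}) +
      (\<Sum>t\<in>Tset x n (Q y). weight_sum x (card {j \<in> ?J. code_class j = (y, Some t)}))"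
      using T(1) by (subst sum.insert) (auto simp: sum.reindex)
    also have "\<dots> = weight_sum x (Q y) + (\<Sum>t\<in>Tset x n (Q y). 1)"
    proof -
      have "card {j \<in> ?J. code_class j = (y, None)} = Q y" by (rule code_label_classes(1)[OF x Q y])
      moreover have "card {j \<in> ?J. code_class j = (y, Some t)} = 1" if "t \<in> Tset x n (Q y)" for t
        by (rule code_label_classes(2)[where Y = Y and Q = Q and y = y and t = t, OF x Q y that])
      ultimately show ?thesis by (simp only: s1 cong: sum.cong)
    qed
    finally show "(\<Sum>o'\<in>insert None (Some ` Tset x n (Q y)). weight_sum x (card {j \<in> ?J. code_class j = (y, o')})) = 3 ^ n"
      using T(2) by simp
  qed
  finally show ?thesis by simp
qed

text \<open>If \<open>A\<close> embeds in a transmittable \<open>B\<close>, then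
  \<open>correctable_bound\<close> limits every system of matrix units of a correctable copy of
  \<open>B\<close> by the total that \<open>A\<close> attains already, so the embedding is onto by
  \<open>embedding_onto\<close>.\<close>

lemma tight_maximal:
  fixes c :: "'j \<Rightarrow> 'c"
  assumes C: "cube_channel n Y \<Lambda> \<beta> \<tau> \<chi>" and Y: "finite Y" and x: "weight_enumeration n x"
    and A: "is_block A J c" and tr: "transmittable \<Lambda> A"
    and tight: "(\<Sum>k\<in>c ` J. weight_sum x (card {j \<in> J. c j = k})) = card Y * 3 ^ n"
  shows "maximal_transmittable \<Lambda> A"
  unfolding maximal_transmittable_def
proof (intro conjI allI impI)
  fix B assume B: "transmittable \<Lambda> B \<and> embeds A B"
  obtain d where d: "star_subalgebra d A" using is_block_star_subalgebra[OF A] by blast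
  obtain \<pi> where \<pi>: "star_hom B (full_matrix_algebra (idim \<Lambda>)) \<pi>" "inj_on \<pi> B" "correctable \<Lambda> (\<pi> ` B)"
    using B by (auto simp: transmittable_def)
  obtain \<rho> where \<rho>: "star_hom A B \<rho>" "inj_on \<rho> A" using B by (auto simp: embeds_def)
  have S: "star_subalgebra (idim \<Lambda>) (\<pi> ` B)" using \<pi>(3) by (simp add: correctable_def)
  have "star_hom B (\<pi> ` B) \<pi>" using \<pi>(1) by (auto simp: star_hom_def)
  then have hom: "star_hom A (\<pi> ` B) (\<pi> \<circ> \<rho>)" by (rule star_hom_comp[OF \<rho>(1)])
  have \<rho>B: "\<rho> X \<in> B" if "X \<in> A" for X using star_homD(1)[OF \<rho>(1) that] .
  obtain h where h: "fmat_hom (to_fmat ` A) (to_fmat ` \<pi> ` B) h" "\<And>X. X \<in> A \<Longrightarrow> h (to_fmat X) = to_fmat ((\<pi> \<circ> \<rho>) X)"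
    using star_hom_to_fmat[OF d S hom] by blast
  have inj: "inj_on h (to_fmat ` A)"
  proof (rule inj_onI)
    fix U W assume "U \<in> to_fmat ` A" "W \<in> to_fmat ` A" "h U = h W"
    then obtain X Z where X: "X \<in> A" "Z \<in> A" "U = to_fmat X" "W = to_fmat Z" "to_fmat (\<pi> (\<rho> X)) = to_fmat (\<pi> (\<rho> Z))"
      using h(2) by auto
    then have "\<pi> (\<rho> X) = \<pi> (\<rho> Z)" using inj_onD[OF inj_on_to_fmat[OF S]] \<rho>B by blast
    then have "\<rho> X = \<rho> Z" using inj_onD[OF \<pi>(2)] \<rho>B X by blast
    then show "U = W" using X inj_onD[OF \<rho>(2)] by blast
  qed
  obtain g where g: "full_matrix_units (to_fmat ` A) J c g" using is_block_units[OF A] by blast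
  have "h ` to_fmat ` A = to_fmat ` \<pi> ` B"
  proof (rule embedding_onto[OF subalg_to_fmat[OF d] g subalg_to_fmat[OF S] h(1) inj, where s = "weight_sum x" and L = "2 ^ n"])
    show "weight_sum x 0 = 0" by (simp add: weight_sum_def)
    show "weight_sum x a + weight_sum x b < weight_sum x (a + b)" if "0 < a" "0 < b" "a + b \<le> 2 ^ n" for a b
      by (rule weight_sum_strict_superadditive[OF x that])
    show "0 < weight_sum x a" if "0 < a" for a
      using that by (auto simp: weight_sum_def intro!: sum_pos)
    show "(\<forall>i\<in>I. card {k \<in> I. b k = b i} \<le> 2 ^ n) \<and>
      (\<Sum>D\<in>b ` I. weight_sum x (card {i \<in> I. b i = D})) \<le> (\<Sum>k\<in>c ` J. weight_sum x (card {j \<in> J. c j = k}))"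
      if "matrix_units (to_fmat ` \<pi> ` B) I b f" for I :: "'j option set" and b :: "'j option \<Rightarrow> 'j option set" and f
      unfolding tight by (rule correctable_bound[OF C Y x \<pi>(3) that])
  qed
  moreover have "h ` to_fmat ` A = to_fmat ` \<pi> ` \<rho> ` A" unfolding image_image by (rule image_cong[OF refl]) (simp add: h(2))
  ultimately have eq: "to_fmat ` \<pi> ` \<rho> ` A = to_fmat ` \<pi> ` B" by simp
  have "\<rho> ` A = B"
  proof
    show "\<rho> ` A \<subseteq> B" using \<rho>B by blast
    show "B \<subseteq> \<rho> ` A"
    proof
      fix Z assume Z: "Z \<in> B"
      then have "to_fmat (\<pi> Z) \<in> to_fmat ` \<pi> ` \<rho> ` A" unfolding eq by blast
      then obtain X where X: "X \<in> A" "to_fmat (\<pi> Z) = to_fmat (\<pi> (\<rho> X))" by blast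
      then have "\<pi> Z = \<pi> (\<rho> X)" using inj_onD[OF inj_on_to_fmat[OF S]] Z \<rho>B by blast
      then have "Z = \<rho> X" using inj_onD[OF \<pi>(2)] Z \<rho>B X by blast
      then show "Z \<in> \<rho> ` A" using X by blast
    qed
  qed
  then show "star_iso A B" unfolding star_iso_def using \<rho> by (auto simp: bij_betw_def)
qed (rule tr)

lemma sum_B_alg_maximal:
  assumes C: "cube_channel n Y \<Lambda> \<beta> \<tau> \<chi>" and Y: "finite Y" "Y \<noteq> {}" and x: "weight_enumeration n x"
    and qs: "length qs = card Y" "\<And>q. q \<in> set qs \<Longrightarrow> 1 \<le> q \<and> q \<le> 2 ^ n"
  shows "transmittable \<Lambda> (direct_sum (map (B_alg x n) qs))"
    and "maximal_transmittable \<Lambda> (direct_sum (map (B_alg x n) qs))"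
proof -
  obtain k where k: "bij_betw k Y {..<length qs}"
    using ex_bij_betw_finite_nat[OF Y(1)] qs(1) by (auto simp: atLeast0LessThan)
  let ?Q = "\<lambda>y. qs ! k y"
  have Q: "1 \<le> ?Q y \<and> ?Q y \<le> 2 ^ n" if "y \<in> Y" for y using qs(2) bij_betwE[OF k] that by auto
  have blk: "is_block (direct_sum (map (B_alg x n) qs)) (code_labels x n Y ?Q) code_class"
    by (rule is_block_sum_B_alg[OF x _ k]) (use qs in auto)
  show tr: "transmittable \<Lambda> (direct_sum (map (B_alg x n) qs))"
    by (rule cube_transmittable[OF C x Q Y(2) blk])
  show "maximal_transmittable \<Lambda> (direct_sum (map (B_alg x n) qs))"
    by (rule tight_maximal[OF C Y(1) x blk tr code_label_total[OF x Y(1) Q]])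
qed

text \<open>Block sizes are invariant under isomorphism. A size of at least 2 can only stem from a
  matrix block, hence from the list, whereas size 1 also occurs for the remaining summands; this is
  the reason for the bound on \<open>q\<close>.\<close>

lemma sum_B_alg_iso:
  assumes x: "weight_enumeration n x" and iso: "star_iso (direct_sum (map (B_alg x n) qs)) (direct_sum (map (B_alg x n) qs'))"
    and qs: "\<And>q. q \<in> set qs \<Longrightarrow> 1 \<le> q \<and> q \<le> 2 ^ n" and qs': "\<And>q. q \<in> set qs' \<Longrightarrow> 1 \<le> q \<and> q \<le> 2 ^ n"
    and q: "2 \<le> q" "q \<in> set qs"
  shows "q \<in> set qs'"
proof -
  obtain p where p: "p < length qs" "qs ! p = q" using q by (auto simp: in_set_conv_nth)
  let ?I = "code_labels x n {..<length qs} (\<lambda>y. qs ! id y)" and ?J = "code_labels x n {..<length qs'} (\<lambda>y. qs' ! id y)"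
  have A: "is_block (direct_sum (map (B_alg x n) qs)) ?I code_class"
    by (rule is_block_sum_B_alg[OF x _ bij_betw_id]) (use qs in auto)
  have B: "is_block (direct_sum (map (B_alg x n) qs')) ?J code_class"
    by (rule is_block_sum_B_alg[OF x _ bij_betw_id]) (use qs' in auto)
  have Q: "1 \<le> qs ! id y \<and> qs ! id y \<le> 2 ^ n" if "y \<in> {..<length qs}" for y using qs that by simp
  have Q': "1 \<le> qs' ! id y \<and> qs' ! id y \<le> 2 ^ n" if "y \<in> {..<length qs'}" for y using qs' that by simp
  have pI: "(p, Inl (x 1)) \<in> ?I" using p q by (auto simp: Zset_def)
  obtain j where j: "j \<in> ?J" "card {k \<in> ?I. code_class k = code_class (p, Inl (x 1))} = card {l \<in> ?J. code_class l = code_class j}"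
    using is_block_sizes_iso[OF A B iso pI] by blast
  have "card {k \<in> ?I. code_class k = code_class (p, Inl (x 1))} = q"
    using code_label_classes(1)[of n x "{..<length qs}" "\<lambda>y. qs ! id y" p, OF x Q] p by (simp add: block_class_def)
  then have cj: "card {l \<in> ?J. code_class l = code_class j} = q" using j(2) by simp
  obtain y i where yi: "j = (y, i)" by (cases j)
  have y: "y \<in> {..<length qs'}" using j(1) yi by auto
  show ?thesis
  proof (cases i)
    case (Inl z)
    then have "code_class j = (y, None)" using yi by (simp add: block_class_def)
    then have "qs' ! y = q" using cj code_label_classes(1)[of n x "{..<length qs'}" "\<lambda>y. qs' ! id y" y, OF x Q' y] by simp
    then show ?thesis using y by auto
  next
    case (Inr t)
    then have "code_class j = (y, Some t)" "t \<in> Tset x n (qs' ! id y)" using yi j(1) by (auto simp: block_class_def)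
    then have "q = 1" using cj code_label_classes(2)[of n x "{..<length qs'}" "\<lambda>y. qs' ! id y" y t, OF x Q' y] by simp
    then show ?thesis using q by simp
  qed
qed

lemma C_alg_eq: "C_alg x n N = direct_sum (map (B_alg x n) (concat (map (\<lambda>q. replicate (N q) q) [1..<2 ^ n + 1])))"
  by (simp add: C_alg_def map_concat comp_def)

lemma B_alg_eq: "B_alg x n q = direct_sum (map (B_alg x n) [q])"
proof -
  have fb: "four_block_mat Z (0\<^sub>m (dim_row Z) 0) (0\<^sub>m 0 (dim_col Z)) (0\<^sub>m 0 0) = Z" for Z :: "complex mat"
    by (rule eq_matI) (auto simp: four_block_mat_def Let_def)
  have "direct_sum [A] = A" for A
  proof (intro equalityI subsetI)
    fix Z assume "Z \<in> direct_sum [A]"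
    then show "Z \<in> A" by (auto simp: direct_sum_def list_all2_Cons2 fb)
  next
    fix Z assume "Z \<in> A"
    then have "list_all2 (\<in>) [Z] [A]" "Z = diag_block_mat [Z]" by (simp_all add: fb)
    then show "Z \<in> direct_sum [A]" unfolding direct_sum_def by blast
  qed
  then show ?thesis by simp
qed

theorem proposition5p5:
  fixes n :: nat and x :: "nat \<Rightarrow> bool list"
  assumes "n \<ge> 1" and "weight_enumeration n x"
  shows
    "((\<forall>q. 1 \<le> q \<and> q \<le> 2 ^ n \<longrightarrow>
          transmittable (tensor_power Phi n) (B_alg x n q) \<and>
          maximal_transmittable (tensor_power Phi n) (B_alg x n q)) \<and>
      2 ^ n \<le> width n Phi) \<and>
     ((\<forall>N :: nat \<Rightarrow> nat. (\<Sum>q = 1..2 ^ n. N q) = 2 ^ n \<longrightarrow>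
          transmittable (tensor_power Psi n) (C_alg x n N) \<and>
          maximal_transmittable (tensor_power Psi n) (C_alg x n N)) \<and>
      2 ^ (2 ^ n - 1) \<le> width n Psi)"
proof -
  note x = assms(2)
  \<comment> \<open>For \<open>Phi\<close> the register is trivial, with a single word over
    \<open>{False}\<close>, so the tight total is \<open>3^n\<close>; for \<open>Psi\<close> there
    are \<open>2^n\<close> words and the total is \<open>6^n\<close>.\<close>
  obtain \<beta> \<tau> \<chi> where CP: "cube_channel n (words {False} n) (tensor_power Phi n) \<beta> \<tau> \<chi>"
    using tensor_power_cube[OF base_cube_Phi] by blast
  obtain \<beta>' \<tau>' \<chi>' where CQ: "cube_channel n (words UNIV n) (tensor_power Psi n) \<beta>' \<tau>' \<chi>'"
    using tensor_power_cube[OF base_cube_Psi] by blast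
  have W: "finite (words Y n)" "card (words Y n) = card Y ^ n" for Y
    unfolding words_def using finite_lists_length_eq[of Y n] card_lists_length_eq[of Y n] by auto
  have W1: "card (words {False} n) = 1" and W2: "card (words UNIV n) = 2 ^ n" using W(2) by simp_all
  have Wne: "words {False} n \<noteq> {}" "words UNIV n \<noteq> {}" using W1 W2 by (metis card.empty zero_neq_one power_not_zero zero_neq_numeral)+
  have a: "transmittable (tensor_power Phi n) (B_alg x n q) \<and> maximal_transmittable (tensor_power Phi n) (B_alg x n q)"
    if q: "1 \<le> q" "q \<le> 2 ^ n" for q
  proof -
    have l: "length [q] = card (words {False} n)" using W1 by simp
    have s: "1 \<le> p \<and> p \<le> 2 ^ n" if "p \<in> set [q]" for p using that q by simp
    show ?thesis unfolding B_alg_eq[of x n q]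
      using sum_B_alg_maximal[OF CP W(1) Wne(1) x l s] by blast
  qed
  have "card {1..2 ^ n :: nat} \<le> card (max_classes (tensor_power Phi n))"
  proof (rule card_max_classes_ge[where A = "B_alg x n"])
    fix q p :: nat assume qp: "q \<in> {1..2 ^ n}" "p \<in> {1..2 ^ n}" "star_iso (B_alg x n q) (B_alg x n p)"
    have iso: "star_iso (direct_sum (map (B_alg x n) [q])) (direct_sum (map (B_alg x n) [p]))"
      using qp(3) unfolding B_alg_eq[symmetric] .
    have "star_subalgebra d (B_alg x n q) \<Longrightarrow> star_iso (B_alg x n p) (B_alg x n q)" for d
      using star_iso_sym qp(3) by blast
    then have "star_iso (B_alg x n p) (B_alg x n q)"
      using is_block_star_subalgebra[OF is_block_B_alg[OF x]] qp(1) by auto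
    then have iso': "star_iso (direct_sum (map (B_alg x n) [p])) (direct_sum (map (B_alg x n) [q]))"
      unfolding B_alg_eq[symmetric] .
    have sq: "1 \<le> r \<and> r \<le> 2 ^ n" if "r \<in> set [q]" for r using that qp by simp
    have sp: "1 \<le> r \<and> r \<le> 2 ^ n" if "r \<in> set [p]" for r using that qp by simp
    \<comment> \<open>A size of at least 2 in one algebra must be the size in the other; if neither
      is at least 2, both are 1.\<close>
    show "q = p"
      using sum_B_alg_iso[OF x iso sq sp, of q] sum_B_alg_iso[OF x iso' sp sq, of p] qp(1,2)
      by (cases "2 \<le> q"; cases "2 \<le> p") auto
  qed (use a in auto)
  then have wa: "2 ^ n \<le> width n Phi" by (simp add: width_def)
  \<comment> \<open>The multiplicities are written out as a list of sizes, whose length is the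
    number of register words.\<close>
  define cs where "cs N = concat (map (\<lambda>q. replicate (N q) q) [1..<2 ^ n + 1])" for N :: "nat \<Rightarrow> nat"
  have C_eq: "C_alg x n N = direct_sum (map (B_alg x n) (cs N))" for N unfolding cs_def by (rule C_alg_eq)
  have cs_set: "q \<in> set (cs N) \<longleftrightarrow> 1 \<le> q \<and> q \<le> 2 ^ n \<and> 0 < N q" for N q
    by (auto simp: cs_def less_Suc_eq_le simp del: upt_Suc)
  have cs_len: "length (cs N) = (\<Sum>q = 1..2 ^ n. N q)" for N
  proof -
    have "length (cs N) = sum_list (map N [1..<2 ^ n + 1])" by (simp add: cs_def length_concat comp_def)
    also have "\<dots> = (\<Sum>q\<in>set [1..<2 ^ n + 1]. N q)" by (rule sum_list_distinct_conv_sum_set) simp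
    also have "set [1..<2 ^ n + 1] = {1..2 ^ n :: nat}" by auto
    finally show ?thesis .
  qed
  have b: "transmittable (tensor_power Psi n) (C_alg x n N) \<and> maximal_transmittable (tensor_power Psi n) (C_alg x n N)"
    if N: "(\<Sum>q = 1..2 ^ n. N q) = 2 ^ n" for N
  proof -
    have l: "length (cs N) = card (words UNIV n)" using cs_len N W2 by simp
    have s: "1 \<le> p \<and> p \<le> 2 ^ n" if "p \<in> set (cs N)" for p using that cs_set by blast
    show ?thesis unfolding C_eq using sum_B_alg_maximal[OF CQ W(1) Wne(2) x l s] by blast
  qed
  \<comment> \<open>A subset \<open>T\<close> of \<open>{2..2^n}\<close> is encoded by one summand
    for each size in \<open>T\<close>, filled up with copies of \<open>B_alg x n 1\<close> to the
    required number \<open>2^n\<close>. The sizes of at least 2 recover \<open>T\<close>, so the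
    \<open>2^(2^n - 1)\<close> subsets give pairwise non-isomorphic algebras.\<close>
  define M where "M T q = (if q = 1 then 2 ^ n - card T else if q \<in> T then 1 else 0)" for T and q :: nat
  have M: "(\<Sum>q = 1..2 ^ n. M T q) = 2 ^ n" if T: "T \<subseteq> {2..2 ^ n}" for T
  proof -
    have fT: "finite T" using T finite_subset by blast
    have "card T \<le> card {2..2 ^ n :: nat}" using T by (intro card_mono) auto
    then have cT: "card T \<le> 2 ^ n" by simp
    have "{1..2 ^ n :: nat} = insert 1 {2..2 ^ n}" by (auto simp: Suc_le_eq)
    then have "(\<Sum>q = 1..2 ^ n. M T q) = M T 1 + (\<Sum>q = 2..2 ^ n. M T q)" by simp
    also have "(\<Sum>q = 2..2 ^ n. M T q) = (\<Sum>q = 2..2 ^ n. if q \<in> T then 1 else 0)"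
      by (intro sum.cong refl) (auto simp: M_def)
    also have "\<dots> = card T" using T fT by (simp add: sum.inter_restrict[symmetric] Int_absorb1)
    finally show ?thesis using cT by (simp add: M_def)
  qed
  have "card (Pow {2..2 ^ n :: nat}) \<le> card (max_classes (tensor_power Psi n))"
  proof (rule card_max_classes_ge[where A = "\<lambda>T. C_alg x n (M T)"])
    fix T U assume TU: "T \<in> Pow {2..2 ^ n :: nat}" "U \<in> Pow {2..2 ^ n}" "star_iso (C_alg x n (M T)) (C_alg x n (M U))"
    have iso: "star_iso (direct_sum (map (B_alg x n) (cs (M T)))) (direct_sum (map (B_alg x n) (cs (M U))))"
      using TU(3) by (simp add: C_eq)
    have "cstar_algebra (C_alg x n (M T))" using b[OF M] TU(1) by (simp add: transmittable_def)
    then have "star_iso (C_alg x n (M U)) (C_alg x n (M T))" using star_iso_sym TU(3) by (auto simp: cstar_algebra_def)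
    then have iso': "star_iso (direct_sum (map (B_alg x n) (cs (M U)))) (direct_sum (map (B_alg x n) (cs (M T))))"
      by (simp add: C_eq)
    have s: "1 \<le> p \<and> p \<le> 2 ^ n" if "p \<in> set (cs N)" for p N using that cs_set by blast
    have mem: "q \<in> V \<longleftrightarrow> 2 \<le> q \<and> q \<in> set (cs (M V))" if "V \<in> Pow {2..2 ^ n}" for V q
      using that unfolding cs_set M_def by auto
    have "q \<in> set (cs (M U))" if "2 \<le> q" "q \<in> set (cs (M T))" for q by (rule sum_B_alg_iso[OF x iso s s that])
    moreover have "q \<in> set (cs (M T))" if "2 \<le> q" "q \<in> set (cs (M U))" for q by (rule sum_B_alg_iso[OF x iso' s s that])
    ultimately show "T = U" unfolding set_eq_iff mem[OF TU(1)] mem[OF TU(2)] by blast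
  qed (use b M in auto)
  then have wb: "2 ^ (2 ^ n - 1) \<le> width n Psi" by (simp add: width_def card_Pow)
  show ?thesis using a b wa wb by blast
qed

end
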